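(* Let $(\mathcal{A}, \mathbb{E}, \mathbb{F}, \varepsilon)$ be a $\mathcal{B}$-$\mathcal{B}$-non-commutative probability space with a pair of $(\mathcal{B}, \mathcal{D})$-valued expectations. The operator-valued conditionally bi-free cumulant pair $(\kappa, \mathcal{K})$ on $\mathcal{A}$ is operator-valued conditionally bi-multiplicative.
   Context: All algebras are over $\mathbb{C}$. Spaces. A $\mathcal{B}$-$\mathcal{B}$-non-commutative probability space with a pair of $(\mathcal{B},\mathcal{D})$-valued expectations is a quadruple $(\mathcal{A},\mathbb{E},\mathbb{F},\varepsilon)$ where $\mathcal{A},\mathcal{B},\mathcal{D}$ are unital algebras with $1:=1_{\mathcal{D}}\in\mathcal{B}\subset\mathcal{D}$, $\varepsilon:\mathcal{B}\otimes\mathcal{B}^{\mathrm{op}}\to\mathcal{A}$ is a unital homomorphism whose restrictions to $\mathcal{B}\otimes 1$ and $1\otimes\mathcal{B}^{\mathrm{op}}$ are injective, and $\mathbb{E}:\mathcal{A}\to\mathcal{B}$, $\mathbb{F}:\mathcal{A}\to\mathcal{D}$ are unital linear maps such that, writing $L_b=\varepsilon(b\otimes 1)$ and $R_b=\varepsilon(1\otimes b)$, for all $b_1,b_2,b\in\mathcal{B}$ and $Z\in\mathcal{A}$: $\mathbb{E}(L_{b_1}R_{b_2}Z)=b_1\mathbb{E}(Z)b_2$, $\mathbb{E}(ZL_b)=\mathbb{E}(ZR_b)$, $\mathbb{F}(L_{b_1}R_{b_2}Z)=b_1\mathbb{F}(Z)b_2$, $\mathbb{F}(ZL_b)=\mathbb{F}(ZR_b)$.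 Set $\mathcal{A}_\ell=\{Z\in\mathcal{A}: ZR_b=R_bZ\ \forall b\in\mathcal{B}\}$ and $\mathcal{A}_r=\{Z\in\mathcal{A}: ZL_b=L_bZ\ \forall b\in\mathcal{B}\}$. Bi-non-crossing partitions. For $\chi:\{1,\dots,n\}\to\{\ell,r\}$ with $\chi^{-1}(\ell)=\{i_1<\dots<i_p\}$ and $\chi^{-1}(r)=\{j_1<\dots<j_{n-p}\}$, $\prec_\chi$ is the total order $i_1\prec_\chi\dots\prec_\chi i_p\prec_\chi j_{n-p}\prec_\chi\dots\prec_\chi j_1$. A $\chi$-interval is an interval for $\prec_\chi$. $\mathcal{BNC}(\chi)$ is the lattice (under refinement) of partitions of $\{1,\dots,n\}$ that are non-crossing with respect to $\prec_\chi$; $1_\chi$ is the one-block partition and $\mu_{\mathcal{BNC}}$ the Möbius function of this lattice. For a subset $V$, $\pi|_V$, $\chi|_V$ and $(Z_1,\dots,Z_n)|_V$ denote restriction to the indices in $V$ (relabelled in increasing order). $\min(V)$ is for the usual order; $\min_{\prec_\chi},\max_{\prec_\chi}$ for $\prec_\chi$. Bi-free moments and cumulants. For $\pi\in\mathcal{BNC}(\chi)$ and $Z_1,\dots,Z_n\in\mathcal{A}$ define $\mathcal{E}_\pi(Z_1,\dots,Z_n)\in\mathcal{B}$ recursively. If $\pi=1_\chi$, it is $\mathbb{E}(Z_1\cdots Z_n)$. Otherwise let $V=\{v_1<\dots<v_s\}$ be the block with the largest $\min(V)$, $m=\min(V)$, $b=\mathbb{E}(Z_{v_1}\cdots Z_{v_s})$,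 and $T_b=L_b$ if $\chi(m)=\ell$, $T_b=R_b$ if $\chi(m)=r$. If $V=\{m,\dots,n\}$, then $\mathcal{E}_\pi(Z_1,\dots,Z_n)=\mathcal{E}_{\pi|_{V^\complement}}(Z_1,\dots,Z_{m-2},Z_{m-1}T_b)$. Otherwise let $W$ be the block containing the $\prec_\chi$-smallest (if $\chi(m)=\ell$) or $\prec_\chi$-largest (if $\chi(m)=r$) element of $\{m+1,\dots,n\}\setminus V$ (the block whose spine is adjacent to $\min(V)$ in the diagram of $\pi$), let $k=\min\{j\in W: j>m\}$, and set $\mathcal{E}_\pi(Z_1,\dots,Z_n)=\mathcal{E}_{\pi|_{V^\complement}}((Z_1,\dots,Z_{k-1},T_bZ_k,Z_{k+1},\dots,Z_n)|_{V^\complement})$. The operator-valued bi-free cumulant function is $\kappa_\pi(Z_1,\dots,Z_n)=\sum_{\sigma\in\mathcal{BNC}(\chi),\,\sigma\le\pi}\mathcal{E}_\sigma(Z_1,\dots,Z_n)\mu_{\mathcal{BNC}}(\sigma,\pi)$ for $Z_k\in\mathcal{A}_{\chi(k)}$. Conditionally bi-free cumulants. For $\pi\in\mathcal{BNC}(\chi)$ and $Z_k\in\mathcal{A}_{\chi(k)}$, $\mathcal{K}_\pi(Z_1,\dots,Z_n)\in\mathcal{D}$ is defined recursively on $n$. If $n=1$, $\mathcal{K}_{1_\chi}(Z)=\mathbb{F}(Z)$. If $n\ge2$ and $\pi\ne1_\chi$, let $V_1,\dots,V_t$ (ordered by $\prec_\chi$) be the unique partition of $\{1,\dots,n\}$ into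 $\chi$-intervals, each a union of blocks of $\pi$, such that $\min_{\prec_\chi}(V_i)$ and $\max_{\prec_\chi}(V_i)$ lie in a common block $V_i'$ of $\pi$ for each $i$; then $\mathcal{K}_\pi(Z_1,\dots,Z_n)=\mathcal{K}_{\pi|_{V_1}}((Z_1,\dots,Z_n)|_{V_1})\cdots\mathcal{K}_{\pi|_{V_t}}((Z_1,\dots,Z_n)|_{V_t})$, where each factor is reduced as follows until only the block $V_i'$ remains: let $V\subset V_i\setminus V_i'$ be the block of $\pi$ with the largest $\min(V)$, let $p=\max_{\prec_\chi}\{j\in V_i: j\prec_\chi\min_{\prec_\chi}(V)\}$ and $c=\kappa_{\pi|_V}((Z_1,\dots,Z_n)|_V)$; then $\mathcal{K}_{\pi|_{V_i}}((Z_1,\dots,Z_n)|_{V_i})$ equals $\mathcal{K}_{\pi|_{V_i\setminus V}}$ evaluated at $(Z_1,\dots,Z_n)|_{V_i\setminus V}$ with $Z_p$ replaced by $Z_pL_c$ if $\chi(p)=\ell$ and by $R_cZ_p$ if $\chi(p)=r$. Finally, $\mathcal{K}_{1_\chi}(Z_1,\dots,Z_n)=\mathbb{F}(Z_1\cdots Z_n)-\sum_{\pi\in\mathcal{BNC}(\chi),\,\pi\ne1_\chi}\mathcal{K}_\pi(Z_1,\dots,Z_n)$. The pair $(\kappa,\mathcal{K})$ is the operator-valued conditionally bi-free cumulant pair. Conditional bi-multiplicativity. Let $\Psi$ ($\mathcal{B}$-valued) and $\Phi$ ($\mathcal{D}$-valued) be functions on $\bigcup_{n\ge1}\bigcup_{\chi:\{1,\dots,n\}\to\{\ell,r\}}\mathcal{BNC}(\chi)\times\mathcal{A}_{\chi(1)}\times\cdots\times\mathcal{A}_{\chi(n)}$,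 linear in each $\mathcal{A}_{\chi(k)}$. The pair $(\Psi,\Phi)$ is operator-valued conditionally bi-multiplicative if for all $\chi:\{1,\dots,n\}\to\{\ell,r\}$, $Z_k\in\mathcal{A}_{\chi(k)}$, $b\in\mathcal{B}$, $\pi\in\mathcal{BNC}(\chi)$ the following hold (with $\max\emptyset=-\infty$), where (1)-(3) are required for both $\Theta=\Psi$ and $\Theta=\Phi$: (1) Let $q=\max\{k:\chi(k)\ne\chi(n)\}$. If $\chi(n)=\ell$, then $\Theta_{1_\chi}(Z_1,\dots,Z_{n-1},Z_nL_b)$ equals $\Theta_{1_\chi}(Z_1,\dots,Z_{q-1},Z_qR_b,Z_{q+1},\dots,Z_n)$ if $q\ne-\infty$ and $\Theta_{1_\chi}(Z_1,\dots,Z_n)b$ if $q=-\infty$. If $\chi(n)=r$, then $\Theta_{1_\chi}(Z_1,\dots,Z_{n-1},Z_nR_b)$ equals $\Theta_{1_\chi}(Z_1,\dots,Z_{q-1},Z_qL_b,Z_{q+1},\dots,Z_n)$ if $q\neq-\infty$ and $b\,\Theta_{1_\chi}(Z_1,\dots,Z_n)$ if $q=-\infty$. (2) Let $p\in\{1,\dots,n\}$ and $q=\max\{k<p:\chi(k)=\chi(p)\}$. If $\chi(p)=\ell$, then $\Theta_{1_\chi}(Z_1,\dots,L_bZ_p,\dots,Z_n)$ equals $\Theta_{1_\chi}(Z_1,\dots,Z_qL_b,\dots,Z_n)$ if $q\ne-\infty$ and $b\,\Theta_{1_\chi}(Z_1,\dots,Z_n)$ if $q=-\infty$. If $\chi(p)=r$,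 then $\Theta_{1_\chi}(Z_1,\dots,R_bZ_p,\dots,Z_n)$ equals $\Theta_{1_\chi}(Z_1,\dots,Z_qR_b,\dots,Z_n)$ if $q\ne-\infty$ and $\Theta_{1_\chi}(Z_1,\dots,Z_n)b$ if $q=-\infty$. (3) If $V_1,\dots,V_m$ are $\chi$-intervals ordered by $\prec_\chi$ which partition $\{1,\dots,n\}$, each a union of blocks of $\pi$, then $\Theta_\pi(Z_1,\dots,Z_n)=\Theta_{\pi|_{V_1}}((Z_1,\dots,Z_n)|_{V_1})\cdots\Theta_{\pi|_{V_m}}((Z_1,\dots,Z_n)|_{V_m})$. (4) Suppose $V$ and $W$ partition $\{1,\dots,n\}$, each a union of blocks of $\pi$, $V$ is a $\chi$-interval, and $\min_{\prec_\chi}(\{1,\dots,n\}),\max_{\prec_\chi}(\{1,\dots,n\})\in W$. Let $p=\max_{\prec_\chi}\{k\in W:k\prec_\chi\min_{\prec_\chi}(V)\}$, $q=\min_{\prec_\chi}\{k\in W:\max_{\prec_\chi}(V)\prec_\chi k\}$ and $c=\Psi_{\pi|_V}((Z_1,\dots,Z_n)|_V)$. Then, for $\Theta=\Psi$ always, and for $\Theta=\Phi$ under the additional assumption that $\min_{\prec_\chi}(\{1,\dots,n\})$ and $\max_{\prec_\chi}(\{1,\dots,n\})$ lie in the same block of $\pi$: $\Theta_\pi(Z_1,\dots,Z_n)$ equals $\Theta_{\pi|_W}$ evaluated at $(Z_1,\dots,Z_n)|_W$ with $Z_p$ replaced by $Z_pL_c$ if $\chi(p)=\ell$ and by $R_cZ_p$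 if $\chi(p)=r$; and it also equals $\Theta_{\pi|_W}$ evaluated at $(Z_1,\dots,Z_n)|_W$ with $Z_q$ replaced by $L_cZ_q$ if $\chi(q)=\ell$ and by $Z_qR_c$ if $\chi(q)=r$. *)

theory Defs
  imports Complex_Main "HOL-Library.Poly_Mapping" "HOL-Library.Disjoint_Sets"
begin

section \<open>Unital complex algebras\<close>

text \<open>The sort is \<open>ring\<close> and \<open>monoid_mult\<close> rather than \<open>ring_1\<close>, so that the zero algebra is included.\<close>

class complex_unital_algebra = ring + monoid_mult +
  fixes scaleC :: "complex \<Rightarrow> 'a \<Rightarrow> 'a" (infixr \<open>*\<^sub>C\<close> 75)
  assumes scaleC_add_right: "c *\<^sub>C (x + y) = c *\<^sub>C x + c *\<^sub>C y"
    and scaleC_add_left: "(c + d) *\<^sub>C x = c *\<^sub>C x + d *\<^sub>C x"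
    and scaleC_scaleC: "c *\<^sub>C d *\<^sub>C x = (c * d) *\<^sub>C x"
    and scaleC_one: "1 *\<^sub>C x = x"
    and mult_scaleC_left: "(c *\<^sub>C x) * y = c *\<^sub>C (x * y)"
    and mult_scaleC_right: "x * (c *\<^sub>C y) = c *\<^sub>C (x * y)"

interpretation complex_alg: vector_space "scaleC :: complex \<Rightarrow> 'a::complex_unital_algebra \<Rightarrow> 'a"
  by unfold_locales (simp_all add: scaleC_add_right scaleC_add_left scaleC_scaleC scaleC_one)

abbreviation complex_linear ::
    "('a::complex_unital_algebra \<Rightarrow> 'b::complex_unital_algebra) \<Rightarrow> bool" where
  "complex_linear \<equiv> Vector_Spaces.linear scaleC scaleC"

definition unital_algebra_hom ::
    "('a::complex_unital_algebra \<Rightarrow> 'b::complex_unital_algebra) \<Rightarrow> bool" where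
  "unital_algebra_hom f \<longleftrightarrow>
     complex_linear f \<and> f 1 = 1 \<and> (\<forall>x y. f (x * y) = f x * f y)"


subsection \<open>The opposite algebra\<close>

datatype 'a opp = Opp (unopp: 'a)

instantiation opp :: (complex_unital_algebra) complex_unital_algebra
begin

definition "0 = Opp 0"
definition "1 = Opp 1"
definition "x + y = Opp (unopp x + unopp y)"
definition "x - y = Opp (unopp x - unopp y)"
definition "- x = Opp (- unopp x)"
definition "x * y = Opp (unopp y * unopp x)"
definition "c *\<^sub>C x = Opp (c *\<^sub>C unopp x)"

instance
  by standard
    (auto simp: zero_opp_def one_opp_def plus_opp_def minus_opp_def uminus_opp_def times_opp_def
      scaleC_opp_def algebra_simps scaleC_add_right scaleC_add_left scaleC_scaleC scaleC_one
      mult_scaleC_left mult_scaleC_right)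

end


subsection \<open>The algebraic tensor product of two algebras\<close>

text \<open>
  The free complex vector space on pairs \<open>(a, b)\<close>, modulo the span of the bilinearity relators.
  The pairs are given the additively written monoid structure \<open>(a, b) + (a', b') = (a a', b b')\<close>, so
  that the convolution product of \<^type>\<open>poly_mapping\<close> is the multiplication
  \<open>(a \<otimes> b) (a' \<otimes> b') = a a' \<otimes> b b'\<close> and scalars act as \<open>single 0 c\<close>.
\<close>

datatype ('a, 'b) pure = Pure 'a 'b

instantiation pure :: (monoid_mult, monoid_mult) monoid_add
begin

definition "0 = Pure 1 1"

fun plus_pure :: "('a, 'b) pure \<Rightarrow> ('a, 'b) pure \<Rightarrow> ('a, 'b) pure" where
  "Pure a b + Pure a' b' = Pure (a * a') (b * b')"

instance
proof
  fix x y z :: "('a, 'b) pure"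
  show "x + y + z = x + (y + z)"
    by (cases x; cases y; cases z) (simp add: mult.assoc)
  show "0 + x = x" and "x + 0 = x"
    by (cases x; simp add: zero_pure_def)+
qed

end

inductive_set tensor_null ::
    "(('a::complex_unital_algebra, 'b::complex_unital_algebra) pure \<Rightarrow>\<^sub>0 complex) set" where
  null_zero: "0 \<in> tensor_null"
| null_add: "x \<in> tensor_null \<Longrightarrow> y \<in> tensor_null \<Longrightarrow> x + y \<in> tensor_null"
| null_scale: "x \<in> tensor_null \<Longrightarrow> Poly_Mapping.single 0 c * x \<in> tensor_null"
| null_add_left: "Poly_Mapping.single (Pure (a + a') b) 1 - Poly_Mapping.single (Pure a b) 1
    - Poly_Mapping.single (Pure a' b) 1 \<in> tensor_null"
| null_add_right: "Poly_Mapping.single (Pure a (b + b')) 1 - Poly_Mapping.single (Pure a b) 1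
    - Poly_Mapping.single (Pure a b') 1 \<in> tensor_null"
| null_scale_left: "Poly_Mapping.single (Pure (c *\<^sub>C a) b) 1 - Poly_Mapping.single (Pure a b) c
    \<in> tensor_null"
| null_scale_right: "Poly_Mapping.single (Pure a (c *\<^sub>C b)) 1 - Poly_Mapping.single (Pure a b) c
    \<in> tensor_null"

lemma tensor_null_uminus: "x \<in> tensor_null \<Longrightarrow> - x \<in> tensor_null"
  using null_scale[of x "- 1"] by (simp add: single_uminus)

lemma tensor_null_diff: "x \<in> tensor_null \<Longrightarrow> y \<in> tensor_null \<Longrightarrow> x - y \<in> tensor_null"
  using null_add[of x "- y"] by (simp add: tensor_null_uminus)

lemma pure_mapping_induct [case_names zero single add]:
  assumes "P 0" "\<And>p c. P (Poly_Mapping.single p c)" "\<And>x y. P x \<Longrightarrow> P y \<Longrightarrow> P (x + y)"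
  shows "P (x :: 'k \<Rightarrow>\<^sub>0 complex)"
proof (induction x rule: update_induct)
  case const
  show ?case by (rule assms)
next
  case (update f a b)
  have "Poly_Mapping.update a b f = f + Poly_Mapping.single a b"
    using update(1)
    by (intro poly_mapping_eqI) (auto simp: lookup_update lookup_add lookup_single when_def in_keys_iff)
  then show ?case using assms update by simp
qed

lemma single_scale: "Poly_Mapping.single (p::'k::monoid_add) (c::complex)
    = Poly_Mapping.single 0 c * Poly_Mapping.single p 1"
  by (simp add: mult_single)

lemma single_scale_commute: "Poly_Mapping.single 0 (c::complex) * x = x * Poly_Mapping.single 0 c"
  for x :: "'k::monoid_add \<Rightarrow>\<^sub>0 complex"
  by (induction x rule: pure_mapping_induct) (simp_all add: mult_single algebra_simps)

lemma tensor_null_mult_single_left: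
  assumes "x \<in> tensor_null"
  shows "Poly_Mapping.single p d * x \<in> tensor_null"
proof -
  obtain u v where p: "p = Pure u v" by (cases p)
  have "Poly_Mapping.single p 1 * x \<in> tensor_null"
    using assms
  proof induction
    case (null_scale x c)
    then show ?case
      using tensor_null.null_scale[OF null_scale.IH, of c]
      by (simp add: single_scale_commute[of c] mult.assoc)
  next
    case (null_add_left a a' b)
    show ?case
      using tensor_null.null_add_left[of "u * a" "u * a'" "v * b"]
      by (simp add: p right_diff_distrib mult_single distrib_left)
  next
    case (null_add_right a b b')
    show ?case
      using tensor_null.null_add_right[of "u * a" "v * b" "v * b'"]
      by (simp add: p right_diff_distrib mult_single distrib_left)
  next
    case (null_scale_left c a b)
    show ?case
      using tensor_null.null_scale_left[of c "u * a" "v * b"]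
      by (simp add: p right_diff_distrib mult_single mult_scaleC_right)
  next
    case (null_scale_right a c b)
    show ?case
      using tensor_null.null_scale_right[of "u * a" c "v * b"]
      by (simp add: p right_diff_distrib mult_single mult_scaleC_right)
  qed (simp_all add: null_zero distrib_left null_add)
  from tensor_null.null_scale[OF this, of d] show ?thesis
    by (simp add: mult_single flip: mult.assoc)
qed

lemma tensor_null_mult_single_right:
  assumes "x \<in> tensor_null"
  shows "x * Poly_Mapping.single p d \<in> tensor_null"
proof -
  obtain u v where p: "p = Pure u v" by (cases p)
  have "x * Poly_Mapping.single p 1 \<in> tensor_null"
    using assms
  proof induction
    case (null_scale x c)
    then show ?case
      using tensor_null.null_scale[OF null_scale.IH, of c] by (simp add: mult.assoc)
  next
    case (null_add_left a a' b)
    show ?case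
      using tensor_null.null_add_left[of "a * u" "a' * u" "b * v"]
      by (simp add: p left_diff_distrib mult_single distrib_right)
  next
    case (null_add_right a b b')
    show ?case
      using tensor_null.null_add_right[of "a * u" "b * v" "b' * v"]
      by (simp add: p left_diff_distrib mult_single distrib_right)
  next
    case (null_scale_left c a b)
    show ?case
      using tensor_null.null_scale_left[of c "a * u" "b * v"]
      by (simp add: p left_diff_distrib mult_single mult_scaleC_left)
  next
    case (null_scale_right a c b)
    show ?case
      using tensor_null.null_scale_right[of "a * u" c "b * v"]
      by (simp add: p left_diff_distrib mult_single mult_scaleC_left)
  qed (simp_all add: null_zero distrib_right null_add)
  from tensor_null.null_scale[OF this, of d] show ?thesis
    by (simp add: single_scale_commute[of d] mult.assoc mult_single)
qed

lemma tensor_null_mult_left: "x \<in> tensor_null \<Longrightarrow> y * x \<in> tensor_null"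
  by (induction y rule: pure_mapping_induct)
    (auto simp: distrib_right null_zero intro: tensor_null_mult_single_left null_add)

lemma tensor_null_mult_right: "x \<in> tensor_null \<Longrightarrow> x * y \<in> tensor_null"
  by (induction y rule: pure_mapping_induct)
    (auto simp: distrib_left null_zero intro: tensor_null_mult_single_right null_add)

quotient_type (overloaded) ('a, 'b) tensor =
  "('a::complex_unital_algebra, 'b::complex_unital_algebra) pure \<Rightarrow>\<^sub>0 complex"
  / "\<lambda>x y. x - y \<in> tensor_null"
proof (rule equivpI)
  show "reflp (\<lambda>x y. x - y \<in> tensor_null)"
    by (simp add: reflp_def null_zero)
  show "symp (\<lambda>x y. x - y \<in> tensor_null)"
    using tensor_null_uminus by (fastforce intro!: sympI)
  show "transp (\<lambda>x y. x - y \<in> tensor_null)"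
    using null_add by (fastforce intro!: transpI)
qed

instantiation tensor :: (complex_unital_algebra, complex_unital_algebra) complex_unital_algebra
begin

lift_definition zero_tensor :: "('a, 'b) tensor" is 0 .
lift_definition one_tensor :: "('a, 'b) tensor" is 1 .
lift_definition plus_tensor :: "('a, 'b) tensor \<Rightarrow> ('a, 'b) tensor \<Rightarrow> ('a, 'b) tensor" is "(+)"
  by (drule (1) null_add) (simp add: algebra_simps)
lift_definition minus_tensor :: "('a, 'b) tensor \<Rightarrow> ('a, 'b) tensor \<Rightarrow> ('a, 'b) tensor" is "(-)"
  by (drule (1) tensor_null_diff) (simp add: algebra_simps)
lift_definition uminus_tensor :: "('a, 'b) tensor \<Rightarrow> ('a, 'b) tensor" is uminus
  by (drule tensor_null_uminus) simp
lift_definition times_tensor :: "('a, 'b) tensor \<Rightarrow> ('a, 'b) tensor \<Rightarrow> ('a, 'b) tensor" is "(*)"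
proof -
  fix x x' y y' :: "('a, 'b) pure \<Rightarrow>\<^sub>0 complex"
  assume "x - x' \<in> tensor_null" "y - y' \<in> tensor_null"
  then have "(x - x') * y + x' * (y - y') \<in> tensor_null"
    by (intro null_add tensor_null_mult_left tensor_null_mult_right)
  then show "x * y - x' * y' \<in> tensor_null"
    by (simp add: algebra_simps)
qed
lift_definition scaleC_tensor :: "complex \<Rightarrow> ('a, 'b) tensor \<Rightarrow> ('a, 'b) tensor"
  is "\<lambda>c x. Poly_Mapping.single 0 c * x"
  by (simp add: null_scale flip: right_diff_distrib)

instance
proof
  fix x y z :: "('a, 'b) tensor" and c d :: complex
  show "x * y * z = x * (y * z)" by transfer (simp add: mult.assoc null_zero)
  show "1 * x = x" "x * 1 = x" by (transfer; simp add: null_zero)+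
  show "x + y + z = x + (y + z)" by transfer (simp add: add.assoc null_zero)
  show "x + y = y + x" by transfer (simp add: add.commute null_zero)
  show "0 + x = x" by transfer (simp add: null_zero)
  show "- x + x = 0" by transfer (simp add: null_zero)
  show "x - y = x + - y" by transfer (simp add: null_zero)
  show "(x + y) * z = x * z + y * z" by transfer (simp add: distrib_right null_zero)
  show "x * (y + z) = x * y + x * z" by transfer (simp add: distrib_left null_zero)
  show "c *\<^sub>C (x + y) = c *\<^sub>C x + c *\<^sub>C y" by transfer (simp add: distrib_left null_zero)
  show "(c + d) *\<^sub>C x = c *\<^sub>C x + d *\<^sub>C x"
    by transfer (simp add: single_add distrib_right null_zero)
  show "c *\<^sub>C d *\<^sub>C x = (c * d) *\<^sub>C x"
    by transfer (simp add: mult_single null_zero flip: mult.assoc)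
  show "1 *\<^sub>C x = x" by transfer (simp add: null_zero)
  show "(c *\<^sub>C x) * y = c *\<^sub>C (x * y)" by transfer (simp add: mult.assoc null_zero)
  show "x * (c *\<^sub>C y) = c *\<^sub>C (x * y)"
    by transfer (simp add: single_scale_commute mult.assoc null_zero)
qed

end

lift_definition tens :: "'a::complex_unital_algebra \<Rightarrow> 'b::complex_unital_algebra \<Rightarrow> ('a, 'b) tensor"
    (infixl \<open>\<otimes>\<close> 70)
  is "\<lambda>a b. Poly_Mapping.single (Pure a b) 1" .

lemma tens_add_left: "(a + a') \<otimes> b = a \<otimes> b + a' \<otimes> b"
  by transfer (simp add: null_add_left flip: diff_diff_eq)

lemma tens_add_right: "a \<otimes> (b + b') = a \<otimes> b + a \<otimes> b'"
  by transfer (simp add: null_add_right flip: diff_diff_eq)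

lemma tens_scaleC_left: "(c *\<^sub>C a) \<otimes> b = c *\<^sub>C (a \<otimes> b)"
  by transfer (simp add: null_scale_left flip: single_scale)

lemma tens_scaleC_right: "a \<otimes> (c *\<^sub>C b) = c *\<^sub>C (a \<otimes> b)"
  by transfer (simp add: null_scale_right flip: single_scale)

lemma tens_mult: "(a \<otimes> b) * (a' \<otimes> b') = (a * a') \<otimes> (b * b')"
  by transfer (simp add: mult_single null_zero)

lemma tens_one: "1 \<otimes> 1 = 1"
  by transfer (simp add: null_zero flip: zero_pure_def)


section \<open>Bi-non-crossing partitions\<close>

text \<open>
  The index set \<open>{1, ..., n}\<close> is rendered as \<open>{..<n}\<close>, and \<open>\<chi>\<close> as a list of length \<open>n\<close>.
  The restriction of \<open>\<chi>\<close> and of \<open>(Z\<^sub>1, ..., Z\<^sub>n)\<close> to a set \<open>V\<close> of indices is \<^const>\<open>nths\<close>.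
\<close>

datatype side = Lft | Rgt

definition chi_less :: "side list \<Rightarrow> nat \<Rightarrow> nat \<Rightarrow> bool" where
  "chi_less \<chi> i j \<longleftrightarrow>
     (case (\<chi> ! i, \<chi> ! j) of
        (Lft, Lft) \<Rightarrow> i < j | (Lft, Rgt) \<Rightarrow> True | (Rgt, Lft) \<Rightarrow> False | (Rgt, Rgt) \<Rightarrow> j < i)"

definition chi_min :: "side list \<Rightarrow> nat set \<Rightarrow> nat" where
  "chi_min \<chi> S = (THE i. i \<in> S \<and> (\<forall>j\<in>S. j = i \<or> chi_less \<chi> i j))"

definition chi_max :: "side list \<Rightarrow> nat set \<Rightarrow> nat" where
  "chi_max \<chi> S = (THE i. i \<in> S \<and> (\<forall>j\<in>S. j = i \<or> chi_less \<chi> j i))"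

definition chi_interval :: "side list \<Rightarrow> nat set \<Rightarrow> bool" where
  "chi_interval \<chi> V \<longleftrightarrow> V \<subseteq> {..<length \<chi>} \<and> V \<noteq> {} \<and>
     (\<forall>i\<in>V. \<forall>k\<in>V. \<forall>j<length \<chi>. chi_less \<chi> i j \<and> chi_less \<chi> j k \<longrightarrow> j \<in> V)"

definition BNC :: "side list \<Rightarrow> nat set set set" where
  "BNC \<chi> = {\<pi>. partition_on {..<length \<chi>} \<pi> \<and>
     (\<forall>U\<in>\<pi>. \<forall>W\<in>\<pi>. \<forall>a\<in>U. \<forall>b\<in>W. \<forall>c\<in>U. \<forall>d\<in>W.
        chi_less \<chi> a b \<and> chi_less \<chi> b c \<and> chi_less \<chi> c d \<longrightarrow> U = W)}"

abbreviation refinement :: "side list \<Rightarrow> nat set set \<Rightarrow> nat set set \<Rightarrow> bool" where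
  "refinement \<chi> \<equiv> refines {..<length \<chi>}"

abbreviation one_chi :: "side list \<Rightarrow> nat set set" where
  "one_chi \<chi> \<equiv> {{..<length \<chi>}}"

definition relabel :: "nat set \<Rightarrow> nat \<Rightarrow> nat" where
  "relabel V i = card {j \<in> V. j < i}"

definition restrict_part :: "nat set \<Rightarrow> nat set set \<Rightarrow> nat set set" where
  "restrict_part V \<pi> = (\<lambda>U. relabel V ` (U \<inter> V)) ` \<pi> - {{}}"

definition union_of_blocks :: "nat set set \<Rightarrow> nat set \<Rightarrow> bool" where
  "union_of_blocks \<pi> V \<longleftrightarrow> (\<exists>S\<subseteq>\<pi>. V = \<Union>S)"

definition interval_decomp :: "side list \<Rightarrow> nat set set \<Rightarrow> nat set list \<Rightarrow> bool" where
  "interval_decomp \<chi> \<pi> Vs \<longleftrightarrow>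
     partition_on {..<length \<chi>} (set Vs) \<and>
     sorted_wrt (\<lambda>V W. \<forall>i\<in>V. \<forall>j\<in>W. chi_less \<chi> i j) Vs \<and>
     (\<forall>V\<in>set Vs. chi_interval \<chi> V \<and> union_of_blocks \<pi> V)"

definition is_outer_decomp :: "side list \<Rightarrow> nat set set \<Rightarrow> nat set list \<Rightarrow> bool" where
  "is_outer_decomp \<chi> \<pi> Vs \<longleftrightarrow> interval_decomp \<chi> \<pi> Vs \<and>
     (\<forall>V\<in>set Vs. \<exists>U\<in>\<pi>. chi_min \<chi> V \<in> U \<and> chi_max \<chi> V \<in> U)"

definition outer_decomp :: "side list \<Rightarrow> nat set set \<Rightarrow> nat set list" where
  "outer_decomp \<chi> \<pi> = (THE Vs. is_outer_decomp \<chi> \<pi> Vs)"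

lemma chi_less_irrefl [simp]: "\<not> chi_less \<chi> i i"
  by (cases "\<chi> ! i") (auto simp: chi_less_def)

lemma chi_less_trans: "chi_less \<chi> i j \<Longrightarrow> chi_less \<chi> j k \<Longrightarrow> chi_less \<chi> i k"
  by (auto simp: chi_less_def split: side.splits)

lemma chi_less_total: "i = j \<or> chi_less \<chi> i j \<or> chi_less \<chi> j i"
  by (auto simp: chi_less_def split: side.splits)

lemma chi_less_asym: "chi_less \<chi> i j \<Longrightarrow> \<not> chi_less \<chi> j i"
  by (metis chi_less_irrefl chi_less_trans)

lemma chi_min_unique: 
  assumes "i \<in> S" "\<forall>j\<in>S. j = i \<or> chi_less \<chi> i j"
  shows "chi_min \<chi> S = i"
  unfolding chi_min_def
  by (rule the_equality) (use assms in blast, metis assms chi_less_asym)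

lemma chi_max_unique: 
  assumes "i \<in> S" "\<forall>j\<in>S. j = i \<or> chi_less \<chi> j i"
  shows "chi_max \<chi> S = i"
  unfolding chi_max_def
  by (rule the_equality) (use assms in blast, metis assms chi_less_asym)

lemma chi_min_least:
  assumes "finite S" "S \<noteq> {}"
  shows "chi_min \<chi> S \<in> S \<and> (\<forall>j\<in>S. j = chi_min \<chi> S \<or> chi_less \<chi> (chi_min \<chi> S) j)"
proof -
  have "\<exists>i\<in>S. \<forall>j\<in>S. j = i \<or> chi_less \<chi> i j"
    using assms
  proof (induction S rule: finite_ne_induct)
    case (insert x F)
    then obtain i where i: "i \<in> F" "\<forall>j\<in>F. j = i \<or> chi_less \<chi> i j" by blast
    show ?case
    proof (cases "chi_less \<chi> x i")
      case True
      then have "\<forall>j\<in>insert x F. j = x \<or> chi_less \<chi> x j" using i by (metis chi_less_trans insertE)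
      then show ?thesis by blast
    next
      case False
      then show ?thesis using i insert.hyps chi_less_total by blast
    qed
  qed auto
  then show ?thesis using chi_min_unique by metis
qed

lemma chi_max_greatest:
  assumes "finite S" "S \<noteq> {}"
  shows "chi_max \<chi> S \<in> S \<and> (\<forall>j\<in>S. j = chi_max \<chi> S \<or> chi_less \<chi> j (chi_max \<chi> S))"
proof -
  have "\<exists>i\<in>S. \<forall>j\<in>S. j = i \<or> chi_less \<chi> j i"
    using assms
  proof (induction S rule: finite_ne_induct)
    case (insert x F)
    then obtain i where i: "i \<in> F" "\<forall>j\<in>F. j = i \<or> chi_less \<chi> j i" by blast
    show ?case
    proof (cases "chi_less \<chi> i x")
      case True
      then have "\<forall>j\<in>insert x F. j = x \<or> chi_less \<chi> j x" using i by (metis chi_less_trans insertE)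
      then show ?thesis by blast
    next
      case False
      then show ?thesis using i insert.hyps chi_less_total by blast
    qed
  qed auto
  then show ?thesis using chi_max_unique by metis
qed

lemma finite_BNC: "finite (BNC \<chi>)"
  by (rule finite_subset[of _ "Pow (Pow {..<length \<chi>})"]) (auto simp: BNC_def partition_on_def)

lemma BNC_D:
  assumes "\<pi> \<in> BNC \<chi>"
  shows "partition_on {..<length \<chi>} \<pi>" "\<Union>\<pi> = {..<length \<chi>}" "disjoint \<pi>" "{} \<notin> \<pi>" "finite \<pi>"
    "U \<in> \<pi> \<Longrightarrow> finite U" "U \<in> \<pi> \<Longrightarrow> U \<subseteq> {..<length \<chi>}"
proof -
  show p: "partition_on {..<length \<chi>} \<pi>" using assms by (simp add: BNC_def)
  show 1: "\<Union>\<pi> = {..<length \<chi>}" and "disjoint \<pi>" "{} \<notin> \<pi>"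
    using p by (auto simp: partition_on_def)
  show "finite \<pi>" using p by (rule finite_elements[rotated]) simp
  show 2: "U \<in> \<pi> \<Longrightarrow> U \<subseteq> {..<length \<chi>}" using 1 by blast
  then show "U \<in> \<pi> \<Longrightarrow> finite U" by (meson finite_lessThan finite_subset)
qed

lemma BNC_disjoint: "\<pi> \<in> BNC \<chi> \<Longrightarrow> U \<in> \<pi> \<Longrightarrow> W \<in> \<pi> \<Longrightarrow> x \<in> U \<Longrightarrow> x \<in> W \<Longrightarrow> U = W"
  using BNC_D(3) unfolding disjoint_def by blast

lemma BNC_noncrossing:
  "\<pi> \<in> BNC \<chi> \<Longrightarrow> U \<in> \<pi> \<Longrightarrow> W \<in> \<pi> \<Longrightarrow> a \<in> U \<Longrightarrow> b \<in> W \<Longrightarrow> c \<in> U \<Longrightarrow> d \<in> W \<Longrightarrow>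
    chi_less \<chi> a b \<Longrightarrow> chi_less \<chi> b c \<Longrightarrow> chi_less \<chi> c d \<Longrightarrow> U = W"
  unfolding BNC_def mem_Collect_eq by meson

text \<open>The outer decomposition into \<open>\<chi>\<close>-intervals exists and is unique.\<close>

lemma outer_decomp_aux:
  assumes "\<pi> \<in> BNC \<chi>" "S \<subseteq> {..<length \<chi>}" "union_of_blocks \<pi> S"
  shows "\<exists>!Vs. \<Union>(set Vs) = S \<and> {} \<notin> set Vs \<and>
    sorted_wrt (\<lambda>V W. \<forall>i\<in>V. \<forall>j\<in>W. chi_less \<chi> i j) Vs \<and>
    (\<forall>V\<in>set Vs. union_of_blocks \<pi> V \<and> (\<exists>U\<in>\<pi>. chi_min \<chi> V \<in> U \<and> chi_max \<chi> V \<in> U))"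
  (is "\<exists>!Vs. ?P S Vs")
  using assms(2,3)
proof (induction "card S" arbitrary: S rule: less_induct)
  case less
  have fin: "finite S" using less.prems(1) by (rule finite_subset) simp
  have union: "U \<subseteq> S" if U: "U \<in> \<pi>" "x \<in> U" "x \<in> S" "union_of_blocks \<pi> S" for U x S
  proof -
    obtain T where T: "T \<subseteq> \<pi>" "S = \<Union>T"
      using U(4) unfolding union_of_blocks_def by (elim exE conjE)
    then obtain X where X: "X \<in> T" "x \<in> X" using U(3) by (auto elim: UnionE)
    then have "U = X" using BNC_disjoint[OF assms(1) U(1) _ U(2) X(2)] T(1) by auto
    then show ?thesis using X T by auto
  qed
  show ?case
  proof (cases "S = {}")
    case True
    have "Vs = []" if "?P S Vs" for Vs
      using that True by (cases Vs) auto
    moreover have "?P S []" using True by simp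
    ultimately show ?thesis by (intro ex1I[of _ "[]"])
  next
    case False
    define e where "e = chi_min \<chi> S"
    have e: "e \<in> S" "\<And>j. j \<in> S \<Longrightarrow> j = e \<or> chi_less \<chi> e j"
      using chi_min_least[OF fin False] by (auto simp: e_def)
    obtain U where U: "U \<in> \<pi>" "e \<in> U"
      using e(1) less.prems(2) unfolding union_of_blocks_def by blast
    have US: "U \<subseteq> S" using union U e(1) less.prems(2) by blast
    define m where "m = chi_max \<chi> U"
    have m: "m \<in> U" "\<And>j. j \<in> U \<Longrightarrow> j = m \<or> chi_less \<chi> j m"
      using chi_max_greatest[of U \<chi>] U BNC_D(6)[OF assms(1)] by (auto simp: m_def)
    define V where "V = {j \<in> S. j = m \<or> chi_less \<chi> j m}"
    have VS: "V \<subseteq> S" and UV: "U \<subseteq> V" using US m(2) by (auto simp: V_def)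
    have eV: "e \<in> V" using UV U by blast
    have minV: "chi_min \<chi> V = e" using eV VS e(2) by (intro chi_min_unique) auto
    have maxV: "chi_max \<chi> V = m" using UV m by (intro chi_max_unique) (auto simp: V_def)
    have blkV: "W \<subseteq> V" if W: "W \<in> \<pi>" "x \<in> W" "x \<in> V" for W x
    proof
      fix y assume y: "y \<in> W"
      have yS: "y \<in> S" using union[OF W(1,2) _ less.prems(2)] W(3) VS y by blast
      show "y \<in> V"
      proof (rule ccontr)
        assume "y \<notin> V"
        then have my: "chi_less \<chi> m y" using yS chi_less_total by (auto simp: V_def)
        have WU: "W \<noteq> U" using y UV \<open>y \<notin> V\<close> by blast
        then have "x \<noteq> m" "x \<noteq> e" using BNC_disjoint[OF assms(1) W(1) U(1)] W(2) m(1) U(2) by blast+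
        then have "chi_less \<chi> e x" "chi_less \<chi> x m" using W(3) e(2) by (auto simp: V_def)
        then show False
          using BNC_noncrossing[OF assms(1) U(1) W(1) U(2) W(2) m(1) y] my WU by auto
      qed
    qed
    have unionI: "union_of_blocks \<pi> T" if T: "T \<subseteq> S" "\<And>W x. W \<in> \<pi> \<Longrightarrow> x \<in> W \<Longrightarrow> x \<in> T \<Longrightarrow> W \<subseteq> T" for T
    proof -
      have "x \<in> \<Union>{W \<in> \<pi>. W \<subseteq> T}" if x: "x \<in> T" for x
      proof -
        obtain W where "W \<in> \<pi>" "x \<in> W"
          using less.prems(1) BNC_D(2)[OF assms(1)] x T(1) by (metis UnionE subsetD)
        then show ?thesis using T(2) x by auto
      qed
      then have "T = \<Union>{W \<in> \<pi>. W \<subseteq> T}" by auto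
      then show ?thesis unfolding union_of_blocks_def by (intro exI[of _ "{W \<in> \<pi>. W \<subseteq> T}"]) auto
    qed
    have uV: "union_of_blocks \<pi> V" by (rule unionI[OF VS blkV])
    have uSV: "union_of_blocks \<pi> (S - V)"
    proof (rule unionI)
      fix W x assume W: "W \<in> \<pi>" "x \<in> W" "x \<in> S - V"
      then have "W \<subseteq> S" using union less.prems(2) by simp
      moreover have "y \<notin> V" if "y \<in> W" for y using blkV[OF W(1) that] W by auto
      ultimately show "W \<subseteq> S - V" by auto
    qed simp
    have "card (S - V) < card S"
      using fin eV VS by (intro psubset_card_mono) auto
    then have ex1: "\<exists>!Vs. ?P (S - V) Vs"
      using less.prems(1) by (intro less.hyps uSV) auto
    obtain Vs where Vs1: "?P (S - V) Vs"
      using ex1_implies_ex[OF ex1] by (elim exE) (rule that)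
    have Vs2: "Ws = Vs" if "?P (S - V) Ws" for Ws
      using ex1[unfolded ex1_iff_ex_Uniq, THEN conjunct2] that Vs1 by (rule Uniq_D)
    have lessV: "chi_less \<chi> i j" if "i \<in> V" "j \<in> S - V" for i j
      using that chi_less_total[of j m \<chi>] chi_less_trans[of \<chi> i m j] unfolding V_def by auto
    have "?P S (V # Vs)"
    proof (intro conjI)
      show "\<Union>(set (V # Vs)) = S" "{} \<notin> set (V # Vs)" using Vs1 VS eV by auto
      have "chi_less \<chi> i j" if "i \<in> V" "W \<in> set Vs" "j \<in> W" for i j W
        using that Vs1 by (intro lessV) auto
      then show "sorted_wrt (\<lambda>V W. \<forall>i\<in>V. \<forall>j\<in>W. chi_less \<chi> i j) (V # Vs)"
        using Vs1 by simp
      have "\<exists>U\<in>\<pi>. chi_min \<chi> V \<in> U \<and> chi_max \<chi> V \<in> U"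
        using U m(1) unfolding minV maxV by auto
      then show "\<forall>V\<in>set (V # Vs). union_of_blocks \<pi> V \<and>
          (\<exists>U\<in>\<pi>. chi_min \<chi> V \<in> U \<and> chi_max \<chi> V \<in> U)"
        using Vs1 uV by simp
    qed
    moreover have "Ws = V # Vs" if Ws: "?P S Ws" for Ws
    proof (cases Ws)
      case Nil
      then show ?thesis using Ws False by simp
    next
      case (Cons X Xs)
      have XS: "X \<subseteq> S" and Xne: "X \<noteq> {}" and uX: "union_of_blocks \<pi> X"
        and less: "\<And>i j W. i \<in> X \<Longrightarrow> W \<in> set Xs \<Longrightarrow> j \<in> W \<Longrightarrow> chi_less \<chi> i j"
        using Ws Cons by auto
      have finX: "finite X" using XS fin by (rule finite_subset)
      have "S = X \<union> \<Union>(set Xs)" using Ws Cons by auto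
      moreover have "x \<notin> \<Union>(set Xs)" if "x \<in> X" for x
        using less[OF that, of _ x] by auto
      ultimately have SX: "S - X = \<Union>(set Xs)" by auto
      have eX: "e \<in> X"
      proof (rule ccontr)
        assume "e \<notin> X"
        then have *: "e \<in> \<Union>(set Xs)" using e(1) SX by auto
        obtain x where x: "x \<in> X" using Xne by auto
        then have "chi_less \<chi> x e" using * less by auto
        then show False using x XS e(2)[of x] chi_less_asym[of \<chi> x e] by auto
      qed
      then have minX: "chi_min \<chi> X = e" using XS e(2) by (intro chi_min_unique) auto
      have "U \<subseteq> X" using union[OF U eX uX] .
      moreover have maxU: "chi_max \<chi> X \<in> U"
        using Ws Cons minX BNC_disjoint[OF assms(1) _ U(1) _ U(2)] by auto
      ultimately have maxX: "chi_max \<chi> X = m"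
        using m chi_max_greatest[OF finX Xne, of \<chi>] chi_less_asym by (metis subsetD)
      have "X = V"
      proof
        show "X \<subseteq> V"
          using XS chi_max_greatest[OF finX Xne, of \<chi>] unfolding maxX V_def by auto
        have mX: "m \<in> X" using maxX chi_max_greatest[OF finX Xne, of \<chi>] by simp
        show "V \<subseteq> X"
        proof
          fix j assume j: "j \<in> V"
          show "j \<in> X"
          proof (rule ccontr)
            assume "j \<notin> X"
            then have "j \<in> \<Union>(set Xs)" using j VS SX by auto
            then have "chi_less \<chi> m j" using less mX by auto
            moreover have "j \<noteq> m" using \<open>j \<notin> X\<close> mX by auto
            ultimately show False using j chi_less_asym[of \<chi> m j] unfolding V_def by auto
          qed
        qed
      qed
      moreover have "?P (S - X) Xs" using SX Ws Cons by auto
      ultimately show ?thesis using Vs2[of Xs] Cons by simp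
    qed
    ultimately show ?thesis by (rule ex1I)
  qed
qed

lemma is_outer_decomp_iff:
  "is_outer_decomp \<chi> \<pi> Vs \<longleftrightarrow> \<Union>(set Vs) = {..<length \<chi>} \<and> {} \<notin> set Vs \<and>
    sorted_wrt (\<lambda>V W. \<forall>i\<in>V. \<forall>j\<in>W. chi_less \<chi> i j) Vs \<and>
    (\<forall>V\<in>set Vs. union_of_blocks \<pi> V \<and> (\<exists>U\<in>\<pi>. chi_min \<chi> V \<in> U \<and> chi_max \<chi> V \<in> U))"
  (is "_ \<longleftrightarrow> ?R")
proof
  show "is_outer_decomp \<chi> \<pi> Vs \<Longrightarrow> ?R"
    by (auto simp: is_outer_decomp_def interval_decomp_def partition_on_def)
next
  assume R: ?R
  have trich: "V = W \<or> (\<forall>i\<in>V. \<forall>j\<in>W. chi_less \<chi> i j) \<or> (\<forall>i\<in>V. \<forall>j\<in>W. chi_less \<chi> j i)"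
    if VW: "V \<in> set Vs" "W \<in> set Vs" for V W
  proof -
    obtain a b where ab: "a < length Vs" "b < length Vs" "V = Vs ! a" "W = Vs ! b"
      using VW by (metis in_set_conv_nth)
    show ?thesis
      using R ab sorted_wrt_nth_less[of _ Vs] by (cases a b rule: linorder_cases) blast+
  qed
  have disj: "V = W" if "V \<in> set Vs" "W \<in> set Vs" "x \<in> V" "x \<in> W" for V W x
    using trich[OF that(1,2)] that(3,4) chi_less_irrefl by blast
  have "partition_on {..<length \<chi>} (set Vs)"
    using R disj unfolding partition_on_def disjoint_def by blast
  moreover have "chi_interval \<chi> V" if V: "V \<in> set Vs" for V
    unfolding chi_interval_def
  proof (intro conjI ballI allI impI)
    show "V \<subseteq> {..<length \<chi>}" "V \<noteq> {}" using R V by auto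
    fix i k j
    assume ik: "i \<in> V" "k \<in> V" and j: "j < length \<chi>" "chi_less \<chi> i j \<and> chi_less \<chi> j k"
    then obtain W where W: "W \<in> set Vs" "j \<in> W" using R by blast
    show "j \<in> V" using trich[OF V W(1)] W(2) ik j(2) chi_less_asym by blast
  qed
  ultimately show "is_outer_decomp \<chi> \<pi> Vs"
    using R by (simp add: is_outer_decomp_def interval_decomp_def)
qed

lemma ex1_outer_decomp:
  assumes "\<pi> \<in> BNC \<chi>"
  shows "\<exists>!Vs. is_outer_decomp \<chi> \<pi> Vs"
proof -
  have "union_of_blocks \<pi> {..<length \<chi>}"
    using BNC_D(2)[OF assms] unfolding union_of_blocks_def by blast
  from outer_decomp_aux[OF assms order_refl this] show ?thesis
    unfolding is_outer_decomp_iff .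
qed

lemma outer_decomp: "\<pi> \<in> BNC \<chi> \<Longrightarrow> is_outer_decomp \<chi> \<pi> (outer_decomp \<chi> \<pi>)"
  unfolding outer_decomp_def by (rule theI') (rule ex1_outer_decomp)

lemma nth_nths: "i \<in> V \<Longrightarrow> i < length xs \<Longrightarrow> nths xs V ! relabel V i = xs ! i"
proof (induction xs arbitrary: V i)
  case (Cons x xs)
  show ?case
  proof (cases i)
    case 0
    then show ?thesis using Cons.prems by (simp add: nths_Cons relabel_def)
  next
    case (Suc i')
    have "{j \<in> V. j < i} = (if 0 \<in> V then {0} else {}) \<union> Suc ` {j. Suc j \<in> V \<and> j < i'}"
      unfolding Suc using less_Suc_eq_0_disj by auto
    then have "relabel V i = (if 0 \<in> V then 1 else 0) + relabel {j. Suc j \<in> V} i'"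
      unfolding relabel_def by (simp add: card_insert_if card_image)
    then show ?thesis using Cons.IH[of i' "{j. Suc j \<in> V}"] Cons.prems Suc
      by (simp add: nths_Cons)
  qed
qed simp

lemma relabel_less: "i \<in> V \<Longrightarrow> i < j \<Longrightarrow> relabel V i < relabel V j"
  unfolding relabel_def by (rule psubset_card_mono) auto

lemma relabel_less_iff: "i \<in> V \<Longrightarrow> j \<in> V \<Longrightarrow> relabel V i < relabel V j \<longleftrightarrow> i < j"
  by (metis relabel_less less_asym linorder_neqE_nat order_less_irrefl)

lemma relabel_inj_on: "inj_on (relabel V) V"
  by (metis inj_onI less_irrefl_nat nat_neq_iff relabel_less)

lemma relabel_image:
  assumes "V \<subseteq> {..<length xs}"
  shows "relabel V ` V = {..<length (nths xs V)}"
proof -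
  have len: "length (nths xs V) = card V"
    using assms unfolding length_nths by (metis (no_types, lifting) Collect_cong Collect_mem_eq lessThan_iff subsetD)
  have fin: "finite V" using assms by (rule finite_subset) simp
  have "relabel V ` V \<subseteq> {..<card V}"
    unfolding relabel_def using fin by (auto intro!: psubset_card_mono)
  moreover have "card (relabel V ` V) = card V"
    using relabel_inj_on by (rule card_image)
  ultimately show ?thesis using len by (metis card_lessThan card_subset_eq finite_lessThan)
qed

lemma chi_less_nths:
  assumes "V \<subseteq> {..<length \<chi>}" "i \<in> V" "j \<in> V"
  shows "chi_less (nths \<chi> V) (relabel V i) (relabel V j) \<longleftrightarrow> chi_less \<chi> i j"
proof -
  have "i < length \<chi>" "j < length \<chi>" using assms by auto
  then show ?thesis
    using assms unfolding chi_less_def by (simp add: nth_nths relabel_less_iff split: side.split)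
qed

lemma restrict_part_BNC:
  assumes "\<pi> \<in> BNC \<chi>" "V \<subseteq> {..<length \<chi>}"
  shows "restrict_part V \<pi> \<in> BNC (nths \<chi> V)"
proof -
  have r: "X \<in> restrict_part V \<pi> \<longleftrightarrow> (\<exists>U\<in>\<pi>. U \<inter> V \<noteq> {} \<and> X = relabel V ` (U \<inter> V))" for X
    by (auto simp: restrict_part_def)
  have "\<Union>(restrict_part V \<pi>) = relabel V ` (\<Union>\<pi> \<inter> V)"
    by (auto simp: restrict_part_def)
  then have "\<Union>(restrict_part V \<pi>) = {..<length (nths \<chi> V)}"
    using BNC_D(2)[OF assms(1)] relabel_image[OF assms(2)] assms(2) by (simp add: Int_absorb1)
  moreover have "disjoint (restrict_part V \<pi>)"
  proof (rule disjointI)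
    fix X Y
    assume XY: "X \<in> restrict_part V \<pi>" "Y \<in> restrict_part V \<pi>" "X \<noteq> Y"
    from XY(1) obtain U where U: "U \<in> \<pi>" "X = relabel V ` (U \<inter> V)" using r by auto
    from XY(2) obtain W where W: "W \<in> \<pi>" "Y = relabel V ` (W \<inter> V)" using r by auto
    have "(U \<inter> V) \<inter> (W \<inter> V) = {}"
      using XY(3) U W BNC_disjoint[OF assms(1) U(1) W(1)] by auto
    then show "X \<inter> Y = {}"
      using inj_on_image_Int[OF relabel_inj_on[of V], of "U \<inter> V" "W \<inter> V"] U W by simp
  qed
  moreover have "{} \<notin> restrict_part V \<pi>" by (simp add: restrict_part_def)
  moreover have "X = Y" if XY: "X \<in> restrict_part V \<pi>" "Y \<in> restrict_part V \<pi>"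
    "a \<in> X" "b \<in> Y" "c \<in> X" "d \<in> Y"
    and less: "chi_less (nths \<chi> V) a b \<and> chi_less (nths \<chi> V) b c \<and> chi_less (nths \<chi> V) c d"
    for X Y a b c d
  proof -
    from XY(1) obtain U where U: "U \<in> \<pi>" "X = relabel V ` (U \<inter> V)" using r by auto
    from XY(2) obtain W where W: "W \<in> \<pi>" "Y = relabel V ` (W \<inter> V)" using r by auto
    from XY(3) U obtain a' where a: "a' \<in> U" "a' \<in> V" "a = relabel V a'" by auto
    from XY(4) W obtain b' where b: "b' \<in> W" "b' \<in> V" "b = relabel V b'" by auto
    from XY(5) U obtain c' where c: "c' \<in> U" "c' \<in> V" "c = relabel V c'" by auto
    from XY(6) W obtain d' where d: "d' \<in> W" "d' \<in> V" "d = relabel V d'" by auto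
    have "chi_less \<chi> a' b'" "chi_less \<chi> b' c'" "chi_less \<chi> c' d'"
      using less assms(2) a b c d by (simp_all add: chi_less_nths)
    then have "U = W"
      using BNC_noncrossing[OF assms(1) U(1) W(1) a(1) b(1) c(1) d(1)] by simp
    then show ?thesis using U W by simp
  qed
  ultimately show ?thesis
    unfolding BNC_def partition_on_def by (intro CollectI conjI ballI impI) simp_all
qed

subsection \<open>The Moebius function of the lattice of bi-non-crossing partitions\<close>

text \<open>Values outside \<open>{(\<sigma>, \<pi>). \<sigma> \<le> \<pi>}\<close> are \<open>0\<close>.\<close>

function mu_BNC :: "side list \<Rightarrow> nat set set \<Rightarrow> nat set set \<Rightarrow> int" where
  "mu_BNC \<chi> \<sigma> \<pi> =
     (if \<sigma> \<in> BNC \<chi> \<and> \<pi> \<in> BNC \<chi> \<and> refinement \<chi> \<sigma> \<pi> then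
        if \<sigma> = \<pi> then 1
        else - (\<Sum>\<tau> \<in> {\<tau> \<in> BNC \<chi>. refinement \<chi> \<sigma> \<tau> \<and> refinement \<chi> \<tau> \<pi> \<and> \<tau> \<noteq> \<pi>}. mu_BNC \<chi> \<sigma> \<tau>)
      else 0)"
  by auto
termination
proof (relation "measure (\<lambda>(\<chi>, \<sigma>, \<pi>). card {\<rho> \<in> BNC \<chi>. refinement \<chi> \<rho> \<pi>})", goal_cases)
  case (2 \<chi> \<sigma> \<pi> \<tau>)
  then have "{\<rho> \<in> BNC \<chi>. refinement \<chi> \<rho> \<tau>} \<subset> {\<rho> \<in> BNC \<chi>. refinement \<chi> \<rho> \<pi>}"
    using refines_trans refines_asym refines_refl BNC_D(1) by blast
  then show ?case by (simp add: psubset_card_mono finite_BNC)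
qed simp

declare mu_BNC.simps [simp del]

lemma length_nths_psubset: "V \<subset> {..<length xs} \<Longrightarrow> length (nths xs V) < length xs"
  unfolding length_nths using psubset_card_mono[of "{..<length xs}" "{i. i < length xs \<and> i \<in> V}"]
  by auto

lemma BNC_arg_max_Min:
  assumes "\<pi> \<in> BNC \<chi>" "U \<in> \<pi>" "P U"
  shows "(ARG_MAX Min V. V \<in> \<pi> \<and> P V) \<in> \<pi> \<and> P (ARG_MAX Min V. V \<in> \<pi> \<and> P V)"
proof (rule arg_max_natI)
  show "\<forall>V. V \<in> \<pi> \<and> P V \<longrightarrow> Min V < length \<chi>"
    using BNC_D(4,6,7)[OF assms(1)] by (metis Min_in lessThan_iff subsetD)
qed (use assms in simp)

lemma BNC_remove_block:
  assumes "\<pi> \<in> BNC \<chi>" "V \<in> \<pi>"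
  shows "length (nths \<chi> ({..<length \<chi>} - V)) < length \<chi>"
proof (rule length_nths_psubset)
  have "V \<noteq> {}" "V \<subseteq> {..<length \<chi>}" using BNC_D(4,7)[OF assms(1)] assms(2) by auto
  then show "{..<length \<chi>} - V \<subset> {..<length \<chi>}" by auto
qed

section \<open>The spaces\<close>

text \<open>The inclusion \<open>\<B> \<subseteq> \<D>\<close> is an injective unital homomorphism \<open>\<iota>\<close> between types.\<close>

definition left_op :: "(('b::complex_unital_algebra, 'b opp) tensor \<Rightarrow> 'a) \<Rightarrow> 'b \<Rightarrow> 'a" where
  "left_op \<epsilon> b = \<epsilon> (b \<otimes> 1)"

definition right_op :: "(('b::complex_unital_algebra, 'b opp) tensor \<Rightarrow> 'a) \<Rightarrow> 'b \<Rightarrow> 'a" where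
  "right_op \<epsilon> b = \<epsilon> (1 \<otimes> Opp b)"

locale bb_nc_prob_space_pair =
  fixes \<iota> :: "'b::complex_unital_algebra \<Rightarrow> 'd::complex_unital_algebra"
    and \<epsilon> :: "('b, 'b opp) tensor \<Rightarrow> 'a::complex_unital_algebra"
    and E :: "'a \<Rightarrow> 'b"
    and F :: "'a \<Rightarrow> 'd"
  assumes incl_hom: "unital_algebra_hom \<iota>"
    and incl_inj: "inj \<iota>"
    and eps_hom: "unital_algebra_hom \<epsilon>"
    and eps_inj_left: "inj_on \<epsilon> (range (\<lambda>b. b \<otimes> 1))"
    and eps_inj_right: "inj_on \<epsilon> (range (\<lambda>b. 1 \<otimes> b))"
    and E_linear: "complex_linear E"
    and E_one: "E 1 = 1"
    and F_linear: "complex_linear F"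
    and F_one: "F 1 = 1"
    and E_bimodule: "E (left_op \<epsilon> b\<^sub>1 * right_op \<epsilon> b\<^sub>2 * Z) = b\<^sub>1 * E Z * b\<^sub>2"
    and E_right: "E (Z * left_op \<epsilon> b) = E (Z * right_op \<epsilon> b)"
    and F_bimodule: "F (left_op \<epsilon> b\<^sub>1 * right_op \<epsilon> b\<^sub>2 * Z) = \<iota> b\<^sub>1 * F Z * \<iota> b\<^sub>2"
    and F_right: "F (Z * left_op \<epsilon> b) = F (Z * right_op \<epsilon> b)"

text \<open>\<open>face \<epsilon> Lft\<close> is \<open>\<A>\<^sub>\<ell>\<close> and \<open>face \<epsilon> Rgt\<close> is \<open>\<A>\<^sub>r\<close>.\<close>

definition face ::
    "(('b::complex_unital_algebra, 'b opp) tensor \<Rightarrow> 'a::complex_unital_algebra) \<Rightarrow> side \<Rightarrow> 'a set" where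
  "face \<epsilon> s = (case s of
     Lft \<Rightarrow> {Z. \<forall>b. Z * right_op \<epsilon> b = right_op \<epsilon> b * Z}
   | Rgt \<Rightarrow> {Z. \<forall>b. Z * left_op \<epsilon> b = left_op \<epsilon> b * Z})"

definition face_tuples ::
    "(('b::complex_unital_algebra, 'b opp) tensor \<Rightarrow> 'a::complex_unital_algebra) \<Rightarrow> side list \<Rightarrow> 'a list set"
  where "face_tuples \<epsilon> \<chi> = {Z. length Z = length \<chi> \<and> (\<forall>k<length \<chi>. Z ! k \<in> face \<epsilon> (\<chi> ! k))}"


section \<open>Moments and cumulants\<close>

text \<open>
  In the recursive definitions below the argument \<open>(\<chi>, \<pi>, Z)\<close> is meaningful if \<open>\<chi>\<close> and \<open>Z\<close> have
  the same positive length and \<open>\<pi> \<in> BNC \<chi>\<close>; the value is \<open>0\<close> otherwise. Recursive calls stay in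
  this domain by \<open>restrict_part_BNC\<close>.
\<close>

definition last_block :: "nat set set \<Rightarrow> nat set" where
  "last_block \<pi> = (ARG_MAX Min V. V \<in> \<pi>)"

text \<open>The entries \<open>(Z\<^sub>1, ..., Z\<^sub>n)\<close> after the contribution of \<open>last_block \<pi>\<close> has been moved into one of
  the entries of another block.\<close>

definition absorb_last_block ::
    "(('b::complex_unital_algebra, 'b opp) tensor \<Rightarrow> 'a::complex_unital_algebra) \<Rightarrow> ('a \<Rightarrow> 'b) \<Rightarrow>
     side list \<Rightarrow> nat set set \<Rightarrow> 'a list \<Rightarrow> 'a list" where
  "absorb_last_block \<epsilon> E \<chi> \<pi> Z =
     (let n = length \<chi>;
          V = last_block \<pi>;
          m = Min V;
          b = E (prod_list (nths Z V));
          T = (case \<chi> ! m of Lft \<Rightarrow> left_op \<epsilon> b | Rgt \<Rightarrow> right_op \<epsilon> b)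
      in if V = {m..<n} then Z[m - 1 := Z ! (m - 1) * T]
         else
           let S = {m<..<n} - V;
               w = (case \<chi> ! m of Lft \<Rightarrow> chi_min \<chi> S | Rgt \<Rightarrow> chi_max \<chi> S);
               W = (THE U. U \<in> \<pi> \<and> w \<in> U);
               k = Min {j \<in> W. m < j}
           in Z[k := T * Z ! k])"

function bi_moment ::
    "(('b::complex_unital_algebra, 'b opp) tensor \<Rightarrow> 'a::complex_unital_algebra) \<Rightarrow> ('a \<Rightarrow> 'b) \<Rightarrow>
     side list \<Rightarrow> nat set set \<Rightarrow> 'a list \<Rightarrow> 'b" where
  "bi_moment \<epsilon> E \<chi> \<pi> Z =
     (if \<pi> \<in> BNC \<chi> \<and> length Z = length \<chi> \<and> \<chi> \<noteq> [] then
        if \<pi> = one_chi \<chi> then E (prod_list Z)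
        else
          let C = {..<length \<chi>} - last_block \<pi>
          in bi_moment \<epsilon> E (nths \<chi> C) (restrict_part C \<pi>) (nths (absorb_last_block \<epsilon> E \<chi> \<pi> Z) C)
      else 0)"
  by auto
termination
proof (relation "measure (\<lambda>(\<epsilon>, E, \<chi>, \<pi>, Z). length \<chi>)", goal_cases)
  case prems: (2 \<epsilon> E \<chi> \<pi> Z C)
  have \<pi>: "\<pi> \<in> BNC \<chi>" using prems(1) by simp
  have "\<Union>\<pi> \<noteq> {}" using prems(1) BNC_D(2)[OF \<pi>] by auto
  then obtain U where "U \<in> \<pi>" by auto
  then have "last_block \<pi> \<in> \<pi>"
    using BNC_arg_max_Min[OF \<pi>, of U "\<lambda>_. True"] by (simp add: last_block_def)
  then show ?case using BNC_remove_block[OF \<pi>] prems by simp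
qed simp

declare bi_moment.simps [simp del]

definition bi_cumulant ::
    "(('b::complex_unital_algebra, 'b opp) tensor \<Rightarrow> 'a::complex_unital_algebra) \<Rightarrow> ('a \<Rightarrow> 'b) \<Rightarrow>
     side list \<Rightarrow> nat set set \<Rightarrow> 'a list \<Rightarrow> 'b" where
  "bi_cumulant \<epsilon> E \<chi> \<pi> Z =
     (\<Sum>\<sigma> \<in> {\<sigma> \<in> BNC \<chi>. refinement \<chi> \<sigma> \<pi>}. of_int (mu_BNC \<chi> \<sigma> \<pi>) *\<^sub>C bi_moment \<epsilon> E \<chi> \<sigma> Z)"

definition insert_after ::
    "(('b::complex_unital_algebra, 'b opp) tensor \<Rightarrow> 'a::complex_unital_algebra) \<Rightarrow>
     side list \<Rightarrow> nat \<Rightarrow> 'b \<Rightarrow> 'a list \<Rightarrow> 'a list" where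
  "insert_after \<epsilon> \<chi> p c Z =
     Z[p := (case \<chi> ! p of Lft \<Rightarrow> Z ! p * left_op \<epsilon> c | Rgt \<Rightarrow> right_op \<epsilon> c * Z ! p)]"

definition insert_before ::
    "(('b::complex_unital_algebra, 'b opp) tensor \<Rightarrow> 'a::complex_unital_algebra) \<Rightarrow>
     side list \<Rightarrow> nat \<Rightarrow> 'b \<Rightarrow> 'a list \<Rightarrow> 'a list" where
  "insert_before \<epsilon> \<chi> q c Z =
     Z[q := (case \<chi> ! q of Lft \<Rightarrow> left_op \<epsilon> c * Z ! q | Rgt \<Rightarrow> Z ! q * right_op \<epsilon> c)]"

definition outer_block :: "side list \<Rightarrow> nat set set \<Rightarrow> nat set" where
  "outer_block \<chi> \<pi> =
     (THE U. U \<in> \<pi> \<and> chi_min \<chi> {..<length \<chi>} \<in> U \<and> chi_max \<chi> {..<length \<chi>} \<in> U)"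

definition last_inner_block :: "side list \<Rightarrow> nat set set \<Rightarrow> nat set" where
  "last_inner_block \<chi> \<pi> = (ARG_MAX Min V. V \<in> \<pi> \<and> V \<noteq> outer_block \<chi> \<pi>)"

definition absorb_last_inner_block ::
    "(('b::complex_unital_algebra, 'b opp) tensor \<Rightarrow> 'a::complex_unital_algebra) \<Rightarrow> ('a \<Rightarrow> 'b) \<Rightarrow>
     side list \<Rightarrow> nat set set \<Rightarrow> 'a list \<Rightarrow> 'a list" where
  "absorb_last_inner_block \<epsilon> E \<chi> \<pi> Z =
     (let V = last_inner_block \<chi> \<pi>;
          p = chi_max \<chi> {j \<in> {..<length \<chi>}. chi_less \<chi> j (chi_min \<chi> V)};
          c = bi_cumulant \<epsilon> E (nths \<chi> V) (restrict_part V \<pi>) (nths Z V)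
      in insert_after \<epsilon> \<chi> p c Z)"

text \<open>
  For \<open>\<pi> \<noteq> 1\<^sub>\<chi>\<close> the recursion first splits along \<open>outer_decomp\<close>; once the decomposition is trivial,
  so that the first and the last index lie in one block, it removes the other blocks one by one.
\<close>

function cond_bi_cumulant ::
    "(('b::complex_unital_algebra, 'b opp) tensor \<Rightarrow> 'a::complex_unital_algebra) \<Rightarrow> ('a \<Rightarrow> 'b) \<Rightarrow>
     ('a \<Rightarrow> 'd::complex_unital_algebra) \<Rightarrow> side list \<Rightarrow> nat set set \<Rightarrow> 'a list \<Rightarrow> 'd" where
  "cond_bi_cumulant \<epsilon> E F \<chi> \<pi> Z =
     (if \<pi> \<in> BNC \<chi> \<and> length Z = length \<chi> \<and> \<chi> \<noteq> [] then
        if length \<chi> = 1 then F (Z ! 0)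
        else if \<pi> = one_chi \<chi> then
          F (prod_list Z) - (\<Sum>\<sigma> \<in> BNC \<chi> - {one_chi \<chi>}. cond_bi_cumulant \<epsilon> E F \<chi> \<sigma> Z)
        else if outer_decomp \<chi> \<pi> = [{..<length \<chi>}] then
          let C = {..<length \<chi>} - last_inner_block \<chi> \<pi>
          in cond_bi_cumulant \<epsilon> E F (nths \<chi> C) (restrict_part C \<pi>)
               (nths (absorb_last_inner_block \<epsilon> E \<chi> \<pi> Z) C)
        else
          prod_list (map (\<lambda>V. cond_bi_cumulant \<epsilon> E F (nths \<chi> V) (restrict_part V \<pi>) (nths Z V))
            (outer_decomp \<chi> \<pi>))
      else 0)"
  by auto
termination
proof (relation "measures [\<lambda>(\<epsilon>, E, F, \<chi>, \<pi>, Z). length \<chi>,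
    \<lambda>(\<epsilon>, E, F, \<chi>, \<pi>, Z). if \<pi> = one_chi \<chi> then 1 else 0]", goal_cases)
  case (2 \<epsilon> E F \<chi> \<pi> Z \<sigma>)
  then show ?case by simp
next
  case prems: (3 \<epsilon> E F \<chi> \<pi> Z C)
  have \<pi>: "\<pi> \<in> BNC \<chi>" and ne: "\<pi> \<noteq> one_chi \<chi>" using prems by simp_all
  have "\<exists>U\<in>\<pi>. U \<noteq> outer_block \<chi> \<pi>"
  proof (rule ccontr)
    assume "\<not> ?thesis"
    moreover have "\<Union>\<pi> \<noteq> {}" using prems(1) BNC_D(2)[OF \<pi>] by auto
    ultimately have "\<pi> = {outer_block \<chi> \<pi>}" by auto
    moreover from this have "outer_block \<chi> \<pi> = {..<length \<chi>}"
      using BNC_D(2)[OF \<pi>] by (metis cSup_singleton)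
    ultimately show False using ne by metis
  qed
  then obtain U where "U \<in> \<pi>" "U \<noteq> outer_block \<chi> \<pi>" by auto
  then have "last_inner_block \<chi> \<pi> \<in> \<pi>"
    using BNC_arg_max_Min[OF \<pi>, of U "\<lambda>V. V \<noteq> outer_block \<chi> \<pi>"] by (simp add: last_inner_block_def)
  then show ?case using BNC_remove_block[OF \<pi>] prems by simp
next
  case prems: (4 \<epsilon> E F \<chi> \<pi> Z V)
  have \<pi>: "\<pi> \<in> BNC \<chi>" using prems(1) by simp
  define n Vs where "n = length \<chi>" and "Vs = outer_decomp \<chi> \<pi>"
  note defs = this
  have dec: "is_outer_decomp \<chi> \<pi> Vs" using outer_decomp[OF \<pi>] defs by simp
  have sub: "W \<subseteq> {..<n}" and nonempty: "W \<noteq> {}" if "W \<in> set Vs" for W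
    using dec that defs unfolding is_outer_decomp_iff by auto
  have V: "V \<in> set Vs" and triv: "Vs \<noteq> [{..<n}]" using prems defs by simp_all
  have "V \<noteq> {..<n}"
  proof
    assume eq: "V = {..<n}"
    obtain xs ys where split: "Vs = xs @ V # ys" using split_list[OF V] by auto
    have False if W: "W \<in> set xs \<union> set ys" for W
    proof -
      have "W \<in> set Vs" using W split by auto
      then obtain x where x: "x \<in> W" "x \<in> V" using sub nonempty eq by blast
      have "sorted_wrt (\<lambda>V W. \<forall>i\<in>V. \<forall>j\<in>W. chi_less \<chi> i j) (xs @ V # ys)"
        using dec unfolding is_outer_decomp_iff split by simp
      then have "(\<forall>W\<in>set xs. \<forall>i\<in>W. \<forall>j\<in>V. chi_less \<chi> i j) \<and>
          (\<forall>W\<in>set ys. \<forall>i\<in>V. \<forall>j\<in>W. chi_less \<chi> i j)"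
        unfolding sorted_wrt_append by simp
      then have "chi_less \<chi> x x" using W x by (metis Un_iff)
      then show False by simp
    qed
    then have "xs = []" "ys = []" by (cases xs; cases ys; auto)+
    then show False using split eq triv by simp
  qed
  then have "V \<subset> {..<n}" using sub[OF V] by auto
  then show ?case using length_nths_psubset[of V \<chi>] prems defs by simp
qed simp

declare cond_bi_cumulant.simps [simp del]


section \<open>Conditional bi-multiplicativity\<close>

text \<open>
  A function \<open>\<Theta>\<close> on \<open>\<Union>\<^sub>\<chi> BNC(\<chi>) \<times> \<A>\<^bsub>\<chi>(1)\<^esub> \<times> \<dots> \<times> \<A>\<^bsub>\<chi>(n)\<^esub>\<close> takes the arguments \<open>\<chi>\<close>, \<open>\<pi>\<close>, \<open>Z\<close>.
  To treat \<open>\<B>\<close>- and \<open>\<D>\<close>-valued \<open>\<Theta>\<close> together, conditions (1) and (2) take the map \<open>j\<close>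
  (the identity or \<open>\<iota>\<close>) by which \<open>\<B>\<close> is regarded as a subset of the codomain.
\<close>

definition face_multilinear ::
    "(('b::complex_unital_algebra, 'b opp) tensor \<Rightarrow> 'a::complex_unital_algebra) \<Rightarrow>
     (side list \<Rightarrow> nat set set \<Rightarrow> 'a list \<Rightarrow> 'c::complex_unital_algebra) \<Rightarrow> bool" where
  "face_multilinear \<epsilon> \<Theta> \<longleftrightarrow>
     (\<forall>\<chi> \<pi>. \<forall>Z \<in> face_tuples \<epsilon> \<chi>. \<forall>k<length \<chi>. \<forall>X \<in> face \<epsilon> (\<chi> ! k). \<forall>Y \<in> face \<epsilon> (\<chi> ! k). \<forall>a.
        \<pi> \<in> BNC \<chi> \<longrightarrow>
        \<Theta> \<chi> \<pi> (Z[k := X + Y]) = \<Theta> \<chi> \<pi> (Z[k := X]) + \<Theta> \<chi> \<pi> (Z[k := Y]) \<and>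
        \<Theta> \<chi> \<pi> (Z[k := a *\<^sub>C X]) = a *\<^sub>C \<Theta> \<chi> \<pi> (Z[k := X]))"

definition bi_mult_1 ::
    "(('b::complex_unital_algebra, 'b opp) tensor \<Rightarrow> 'a::complex_unital_algebra) \<Rightarrow>
     ('b \<Rightarrow> 'c::complex_unital_algebra) \<Rightarrow> (side list \<Rightarrow> nat set set \<Rightarrow> 'a list \<Rightarrow> 'c) \<Rightarrow> bool" where
  "bi_mult_1 \<epsilon> j \<Theta> \<longleftrightarrow>
     (\<forall>\<chi>. \<forall>Z \<in> face_tuples \<epsilon> \<chi>. \<forall>b. \<chi> \<noteq> [] \<longrightarrow>
        (let n = length \<chi>; Q = {k. k < n \<and> \<chi> ! k \<noteq> \<chi> ! (n - 1)}; q = Max Q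
         in case \<chi> ! (n - 1) of
              Lft \<Rightarrow> \<Theta> \<chi> (one_chi \<chi>) (Z[n - 1 := Z ! (n - 1) * left_op \<epsilon> b]) =
                (if Q \<noteq> {} then \<Theta> \<chi> (one_chi \<chi>) (Z[q := Z ! q * right_op \<epsilon> b])
                 else \<Theta> \<chi> (one_chi \<chi>) Z * j b)
            | Rgt \<Rightarrow> \<Theta> \<chi> (one_chi \<chi>) (Z[n - 1 := Z ! (n - 1) * right_op \<epsilon> b]) =
                (if Q \<noteq> {} then \<Theta> \<chi> (one_chi \<chi>) (Z[q := Z ! q * left_op \<epsilon> b])
                 else j b * \<Theta> \<chi> (one_chi \<chi>) Z)))"

definition bi_mult_2 ::
    "(('b::complex_unital_algebra, 'b opp) tensor \<Rightarrow> 'a::complex_unital_algebra) \<Rightarrow>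
     ('b \<Rightarrow> 'c::complex_unital_algebra) \<Rightarrow> (side list \<Rightarrow> nat set set \<Rightarrow> 'a list \<Rightarrow> 'c) \<Rightarrow> bool" where
  "bi_mult_2 \<epsilon> j \<Theta> \<longleftrightarrow>
     (\<forall>\<chi>. \<forall>Z \<in> face_tuples \<epsilon> \<chi>. \<forall>b. \<forall>p<length \<chi>.
        (let Q = {k. k < p \<and> \<chi> ! k = \<chi> ! p}; q = Max Q
         in case \<chi> ! p of
              Lft \<Rightarrow> \<Theta> \<chi> (one_chi \<chi>) (Z[p := left_op \<epsilon> b * Z ! p]) =
                (if Q \<noteq> {} then \<Theta> \<chi> (one_chi \<chi>) (Z[q := Z ! q * left_op \<epsilon> b])
                 else j b * \<Theta> \<chi> (one_chi \<chi>) Z)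
            | Rgt \<Rightarrow> \<Theta> \<chi> (one_chi \<chi>) (Z[p := right_op \<epsilon> b * Z ! p]) =
                (if Q \<noteq> {} then \<Theta> \<chi> (one_chi \<chi>) (Z[q := Z ! q * right_op \<epsilon> b])
                 else \<Theta> \<chi> (one_chi \<chi>) Z * j b)))"

definition bi_mult_3 ::
    "(('b::complex_unital_algebra, 'b opp) tensor \<Rightarrow> 'a::complex_unital_algebra) \<Rightarrow>
     (side list \<Rightarrow> nat set set \<Rightarrow> 'a list \<Rightarrow> 'c::complex_unital_algebra) \<Rightarrow> bool" where
  "bi_mult_3 \<epsilon> \<Theta> \<longleftrightarrow>
     (\<forall>\<chi> Vs. \<forall>\<pi> \<in> BNC \<chi>. \<forall>Z \<in> face_tuples \<epsilon> \<chi>. \<chi> \<noteq> [] \<and> interval_decomp \<chi> \<pi> Vs \<longrightarrow>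
        \<Theta> \<chi> \<pi> Z = prod_list (map (\<lambda>V. \<Theta> (nths \<chi> V) (restrict_part V \<pi>) (nths Z V)) Vs))"

definition bi_mult_4 ::
    "(('b::complex_unital_algebra, 'b opp) tensor \<Rightarrow> 'a::complex_unital_algebra) \<Rightarrow>
     (side list \<Rightarrow> nat set set \<Rightarrow> bool) \<Rightarrow> (side list \<Rightarrow> nat set set \<Rightarrow> 'a list \<Rightarrow> 'b) \<Rightarrow>
     (side list \<Rightarrow> nat set set \<Rightarrow> 'a list \<Rightarrow> 'c::complex_unital_algebra) \<Rightarrow> bool" where
  "bi_mult_4 \<epsilon> admissible \<Psi> \<Theta> \<longleftrightarrow>
     (\<forall>\<chi> V W. \<forall>\<pi> \<in> BNC \<chi>. \<forall>Z \<in> face_tuples \<epsilon> \<chi>.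
        \<chi> \<noteq> [] \<and> V \<union> W = {..<length \<chi>} \<and> V \<inter> W = {} \<and>
        union_of_blocks \<pi> V \<and> union_of_blocks \<pi> W \<and> chi_interval \<chi> V \<and>
        chi_min \<chi> {..<length \<chi>} \<in> W \<and> chi_max \<chi> {..<length \<chi>} \<in> W \<and> admissible \<chi> \<pi> \<longrightarrow>
        (let p = chi_max \<chi> {k \<in> W. chi_less \<chi> k (chi_min \<chi> V)};
             q = chi_min \<chi> {k \<in> W. chi_less \<chi> (chi_max \<chi> V) k};
             c = \<Psi> (nths \<chi> V) (restrict_part V \<pi>) (nths Z V)
         in \<Theta> \<chi> \<pi> Z = \<Theta> (nths \<chi> W) (restrict_part W \<pi>) (nths (insert_after \<epsilon> \<chi> p c Z) W) \<and>
            \<Theta> \<chi> \<pi> Z = \<Theta> (nths \<chi> W) (restrict_part W \<pi>) (nths (insert_before \<epsilon> \<chi> q c Z) W)))"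

definition cond_bi_multiplicative ::
    "('b::complex_unital_algebra \<Rightarrow> 'd::complex_unital_algebra) \<Rightarrow>
     (('b, 'b opp) tensor \<Rightarrow> 'a::complex_unital_algebra) \<Rightarrow>
     (side list \<Rightarrow> nat set set \<Rightarrow> 'a list \<Rightarrow> 'b) \<Rightarrow> (side list \<Rightarrow> nat set set \<Rightarrow> 'a list \<Rightarrow> 'd) \<Rightarrow> bool" where
  "cond_bi_multiplicative \<iota> \<epsilon> \<Psi> \<Phi> \<longleftrightarrow>
     face_multilinear \<epsilon> \<Psi> \<and> face_multilinear \<epsilon> \<Phi> \<and>
     bi_mult_1 \<epsilon> (\<lambda>b. b) \<Psi> \<and> bi_mult_1 \<epsilon> \<iota> \<Phi> \<and>
     bi_mult_2 \<epsilon> (\<lambda>b. b) \<Psi> \<and> bi_mult_2 \<epsilon> \<iota> \<Phi> \<and>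
     bi_mult_3 \<epsilon> \<Psi> \<and> bi_mult_3 \<epsilon> \<Phi> \<and>
     bi_mult_4 \<epsilon> (\<lambda>_ _. True) \<Psi> \<Psi> \<and>
     bi_mult_4 \<epsilon> (\<lambda>\<chi> \<pi>. \<exists>U\<in>\<pi>. chi_min \<chi> {..<length \<chi>} \<in> U \<and> chi_max \<chi> {..<length \<chi>} \<in> U) \<Psi> \<Phi>"

end

theory Submission
  imports Defs
begin

text \<open>
  With respect to \<open>\<prec>\<^sub>\<chi>\<close> every face is a \<open>\<B>\<close>-\<open>\<B>\<close>-bimodule, and \<open>(Z\<^sub>1, \<dots>, Z\<^sub>n) \<mapsto> E(Z\<^sub>1 \<dots> Z\<^sub>n)\<close> becomes a
  balanced bimodule map: a scalar may be moved between \<open>\<prec>\<^sub>\<chi>\<close>-neighbours and out of the two ends. So the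
  bi-free situation is reduced to the free one, in which a family of balanced one-block functions has a
  canonical extension to non-crossing partitions by nesting. This extension is multiplicative over
  intervals, admits insertion of an interval at either neighbour, and is again balanced; all this is
  proved by induction on the number of indices along the block of the first index.

  The recursive moments are this extension of \<open>E\<close>. If \<open>\<kappa>'\<close> is the extension of the one-block
  cumulants, then \<open>\<Sum>\<^sub>\<sigma>\<^sub>\<le>\<^sub>\<pi> \<kappa>'\<^sub>\<sigma> = \<E>\<^sub>\<pi>\<close> follows for \<open>\<pi> \<noteq> 1\<close> by removing a gap of \<open>\<pi>\<close>, and
  Moebius inversion gives \<open>\<kappa> = \<kappa>'\<close>. Likewise \<open>\<K>\<close> extends its own one-block values, with the gaps
  filled by \<open>\<kappa>\<close>; these values are balanced by induction, being \<open>F\<close> minus terms with smaller blocks.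
\<close>

section \<open>Relabelling and Moebius inversion\<close>

text \<open>The definitions relabel indices after every removal of a block, and they absorb a moment
  into an entry chosen by the natural order, possibly of the wrong side. Against the first, nothing
  is relabelled: \<chi> and a family \<pi> stay fixed, tuples become functions on all indices, only
  subsets S of the index set shrink, and \<open>tuple\<close>, \<open>sides\<close> and
  \<open>restrict_part\<close> lead back to the lists. Against the second, the moment recursion gets
  a congruence that does not ask entries to lie in faces.

  The sum over the refinements of \<pi> factors along a gap because each block of a refinement lies
  inside the gap or outside it, and because the value of the gap enters the rest linearly, through
  one entry. The one-block partition has no gap, but an extension agrees there with its data.

  Only elements of \<B> act on the faces, so \<D>-valued quantities can never be absorbed by
  entries. Hence the gaps of an outermost block carry cumulants while the outermost blocks multiply
  in \<D>, and insertion for \<Phi> needs an interval enclosed by an outermost block.\<close>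

lemma nths_nths_relabel:
  assumes "T \<subseteq> S"
  shows "nths (nths xs S) (relabel S ` T) = nths xs T"
proof -
  have "{i \<in> S. \<exists>j\<in>relabel S ` T. card {i' \<in> S. i' < i} = j} = T"
    using assms inj_onD[OF relabel_inj_on[of S]] by (auto simp: relabel_def[symmetric])
  then show ?thesis by (simp add: nths_nths)
qed

lemma relabel_relabel:
  assumes "T \<subseteq> S" "i \<in> S"
  shows "relabel (relabel S ` T) (relabel S i) = relabel T i"
proof -
  have "{j \<in> relabel S ` T. j < relabel S i} = relabel S ` {j \<in> T. j < i}"
    using assms relabel_less_iff[of _ S i] by auto
  moreover have "inj_on (relabel S) {j \<in> T. j < i}"
    using relabel_inj_on by (rule inj_on_subset) (use assms in auto)
  ultimately show ?thesis unfolding relabel_def[of "relabel S ` T"] by (simp add: card_image relabel_def[of T])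
qed

text \<open>Restricting in two steps is restricting once, since the rank of an index inside
  \<open>T\<close> does not depend on the passage through \<open>S\<close>. Thus every nested call
  of the recursions refers to a subset of the original index set.\<close>

lemma restrict_part_relabel:
  assumes "T \<subseteq> S"
  shows "restrict_part (relabel S ` T) (restrict_part S \<pi>) = restrict_part T \<pi>"
proof -
  have 1: "relabel (relabel S ` T) ` (relabel S ` (U \<inter> S) \<inter> relabel S ` T) = relabel T ` (U \<inter> T)" for U
  proof -
    have "relabel S ` (U \<inter> S) \<inter> relabel S ` T = relabel S ` (U \<inter> S \<inter> T)"
      using inj_on_image_Int[OF relabel_inj_on[of S], of "U \<inter> S" T] assms by simp
    moreover have "U \<inter> S \<inter> T = U \<inter> T" using assms by auto
    ultimately have "relabel S ` (U \<inter> S) \<inter> relabel S ` T = relabel S ` (U \<inter> T)" by simp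
    then show ?thesis unfolding image_image
      by (simp add: image_image) (rule image_cong[OF refl], use relabel_relabel[OF assms] assms in auto)
  qed
  show ?thesis
  proof (intro set_eqI iffI)
    fix X assume "X \<in> restrict_part (relabel S ` T) (restrict_part S \<pi>)"
    then obtain U where "U \<in> \<pi>" "X = relabel (relabel S ` T) ` (relabel S ` (U \<inter> S) \<inter> relabel S ` T)" "X \<noteq> {}"
      by (auto simp: restrict_part_def)
    then show "X \<in> restrict_part T \<pi>" unfolding 1 by (auto simp: restrict_part_def)
  next
    fix X assume "X \<in> restrict_part T \<pi>"
    then obtain U where U: "U \<in> \<pi>" "X = relabel T ` (U \<inter> T)" "U \<inter> T \<noteq> {}"
      by (auto simp: restrict_part_def)
    then have "relabel S ` (U \<inter> S) \<in> restrict_part S \<pi>" using assms by (auto simp: restrict_part_def)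
    then have "X \<in> (\<lambda>W. relabel (relabel S ` T) ` (W \<inter> relabel S ` T)) ` restrict_part S \<pi>"
      by (rule image_eqI[rotated]) (simp add: 1 U)
    moreover have "X \<noteq> {}" using U by simp
    ultimately show "X \<in> restrict_part (relabel S ` T) (restrict_part S \<pi>)"
      unfolding restrict_part_def[of "relabel S ` T"] by simp
  qed
qed

lemma length_nths_card: "S \<subseteq> {..<length xs} \<Longrightarrow> length (nths xs S) = card S"
  using relabel_image[of S xs] card_image[OF relabel_inj_on[of S]] by simp

lemma nths_update:
  assumes "S \<subseteq> {..<length xs}" "k \<in> S"
  shows "(nths xs S)[relabel S k := v] = nths (xs[k := v]) S"
proof (rule nth_equalityI)
  show "length ((nths xs S)[relabel S k := v]) = length (nths (xs[k := v]) S)"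
    using assms by (simp add: length_nths_card)
  fix i assume "i < length ((nths xs S)[relabel S k := v])"
  then have i: "i < length (nths xs S)" by simp
  then obtain i' where i': "i' \<in> S" "i = relabel S i'" using relabel_image[OF assms(1)] by auto
  then have "i' < length xs" "k < length xs" using assms by auto
  moreover have "relabel S k = relabel S i' \<longleftrightarrow> k = i'" using relabel_inj_on assms(2) i'(1) by (auto dest: inj_onD)
  ultimately show "(nths xs S)[relabel S k := v] ! i = nths (xs[k := v]) S ! i"
    using i i' nth_nths[OF i'(1), of xs] nth_nths[OF i'(1), of "xs[k := v]"]
    by (cases "k = i'") auto
qed

lemma Min_relabel:
  assumes "T \<subseteq> S" "finite T" "T \<noteq> {}"
  shows "Min (relabel S ` T) = relabel S (Min T)"
proof (rule Min_eqI)
  show "relabel S (Min T) \<in> relabel S ` T" using assms by simp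
  fix y assume "y \<in> relabel S ` T"
  then obtain t where t: "t \<in> T" "y = relabel S t" by auto
  then have "Min T = t \<or> Min T < t" using Min_le[OF assms(2), of t] by auto
  then show "relabel S (Min T) \<le> y" using t relabel_less[of "Min T" S t] Min_in[OF assms(2,3)] assms(1) by auto
qed (use assms in simp)

section \<open>Moebius inversion between moments and cumulants\<close>

lemma mu_BNC_sum:
  assumes "\<sigma> \<in> BNC \<chi>" "\<pi> \<in> BNC \<chi>" "refinement \<chi> \<sigma> \<pi>"
  shows "(\<Sum>\<tau> \<in> {\<tau> \<in> BNC \<chi>. refinement \<chi> \<sigma> \<tau> \<and> refinement \<chi> \<tau> \<pi>}. mu_BNC \<chi> \<sigma> \<tau>) = (if \<sigma> = \<pi> then 1 else 0)"
proof (cases "\<sigma> = \<pi>")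
  case True
  have "{\<tau> \<in> BNC \<chi>. refinement \<chi> \<sigma> \<tau> \<and> refinement \<chi> \<tau> \<pi>} = {\<pi>}"
    using assms True refines_asym[of _ \<pi>] by blast
  then show ?thesis using assms True mu_BNC.simps[of \<chi> \<pi> \<pi>] by simp
next
  case False
  let ?A = "{\<tau> \<in> BNC \<chi>. refinement \<chi> \<sigma> \<tau> \<and> refinement \<chi> \<tau> \<pi> \<and> \<tau> \<noteq> \<pi>}"
  have "refinement \<chi> \<pi> \<pi>" using refines_refl BNC_D(1)[OF assms(2)] by blast
  then have "{\<tau> \<in> BNC \<chi>. refinement \<chi> \<sigma> \<tau> \<and> refinement \<chi> \<tau> \<pi>} = insert \<pi> ?A"
    using assms by blast
  moreover have "finite ?A" using finite_BNC by simp
  ultimately show ?thesis using assms False mu_BNC.simps[of \<chi> \<sigma> \<pi>] by simp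
qed

text \<open>Exchanging the sums leaves, for each \<sigma>, the total of the Moebius function over
  the interval from \<sigma> to \<pi>, which vanishes unless \<sigma> = \<pi>.\<close>

lemma sum_bi_cumulant:
  assumes "\<pi> \<in> BNC \<chi>"
  shows "(\<Sum>\<tau> \<in> {\<tau> \<in> BNC \<chi>. refinement \<chi> \<tau> \<pi>}. bi_cumulant \<epsilon> E \<chi> \<tau> Z) = bi_moment \<epsilon> E \<chi> \<pi> Z"
proof -
  let ?m = "\<lambda>\<sigma>. bi_moment \<epsilon> E \<chi> \<sigma> Z" and ?le = "refinement \<chi>"
  let ?A = "{\<tau> \<in> BNC \<chi>. ?le \<tau> \<pi>}"
  have fin: "finite ?A" using finite_BNC by simp
  have "(\<Sum>\<tau>\<in>?A. bi_cumulant \<epsilon> E \<chi> \<tau> Z) =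
      (\<Sum>\<tau>\<in>?A. \<Sum>\<sigma>\<in>{\<sigma>\<in>?A. ?le \<sigma> \<tau>}. of_int (mu_BNC \<chi> \<sigma> \<tau>) *\<^sub>C ?m \<sigma>)"
    unfolding bi_cumulant_def
    by (rule sum.cong[OF refl], rule sum.cong) (use refines_trans in blast)+
  also have "\<dots> = (\<Sum>\<sigma>\<in>?A. \<Sum>\<tau>\<in>{\<tau>\<in>?A. ?le \<sigma> \<tau>}. of_int (mu_BNC \<chi> \<sigma> \<tau>) *\<^sub>C ?m \<sigma>)"
    by (rule sum.swap_restrict[OF fin fin])
  also have "\<dots> = (\<Sum>\<sigma>\<in>?A. if \<sigma> = \<pi> then ?m \<sigma> else 0)"
  proof (rule sum.cong[OF refl])
    fix \<sigma> assume s: "\<sigma> \<in> ?A"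
    have Aeq: "{\<tau>\<in>?A. ?le \<sigma> \<tau>} = {\<tau> \<in> BNC \<chi>. ?le \<sigma> \<tau> \<and> ?le \<tau> \<pi>}" by auto
    have "(\<Sum>\<tau>\<in>{\<tau>\<in>?A. ?le \<sigma> \<tau>}. of_int (mu_BNC \<chi> \<sigma> \<tau>) *\<^sub>C ?m \<sigma>)
        = of_int (\<Sum>\<tau>\<in>{\<tau>\<in>?A. ?le \<sigma> \<tau>}. mu_BNC \<chi> \<sigma> \<tau>) *\<^sub>C ?m \<sigma>"
      by (simp add: complex_alg.scale_sum_left)
    also have "(\<Sum>\<tau>\<in>{\<tau>\<in>?A. ?le \<sigma> \<tau>}. mu_BNC \<chi> \<sigma> \<tau>) = (if \<sigma> = \<pi> then 1 else 0)"
      unfolding Aeq using s by (intro mu_BNC_sum assms) auto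
    also have "of_int (if \<sigma> = \<pi> then 1 else 0) *\<^sub>C ?m \<sigma> = (if \<sigma> = \<pi> then ?m \<sigma> else 0)" by simp
    finally show "(\<Sum>\<tau>\<in>{\<tau>\<in>?A. ?le \<sigma> \<tau>}. of_int (mu_BNC \<chi> \<sigma> \<tau>) *\<^sub>C ?m \<sigma>) = (if \<sigma> = \<pi> then ?m \<sigma> else 0)" .
  qed
  also have "\<dots> = ?m \<pi>" using fin assms refines_refl[OF BNC_D(1)[OF assms]] by (simp add: sum.delta)
  finally show ?thesis .
qed

section \<open>Bimodule actions and non-crossing families\<close>

text \<open>\<chi> is fixed here so that the order, the actions and the faces carry no extra
  argument; each condition is proved for one \<chi> and generalised at the end.\<close>

locale bi_index = bb_nc_prob_space_pair \<iota> \<epsilon> E F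
  for \<iota> :: "'b::complex_unital_algebra \<Rightarrow> 'd::complex_unital_algebra"
    and \<epsilon> :: "('b, 'b opp) tensor \<Rightarrow> 'a::complex_unital_algebra"
    and E :: "'a \<Rightarrow> 'b" and F :: "'a \<Rightarrow> 'd" +
  fixes \<chi> :: "side list"
begin

abbreviation chi_lt :: "nat \<Rightarrow> nat \<Rightarrow> bool" (infix \<open>\<prec>\<close> 50) where "i \<prec> j \<equiv> chi_less \<chi> i j"
abbreviation lop where "lop \<equiv> left_op \<epsilon>"
abbreviation rop where "rop \<equiv> right_op \<epsilon>"
abbreviation face_at where "face_at i \<equiv> face \<epsilon> (\<chi> ! i)"

lemma eps_simps:
  "\<epsilon> (x * y) = \<epsilon> x * \<epsilon> y" "\<epsilon> (x + y) = \<epsilon> x + \<epsilon> y" "\<epsilon> (c *\<^sub>C x) = c *\<^sub>C \<epsilon> x" "\<epsilon> 1 = 1"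
  using eps_hom unfolding unital_algebra_hom_def
  by (auto simp: Vector_Spaces.linear_iff)

lemma lop_rop_simps:
  "lop (b + c) = lop b + lop c" "rop (b + c) = rop b + rop c"
  "lop (a *\<^sub>C b) = a *\<^sub>C lop b" "rop (a *\<^sub>C b) = a *\<^sub>C rop b"
  "lop (b * c) = lop b * lop c" "rop (b * c) = rop c * rop b"
  "lop 1 = 1" "rop 1 = 1"
proof -
  have plus: "Opp (x + y) = Opp x + Opp y" for x y :: 'b by (simp add: plus_opp_def)
  have scale: "Opp (c *\<^sub>C x) = c *\<^sub>C Opp x" for c and x :: 'b by (simp add: scaleC_opp_def)
  show "lop (b + c) = lop b + lop c" "rop (b + c) = rop b + rop c"
    "lop (a *\<^sub>C b) = a *\<^sub>C lop b" "rop (a *\<^sub>C b) = a *\<^sub>C rop b"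
    by (simp_all add: left_op_def right_op_def plus scale tens_add_left tens_add_right
      tens_scaleC_left tens_scaleC_right eps_simps)
  have "Opp (b * c) = Opp c * Opp b" by (simp add: times_opp_def)
  then show "lop (b * c) = lop b * lop c" "rop (b * c) = rop c * rop b"
    by (simp_all add: left_op_def right_op_def tens_mult flip: eps_simps(1))
  have "Opp 1 = (1 :: 'b opp)" by (simp add: one_opp_def)
  then show "lop 1 = 1" "rop 1 = 1"
    by (simp_all add: left_op_def right_op_def tens_one eps_simps)
qed

lemma lop_rop_commute: "lop b * rop c = rop c * lop b"
  by (simp add: left_op_def right_op_def tens_mult flip: eps_simps(1))

text \<open>
  Both faces are \<open>\<B>\<close>-\<open>\<B>\<close>-bimodules; on the right face the two sides are exchanged, because
  \<open>rop\<close> reverses products and \<open>\<prec>\<close> reverses the order of the right indices. With these actions a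
  scalar can be moved between \<open>\<prec>\<close>-neighbours whatever their sides are.
\<close>

definition lact :: "nat \<Rightarrow> 'b \<Rightarrow> 'a \<Rightarrow> 'a" where
  "lact i c z = (case \<chi> ! i of Lft \<Rightarrow> lop c * z | Rgt \<Rightarrow> z * rop c)"

definition ract :: "nat \<Rightarrow> 'a \<Rightarrow> 'b \<Rightarrow> 'a" where
  "ract i z c = (case \<chi> ! i of Lft \<Rightarrow> z * lop c | Rgt \<Rightarrow> rop c * z)"

lemma action_simps:
  "ract i (ract i z b) c = ract i z (b * c)" "lact i b (lact i c z) = lact i (b * c) z"
  "ract i (lact i b z) c = lact i b (ract i z c)"
  "ract i z 1 = z" "lact i 1 z = z"
  "ract i (z + z') c = ract i z c + ract i z' c" "ract i z (c + c') = ract i z c + ract i z c'"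
  "ract i (a *\<^sub>C z) c = a *\<^sub>C ract i z c" "ract i z (a *\<^sub>C c) = a *\<^sub>C ract i z c"
  "lact i b (z + z') = lact i b z + lact i b z'" "lact i b (a *\<^sub>C z) = a *\<^sub>C lact i b z"
  by (cases "\<chi> ! i"; simp add: lact_def ract_def lop_rop_simps mult.assoc distrib_left distrib_right
    mult_scaleC_left mult_scaleC_right)+

lemma commute_mult: "(z::'a) * x = x * z \<Longrightarrow> y * x = x * y \<Longrightarrow> (z * y) * x = x * (z * y)"
  by (metis mult.assoc)

text \<open>Left and right operators commute, so multiplying by an operator of its own side keeps an
  entry in its face. The operator absorbed in the moment recursion may come from the other side, and
  then the entry can leave its face.\<close>

lemma face_closed:
  assumes "z \<in> face_at i"
  shows "ract i z c \<in> face_at i" "lact i c z \<in> face_at i"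
  using assms
  by (cases "\<chi> ! i"; auto simp: ract_def lact_def face_def lop_rop_commute intro!: commute_mult)+

lemma face_add: "x \<in> face \<epsilon> s \<Longrightarrow> y \<in> face \<epsilon> s \<Longrightarrow> x + y \<in> face \<epsilon> s"
  and face_scale: "x \<in> face \<epsilon> s \<Longrightarrow> a *\<^sub>C x \<in> face \<epsilon> s"
  by (cases s; simp add: face_def distrib_left distrib_right mult_scaleC_left mult_scaleC_right)+

definition faces :: "nat set \<Rightarrow> (nat \<Rightarrow> 'a) \<Rightarrow> bool" where
  "faces S Z \<longleftrightarrow> (\<forall>i\<in>S. Z i \<in> face_at i)"

lemma faces_upd: "faces S Z \<Longrightarrow> z \<in> face_at i \<Longrightarrow> faces S (Z(i := z))"
  by (simp add: faces_def)

lemma faces_mono: "faces S Z \<Longrightarrow> T \<subseteq> S \<Longrightarrow> faces T Z"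
  by (auto simp: faces_def)

lemma facesD: "faces S Z \<Longrightarrow> i \<in> S \<Longrightarrow> Z i \<in> face_at i"
  by (simp add: faces_def)

section \<open>Non-crossing families, the block of the first index and its gaps\<close>

definition nc_fam :: "nat set set \<Rightarrow> bool" where
  "nc_fam \<pi> \<longleftrightarrow> (\<forall>U\<in>\<pi>. \<forall>W\<in>\<pi>. \<forall>i. i \<in> U \<longrightarrow> i \<in> W \<longrightarrow> U = W) \<and>
     (\<forall>U\<in>\<pi>. \<forall>W\<in>\<pi>. \<forall>a b c d. a \<in> U \<longrightarrow> b \<in> W \<longrightarrow> c \<in> U \<longrightarrow> d \<in> W \<longrightarrow>
        a \<prec> b \<longrightarrow> b \<prec> c \<longrightarrow> c \<prec> d \<longrightarrow> U = W)"

text \<open>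
  The family \<open>\<pi>\<close> may have blocks outside \<open>S\<close>: only those inside \<open>S\<close> matter, so that a fixed \<open>\<pi>\<close>
  serves for all unions \<open>S\<close> of its blocks and no relabelling is needed.
\<close>

definition nc_on :: "nat set set \<Rightarrow> nat set \<Rightarrow> bool" where
  "nc_on \<pi> S \<longleftrightarrow> S \<subseteq> {..<length \<chi>} \<and> (\<forall>i\<in>S. \<exists>U\<in>\<pi>. i \<in> U \<and> U \<subseteq> S) \<and> nc_fam \<pi>"

definition block_of :: "nat set set \<Rightarrow> nat \<Rightarrow> nat set" where
  "block_of \<pi> i = (THE U. U \<in> \<pi> \<and> i \<in> U)"

text \<open>For \<open>i\<close> in \<open>U\<close> this is the part of \<open>S\<close> between
  \<open>i\<close> and its successor in \<open>U\<close>. For the last element of \<open>U\<close>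
  the quantifier is vacuous and the gap is all of \<open>S\<close> behind it, which is how
  \<open>tail\<close> arises.\<close>

definition gap :: "nat set \<Rightarrow> nat set \<Rightarrow> nat \<Rightarrow> nat set" where
  "gap S U i = {j \<in> S. i \<prec> j \<and> (\<forall>u\<in>U. i \<prec> u \<longrightarrow> j \<prec> u)}"

abbreviation cmin where "cmin S \<equiv> chi_min \<chi> S"
abbreviation cmax where "cmax S \<equiv> chi_max \<chi> S"

definition first_block :: "nat set set \<Rightarrow> nat set \<Rightarrow> nat set" where "first_block \<pi> S = block_of \<pi> (cmin S)"
definition first_end :: "nat set set \<Rightarrow> nat set \<Rightarrow> nat" where "first_end \<pi> S = cmax (first_block \<pi> S)"
definition tail :: "nat set set \<Rightarrow> nat set \<Rightarrow> nat set" where "tail \<pi> S = gap S (first_block \<pi> S) (first_end \<pi> S)"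

lemma nc_finite: "nc_on \<pi> S \<Longrightarrow> finite S"
  unfolding nc_on_def by (meson finite_lessThan finite_subset)

lemma
  assumes "nc_on \<pi> S"
  shows nc_dom: "S \<subseteq> {..<length \<chi>}"
    and nc_ex: "i \<in> S \<Longrightarrow> \<exists>U\<in>\<pi>. i \<in> U \<and> U \<subseteq> S"
    and nc_fam: "nc_fam \<pi>"
  using assms by (simp_all add: nc_on_def)

lemma nc_disj: "nc_on \<pi> S \<Longrightarrow> U \<in> \<pi> \<Longrightarrow> W \<in> \<pi> \<Longrightarrow> i \<in> U \<Longrightarrow> i \<in> W \<Longrightarrow> U = W"
  using nc_fam unfolding nc_fam_def by meson

lemma nc_cross: "nc_on \<pi> S \<Longrightarrow> U \<in> \<pi> \<Longrightarrow> W \<in> \<pi> \<Longrightarrow> a \<in> U \<Longrightarrow> b \<in> W \<Longrightarrow> c \<in> U \<Longrightarrow> d \<in> W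
      \<Longrightarrow> a \<prec> b \<Longrightarrow> b \<prec> c \<Longrightarrow> c \<prec> d \<Longrightarrow> U = W"
  using nc_fam unfolding nc_fam_def by meson

lemma nc_sub:
  assumes "nc_on \<pi> S" "T \<subseteq> S" "\<And>i. i \<in> T \<Longrightarrow> \<exists>U\<in>\<pi>. i \<in> U \<and> U \<subseteq> T"
  shows "nc_on \<pi> T"
  using assms(2,3) nc_dom[OF assms(1)] nc_fam[OF assms(1)] unfolding nc_on_def by simp

lemma block_of_eq: "nc_on \<pi> S \<Longrightarrow> U \<in> \<pi> \<Longrightarrow> i \<in> U \<Longrightarrow> block_of \<pi> i = U"
  unfolding block_of_def by (rule the_equality) (use nc_disj in blast)+

lemma block_of:
  assumes "nc_on \<pi> S" "i \<in> S"
  shows "block_of \<pi> i \<in> \<pi>" "i \<in> block_of \<pi> i" "block_of \<pi> i \<subseteq> S"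
  using nc_ex[OF assms] block_of_eq[OF assms(1)] by auto

lemma nc_block_sub:
  assumes "nc_on \<pi> S" "U \<in> \<pi>" "i \<in> U" "i \<in> S"
  shows "U \<subseteq> S"
  using block_of_eq[OF assms(1-3)] block_of(3)[OF assms(1,4)] by simp

lemma nc_Diff:
  assumes "nc_on \<pi> S" "nc_on \<pi> V"
  shows "nc_on \<pi> (S - V)"
proof (rule nc_sub[OF assms(1)])
  fix i assume i: "i \<in> S - V"
  then obtain U where U: "U \<in> \<pi>" "i \<in> U" "U \<subseteq> S" using nc_ex[OF assms(1)] by blast
  have "U \<inter> V = {}" using nc_block_sub[OF assms(2) U(1)] U(2) i by blast
  then show "\<exists>U\<in>\<pi>. i \<in> U \<and> U \<subseteq> S - V" using U by blast
qed auto

lemma cminI: "e \<in> S \<Longrightarrow> (\<And>j. j \<in> S \<Longrightarrow> j = e \<or> e \<prec> j) \<Longrightarrow> cmin S = e"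
  by (rule chi_min_unique) auto

lemma cmaxI: "e \<in> S \<Longrightarrow> (\<And>j. j \<in> S \<Longrightarrow> j = e \<or> j \<prec> e) \<Longrightarrow> cmax S = e"
  by (rule chi_max_unique) auto

lemma cmin: "finite S \<Longrightarrow> S \<noteq> {} \<Longrightarrow> cmin S \<in> S" "finite S \<Longrightarrow> j \<in> S \<Longrightarrow> j = cmin S \<or> cmin S \<prec> j"
  using chi_min_least[of S] by auto

lemma cmax: "finite S \<Longrightarrow> S \<noteq> {} \<Longrightarrow> cmax S \<in> S" "finite S \<Longrightarrow> j \<in> S \<Longrightarrow> j = cmax S \<or> j \<prec> cmax S"
  using chi_max_greatest[of S] by auto

lemma first_block:
  assumes "nc_on \<pi> S" "S \<noteq> {}"
  shows "first_block \<pi> S \<in> \<pi>" "cmin S \<in> first_block \<pi> S" "first_block \<pi> S \<subseteq> S" "finite (first_block \<pi> S)" "first_end \<pi> S \<in> first_block \<pi> S"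
    "\<And>j. j \<in> first_block \<pi> S \<Longrightarrow> j = first_end \<pi> S \<or> j \<prec> first_end \<pi> S" "first_block \<pi> S \<noteq> {}" "first_end \<pi> S \<in> S"
proof -
  have e: "cmin S \<in> S" using assms cmin nc_finite by simp
  show 1: "first_block \<pi> S \<in> \<pi>" "cmin S \<in> first_block \<pi> S" "first_block \<pi> S \<subseteq> S"
    using block_of[OF assms(1) e] by (auto simp: first_block_def)
  then show 2: "finite (first_block \<pi> S)" "first_block \<pi> S \<noteq> {}" using nc_finite[OF assms(1)] finite_subset by auto
  show "first_end \<pi> S \<in> first_block \<pi> S" "\<And>j. j \<in> first_block \<pi> S \<Longrightarrow> j = first_end \<pi> S \<or> j \<prec> first_end \<pi> S"
    unfolding first_end_def using 2 cmax by auto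
  then show "first_end \<pi> S \<in> S" using 1 by auto
qed

lemma gap_sub: "gap S U i \<subseteq> S" by (auto simp: gap_def)

lemma gap_disj: "j \<in> gap S U i \<Longrightarrow> j \<notin> U"
  by (auto simp: gap_def)

lemma gap_unique: "j \<in> gap S U i \<Longrightarrow> j \<in> gap S U i' \<Longrightarrow> i \<in> U \<Longrightarrow> i' \<in> U \<Longrightarrow> i = i'"
  unfolding gap_def using chi_less_total[of i i' \<chi>] chi_less_asym by blast

lemma gap_psub:
  assumes "nc_on \<pi> S" "S \<noteq> {}" "i \<in> first_block \<pi> S"
  shows "gap S (first_block \<pi> S) i \<subset> S" "card (gap S (first_block \<pi> S) i) < card S"
proof -
  show "gap S (first_block \<pi> S) i \<subset> S" using gap_sub first_block[OF assms(1,2)] gap_disj by blast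
  then show "card (gap S (first_block \<pi> S) i) < card S" using nc_finite[OF assms(1)] psubset_card_mono by blast
qed

text \<open>A block that meets a gap and leaves it would cross the first block: on the left it has
  to pass \<open>i\<close> with \<open>cmin S\<close> still before it, on the right it has to pass a
  later element of the first block.\<close>

lemma nc_gap:
  assumes "nc_on \<pi> S" "S \<noteq> {}" "i \<in> first_block \<pi> S"
  shows "nc_on \<pi> (gap S (first_block \<pi> S) i)"
proof (rule nc_sub[OF assms(1)])
  let ?U = "first_block \<pi> S"
  note U = first_block[OF assms(1,2)]
  fix j assume j: "j \<in> gap S ?U i"
  have jS: "j \<in> S" using j gap_sub by blast
  define W where "W = block_of \<pi> j"
  have W: "W \<in> \<pi>" "j \<in> W" "W \<subseteq> S" using block_of[OF assms(1) jS] by (auto simp: W_def)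
  have WU: "W \<noteq> ?U" using W gap_disj[OF j] by auto
  have ij: "i \<prec> j" using j by (simp add: gap_def)
  have "W \<subseteq> gap S ?U i"
  proof
    fix y assume y: "y \<in> W"
    have yU: "y \<notin> ?U" using WU nc_disj[OF assms(1) W(1) U(1) y] by blast
    have "cmin S \<prec> y" using cmin(2)[OF nc_finite[OF assms(1)], of y] y W(3) yU U(2) by auto
    then have "\<not> y \<prec> i" using nc_cross[OF assms(1) U(1) W(1) U(2) y assms(3) W(2)] ij WU by auto
    then have iy: "i \<prec> y" using chi_less_total assms(3) yU by metis
    have "y \<prec> u" if u: "u \<in> ?U" "i \<prec> u" for u
    proof (rule ccontr)
      assume "\<not> y \<prec> u"
      then have "u \<prec> y" using chi_less_total u yU by metis
      moreover have "j \<prec> u" using j u by (auto simp: gap_def)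
      ultimately show False using nc_cross[OF assms(1) U(1) W(1) assms(3) W(2) u(1) y] ij WU by auto
    qed
    then show "y \<in> gap S ?U i" using y W(3) iy by (auto simp: gap_def)
  qed
  then show "\<exists>U\<in>\<pi>. j \<in> U \<and> U \<subseteq> gap S ?U i" using W by blast
qed (rule gap_sub)

lemma gap_cover:
  assumes "nc_on \<pi> S" "j \<in> S" "j \<notin> first_block \<pi> S"
  obtains i where "i \<in> first_block \<pi> S" "j \<in> gap S (first_block \<pi> S) i"
proof -
  let ?U = "first_block \<pi> S"
  have S: "S \<noteq> {}" using assms by auto
  note U = first_block[OF assms(1) S]
  let ?A = "{u\<in>?U. u \<prec> j}"
  have "cmin S \<prec> j" using cmin(2)[OF nc_finite[OF assms(1)] assms(2)] assms(3) U(2) by auto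
  then have ne: "?A \<noteq> {}" using U(2) by auto
  have fin: "finite ?A" using U(4) by simp
  define i where "i = cmax ?A"
  have i: "i \<in> ?A" using cmax(1)[OF fin ne] by (simp add: i_def)
  have "j \<prec> u" if "u \<in> ?U" "i \<prec> u" for u
  proof (rule ccontr)
    assume "\<not> j \<prec> u"
    then have "u \<in> ?A" using that chi_less_total[of u j \<chi>] assms(3) by auto
    then show False using cmax(2)[OF fin, of u] that(2) chi_less_asym unfolding i_def[symmetric] by auto
  qed
  then have "j \<in> gap S ?U i" using i assms(2) by (auto simp: gap_def)
  then show ?thesis using that i by auto
qed

lemma tail_eq:
  assumes "nc_on \<pi> S" "S \<noteq> {}"
  shows "tail \<pi> S = {j\<in>S. first_end \<pi> S \<prec> j}"
  using first_block(6)[OF assms] chi_less_asym unfolding tail_def gap_def by auto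

lemma nc_tail: "nc_on \<pi> S \<Longrightarrow> S \<noteq> {} \<Longrightarrow> nc_on \<pi> (tail \<pi> S)"
  unfolding tail_def using nc_gap first_block(5) by simp

lemma card_tail: "nc_on \<pi> S \<Longrightarrow> S \<noteq> {} \<Longrightarrow> card (tail \<pi> S) < card S"
  unfolding tail_def using gap_psub first_block(5) by simp

section \<open>Extending one-block functions to non-crossing partitions\<close>

text \<open>
  A one-block function \<open>g\<close> is extended by evaluating it on the block of the first index, after the
  values of the gaps inside this block have been absorbed to the left; the rest of \<open>S\<close> contributes a
  factor. The gaps take the values of \<open>h\<close>, which is the extension itself for \<open>inner_ext\<close> (moments and
  cumulants) and the cumulant function for \<open>outer_ext\<close> (conditional cumulants).
\<close>

definition fill :: "(nat set set \<Rightarrow> nat set \<Rightarrow> (nat \<Rightarrow> 'a) \<Rightarrow> 'b) \<Rightarrow> nat set set \<Rightarrow> nat set \<Rightarrow>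
    (nat \<Rightarrow> 'a) \<Rightarrow> nat \<Rightarrow> 'a" where
  "fill h \<pi> S Z i =
     (if i \<in> first_block \<pi> S \<and> i \<noteq> first_end \<pi> S then ract i (Z i) (h \<pi> (gap S (first_block \<pi> S) i) Z) else Z i)"

text \<open>Having the recursion equation as a predicate lets \<open>inner_ext\<close> and
  \<open>outer_ext\<close> share their structural proofs: the former is the case in which
  \<open>h\<close> and the extension coincide.\<close>

definition tree_ext :: "(nat set \<Rightarrow> (nat \<Rightarrow> 'a) \<Rightarrow> 'c::monoid_mult) \<Rightarrow>
    (nat set set \<Rightarrow> nat set \<Rightarrow> (nat \<Rightarrow> 'a) \<Rightarrow> 'b) \<Rightarrow>
    (nat set set \<Rightarrow> nat set \<Rightarrow> (nat \<Rightarrow> 'a) \<Rightarrow> 'c) \<Rightarrow> bool" where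
  "tree_ext g h \<Theta> \<longleftrightarrow> (\<forall>\<pi> S Z. nc_on \<pi> S \<longrightarrow> \<Theta> \<pi> S Z =
     (if S = {} then 1 else g (first_block \<pi> S) (fill h \<pi> S Z) * \<Theta> \<pi> (tail \<pi> S) Z))"

text \<open>The filling is spelled out instead of being taken from \<open>fill\<close>, so that the
  recursive calls on gaps appear under the guard that makes the gap smaller than
  \<open>S\<close>.\<close>

function inner_ext :: "(nat set \<Rightarrow> (nat \<Rightarrow> 'a) \<Rightarrow> 'b) \<Rightarrow> nat set set \<Rightarrow> nat set \<Rightarrow> (nat \<Rightarrow> 'a) \<Rightarrow> 'b" where
  "inner_ext g \<pi> S Z = (if nc_on \<pi> S \<and> S \<noteq> {} then
      g (first_block \<pi> S) (\<lambda>i. if i \<in> first_block \<pi> S \<and> i \<noteq> first_end \<pi> S then ract i (Z i) (inner_ext g \<pi> (gap S (first_block \<pi> S) i) Z) else Z i)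
        * inner_ext g \<pi> (tail \<pi> S) Z else 1)"
  by auto
termination
  by (relation "measure (\<lambda>(g, \<pi>, S, Z). card S)") (auto simp: gap_psub card_tail)

declare inner_ext.simps [simp del]

function outer_ext :: "(nat set \<Rightarrow> (nat \<Rightarrow> 'a) \<Rightarrow> 'c::monoid_mult) \<Rightarrow>
    (nat set set \<Rightarrow> nat set \<Rightarrow> (nat \<Rightarrow> 'a) \<Rightarrow> 'b) \<Rightarrow> nat set set \<Rightarrow> nat set \<Rightarrow> (nat \<Rightarrow> 'a) \<Rightarrow> 'c" where
  "outer_ext g h \<pi> S Z = (if nc_on \<pi> S \<and> S \<noteq> {} then
      g (first_block \<pi> S) (fill h \<pi> S Z) * outer_ext g h \<pi> (tail \<pi> S) Z else 1)"
  by auto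
termination
  by (relation "measure (\<lambda>(g, h, \<pi>, S, Z). card S)") (auto simp: card_tail)

declare outer_ext.simps [simp del]

lemma tree_ext_inner_ext: "tree_ext g (inner_ext g) (inner_ext g)"
proof -
  have "(\<lambda>i. if i \<in> first_block \<pi> S \<and> i \<noteq> first_end \<pi> S then ract i (Z i) (inner_ext g \<pi> (gap S (first_block \<pi> S) i) Z) else Z i)
     = fill (inner_ext g) \<pi> S Z" for \<pi> S Z
    by (auto simp: fill_def)
  then show ?thesis unfolding tree_ext_def using inner_ext.simps[of g] by auto
qed

lemma tree_ext_outer_ext: "tree_ext g h (outer_ext g h)"
  unfolding tree_ext_def using outer_ext.simps[of g h] by auto

lemma tree_ext_empty: "tree_ext g h \<Theta> \<Longrightarrow> nc_on \<pi> {} \<Longrightarrow> \<Theta> \<pi> {} Z = 1"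
  unfolding tree_ext_def by simp

lemma tree_ext_step: "tree_ext g h \<Theta> \<Longrightarrow> nc_on \<pi> S \<Longrightarrow> S \<noteq> {} \<Longrightarrow>
    \<Theta> \<pi> S Z = g (first_block \<pi> S) (fill h \<pi> S Z) * \<Theta> \<pi> (tail \<pi> S) Z"
  unfolding tree_ext_def by simp

lemma nc_Un:
  assumes "nc_on \<pi> S" "nc_on \<pi> T"
  shows "nc_on \<pi> (S \<union> T)"
proof -
  have "\<exists>U\<in>\<pi>. i \<in> U \<and> U \<subseteq> S \<union> T" if "i \<in> S \<union> T" for i
    using that nc_ex[OF assms(1), of i] nc_ex[OF assms(2), of i] by auto
  then show ?thesis using nc_dom[OF assms(1)] nc_dom[OF assms(2)] nc_fam[OF assms(1)]
    unfolding nc_on_def by simp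
qed

text \<open>The union has the first block of \<open>S1\<close>, and all of \<open>S2\<close> falls
  behind its end. So only the tail changes, and induction along the outermost blocks
  applies.\<close>

lemma tree_ext_Un:
  assumes T: "tree_ext g h \<Theta>" and S: "nc_on \<pi> S1" "nc_on \<pi> S2"
    and lt: "\<And>i j. i \<in> S1 \<Longrightarrow> j \<in> S2 \<Longrightarrow> i \<prec> j"
  shows "\<Theta> \<pi> (S1 \<union> S2) Z = \<Theta> \<pi> S1 Z * \<Theta> \<pi> S2 Z"
  using S(1) lt
proof (induction "card S1" arbitrary: S1 rule: less_induct)
  case less
  note lt = less.prems(2)
  show ?case
  proof (cases "S1 = {}")
    case True
    then show ?thesis using tree_ext_empty[OF T] less.prems by simp
  next
    case False
    let ?S = "S1 \<union> S2"
    have S: "nc_on \<pi> ?S" "?S \<noteq> {}" using nc_Un less.prems(1) S(2) False by auto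
    have "cmin ?S = cmin S1"
    proof (rule cminI)
      show e: "cmin S1 \<in> ?S" using cmin(1)[OF nc_finite[OF less.prems(1)] False] by simp
      fix j assume "j \<in> ?S"
      then show "j = cmin S1 \<or> cmin S1 \<prec> j"
        using cmin(2)[OF nc_finite[OF less.prems(1)], of j] lt[of "cmin S1" j]
          cmin(1)[OF nc_finite[OF less.prems(1)] False] by auto
    qed
    then have fb_eq: "first_block \<pi> ?S = first_block \<pi> S1" and fx_eq: "first_end \<pi> ?S = first_end \<pi> S1"
      by (simp_all add: first_block_def first_end_def)
    note U = first_block[OF less.prems(1) False]
    have gap_eq: "gap ?S (first_block \<pi> S1) i = gap S1 (first_block \<pi> S1) i" if i: "i \<in> first_block \<pi> S1" "i \<noteq> first_end \<pi> S1" for i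
    proof -
      have "i \<prec> first_end \<pi> S1" using U(6) i by blast
      then have "j \<notin> gap ?S (first_block \<pi> S1) i" if "j \<in> S2" for j
        using lt[OF U(8) that] U(5) chi_less_asym[of \<chi> j "first_end \<pi> S1"] unfolding gap_def by auto
      then show ?thesis unfolding gap_def by auto
    qed
    have fill_eq: "fill h \<pi> ?S Z = fill h \<pi> S1 Z"
      by (auto simp: fill_def fb_eq fx_eq gap_eq)
    have tail_eq': "tail \<pi> ?S = tail \<pi> S1 \<union> S2"
      using lt[OF U(8)] unfolding tail_eq[OF S] tail_eq[OF less.prems(1) False] fx_eq by auto
    have sub: "tail \<pi> S1 \<subseteq> S1" unfolding tail_def by (rule gap_sub)
    have "\<Theta> \<pi> (tail \<pi> S1 \<union> S2) Z = \<Theta> \<pi> (tail \<pi> S1) Z * \<Theta> \<pi> S2 Z"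
      by (rule less.hyps[OF card_tail nc_tail]) (use less.prems(1) False lt sub in auto)
    then show ?thesis
      unfolding tree_ext_step[OF T S] tree_ext_step[OF T less.prems(1) False] tail_eq'
      by (simp add: fb_eq fill_eq mult.assoc)
  qed
qed

section \<open>Neighbours of an interval, locality, linearity and balance\<close>

definition pred_of :: "nat set \<Rightarrow> nat set \<Rightarrow> nat \<Rightarrow> bool" where
  "pred_of S V p \<longleftrightarrow> p \<in> S - V \<and> (\<forall>v\<in>V. p \<prec> v) \<and> (\<forall>j\<in>S - V. j = p \<or> j \<prec> p \<or> (\<forall>v\<in>V. v \<prec> j))"

text \<open>Like \<open>pred_of\<close>, this also forces \<open>V\<close> to be an interval of
  \<open>S\<close>: every other remaining index lies beyond the neighbour or on the far side of all
  of \<open>V\<close>.\<close>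

definition succ_of :: "nat set \<Rightarrow> nat set \<Rightarrow> nat \<Rightarrow> bool" where
  "succ_of S V q \<longleftrightarrow> q \<in> S - V \<and> (\<forall>v\<in>V. v \<prec> q) \<and> (\<forall>j\<in>S - V. j = q \<or> q \<prec> j \<or> (\<forall>v\<in>V. j \<prec> v))"

definition local_on :: "nat set \<Rightarrow> ((nat \<Rightarrow> 'a) \<Rightarrow> 'c) \<Rightarrow> bool" where
  "local_on S f \<longleftrightarrow> (\<forall>Z Z'. (\<forall>i\<in>S. Z i = Z' i) \<longrightarrow> f Z = f Z')"

lemma local_onD: "local_on S f \<Longrightarrow> (\<And>i. i \<in> S \<Longrightarrow> Z i = Z' i) \<Longrightarrow> f Z = f Z'"
  unfolding local_on_def by blast

definition linear_on :: "nat set \<Rightarrow> ((nat \<Rightarrow> 'a) \<Rightarrow> 'c::complex_unital_algebra) \<Rightarrow> bool" where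
  "linear_on S f \<longleftrightarrow> (\<forall>Z. faces S Z \<longrightarrow> (\<forall>i\<in>S. \<forall>X\<in>face_at i. \<forall>Y\<in>face_at i. \<forall>a.
     f (Z(i := X + Y)) = f (Z(i := X)) + f (Z(i := Y)) \<and> f (Z(i := a *\<^sub>C X)) = a *\<^sub>C f (Z(i := X))))"

lemma linear_onD:
  assumes "linear_on S f" "faces S Z" "i \<in> S" "X \<in> face_at i"
  shows "Y \<in> face_at i \<Longrightarrow> f (Z(i := X + Y)) = f (Z(i := X)) + f (Z(i := Y))"
    "f (Z(i := a *\<^sub>C X)) = a *\<^sub>C f (Z(i := X))"
  using assms unfolding linear_on_def by simp_all

text \<open>
  Conditions (1) and (2) of conditional bi-multiplicativity are the three cases of this definition,
  read off according to the sides of the two indices involved.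
\<close>

definition balanced :: "('b \<Rightarrow> 'c::complex_unital_algebra) \<Rightarrow> nat set \<Rightarrow> ((nat \<Rightarrow> 'a) \<Rightarrow> 'c) \<Rightarrow> bool" where
  "balanced j S f \<longleftrightarrow> (\<forall>Z b. faces S Z \<longrightarrow>
     (S \<noteq> {} \<longrightarrow> f (Z(cmin S := lact (cmin S) b (Z (cmin S)))) = j b * f Z \<and>
                f (Z(cmax S := ract (cmax S) (Z (cmax S)) b)) = f Z * j b) \<and>
     (\<forall>p\<in>S. \<forall>q\<in>S. p \<prec> q \<and> (\<forall>i\<in>S. \<not> (p \<prec> i \<and> i \<prec> q)) \<longrightarrow>
        f (Z(p := ract p (Z p) b)) = f (Z(q := lact q b (Z q)))))"

lemma balancedD:
  assumes "balanced j S f" "faces S Z"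
  shows "S \<noteq> {} \<Longrightarrow> cmin S = p \<Longrightarrow> f (Z(p := lact p b (Z p))) = j b * f Z"
    "S \<noteq> {} \<Longrightarrow> cmax S = p \<Longrightarrow> f (Z(p := ract p (Z p) b)) = f Z * j b"
    "p \<in> S \<Longrightarrow> q \<in> S \<Longrightarrow> p \<prec> q \<Longrightarrow> (\<And>i. i \<in> S \<Longrightarrow> p \<prec> i \<Longrightarrow> i \<prec> q \<Longrightarrow> False) \<Longrightarrow>
      f (Z(p := ract p (Z p) b)) = f (Z(q := lact q b (Z q)))"
proof -
  note a = assms(1)[unfolded balanced_def, THEN spec, THEN spec, of Z b, THEN mp, OF assms(2)]
  show "S \<noteq> {} \<Longrightarrow> cmin S = p \<Longrightarrow> f (Z(p := lact p b (Z p))) = j b * f Z"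
    "S \<noteq> {} \<Longrightarrow> cmax S = p \<Longrightarrow> f (Z(p := ract p (Z p) b)) = f Z * j b"
    using a(1) by auto
  show "p \<in> S \<Longrightarrow> q \<in> S \<Longrightarrow> p \<prec> q \<Longrightarrow> (\<And>i. i \<in> S \<Longrightarrow> p \<prec> i \<Longrightarrow> i \<prec> q \<Longrightarrow> False) \<Longrightarrow>
      f (Z(p := ract p (Z p) b)) = f (Z(q := lact q b (Z q)))"
    by (rule a[THEN conjunct2, rule_format]) auto
qed

lemma fill_local:
  assumes "nc_on \<pi> S" "S \<noteq> {}" "\<And>S'. card S' < card S \<Longrightarrow> nc_on \<pi> S' \<Longrightarrow> local_on S' (h \<pi> S')"
    and "\<And>i. i \<in> S \<Longrightarrow> Z i = Z' i" "i \<in> first_block \<pi> S"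
  shows "fill h \<pi> S Z i = fill h \<pi> S Z' i"
proof -
  have "h \<pi> (gap S (first_block \<pi> S) i) Z = h \<pi> (gap S (first_block \<pi> S) i) Z'"
    using assms(3)[OF gap_psub(2)[OF assms(1,2,5)] nc_gap[OF assms(1,2,5)]]
    by (rule local_onD) (use assms(4) gap_sub in blast)
  moreover have "Z i = Z' i" using assms(4,5) first_block(3)[OF assms(1,2)] by blast
  ultimately show ?thesis by (simp add: fill_def)
qed

text \<open>The hypotheses on \<open>h\<close> and the extension concern smaller sets only. For
  \<open>inner_ext\<close> both are induction hypotheses; for \<open>outer_ext\<close> the one on
  \<open>h\<close> is known beforehand. \<open>balanced_step\<close> and \<open>linear_step\<close>
  are organised in the same way.\<close>

lemma local_step:
  assumes T: "tree_ext g h \<Theta>" and S: "nc_on \<pi> S" and g: "\<And>U. local_on U (g U)"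
    and h: "\<And>S'. card S' < card S \<Longrightarrow> nc_on \<pi> S' \<Longrightarrow> local_on S' (h \<pi> S')"
    and \<Theta>: "\<And>S'. card S' < card S \<Longrightarrow> nc_on \<pi> S' \<Longrightarrow> local_on S' (\<Theta> \<pi> S')"
  shows "local_on S (\<Theta> \<pi> S)"
  unfolding local_on_def
proof (intro allI impI)
  fix Z Z' :: "nat \<Rightarrow> 'a" assume eq: "\<forall>i\<in>S. Z i = Z' i"
  show "\<Theta> \<pi> S Z = \<Theta> \<pi> S Z'"
  proof (cases "S = {}")
    case True
    then show ?thesis using tree_ext_empty[OF T] S by simp
  next
    case False
    have "g (first_block \<pi> S) (fill h \<pi> S Z) = g (first_block \<pi> S) (fill h \<pi> S Z')"
    proof (rule local_onD[OF g])
      fix i assume "i \<in> first_block \<pi> S"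
      then show "fill h \<pi> S Z i = fill h \<pi> S Z' i"
        using eq h by (intro fill_local[OF S False]) auto
    qed
    moreover have "\<Theta> \<pi> (tail \<pi> S) Z = \<Theta> \<pi> (tail \<pi> S) Z'"
      using \<Theta>[OF card_tail nc_tail, OF S False S False]
      by (rule local_onD) (use eq in \<open>auto simp: tail_def gap_def\<close>)
    ultimately show ?thesis unfolding tree_ext_step[OF T S False] by simp
  qed
qed

lemma inner_ext_local:
  assumes g: "\<And>U. local_on U (g U)" and S: "nc_on \<pi> S"
  shows "local_on S (inner_ext g \<pi> S)"
  using S
proof (induction "card S" arbitrary: S rule: less_induct)
  case less
  show ?case by (rule local_step[OF tree_ext_inner_ext less.prems g]) (rule less.hyps; assumption)+
qed

lemma outer_ext_local:
  assumes g: "\<And>U. local_on U (g U)" and h: "\<And>S. nc_on \<pi> S \<Longrightarrow> local_on S (h \<pi> S)" and S: "nc_on \<pi> S"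
  shows "local_on S (outer_ext g h \<pi> S)"
  using S
proof (induction "card S" arbitrary: S rule: less_induct)
  case less
  show ?case
  proof (rule local_step[OF tree_ext_outer_ext less.prems g])
    show "nc_on \<pi> S' \<Longrightarrow> local_on S' (h \<pi> S')" for S' by (rule h)
  qed (rule less.hyps; assumption)
qed

text \<open>Some index of \<open>S\<close> precedes \<open>V\<close>, so the first index is not in
  \<open>V\<close> and neither is any part of its block. An interval avoiding that block fits into
  one of its gaps, and the predecessor is the left end of this gap or an element of it. Removing
  \<open>V\<close> leaves the first block as it was.\<close>

lemma pred_of_gap:
  assumes S: "nc_on \<pi> S" and V: "nc_on \<pi> V" "V \<subseteq> S" "V \<noteq> {}" and p: "pred_of S V p"
  obtains i where "i \<in> first_block \<pi> S" "V \<subseteq> gap S (first_block \<pi> S) i" "p = i \<or> p \<in> gap S (first_block \<pi> S) i"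
    "\<forall>u\<in>first_block \<pi> S. i \<prec> u \<longrightarrow> (\<forall>v\<in>V. v \<prec> u)"
    "cmin S \<notin> V" "first_block \<pi> S \<inter> V = {}" "cmin (S - V) = cmin S" "nc_on \<pi> (S - V)" "S - V \<noteq> {}"
    "first_block \<pi> (S - V) = first_block \<pi> S" "first_end \<pi> (S - V) = first_end \<pi> S"
proof -
  let ?U = "first_block \<pi> S"
  have ne: "S \<noteq> {}" using V by auto
  note U = first_block[OF S ne]
  have pS: "p \<in> S" "p \<notin> V" and pv: "\<And>v. v \<in> V \<Longrightarrow> p \<prec> v"
    and pj: "\<And>j. j \<in> S \<Longrightarrow> j \<notin> V \<Longrightarrow> j = p \<or> j \<prec> p \<or> (\<forall>v\<in>V. v \<prec> j)"
    using p unfolding pred_of_def by auto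
  have e: "cmin S \<notin> V"
    using cmin(2)[OF nc_finite[OF S] pS(1)] pv[of "cmin S"] chi_less_asym[of \<chi> p "cmin S"] pS(2) by auto
  have UV: "?U \<inter> V = {}" using nc_block_sub[OF V(1) U(1)] U(2) e by auto
  have cmin': "cmin (S - V) = cmin S"
    by (rule cminI) (use cmin(1)[OF nc_finite[OF S] ne] e cmin(2)[OF nc_finite[OF S]] in auto)
  then have first_block': "first_block \<pi> (S - V) = ?U" "first_end \<pi> (S - V) = first_end \<pi> S" by (simp_all add: first_block_def first_end_def)
  obtain v where v: "v \<in> V" using V(3) by blast
  then obtain i where i: "i \<in> ?U" "v \<in> gap S ?U i"
    using gap_cover[OF S, of v] UV V(2) by (metis disjoint_iff subsetD)
  have iS: "i \<in> S" "i \<notin> V" using i U(3) UV by auto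
  have iv: "i \<prec> v" and vu: "\<And>u. u \<in> ?U \<Longrightarrow> i \<prec> u \<Longrightarrow> v \<prec> u" using i(2) by (auto simp: gap_def)
  have ip: "i = p \<or> i \<prec> p" using pj[OF iS] iv v chi_less_asym[OF iv] by auto
  have Vu: "w \<prec> u" if "u \<in> ?U" "i \<prec> u" "w \<in> V" for u w
  proof -
    have "u \<in> S" "u \<notin> V" using that(1) U(3) UV by auto
    moreover have "p \<prec> u" using pv[OF v] vu[OF that(1,2)] by (rule chi_less_trans)
    ultimately show ?thesis using pj[of u] that(3) chi_less_asym[of \<chi> p u] by auto
  qed
  have "w \<in> gap S ?U i" if w: "w \<in> V" for w
    using Vu w V(2) pv[OF w] ip chi_less_trans[of \<chi> i p w] by (auto simp: gap_def)
  moreover have "p \<in> gap S ?U i" if "p \<noteq> i"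
    using that ip pS Vu[OF _ _ v] chi_less_trans[OF pv[OF v]] by (auto simp: gap_def)
  moreover have "S - V \<noteq> {}" using e cmin(1)[OF nc_finite[OF S] ne] by auto
  ultimately show ?thesis
    using Vu by (intro that[OF i(1) _ _ _ e UV cmin' nc_Diff[OF S V(1)] _ first_block']) auto
qed

lemma pred_of_mono: "pred_of S V p \<Longrightarrow> T \<subseteq> S \<Longrightarrow> p \<in> T \<Longrightarrow> pred_of T V p"
  unfolding pred_of_def by auto

lemma gap_Diff: "gap (S - V) U i = gap S U i - V"
  by (auto simp: gap_def)

text \<open>Only the entry at \<open>i\<close>, the left end of the gap containing \<open>V\<close>,
  is affected. If \<open>p = i\<close>, the gap begins with \<open>V\<close>, whose value splits off
  on the left and is absorbed first. Otherwise the insertion takes place inside the gap, a smaller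
  set, which is \<open>M4\<close>.\<close>

lemma fill_insert:
  assumes T: "tree_ext g' h h" and h: "\<And>S. nc_on \<pi> S \<Longrightarrow> local_on S (h \<pi> S)"
    and M4: "\<And>S'. card S' < card S \<Longrightarrow> nc_on \<pi> S' \<Longrightarrow> V \<subseteq> S' \<Longrightarrow> pred_of S' V p \<Longrightarrow> S' \<subseteq> S \<Longrightarrow>
      h \<pi> S' Z = h \<pi> (S' - V) (Z(p := ract p (Z p) (h \<pi> V Z)))"
    and S: "nc_on \<pi> S" and V: "nc_on \<pi> V" "V \<subseteq> S" "V \<noteq> {}" and p: "pred_of S V p"
    and i: "i \<in> first_block \<pi> S" "V \<subseteq> gap S (first_block \<pi> S) i" "p = i \<or> p \<in> gap S (first_block \<pi> S) i" and u: "u \<in> first_block \<pi> S"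
    and tail: "i \<noteq> first_end \<pi> S"
  shows "fill h \<pi> S Z u = fill h \<pi> (S - V) (Z(p := ract p (Z p) (h \<pi> V Z))) u"
proof -
  let ?U = "first_block \<pi> S" and ?Z = "Z(p := ract p (Z p) (h \<pi> V Z))"
  have ne: "S \<noteq> {}" using V by auto
  have eqs: "first_block \<pi> (S - V) = first_block \<pi> S" "first_end \<pi> (S - V) = first_end \<pi> S"
    by (rule pred_of_gap[OF S V p], simp)+
  show ?thesis
  proof (cases "u = i")
    case False
    have disj: "gap S ?U u \<inter> V = {}" using gap_unique[OF _ _ u i(1)] False i(2) by blast
    have pu: "p \<notin> gap S ?U u" using gap_unique[OF _ _ u i(1)] False i(3) gap_disj[of p S ?U u] i(1) by blast
    have pu': "p \<noteq> u" using False i(3) gap_disj[of p S ?U i] u by blast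
    have "h \<pi> (gap S ?U u) Z = h \<pi> (gap S ?U u) ?Z"
      using h[OF nc_gap[OF S ne u]] by (rule local_onD) (use pu in auto)
    moreover have "gap (S - V) ?U u = gap S ?U u" using disj by (auto simp: gap_Diff)
    ultimately show ?thesis using pu' by (simp add: fill_def eqs)
  next
    case True
    let ?G = "gap S ?U i"
    have G: "nc_on \<pi> ?G" "card ?G < card S" using nc_gap[OF S ne i(1)] gap_psub[OF S ne i(1)] by auto
    have hG: "ract i (Z i) (h \<pi> ?G Z) = ract i (?Z i) (h \<pi> (?G - V) ?Z)"
    proof (cases "p = i")
      case True
      have lt: "v \<prec> j" if "v \<in> V" "j \<in> ?G - V" for v j
      proof -
        have "j \<in> S - V" "p \<prec> j" using that(2) True by (auto simp: gap_def)
        then show ?thesis using p that(1) chi_less_asym[of \<chi> p j] unfolding pred_of_def by auto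
      qed
      have "V \<union> (?G - V) = ?G" using i(2) by auto
      then have "h \<pi> ?G Z = h \<pi> V Z * h \<pi> (?G - V) Z"
        using tree_ext_Un[OF T V(1) nc_Diff[OF G(1) V(1)] lt] by simp
      moreover have "h \<pi> (?G - V) Z = h \<pi> (?G - V) ?Z"
        using h[OF nc_Diff[OF G(1) V(1)]] by (rule local_onD) (use True gap_disj i(1) in auto)
      ultimately show ?thesis using True by (simp add: action_simps)
    next
      case False
      then have "p \<in> ?G" using i(3) by auto
      then have "pred_of ?G V p" using pred_of_mono[OF p gap_sub] by blast
      then show ?thesis using M4[OF G(2,1) i(2) _ gap_sub] False by simp
    qed
    then show ?thesis using True tail i(1) by (simp add: fill_def eqs gap_Diff)
  qed
qed

lemma fill_faces: "faces S Z \<Longrightarrow> first_block \<pi> S \<subseteq> S \<Longrightarrow> faces (first_block \<pi> S) (fill h \<pi> S Z)"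
  unfolding faces_def fill_def using face_closed(1) by auto

text \<open>For \<open>V\<close> in an inner gap of the first block this is
  \<open>fill_insert\<close>; for \<open>V\<close> and its predecessor both in the tail it is the
  induction hypothesis. Balance enters when the predecessor is the end of the first block, where the
  value of \<open>V\<close> has to come out of the block as a factor.\<close>

lemma inner_ext_insert_pred:
  assumes g: "\<And>U. local_on U (g U)"
    and bal: "\<And>U. U \<in> \<pi> \<Longrightarrow> U \<subseteq> S \<Longrightarrow> balanced id U (g U)"
    and S: "nc_on \<pi> S" and V: "nc_on \<pi> V" "V \<subseteq> S" "V \<noteq> {}" and p: "pred_of S V p" and Z: "faces S Z"
  shows "inner_ext g \<pi> S Z = inner_ext g \<pi> (S - V) (Z(p := ract p (Z p) (inner_ext g \<pi> V Z)))"
  using S V(2) p bal Z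
proof (induction "card S" arbitrary: S rule: less_induct)
  case less
  note S = less.prems(1) and VS = less.prems(2) and p = less.prems(3)
  let ?U = "first_block \<pi> S" and ?Z = "Z(p := ract p (Z p) (inner_ext g \<pi> V Z))"
  have ne: "S \<noteq> {}" using VS V by auto
  note T = tree_ext_inner_ext[of g]
  note U = first_block[OF S ne]
  note loc = inner_ext_local[OF g]
  have IH: "inner_ext g \<pi> S' Z = inner_ext g \<pi> (S' - V) ?Z"
    if "card S' < card S" "nc_on \<pi> S'" "V \<subseteq> S'" "pred_of S' V p" "S' \<subseteq> S" for S'
    by (rule less.hyps[OF that(1-4)]) (use less.prems(4) that(5) faces_mono[OF less.prems(5) that(5)] in auto)
  obtain i where i: "i \<in> ?U" "V \<subseteq> gap S ?U i" "p = i \<or> p \<in> gap S ?U i"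
    and "\<forall>u\<in>?U. i \<prec> u \<longrightarrow> (\<forall>v\<in>V. v \<prec> u)"
    and V': "cmin S \<notin> V" "?U \<inter> V = {}" "cmin (S - V) = cmin S" "nc_on \<pi> (S - V)" "S - V \<noteq> {}"
    and eqs: "first_block \<pi> (S - V) = first_block \<pi> S" "first_end \<pi> (S - V) = first_end \<pi> S"
    by (rule pred_of_gap[OF S V(1) VS V(3) p])
  have t': "tail \<pi> (S - V) = tail \<pi> S - V" by (simp add: tail_def eqs gap_Diff)
  have tuple: "nc_on \<pi> (tail \<pi> S)" "card (tail \<pi> S) < card S" "tail \<pi> S \<subseteq> S"
    using nc_tail card_tail S ne gap_sub by (auto simp: tail_def)
  show ?case
  proof (cases "i = first_end \<pi> S")
    case False
    have "g ?U (fill (inner_ext g) \<pi> S Z) = g ?U (fill (inner_ext g) \<pi> (S - V) ?Z)"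
    proof (rule local_onD[OF g])
      fix u assume u: "u \<in> ?U"
      show "fill (inner_ext g) \<pi> S Z u = fill (inner_ext g) \<pi> (S - V) ?Z u"
        by (rule fill_insert[OF T loc IH S V(1) VS V(3) p i u False])
    qed
    moreover have "p \<notin> tail \<pi> S" "tail \<pi> S \<inter> V = {}"
      using gap_unique[OF _ _ i(1) U(5), of _ S] False i gap_disj[of p S ?U "first_end \<pi> S"] unfolding tail_def by auto
    then have "tail \<pi> (S - V) = tail \<pi> S" "inner_ext g \<pi> (tail \<pi> S) Z = inner_ext g \<pi> (tail \<pi> S) ?Z"
      by (auto simp: t' intro!: local_onD[OF loc[OF tuple(1)]])
    ultimately show ?thesis
      unfolding tree_ext_step[OF T S ne] tree_ext_step[OF T V'(4,5)] by (simp add: eqs)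
  next
    case True
    have other: "p \<notin> gap S ?U u \<and> gap S ?U u \<inter> V = {}" if u: "u \<in> ?U" "u \<noteq> first_end \<pi> S" for u
      using gap_unique[OF _ _ u(1) i(1), of _ S] u True i gap_disj[of p S ?U u] by auto
    have hg: "inner_ext g \<pi> (gap S ?U u) Z = inner_ext g \<pi> (gap S ?U u - V) (Z(p := z))" if u: "u \<in> ?U" "u \<noteq> first_end \<pi> S" for u z
    proof -
      have "gap S ?U u - V = gap S ?U u" using other[OF u] by auto
      moreover have "inner_ext g \<pi> (gap S ?U u) Z = inner_ext g \<pi> (gap S ?U u) (Z(p := z))"
        using loc[OF nc_gap[OF S ne u(1)]] by (rule local_onD) (use other[OF u] in auto)
      ultimately show ?thesis by simp
    qed
    have tVS: "V \<subseteq> tail \<pi> S" using i(2) True by (simp add: tail_def)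
    show ?thesis
    proof (cases "p = first_end \<pi> S")
      \<comment> \<open>Here \<open>V\<close> comes first in the tail. Balance at the right end
        turns the scalar absorbed by the last entry into a factor, and \<open>tree_ext_Un\<close>
        splits the same factor off the tail.\<close>
      case px: True
      let ?f = "fill (inner_ext g) \<pi> S Z" and ?c = "inner_ext g \<pi> V Z"
      have "fill (inner_ext g) \<pi> (S - V) ?Z u = (?f(p := ract p (?f p) ?c)) u" if "u \<in> ?U" for u
        using hg[OF that] px that by (simp add: fill_def eqs gap_Diff)
      then have "g ?U (fill (inner_ext g) \<pi> (S - V) ?Z) = g ?U (?f(p := ract p (?f p) ?c))"
        by (rule local_onD[OF g])
      also have "\<dots> = g ?U ?f * id ?c"
        by (rule balancedD(2)[OF less.prems(4)[OF U(1,3)]])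
          (use U px fill_faces[OF less.prems(5) U(3)] in \<open>auto simp: first_end_def\<close>)
      finally have 1: "g ?U (fill (inner_ext g) \<pi> (S - V) ?Z) = g ?U ?f * ?c" by simp
      have lt: "v \<prec> j" if "v \<in> V" "j \<in> tail \<pi> S - V" for v j
      proof -
        have "j \<in> S - V" "p \<prec> j" using that(2) px tail_eq[OF S ne] by auto
        then show ?thesis using p that(1) chi_less_asym[of \<chi> p j] unfolding pred_of_def by auto
      qed
      have "V \<union> (tail \<pi> S - V) = tail \<pi> S" using tVS by auto
      then have "inner_ext g \<pi> (tail \<pi> S) Z = inner_ext g \<pi> V Z * inner_ext g \<pi> (tail \<pi> S - V) Z"
        using tree_ext_Un[OF T V(1) nc_Diff[OF tuple(1) V(1)] lt] by simp
      moreover have "inner_ext g \<pi> (tail \<pi> S - V) Z = inner_ext g \<pi> (tail \<pi> S - V) ?Z"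
        using loc[OF nc_Diff[OF tuple(1) V(1)]]
        by (rule local_onD) (use px gap_disj U(5) in \<open>auto simp: tail_def\<close>)
      ultimately show ?thesis
        unfolding tree_ext_step[OF T S ne] tree_ext_step[OF T V'(4,5)] by (simp add: eqs 1 t' mult.assoc)
    next
      case px: False
      then have pt: "p \<in> tail \<pi> S" using i(3) True by (simp add: tail_def)
      then have pU: "p \<notin> ?U" using gap_disj by (simp add: tail_def)
      have "g ?U (fill (inner_ext g) \<pi> S Z) = g ?U (fill (inner_ext g) \<pi> (S - V) ?Z)"
      proof (rule local_onD[OF g])
        fix u assume u: "u \<in> ?U"
        then have "u \<noteq> p" using pU by auto
        then show "fill (inner_ext g) \<pi> S Z u = fill (inner_ext g) \<pi> (S - V) ?Z u"
          using hg[OF u] u by (simp add: fill_def eqs gap_Diff)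
      qed
      moreover have "inner_ext g \<pi> (tail \<pi> S) Z = inner_ext g \<pi> (tail \<pi> S - V) ?Z"
        by (rule IH[OF tuple(2,1) tVS pred_of_mono[OF p tuple(3) pt] tuple(3)])
      ultimately show ?thesis
        unfolding tree_ext_step[OF T S ne] tree_ext_step[OF T V'(4,5)] by (simp add: eqs t')
    qed
  qed
qed

text \<open>Outside the tail \<open>V\<close> lies in a gap of the first block, and gaps are filled
  with \<open>inner_ext k\<close>, whose insertion property is known. An outermost \<open>V\<close>
  in the tail would instead have its value formed with \<open>g\<close>.\<close>

lemma outer_ext_insert_pred:
  assumes g: "\<And>U. local_on U (g U)" and k: "\<And>U. local_on U (k U)"
    and bal: "\<And>U. U \<in> \<pi> \<Longrightarrow> U \<subseteq> S \<Longrightarrow> balanced id U (k U)"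
    and S: "nc_on \<pi> S" and V: "nc_on \<pi> V" "V \<subseteq> S" "V \<noteq> {}" and p: "pred_of S V p" and Z: "faces S Z"
    and tuple: "tail \<pi> S \<inter> V = {}"
  shows "outer_ext g (inner_ext k) \<pi> S Z = outer_ext g (inner_ext k) \<pi> (S - V) (Z(p := ract p (Z p) (inner_ext k \<pi> V Z)))"
proof -
  let ?U = "first_block \<pi> S" and ?Z = "Z(p := ract p (Z p) (inner_ext k \<pi> V Z))"
  have ne: "S \<noteq> {}" using V by auto
  note U = first_block[OF S ne]
  have loc: "local_on T (outer_ext g (inner_ext k) \<pi> T)" if "nc_on \<pi> T" for T
    by (rule outer_ext_local[OF g inner_ext_local[OF k] that])
  obtain i where i: "i \<in> ?U" "V \<subseteq> gap S ?U i" "p = i \<or> p \<in> gap S ?U i"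
    and "\<forall>u\<in>?U. i \<prec> u \<longrightarrow> (\<forall>v\<in>V. v \<prec> u)"
    and V': "cmin S \<notin> V" "?U \<inter> V = {}" "cmin (S - V) = cmin S" "nc_on \<pi> (S - V)" "S - V \<noteq> {}"
    and eqs: "first_block \<pi> (S - V) = first_block \<pi> S" "first_end \<pi> (S - V) = first_end \<pi> S"
    by (rule pred_of_gap[OF S V p])
  have t': "tail \<pi> (S - V) = tail \<pi> S - V" by (simp add: tail_def eqs gap_Diff)
  have ix: "i \<noteq> first_end \<pi> S" using tuple i(2) V(3) unfolding tail_def by blast
  have "g ?U (fill (inner_ext k) \<pi> S Z) = g ?U (fill (inner_ext k) \<pi> (S - V) ?Z)"
  proof (rule local_onD[OF g])
    fix u assume u: "u \<in> ?U"
    show "fill (inner_ext k) \<pi> S Z u = fill (inner_ext k) \<pi> (S - V) ?Z u"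
    proof (rule fill_insert[OF tree_ext_inner_ext inner_ext_local[OF k] _ S V p i u ix])
      fix S' assume S': "nc_on \<pi> S'" "V \<subseteq> S'" "pred_of S' V p" "S' \<subseteq> S"
      then show "inner_ext k \<pi> S' Z = inner_ext k \<pi> (S' - V) ?Z"
        using bal faces_mono[OF Z] by (intro inner_ext_insert_pred[OF k _ S'(1) V(1) S'(2) V(3) S'(3)]) auto
    qed
  qed
  moreover have "p \<notin> tail \<pi> S"
    using gap_unique[OF _ _ i(1) U(5), of _ S] ix i gap_disj[of p S ?U "first_end \<pi> S"] unfolding tail_def by auto
  then have "tail \<pi> (S - V) = tail \<pi> S" "outer_ext g (inner_ext k) \<pi> (tail \<pi> S) Z = outer_ext g (inner_ext k) \<pi> (tail \<pi> S) ?Z"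
    using tuple by (auto simp: t' intro!: local_onD[OF loc[OF nc_tail[OF S ne]]])
  ultimately show ?thesis
    unfolding tree_ext_step[OF tree_ext_outer_ext S ne] tree_ext_step[OF tree_ext_outer_ext V'(4,5)] by (simp add: eqs)
qed

section \<open>Balance and linearity of the extension\<close>

definition local_fam :: "nat set set \<Rightarrow> (nat set set \<Rightarrow> nat set \<Rightarrow> (nat \<Rightarrow> 'a) \<Rightarrow> 'c) \<Rightarrow> bool" where
  "local_fam \<pi> h \<longleftrightarrow> (\<forall>S. nc_on \<pi> S \<longrightarrow> local_on S (h \<pi> S))"

lemma local_famD: "local_fam \<pi> h \<Longrightarrow> nc_on \<pi> S \<Longrightarrow> local_on S (h \<pi> S)"
  by (simp add: local_fam_def)

lemma fill_update_block:
  assumes "nc_on \<pi> S" "S \<noteq> {}" and h: "local_fam \<pi> h"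
    and u: "u \<in> first_block \<pi> S" and z: "z \<in> first_block \<pi> S"
  shows "fill h \<pi> S (Z(z := v)) u = (if u \<noteq> z then fill h \<pi> S Z u
     else if u = first_end \<pi> S then v else ract u v (h \<pi> (gap S (first_block \<pi> S) u) Z))"
proof -
  have "h \<pi> (gap S (first_block \<pi> S) u) (Z(z := v)) = h \<pi> (gap S (first_block \<pi> S) u) Z"
    by (rule local_onD[OF local_famD[OF h nc_gap[OF assms(1,2) u]]]) (use gap_disj z in auto)
  then show ?thesis using u by (cases "u = z") (auto simp: fill_def)
qed

text \<open>An index in a gap is felt only through the value of that gap, hence only by the filled
  entry at its left end, and by no entry of the block when the gap is the tail.\<close>

lemma fill_update_gap:
  assumes "nc_on \<pi> S" "S \<noteq> {}" and h: "local_fam \<pi> h"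
    and u: "u \<in> first_block \<pi> S" and z: "i \<in> first_block \<pi> S" "z \<in> gap S (first_block \<pi> S) i"
  shows "fill h \<pi> S (Z(z := v)) u = (if u = i \<and> i \<noteq> first_end \<pi> S
     then ract i (Z i) (h \<pi> (gap S (first_block \<pi> S) i) (Z(z := v))) else fill h \<pi> S Z u)"
proof -
  have "h \<pi> (gap S (first_block \<pi> S) u) (Z(z := v)) = h \<pi> (gap S (first_block \<pi> S) u) Z" if "u \<noteq> i"
    by (rule local_onD[OF local_famD[OF h nc_gap[OF assms(1,2) u]]]) (use gap_unique[OF _ z(2) u z(1)] that in auto)
  moreover have "u \<noteq> z" using gap_disj[OF z(2)] u by auto
  ultimately show ?thesis using u by (auto simp: fill_def)
qed

lemma tail_update:
  assumes "nc_on \<pi> S" "S \<noteq> {}" and \<Theta>: "local_fam \<pi> \<Theta>"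
    and z: "z \<notin> tail \<pi> S"
  shows "\<Theta> \<pi> (tail \<pi> S) (Z(z := v)) = \<Theta> \<pi> (tail \<pi> S) Z"
  by (rule local_onD[OF local_famD[OF \<Theta> nc_tail[OF assms(1,2)]]]) (use z in auto)

text \<open>Neighbours \<open>p \<prec> q\<close> of \<open>S\<close> are both in the first block
  with an empty gap between them, or in a common gap, or one is in the block and the other at the
  adjacent edge of a gap; the tail counts as a gap. Inside a gap the induction hypothesis moves the
  scalar. At an edge it becomes a factor of the value of the gap, and associativity of the actions
  or of the product does the rest.\<close>

lemma balanced_step:
  assumes T: "tree_ext g h \<Theta>" and S: "nc_on \<pi> S"
    and g: "\<And>U. local_on U (g U)" and gb: "\<And>U. U \<in> \<pi> \<Longrightarrow> U \<subseteq> S \<Longrightarrow> balanced j U (g U)"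
    and h: "local_fam \<pi> h"
    and hb: "\<And>S'. card S' < card S \<Longrightarrow> S' \<subseteq> S \<Longrightarrow> nc_on \<pi> S' \<Longrightarrow> balanced id S' (h \<pi> S')"
    and h1: "\<And>Z. h \<pi> {} Z = 1"
    and \<Theta>: "local_fam \<pi> \<Theta>"
    and \<Theta>b: "\<And>S'. card S' < card S \<Longrightarrow> S' \<subseteq> S \<Longrightarrow> nc_on \<pi> S' \<Longrightarrow> balanced j S' (\<Theta> \<pi> S')"
  shows "balanced j S (\<Theta> \<pi> S)"
proof (cases "S = {}")
  case True
  then show ?thesis by (simp add: balanced_def)
next
  case ne: False
  let ?U = "first_block \<pi> S" and ?x = "first_end \<pi> S" and ?T = "tail \<pi> S"
  note U = first_block[OF S ne]
  note fin = nc_finite[OF S]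
  note gbU = balancedD[OF gb[OF U(1,3)]]
  note step = tree_ext_step[OF T S ne]
  note up = fill_update_block[where h = h, OF S ne h]
  note gp = fill_update_gap[where h = h, OF S ne h]
  note tlu = tail_update[where \<Theta> = \<Theta>, OF S ne \<Theta>]
  have tuple: "nc_on \<pi> ?T" "card ?T < card S" "?T \<subseteq> S"
    using nc_tail[OF S ne] card_tail[OF S ne] gap_sub by (auto simp: tail_def)
  have UT: "u \<notin> ?T" if "u \<in> ?U" for u using gap_disj that by (auto simp: tail_def)
  have GT: "z \<notin> ?T" if "z \<in> gap S ?U i" "i \<in> ?U" "i \<noteq> ?x" for i z
    using gap_unique[OF that(1) _ that(2) U(5)] that(3) by (auto simp: tail_def)
  note hG = hb[OF gap_psub(2)[OF S ne] gap_sub nc_gap[OF S ne]]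
  have mnU: "cmin ?U = cmin S"
    by (rule cminI) (use U(2,3) cmin(2)[OF fin] in auto)
  have mxU: "cmax ?U = ?x" by (simp add: first_end_def)
  show ?thesis
    unfolding balanced_def
  proof (intro allI impI conjI ballI)
    fix Z b assume Z: "faces S Z"
    let ?f = "fill h \<pi> S Z" and ?e = "cmin S"
    have f: "faces ?U ?f" by (rule fill_faces[OF Z U(3)])
    note \<Theta>T = balancedD[OF \<Theta>b[OF tuple(2,3,1)] faces_mono[OF Z tuple(3)]]
    { 
      have "fill h \<pi> S (Z(?e := lact ?e b (Z ?e))) u = (?f(?e := lact ?e b (?f ?e))) u" if "u \<in> ?U" for u
        using up[OF that U(2)] that U(2) by (simp add: fill_def action_simps)
      then have "g ?U (fill h \<pi> S (Z(?e := lact ?e b (Z ?e)))) = g ?U (?f(?e := lact ?e b (?f ?e)))"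
        by (rule local_onD[OF g])
      also have "\<dots> = j b * g ?U ?f" by (rule gbU(1)[OF f U(7) mnU])
      finally show "\<Theta> \<pi> S (Z(?e := lact ?e b (Z ?e))) = j b * \<Theta> \<pi> S Z"
        unfolding step using tlu[OF UT[OF U(2)]] by (simp add: mult.assoc)
    next
      let ?z = "cmax S"
      show "\<Theta> \<pi> S (Z(?z := ract ?z (Z ?z) b)) = \<Theta> \<pi> S Z * j b"
      proof (cases "?T = {}")
        case True
        have "cmax S = ?x"
        proof (rule cmaxI)
          fix k assume "k \<in> S"
          then have "\<not> ?x \<prec> k" using True tail_eq[OF S ne] by auto
          then show "k = ?x \<or> k \<prec> ?x" using chi_less_total by metis
        qed (rule U(8))
        have "fill h \<pi> S (Z(?x := ract ?x (Z ?x) b)) u = (?f(?x := ract ?x (?f ?x) b)) u" if "u \<in> ?U" for u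
          using up[OF that U(5)] that by (simp add: fill_def)
        then have "g ?U (fill h \<pi> S (Z(?x := ract ?x (Z ?x) b))) = g ?U (?f(?x := ract ?x (?f ?x) b))"
          by (rule local_onD[OF g])
        also have "\<dots> = g ?U ?f * j b" by (rule gbU(2)[OF f U(7) mxU])
        finally show ?thesis
          unfolding step \<open>cmax S = ?x\<close> using True T tuple(1) by (simp add: tree_ext_empty)
      next
        case False
        then obtain k where k: "k \<in> S" "?x \<prec> k" using tail_eq[OF S ne] by auto
        then have "?x \<prec> cmax S" using cmax(2)[OF fin k(1)] chi_less_trans by metis
        then have zT: "cmax S \<in> ?T" using cmax(1)[OF fin ne] tail_eq[OF S ne] by auto
        then have zG: "cmax S \<in> gap S ?U ?x" by (simp add: tail_def)
        have "cmax ?T = cmax S" by (rule cmaxI[OF zT]) (use cmax(2)[OF fin] tuple(3) in auto)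
        note 1 = \<Theta>T(2)[OF False this]
        have "g ?U (fill h \<pi> S (Z(?z := ract ?z (Z ?z) b))) = g ?U ?f"
          by (rule local_onD[OF g]) (simp add: gp[OF _ U(5) zG])
        then show ?thesis unfolding step 1 by (simp add: mult.assoc)
      qed
    next
      fix p q assume p: "p \<in> S" and q: "q \<in> S" and pq: "p \<prec> q \<and> (\<forall>i\<in>S. \<not> (p \<prec> i \<and> i \<prec> q))"
      have lt: "p \<prec> q" and adj3: "\<And>i. i \<in> S \<Longrightarrow> p \<prec> i \<Longrightarrow> i \<prec> q \<Longrightarrow> False"
        using pq by auto
      have adj1: "i = q \<or> q \<prec> i" if "i \<in> S" "p \<prec> i" for i
        using adj3[OF that] chi_less_total[of i q \<chi>] by auto
      have adj2: "i = p \<or> i \<prec> p" if "i \<in> S" "i \<prec> q" for i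
        using adj3[OF that(1) _ that(2)] chi_less_total[of i p \<chi>] by auto
      note adj = adj1 adj2 adj3
      let ?Zp = "Z(p := ract p (Z p) b)" and ?Zq = "Z(q := lact q b (Z q))"
      have fq: "fill h \<pi> S ?Zq u = (?f(q := lact q b (?f q))) u" if qU: "q \<in> ?U" and "u \<in> ?U" for u
        using up[OF that(2,1)] that by (simp add: fill_def action_simps)
      show "\<Theta> \<pi> S ?Zp = \<Theta> \<pi> S ?Zq"
      proof (cases "p \<in> ?U")
        case pU: True
        note pT = UT[OF pU]
        show ?thesis
        proof (cases "p = ?x")
          case True
          have qT: "q \<in> ?T" using True lt q tail_eq[OF S ne] by auto
          then have qG: "q \<in> gap S ?U ?x" by (simp add: tail_def)
          have "cmin ?T = q" by (rule cminI[OF qT]) (use adj(1) True tail_eq[OF S ne] in auto)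
          note 1 = \<Theta>T(1)[OF _ this]
          have "fill h \<pi> S ?Zp u = (?f(p := ract p (?f p) b)) u" if "u \<in> ?U" for u
            using up[OF that pU] that True by (simp add: fill_def)
          then have "g ?U (fill h \<pi> S ?Zp) = g ?U (?f(p := ract p (?f p) b))"
            by (rule local_onD[OF g])
          also have "\<dots> = g ?U ?f * j b" using gbU(2)[OF f U(7) mxU] True by simp
          finally have 2: "g ?U (fill h \<pi> S ?Zp) = g ?U ?f * j b" .
          have "g ?U (fill h \<pi> S ?Zq) = g ?U ?f"
            by (rule local_onD[OF g]) (simp add: gp[OF _ U(5) qG])
          moreover have "\<Theta> \<pi> ?T ?Zq = j b * \<Theta> \<pi> ?T Z" using 1 qT by auto
          ultimately show ?thesis unfolding step 2 tlu[OF pT] by (simp add: mult.assoc)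
        next
          case px: False
          show ?thesis
          proof (cases "q \<in> ?U")
            case qU: True
            \<comment> \<open>An empty gap has the value 1 by \<open>h1\<close>, so the filling
              leaves the entry at \<open>p\<close> alone, and \<open>p\<close>, \<open>q\<close> are
              neighbours in the block as well.\<close>
            have "gap S ?U p = {}" using adj(3) qU lt unfolding gap_def by auto
            then have "fill h \<pi> S ?Zp u = (?f(p := ract p (?f p) b)) u" if "u \<in> ?U" for u
              using up[OF that pU] that px h1 by (simp add: fill_def action_simps)
            then have "g ?U (fill h \<pi> S ?Zp) = g ?U (?f(p := ract p (?f p) b))"
              by (rule local_onD[OF g])
            also have "\<dots> = g ?U (?f(q := lact q b (?f q)))"
              by (rule gbU(3)[OF f pU qU lt]) (use adj(3) U(3) in auto)
            also have "\<dots> = g ?U (fill h \<pi> S ?Zq)"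
              by (rule local_onD[OF g], rule fq[OF qU, symmetric])
            finally show ?thesis unfolding step tlu[OF pT] tlu[OF UT[OF qU]] by simp
          next
            case qU: False
            have "q \<prec> u" if "u \<in> ?U" "p \<prec> u" for u using adj(1)[of u] that U(3) qU by auto
            then have qG: "q \<in> gap S ?U p" using q lt by (simp add: gap_def)
            have "cmin (gap S ?U p) = q" by (rule cminI[OF qG]) (use adj(1) in \<open>auto simp: gap_def\<close>)
            moreover have "gap S ?U p \<noteq> {}" using qG by auto
            \<comment> \<open>The scalar enters the gap as a left factor of its value; absorbing
              \<open>b\<close> and then the value is the same as absorbing their product.\<close>
            ultimately have 1: "h \<pi> (gap S ?U p) ?Zq = b * h \<pi> (gap S ?U p) Z"
              using balancedD(1)[OF hG[OF pU pU] faces_mono[OF Z gap_sub]] by simp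
            have "g ?U (fill h \<pi> S ?Zp) = g ?U (fill h \<pi> S ?Zq)"
            proof (rule local_onD[OF g])
              fix u assume u: "u \<in> ?U"
              show "fill h \<pi> S ?Zp u = fill h \<pi> S ?Zq u"
                unfolding up[OF u pU] gp[OF u pU qG] using px 1 qG by (auto simp: action_simps)
            qed
            then show ?thesis unfolding step tlu[OF pT] tlu[OF GT[OF qG pU px]] by simp
          qed
        qed
      next
        case pU: False
        obtain i where i: "i \<in> ?U" "p \<in> gap S ?U i" using gap_cover[OF S p pU] by blast
        have ip: "i \<prec> p" and iu: "\<And>u. u \<in> ?U \<Longrightarrow> i \<prec> u \<Longrightarrow> p \<prec> u" using i(2) by (auto simp: gap_def)
        have iq: "i \<prec> q" using ip lt by (rule chi_less_trans)
        have qG: "q \<in> gap S ?U i" if qU: "q \<notin> ?U"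
        proof -
          have "q \<prec> u" if "u \<in> ?U" "i \<prec> u" for u using adj(1)[OF _ iu[OF that]] that(1) qU U(3) by auto
          then show ?thesis using q iq by (simp add: gap_def)
        qed
        show ?thesis
        proof (cases "i = ?x")
          case True
          have "q \<notin> ?U" using U(6)[of q] iq True chi_less_asym chi_less_irrefl by blast
          note qG = qG[OF this]
          have "p \<in> ?T" "q \<in> ?T" using i(2) qG True by (simp_all add: tail_def)
          then have 1: "\<Theta> \<pi> ?T ?Zp = \<Theta> \<pi> ?T ?Zq"
            by (rule \<Theta>T(3)[OF _ _ lt]) (use adj(3) tuple(3) in auto)
          have "g ?U (fill h \<pi> S ?Zp) = g ?U (fill h \<pi> S ?Zq)"
            by (rule local_onD[OF g]) (simp add: gp[OF _ i] gp[OF _ i(1) qG] True)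
          then show ?thesis unfolding step 1 by simp
        next
          case ix: False
          note pT = GT[OF i(2,1) ix]
          note bG = balancedD[OF hG[OF i(1) i(1)] faces_mono[OF Z gap_sub]]
          show ?thesis
          proof (cases "q \<in> ?U")
            case qU: False
            note qG = qG[OF this]
            have "h \<pi> (gap S ?U i) ?Zp = h \<pi> (gap S ?U i) ?Zq"
              by (rule bG(3)[OF i(2) qG lt]) (use adj(3) in \<open>auto simp: gap_def\<close>)
            then have "g ?U (fill h \<pi> S ?Zp) = g ?U (fill h \<pi> S ?Zq)"
              by (intro local_onD[OF g]) (simp add: gp[OF _ i] gp[OF _ i(1) qG])
            then show ?thesis unfolding step tlu[OF pT] tlu[OF GT[OF qG i(1) ix]] by simp
          next
            case qU: True
            have "k = p \<or> k \<prec> p" if k: "k \<in> gap S ?U i" for k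
              using k qU iq adj(2)[of k] by (simp add: gap_def)
            then have "cmax (gap S ?U i) = p" by (rule cmaxI[OF i(2)])
            moreover have "gap S ?U i \<noteq> {}" using i(2) by auto
            \<comment> \<open>The scalar leaves the gap as a right factor of its value, is absorbed
              by the filled entry \<open>i\<close>, and balance of \<open>g\<close> hands it to
              \<open>q\<close>, the next entry of the block.\<close>
            ultimately have 1: "h \<pi> (gap S ?U i) ?Zp = h \<pi> (gap S ?U i) Z * b"
              using bG(2) by simp
            have "g ?U (fill h \<pi> S ?Zp) = g ?U (?f(i := ract i (?f i) b))"
            proof (rule local_onD[OF g])
              fix u assume u: "u \<in> ?U"
              show "fill h \<pi> S ?Zp u = (?f(i := ract i (?f i) b)) u"
                unfolding gp[OF u i] 1 using ix i(1) by (simp add: fill_def action_simps)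
            qed
            also have "\<dots> = g ?U (?f(q := lact q b (?f q)))"
              by (rule gbU(3)[OF f i(1) qU iq]) (use adj(3) iu U(3) in blast)
            also have "\<dots> = g ?U (fill h \<pi> S ?Zq)"
              by (rule local_onD[OF g], rule fq[OF qU, symmetric])
            finally show ?thesis unfolding step tlu[OF pT] tlu[OF UT[OF qU]] by simp
          qed
        qed
      qed
    }
  qed
qed

lemma linear_step:
  assumes T: "tree_ext g h \<Theta>" and S: "nc_on \<pi> S"
    and g: "\<And>U. local_on U (g U)" and gb: "\<And>U. U \<in> \<pi> \<Longrightarrow> U \<subseteq> S \<Longrightarrow> linear_on U (g U)"
    and h: "local_fam \<pi> h"
    and hb: "\<And>S'. card S' < card S \<Longrightarrow> S' \<subseteq> S \<Longrightarrow> nc_on \<pi> S' \<Longrightarrow> linear_on S' (h \<pi> S')"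
    and \<Theta>: "local_fam \<pi> \<Theta>"
    and \<Theta>b: "\<And>S'. card S' < card S \<Longrightarrow> S' \<subseteq> S \<Longrightarrow> nc_on \<pi> S' \<Longrightarrow> linear_on S' (\<Theta> \<pi> S')"
  shows "linear_on S (\<Theta> \<pi> S)"
proof (cases "S = {}")
  case True
  then show ?thesis by (simp add: linear_on_def)
next
  case ne: False
  let ?U = "first_block \<pi> S" and ?x = "first_end \<pi> S" and ?T = "tail \<pi> S"
  note U = first_block[OF S ne]
  note gbU = linear_onD[OF gb[OF U(1,3)]]
  note step = tree_ext_step[OF T S ne]
  note up = fill_update_block[where h = h, OF S ne h]
  note gp = fill_update_gap[where h = h, OF S ne h]
  note tlu = tail_update[where \<Theta> = \<Theta>, OF S ne \<Theta>]
  have tuple: "nc_on \<pi> ?T" "card ?T < card S" "?T \<subseteq> S"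
    using nc_tail[OF S ne] card_tail[OF S ne] gap_sub by (auto simp: tail_def)
  have UT: "u \<notin> ?T" if "u \<in> ?U" for u using gap_disj that by (auto simp: tail_def)
  have GT: "z \<notin> ?T" if "z \<in> gap S ?U i" "i \<in> ?U" "i \<noteq> ?x" for i z
    using gap_unique[OF that(1) _ that(2) U(5)] that(3) by (auto simp: tail_def)
  note hG = hb[OF gap_psub(2)[OF S ne] gap_sub nc_gap[OF S ne]]
  show ?thesis
    unfolding linear_on_def
  proof (intro allI impI ballI)
    fix Z z X Y a assume Z: "faces S Z" and z: "z \<in> S" and XY: "X \<in> face_at z" "Y \<in> face_at z"
    let ?f = "fill h \<pi> S Z"
    have f: "faces ?U ?f" by (rule fill_faces[OF Z U(3)])
    show "\<Theta> \<pi> S (Z(z := X + Y)) = \<Theta> \<pi> S (Z(z := X)) + \<Theta> \<pi> S (Z(z := Y)) \<and>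
      \<Theta> \<pi> S (Z(z := a *\<^sub>C X)) = a *\<^sub>C \<Theta> \<pi> S (Z(z := X))"
    proof (cases "z \<in> ?U")
      case zU: True
      \<comment> \<open>\<open>\<phi>\<close> is the effect of the filling on a value at
        \<open>z\<close>. It is linear and stays in the face, so linearity of \<open>g\<close>
        applies to it.\<close>
      define \<phi> where "\<phi> v = (if z = ?x then v else ract z v (h \<pi> (gap S ?U z) Z))" for v
      have \<phi>: "\<phi> (v + w) = \<phi> v + \<phi> w" "\<phi> (a *\<^sub>C v) = a *\<^sub>C \<phi> v" "v \<in> face_at z \<Longrightarrow> \<phi> v \<in> face_at z" for v w
        by (auto simp: \<phi>_def action_simps face_closed)
      have G: "g ?U (fill h \<pi> S (Z(z := v))) = g ?U (?f(z := \<phi> v))" for v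
        by (intro local_onD[OF g]) (simp add: up[OF _ zU] \<phi>_def)
      show ?thesis unfolding step G \<phi> gbU(1)[OF f zU \<phi>(3)[OF XY(1)] \<phi>(3)[OF XY(2)]] gbU(2)[OF f zU \<phi>(3)[OF XY(1)]]
          tlu[OF UT[OF zU]]
        by (simp add: distrib_right mult_scaleC_left)
    next
      case zU: False
      obtain i where i: "i \<in> ?U" "z \<in> gap S ?U i" using gap_cover[OF S z zU] by blast
      show ?thesis
      proof (cases "i = ?x")
        case True
        have G: "g ?U (fill h \<pi> S (Z(z := v))) = g ?U ?f" for v
          by (intro local_onD[OF g]) (simp add: gp[OF _ i] True)
        have zT: "z \<in> ?T" using i True by (simp add: tail_def)
        show ?thesis unfolding step G linear_onD[OF \<Theta>b[OF tuple(2,3,1)] faces_mono[OF Z tuple(3)] zT XY(1)]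
          linear_onD(1)[OF \<Theta>b[OF tuple(2,3,1)] faces_mono[OF Z tuple(3)] zT XY]
          by (simp add: distrib_left mult_scaleC_right)
      next
        case False
        let ?h = "\<lambda>v. ract i (Z i) (h \<pi> (gap S ?U i) (Z(z := v)))"
        have G: "g ?U (fill h \<pi> S (Z(z := v))) = g ?U (?f(i := ?h v))" for v
          by (intro local_onD[OF g]) (simp add: gp[OF _ i] False)
        note hl = linear_onD[OF hG[OF i(1) i(1)] faces_mono[OF Z gap_sub] i(2) XY(1)]
        have Zi: "ract i (Z i) c \<in> face_at i" for c using Z U(3) i(1) face_closed by (auto simp: faces_def)
        show ?thesis unfolding step G hl(1)[OF XY(2)] hl(2) action_simps gbU(1)[OF f i(1) Zi Zi] gbU(2)[OF f i(1) Zi]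
          tlu[OF GT[OF i(2,1) False]]
          by (simp add: distrib_right mult_scaleC_left)
      qed
    qed
  qed
qed


lemma inner_ext_local_fam: "(\<And>U. local_on U (g U)) \<Longrightarrow> local_fam \<pi> (inner_ext g)"
  unfolding local_fam_def by (intro allI impI inner_ext_local)

lemma outer_ext_local_fam:
  assumes "\<And>U. local_on U (g U)" "\<And>U. local_on U (k U)"
  shows "local_fam \<pi> (outer_ext g (inner_ext k))"
  unfolding local_fam_def by (intro allI impI outer_ext_local inner_ext_local assms)

lemma inner_ext_empty: "inner_ext g \<pi> {} Z = 1"
  by (subst inner_ext.simps) simp

lemma inner_ext_balanced:
  assumes g: "\<And>U. local_on U (g U)" and S: "nc_on \<pi> S"
    and gb: "\<And>U. U \<in> \<pi> \<Longrightarrow> U \<subseteq> S \<Longrightarrow> balanced id U (g U)"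
  shows "balanced id S (inner_ext g \<pi> S)"
  using S gb
proof (induction "card S" arbitrary: S rule: less_induct)
  case less
  have IH: "balanced id S' (inner_ext g \<pi> S')" if "card S' < card S" "S' \<subseteq> S" "nc_on \<pi> S'" for S'
    by (rule less.hyps[OF that(1,3)]) (use less.prems(2) that(2) in auto)
  show ?case
    by (rule balanced_step[OF tree_ext_inner_ext less.prems(1) g less.prems(2) inner_ext_local_fam[OF g] IH
      inner_ext_empty inner_ext_local_fam[OF g] IH])
qed

lemma inner_ext_linear:
  assumes g: "\<And>U. local_on U (g U)" and S: "nc_on \<pi> S"
    and gb: "\<And>U. U \<in> \<pi> \<Longrightarrow> U \<subseteq> S \<Longrightarrow> linear_on U (g U)"
  shows "linear_on S (inner_ext g \<pi> S)"
  using S gb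
proof (induction "card S" arbitrary: S rule: less_induct)
  case less
  have IH: "linear_on S' (inner_ext g \<pi> S')" if "card S' < card S" "S' \<subseteq> S" "nc_on \<pi> S'" for S'
    by (rule less.hyps[OF that(1,3)]) (use less.prems(2) that(2) in auto)
  show ?case
    by (rule linear_step[OF tree_ext_inner_ext less.prems(1) g less.prems(2) inner_ext_local_fam[OF g] IH
      inner_ext_local_fam[OF g] IH])
qed

lemma outer_ext_balanced:
  assumes g: "\<And>U. local_on U (g U)" and k: "\<And>U. local_on U (k U)" and S: "nc_on \<pi> S"
    and gb: "\<And>U. U \<in> \<pi> \<Longrightarrow> U \<subseteq> S \<Longrightarrow> balanced j U (g U)"
    and kb: "\<And>U. U \<in> \<pi> \<Longrightarrow> U \<subseteq> S \<Longrightarrow> balanced id U (k U)"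
  shows "balanced j S (outer_ext g (inner_ext k) \<pi> S)"
  using S gb kb
proof (induction "card S" arbitrary: S rule: less_induct)
  case less
  have IH: "balanced j S' (outer_ext g (inner_ext k) \<pi> S')" if "card S' < card S" "S' \<subseteq> S" "nc_on \<pi> S'" for S'
    by (rule less.hyps[OF that(1,3)]) (use less.prems(2,3) that(2) in auto)
  have kS: "balanced id S' (inner_ext k \<pi> S')" if "S' \<subseteq> S" "nc_on \<pi> S'" for S'
    by (rule inner_ext_balanced[OF k that(2)]) (use less.prems(3) that(1) in auto)
  show ?case
    by (rule balanced_step[OF tree_ext_outer_ext less.prems(1) g less.prems(2) inner_ext_local_fam[OF k] kS
      inner_ext_empty outer_ext_local_fam[OF g k] IH])
qed

lemma outer_ext_linear:
  assumes g: "\<And>U. local_on U (g U)" and k: "\<And>U. local_on U (k U)" and S: "nc_on \<pi> S"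
    and gb: "\<And>U. U \<in> \<pi> \<Longrightarrow> U \<subseteq> S \<Longrightarrow> linear_on U (g U)"
    and kb: "\<And>U. U \<in> \<pi> \<Longrightarrow> U \<subseteq> S \<Longrightarrow> linear_on U (k U)"
  shows "linear_on S (outer_ext g (inner_ext k) \<pi> S)"
  using S gb kb
proof (induction "card S" arbitrary: S rule: less_induct)
  case less
  have IH: "linear_on S' (outer_ext g (inner_ext k) \<pi> S')" if "card S' < card S" "S' \<subseteq> S" "nc_on \<pi> S'" for S'
    by (rule less.hyps[OF that(1,3)]) (use less.prems(2,3) that(2) in auto)
  have kS: "linear_on S' (inner_ext k \<pi> S')" if "S' \<subseteq> S" "nc_on \<pi> S'" for S'
    by (rule inner_ext_linear[OF k that(2)]) (use less.prems(3) that(1) in auto)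
  show ?case
    by (rule linear_step[OF tree_ext_outer_ext less.prems(1) g less.prems(2) inner_ext_local_fam[OF k] kS
      outer_ext_local_fam[OF g k] IH])
qed

section \<open>Insertion of an interval at its successor\<close>

lemma pred_succ_adjacent:
  assumes "pred_of S V p" "succ_of S V q" "V \<noteq> {}"
  shows "p \<in> S - V" "q \<in> S - V" "p \<prec> q" "\<And>i. i \<in> S - V \<Longrightarrow> p \<prec> i \<Longrightarrow> i \<prec> q \<Longrightarrow> False"
proof -
  obtain v where v: "v \<in> V" using assms(3) by auto
  show "p \<in> S - V" "q \<in> S - V" using assms unfolding pred_of_def succ_of_def by auto
  have "p \<prec> v" "v \<prec> q" using assms v unfolding pred_of_def succ_of_def by auto
  then show "p \<prec> q" by (rule chi_less_trans)
  fix i assume i: "i \<in> S - V" "p \<prec> i" "i \<prec> q"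
  have "v \<prec> i" using assms(1) i(1) v chi_less_asym[OF i(2)] i(2) unfolding pred_of_def by auto
  moreover have "i \<prec> v" using assms(2) i(1) v chi_less_asym[OF i(3)] i(3) unfolding succ_of_def by auto
  ultimately show False using chi_less_asym by metis
qed

lemma faces_ract: "faces S Z \<Longrightarrow> p \<in> S \<Longrightarrow> faces S (Z(p := ract p (Z p) c))"
  and faces_lact: "faces S Z \<Longrightarrow> p \<in> S \<Longrightarrow> faces S (Z(p := lact p c (Z p)))"
  by (auto simp: faces_def face_closed)

text \<open>Once \<open>V\<close> is removed its two neighbours are adjacent, and balance of the
  extension on the rest carries the absorbed value from one to the other. If nothing precedes
  \<open>V\<close>, its value is a left factor by \<open>tree_ext_Un\<close> and enters the first
  remaining entry by balance.\<close>

lemma inner_ext_insert_succ: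
  assumes g: "\<And>U. local_on U (g U)"
    and bal: "\<And>U. U \<in> \<pi> \<Longrightarrow> U \<subseteq> S \<Longrightarrow> balanced id U (g U)"
    and S: "nc_on \<pi> S" and V: "nc_on \<pi> V" "V \<subseteq> S" "V \<noteq> {}" and q: "succ_of S V q" and Z: "faces S Z"
  shows "inner_ext g \<pi> S Z = inner_ext g \<pi> (S - V) (Z(q := lact q (inner_ext g \<pi> V Z) (Z q)))"
proof -
  have W: "nc_on \<pi> (S - V)" using nc_Diff[OF S V(1)] .
  have Wb: "balanced id (S - V) (inner_ext g \<pi> (S - V))"
    by (rule inner_ext_balanced[OF g W bal]) auto
  have ZW: "faces (S - V) Z" using faces_mono[OF Z] by auto
  let ?A = "{j\<in>S - V. \<forall>v\<in>V. j \<prec> v}"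
  have fin: "finite ?A" using nc_finite[OF S] by simp
  have qS: "q \<in> S - V" and Vq: "\<And>v. v \<in> V \<Longrightarrow> v \<prec> q"
    and qj: "\<And>j. j \<in> S - V \<Longrightarrow> j = q \<or> q \<prec> j \<or> (\<forall>v\<in>V. j \<prec> v)"
    using q unfolding succ_of_def by auto
  have after: "v \<prec> j" if "j \<in> S - V" "j \<notin> ?A" "v \<in> V" for j v
    using qj[OF that(1)] that Vq[OF that(3)] chi_less_trans by auto
  show ?thesis
  proof (cases "?A = {}")
    case True
    have "cmin (S - V) = q" by (rule cminI[OF qS], frule qj) (use True in auto)
    moreover have "S - V \<noteq> {}" using qS by auto
    ultimately have 1: "inner_ext g \<pi> (S - V) (Z(q := lact q c (Z q))) = c * inner_ext g \<pi> (S - V) Z" for c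
      using balancedD(1)[OF Wb ZW] by simp
    have "V \<union> (S - V) = S" using V(2) by auto
    moreover have "v \<prec> j" if "v \<in> V" "j \<in> S - V" for v j
      using after[OF that(2) _ that(1)] True by auto
    ultimately have "inner_ext g \<pi> S Z = inner_ext g \<pi> V Z * inner_ext g \<pi> (S - V) Z"
      using tree_ext_Un[OF tree_ext_inner_ext V(1) W, of g Z] by simp
    then show ?thesis using 1 by simp
  next
    case False
    have "pred_of S V (cmax ?A)"
      using cmax(1)[OF fin False] cmax(2)[OF fin] after unfolding pred_of_def by auto
    note p = this
    note ad = pred_succ_adjacent[OF p q V(3)]
    have "inner_ext g \<pi> S Z = inner_ext g \<pi> (S - V) (Z(cmax ?A := ract (cmax ?A) (Z (cmax ?A)) (inner_ext g \<pi> V Z)))"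
      by (rule inner_ext_insert_pred[OF g bal S V p Z])
    also have "\<dots> = inner_ext g \<pi> (S - V) (Z(q := lact q (inner_ext g \<pi> V Z) (Z q)))"
      by (rule balancedD(3)[OF Wb ZW ad])
    finally show ?thesis .
  qed
qed

lemma outer_ext_insert_succ:
  assumes g: "\<And>U. local_on U (g U)" and k: "\<And>U. local_on U (k U)"
    and gb: "\<And>U. U \<in> \<pi> \<Longrightarrow> U \<subseteq> S \<Longrightarrow> balanced j U (g U)"
    and bal: "\<And>U. U \<in> \<pi> \<Longrightarrow> U \<subseteq> S \<Longrightarrow> balanced id U (k U)"
    and S: "nc_on \<pi> S" and V: "nc_on \<pi> V" "V \<subseteq> S" "V \<noteq> {}" and p: "pred_of S V p"
    and q: "succ_of S V q" and Z: "faces S Z" and tuple: "tail \<pi> S \<inter> V = {}"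
  shows "outer_ext g (inner_ext k) \<pi> S Z = outer_ext g (inner_ext k) \<pi> (S - V) (Z(q := lact q (inner_ext k \<pi> V Z) (Z q)))"
proof -
  have W: "nc_on \<pi> (S - V)" using nc_Diff[OF S V(1)] .
  have Wb: "balanced j (S - V) (outer_ext g (inner_ext k) \<pi> (S - V))"
    by (rule outer_ext_balanced[OF g k W gb bal]) auto
  have ZW: "faces (S - V) Z" using faces_mono[OF Z] by auto
  have "outer_ext g (inner_ext k) \<pi> S Z = outer_ext g (inner_ext k) \<pi> (S - V) (Z(p := ract p (Z p) (inner_ext k \<pi> V Z)))"
    by (rule outer_ext_insert_pred[OF g k bal S V p Z tuple])
  also have "\<dots> = outer_ext g (inner_ext k) \<pi> (S - V) (Z(q := lact q (inner_ext k \<pi> V Z) (Z q)))"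
    by (rule balancedD(3)[OF Wb ZW pred_succ_adjacent[OF p q V(3)]])
  finally show ?thesis .
qed

section \<open>Dependence on the blocks inside S, and one-block values\<close>

lemma block_of_cong:
  assumes "nc_on \<pi> S" "nc_on \<pi>' S" "\<And>U. U \<subseteq> S \<Longrightarrow> U \<noteq> {} \<Longrightarrow> U \<in> \<pi> \<Longrightarrow> U \<in> \<pi>'" "i \<in> S"
  shows "block_of \<pi>' i = block_of \<pi> i"
  using block_of[OF assms(1,4)] assms(3)[of "block_of \<pi> i"] block_of_eq[OF assms(2), of "block_of \<pi> i" i] by auto

lemma first_block_cong:
  assumes "nc_on \<pi> S" "nc_on \<pi>' S" "\<And>U. U \<subseteq> S \<Longrightarrow> U \<noteq> {} \<Longrightarrow> U \<in> \<pi> \<Longrightarrow> U \<in> \<pi>'" "S \<noteq> {}"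
  shows "first_block \<pi>' S = first_block \<pi> S" "first_end \<pi>' S = first_end \<pi> S" "tail \<pi>' S = tail \<pi> S"
proof -
  show "first_block \<pi>' S = first_block \<pi> S"
    unfolding first_block_def by (rule block_of_cong[OF assms(1-3)]) (use cmin(1)[OF nc_finite[OF assms(1)] assms(4)] in auto)
  then show "first_end \<pi>' S = first_end \<pi> S" "tail \<pi>' S = tail \<pi> S" by (simp_all add: first_end_def tail_def)
qed

text \<open>The recursion consults \<pi> only through its blocks inside \<open>S\<close>; inclusion
  of these in one direction suffices because both families cover \<open>S\<close> by disjoint
  blocks. This permits exchanging \<pi> for \<open>blocks \<pi> S\<close> when refinements of two
  parts of \<open>S\<close> are combined.\<close>

lemma part_cong_step:
  assumes T: "tree_ext g h \<Theta>" and S: "nc_on \<pi> S" "nc_on \<pi>' S"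
    and eq: "\<And>U. U \<subseteq> S \<Longrightarrow> U \<noteq> {} \<Longrightarrow> U \<in> \<pi> \<Longrightarrow> U \<in> \<pi>'"
    and h: "\<And>S'. card S' < card S \<Longrightarrow> S' \<subseteq> S \<Longrightarrow> nc_on \<pi> S' \<Longrightarrow> nc_on \<pi>' S' \<Longrightarrow> h \<pi> S' Z = h \<pi>' S' Z"
    and \<Theta>: "\<And>S'. card S' < card S \<Longrightarrow> S' \<subseteq> S \<Longrightarrow> nc_on \<pi> S' \<Longrightarrow> nc_on \<pi>' S' \<Longrightarrow> \<Theta> \<pi> S' Z = \<Theta> \<pi>' S' Z"
  shows "\<Theta> \<pi> S Z = \<Theta> \<pi>' S Z"
proof (cases "S = {}")
  case True
  then show ?thesis using T S by (simp add: tree_ext_empty)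
next
  case ne: False
  note c = first_block_cong[OF S eq ne]
  have G: "nc_on \<pi>' (gap S (first_block \<pi> S) i)" if "i \<in> first_block \<pi> S" for i
    using nc_gap[OF S(2) ne, of i] that c by simp
  have "fill h \<pi> S Z = fill h \<pi>' S Z"
    by (rule ext) (simp add: fill_def c h[OF gap_psub(2)[OF S(1) ne] gap_sub nc_gap[OF S(1) ne] G])
  moreover have "\<Theta> \<pi> (tail \<pi> S) Z = \<Theta> \<pi>' (tail \<pi> S) Z"
    by (rule \<Theta>[OF card_tail[OF S(1) ne] _ nc_tail[OF S(1) ne]])
      (use nc_tail[OF S(2) ne] c in \<open>auto simp: tail_def gap_def\<close>)
  ultimately show ?thesis unfolding tree_ext_step[OF T S(1) ne] tree_ext_step[OF T S(2) ne] by (simp add: c)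
qed

lemma inner_ext_part_cong:
  assumes "nc_on \<pi> S" "nc_on \<pi>' S" "\<And>U. U \<subseteq> S \<Longrightarrow> U \<noteq> {} \<Longrightarrow> U \<in> \<pi> \<Longrightarrow> U \<in> \<pi>'"
  shows "inner_ext g \<pi> S Z = inner_ext g \<pi>' S Z"
  using assms
proof (induction "card S" arbitrary: S rule: less_induct)
  case less
  have IH: "inner_ext g \<pi> S' Z = inner_ext g \<pi>' S' Z"
    if "card S' < card S" "S' \<subseteq> S" "nc_on \<pi> S'" "nc_on \<pi>' S'" for S'
    by (rule less.hyps[OF that(1,3,4)]) (use less.prems(3) that(2) in auto)
  show ?case by (rule part_cong_step[OF tree_ext_inner_ext less.prems IH IH])
qed

lemma nc_on_single: "S \<noteq> {} \<Longrightarrow> S \<subseteq> {..<length \<chi>} \<Longrightarrow> nc_on {S} S"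
  by (auto simp: nc_on_def nc_fam_def)

lemma tree_ext_one:
  assumes T: "tree_ext g h \<Theta>" and S: "nc_on \<pi> S" "S \<in> \<pi>" "S \<noteq> {}" and g: "local_on S (g S)"
    and h1: "\<And>Z. h \<pi> {} Z = 1"
  shows "\<Theta> \<pi> S Z = g S Z"
proof -
  have first_block: "first_block \<pi> S = S" unfolding first_block_def
    by (rule block_of_eq[OF S(1,2)]) (use cmin nc_finite S in auto)
  have gap: "gap S S i = {}" for i by (auto simp: gap_def)
  have "nc_on \<pi> {}" using nc_tail[OF S(1,3)] by (simp add: tail_def first_block gap)
  then have "\<Theta> \<pi> S Z = g S (fill h \<pi> S Z)"
    unfolding tree_ext_step[OF T S(1,3)] by (simp add: first_block tail_def gap tree_ext_empty[OF T])
  also have "\<dots> = g S Z"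
    using g by (rule local_onD) (simp add: fill_def first_block gap h1 action_simps)
  finally show ?thesis .
qed

lemma inner_ext_one:
  "nc_on \<pi> S \<Longrightarrow> S \<in> \<pi> \<Longrightarrow> S \<noteq> {} \<Longrightarrow> local_on S (g S) \<Longrightarrow> inner_ext g \<pi> S Z = g S Z"
  by (rule tree_ext_one[OF tree_ext_inner_ext]) (auto simp: inner_ext_empty)

lemma outer_ext_one:
  "nc_on \<pi> S \<Longrightarrow> S \<in> \<pi> \<Longrightarrow> S \<noteq> {} \<Longrightarrow> local_on S (g S) \<Longrightarrow> outer_ext g (inner_ext k) \<pi> S Z = g S Z"
  by (rule tree_ext_one[OF tree_ext_outer_ext]) (auto simp: inner_ext_empty)

section \<open>Moments\<close>

text \<open>The factors follow the natural order of the indices, the order of multiplication in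
  \<A>, and not \<prec>. Comparing the two orders is the content of the balance of moments.\<close>

definition time_prod :: "nat set \<Rightarrow> (nat \<Rightarrow> 'a) \<Rightarrow> 'a" where
  "time_prod S Z = prod_list (map Z (sorted_list_of_set S))"

lemma time_prod_Un:
  assumes "finite A" "finite B" "\<And>a b. a \<in> A \<Longrightarrow> b \<in> B \<Longrightarrow> a < b"
  shows "time_prod (A \<union> B) Z = time_prod A Z * time_prod B Z"
proof -
  let ?l = "sorted_list_of_set A @ sorted_list_of_set B"
  have "sorted ?l"
    unfolding sorted_append using assms(1,2) by (simp add: less_imp_le[OF assms(3)])
  moreover have "A \<inter> B = {}" using assms(3) by (meson disjoint_iff less_irrefl)
  then have "distinct ?l" using assms(1,2) by simp
  moreover have "set ?l = A \<union> B" using assms(1,2) by simp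
  ultimately have "sorted_list_of_set (A \<union> B) = ?l"
    by (metis sorted_list_of_set.idem_if_sorted_distinct)
  then show ?thesis by (simp add: time_prod_def)
qed

lemma time_prod_empty [simp]: "time_prod {} Z = 1" and time_prod_single [simp]: "time_prod {i} Z = Z i"
  by (simp_all add: time_prod_def)

lemma time_prod_cong: "finite S \<Longrightarrow> (\<And>i. i \<in> S \<Longrightarrow> Z i = Z' i) \<Longrightarrow> time_prod S Z = time_prod S Z'"
  unfolding time_prod_def by (intro arg_cong[of _ _ prod_list] map_cong) auto

lemma time_prod_local: "local_on S (time_prod S)"
proof (cases "finite S")
  case True
  then show ?thesis unfolding local_on_def by (intro allI impI time_prod_cong) auto
qed (simp add: local_on_def time_prod_def)

lemma time_prod_split: "finite S \<Longrightarrow> time_prod S Z = time_prod {i\<in>S. i < t} Z * time_prod {i\<in>S. t \<le> i} Z"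
proof -
  assume "finite S"
  then have "time_prod ({i\<in>S. i < t} \<union> {i\<in>S. t \<le> i}) Z = time_prod {i\<in>S. i < t} Z * time_prod {i\<in>S. t \<le> i} Z"
    by (intro time_prod_Un) auto
  moreover have "{i\<in>S. i < t} \<union> {i\<in>S. t \<le> i} = S" by auto
  ultimately show ?thesis by simp
qed

lemma time_prod_split_at:
  assumes "finite S" "t \<in> S"
  shows "time_prod S Z = time_prod {i\<in>S. i < t} Z * (Z t * time_prod {i\<in>S. t < i} Z)"
proof -
  have "time_prod ({t} \<union> {i\<in>S. t < i}) Z = time_prod {t} Z * time_prod {i\<in>S. t < i} Z"
    using assms by (intro time_prod_Un) auto
  moreover have "{t} \<union> {i\<in>S. t < i} = {i\<in>S. t \<le> i}" using assms(2) by auto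
  ultimately show ?thesis using time_prod_split[OF assms(1), of Z t] by simp
qed

lemma time_prod_upd:
  assumes "finite S" "t \<in> S"
  shows "time_prod S (Z(t := v)) = time_prod {i\<in>S. i < t} Z * (v * time_prod {i\<in>S. t < i} Z)"
proof -
  have "time_prod {i\<in>S. i < t} (Z(t := v)) = time_prod {i\<in>S. i < t} Z" "time_prod {i\<in>S. t < i} (Z(t := v)) = time_prod {i\<in>S. t < i} Z"
    by (rule time_prod_cong; use assms in auto)+
  then show ?thesis using time_prod_split_at[OF assms, of "Z(t := v)"] by simp
qed

lemma prod_list_commute:
  "(\<And>x. x \<in> set xs \<Longrightarrow> c * x = x * (c :: 'a)) \<Longrightarrow> c * prod_list xs = prod_list xs * c"
proof (induction xs)
  case (Cons x xs)
  have "c * (x * prod_list xs) = x * (c * prod_list xs)" using Cons.prems[of x] by (simp flip: mult.assoc)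
  also have "\<dots> = x * (prod_list xs * c)" using Cons by simp
  finally show ?case by (simp add: mult.assoc)
qed simp

lemma time_prod_commute: "finite S \<Longrightarrow> (\<And>i. i \<in> S \<Longrightarrow> c * Z i = Z i * c) \<Longrightarrow> c * time_prod S Z = time_prod S Z * c"
  unfolding time_prod_def by (rule prod_list_commute) auto

text \<open>The position \<open>t\<close> need not belong to \<open>S\<close>: placing
  \<open>c\<close> in front of the entry at \<open>t\<close> is position \<open>t\<close>, placing
  it behind is \<open>Suc t\<close>, while 0 and any bound beyond \<open>S\<close> are the two ends.
  Moving an operator becomes a comparison of positions.\<close>

definition time_prod_ins :: "nat set \<Rightarrow> nat \<Rightarrow> 'a \<Rightarrow> (nat \<Rightarrow> 'a) \<Rightarrow> 'a" where
  "time_prod_ins S t c Z = time_prod {i\<in>S. i < t} Z * (c * time_prod {i\<in>S. t \<le> i} Z)"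

lemma time_prod_ins_move:
  assumes "finite S" "t \<le> t'" "\<And>i. i \<in> S \<Longrightarrow> t \<le> i \<Longrightarrow> i < t' \<Longrightarrow> c * Z i = Z i * c"
  shows "time_prod_ins S t c Z = time_prod_ins S t' c Z"
proof -
  let ?M = "{i\<in>S. t \<le> i \<and> i < t'}"
  have "time_prod ({i\<in>S. i < t} \<union> ?M) Z = time_prod {i\<in>S. i < t} Z * time_prod ?M Z"
    "time_prod (?M \<union> {i\<in>S. t' \<le> i}) Z = time_prod ?M Z * time_prod {i\<in>S. t' \<le> i} Z"
    using assms(1) by (auto intro: time_prod_Un)
  moreover have "{i\<in>S. i < t} \<union> ?M = {i\<in>S. i < t'}" "?M \<union> {i\<in>S. t' \<le> i} = {i\<in>S. t \<le> i}"
    using assms(2) by auto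
  ultimately have *: "time_prod {i\<in>S. i < t'} Z = time_prod {i\<in>S. i < t} Z * time_prod ?M Z"
    "time_prod {i\<in>S. t \<le> i} Z = time_prod ?M Z * time_prod {i\<in>S. t' \<le> i} Z" by simp_all
  have "c * time_prod ?M Z = time_prod ?M Z * c" using assms by (intro time_prod_commute) auto
  then have "c * (time_prod ?M Z * x) = time_prod ?M Z * (c * x)" for x by (simp flip: mult.assoc)
  then show ?thesis by (simp add: time_prod_ins_def * mult.assoc)
qed

lemma time_prod_ins_start: "(\<And>i. i \<in> S \<Longrightarrow> t \<le> i) \<Longrightarrow> time_prod_ins S t c Z = c * time_prod S Z"
proof -
  assume "\<And>i. i \<in> S \<Longrightarrow> t \<le> i"
  then have "{i\<in>S. i < t} = {}" "{i\<in>S. t \<le> i} = S" by force+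
  then show ?thesis unfolding time_prod_ins_def by (metis time_prod_empty mult_1)
qed

lemma time_prod_ins_end: "(\<And>i. i \<in> S \<Longrightarrow> i < t) \<Longrightarrow> time_prod_ins S t c Z = time_prod S Z * c"
proof -
  assume "\<And>i. i \<in> S \<Longrightarrow> i < t"
  then have "{i\<in>S. i < t} = S" "{i\<in>S. t \<le> i} = {}" by force+
  then show ?thesis unfolding time_prod_ins_def by (metis time_prod_empty mult_1_right)
qed

lemma time_prod_upd_left:
  assumes "finite S" "t \<in> S"
  shows "time_prod S (Z(t := c * Z t)) = time_prod_ins S t c Z"
proof -
  let ?A = "{i\<in>S. t \<le> i}"
  have "finite ?A" "t \<in> ?A" using assms by auto
  note 1 = time_prod_split_at[OF this, of Z]
  have 2: "{i\<in>?A. i < t} = {}" "{i\<in>?A. t < i} = {i\<in>S. t < i}" by auto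
  show ?thesis
    unfolding time_prod_upd[OF assms] time_prod_ins_def 1 2 time_prod_empty by (simp only: mult.assoc mult_1_left)
qed

lemma time_prod_upd_right:
  assumes "finite S" "t \<in> S"
  shows "time_prod S (Z(t := Z t * c)) = time_prod_ins S (Suc t) c Z"
proof -
  let ?A = "{i\<in>S. i < Suc t}"
  have "finite ?A" "t \<in> ?A" using assms by auto
  note 1 = time_prod_split_at[OF this, of Z]
  have 2: "{i\<in>?A. t < i} = {}" "{i\<in>?A. i < t} = {i\<in>S. i < t}" "{i\<in>S. t < i} = {i\<in>S. Suc t \<le> i}" by auto
  show ?thesis
    unfolding time_prod_upd[OF assms] time_prod_ins_def 1 2 time_prod_empty by (simp only: mult.assoc mult_1_right)
qed

lemma lt_iff: "i \<prec> j \<longleftrightarrow> (if \<chi> ! i = Lft then \<chi> ! j = Lft \<longrightarrow> i < j else \<chi> ! j = Rgt \<and> j < i)"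
  by (cases "\<chi> ! i"; cases "\<chi> ! j") (auto simp: chi_less_def)

lemma side_neq: "s \<noteq> Lft \<longleftrightarrow> s = Rgt" "s \<noteq> Rgt \<longleftrightarrow> s = Lft"
  by (cases s; simp)+

lemma face_L: "z \<in> face \<epsilon> Rgt \<Longrightarrow> lop b * z = z * lop b"
  and face_R: "z \<in> face \<epsilon> Lft \<Longrightarrow> rop b * z = z * rop b"
  by (simp_all add: face_def)

lemma time_prod_ins_lop_move:
  assumes "finite S" "faces S Z" "t \<le> t'" "\<And>i. i \<in> S \<Longrightarrow> t \<le> i \<Longrightarrow> i < t' \<Longrightarrow> \<chi> ! i = Rgt"
  shows "time_prod_ins S t (lop b) Z = time_prod_ins S t' (lop b) Z"
  using assms(2,4) by (intro time_prod_ins_move[OF assms(1,3)]) (use face_L facesD[OF assms(2)] in fastforce)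

lemma time_prod_ins_rop_move:
  assumes "finite S" "faces S Z" "t \<le> t'" "\<And>i. i \<in> S \<Longrightarrow> t \<le> i \<Longrightarrow> i < t' \<Longrightarrow> \<chi> ! i = Lft"
  shows "time_prod_ins S t (rop b) Z = time_prod_ins S t' (rop b) Z"
  using assms(2,4) by (intro time_prod_ins_move[OF assms(1,3)]) (use face_R facesD[OF assms(2)] in fastforce)

lemma time_prod_ract:
  assumes "finite S" "p \<in> S"
  shows "time_prod S (Z(p := ract p (Z p) b)) = (if \<chi> ! p = Lft then time_prod_ins S (Suc p) (lop b) Z else time_prod_ins S p (rop b) Z)"
  using time_prod_upd_right[OF assms] time_prod_upd_left[OF assms] by (cases "\<chi> ! p") (auto simp: ract_def)

lemma time_prod_lact:
  assumes "finite S" "p \<in> S"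
  shows "time_prod S (Z(p := lact p b (Z p))) = (if \<chi> ! p = Lft then time_prod_ins S p (lop b) Z else time_prod_ins S (Suc p) (rop b) Z)"
  using time_prod_upd_right[OF assms] time_prod_upd_left[OF assms] by (cases "\<chi> ! p") (auto simp: lact_def)

text \<open>An operator passes freely through entries of the other side. Neighbours on the same side
  have only entries of the other side between them in time, and the \<prec>-first index, if on the
  left, has only right entries before it; likewise the \<prec>-last one on the right. What remains
  crosses between the sides at the end of the product, where \<open>right\<close> trades a left
  operator for a right one.\<close>

lemma time_prod_balanced:
  fixes G :: "'a \<Rightarrow> 'c::complex_unital_algebra"
  assumes bim: "\<And>b c z. G (lop b * rop c * z) = j b * G z * j c" and j1: "j 1 = 1"
    and right: "\<And>b z. G (z * lop b) = G (z * rop b)" and S: "finite S"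
  shows "balanced j S (\<lambda>Z. G (time_prod S Z))"
proof -
  have GL: "G (lop b * z) = j b * G z" and GR: "G (rop b * z) = G z * j b" for b z
    using bim[of b 1 z] bim[of 1 b z] by (simp_all add: lop_rop_simps j1)
  show ?thesis
    unfolding balanced_def
  proof (intro allI impI conjI ballI)
    fix Z b assume Z: "faces S Z"
    note Lm = time_prod_ins_lop_move[OF S Z] and Rm = time_prod_ins_rop_move[OF S Z]
    {
      assume ne: "S \<noteq> {}"
      define p where "p = cmin S"
      have p: "p \<in> S" "\<And>i. i \<in> S \<Longrightarrow> i = p \<or> p \<prec> i" using cmin[OF S] ne by (auto simp: p_def)
      show "G (time_prod S (Z(cmin S := lact (cmin S) b (Z (cmin S))))) = j b * G (time_prod S Z)"
        unfolding p_def[symmetric]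
      proof (cases "\<chi> ! p")
        case Lft
        have "time_prod_ins S 0 (lop b) Z = time_prod_ins S p (lop b) Z"
        proof (rule Lm)
          fix i assume "i \<in> S" "i < p"
          then show "\<chi> ! i = Rgt" using p(2)[of i] Lft by (cases "\<chi> ! i") (auto simp: lt_iff)
        qed simp
        then show "G (time_prod S (Z(p := lact p b (Z p)))) = j b * G (time_prod S Z)"
          using Lft by (simp add: time_prod_lact[OF S p(1)] time_prod_ins_start GL flip: GL)
      next
        case Rgt
        \<comment> \<open>If the \<prec>-first index is on the right, there are no left indices and
          it is the latest one. Its operator thus stands at the end of the product, where
          \<open>right\<close> turns it into a left operator, and this commutes with every
          entry.\<close>
        have R: "i \<le> p \<and> \<chi> ! i = Rgt" if "i \<in> S" for i using p(2)[OF that] Rgt by (auto simp: lt_iff)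
        have "time_prod_ins S 0 (lop b) Z = time_prod_ins S (Suc p) (lop b) Z"
          by (rule Lm) (use R in auto)
        moreover have "time_prod_ins S (Suc p) c Z = time_prod S Z * c" for c by (rule time_prod_ins_end) (use R in \<open>auto simp: less_Suc_eq_le\<close>)
        moreover have "time_prod_ins S 0 (lop b) Z = lop b * time_prod S Z" by (rule time_prod_ins_start) simp
        ultimately show "G (time_prod S (Z(p := lact p b (Z p)))) = j b * G (time_prod S Z)"
          using Rgt by (simp add: time_prod_lact[OF S p(1)] flip: GL right)
      qed
    next
      assume ne: "S \<noteq> {}"
      define p where "p = cmax S"
      have p: "p \<in> S" "\<And>i. i \<in> S \<Longrightarrow> i = p \<or> i \<prec> p" using cmax[OF S] ne by (auto simp: p_def)
      show "G (time_prod S (Z(cmax S := ract (cmax S) (Z (cmax S)) b))) = G (time_prod S Z) * j b"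
        unfolding p_def[symmetric]
      proof (cases "\<chi> ! p")
        case Rgt
        have "time_prod_ins S 0 (rop b) Z = time_prod_ins S p (rop b) Z"
        proof (rule Rm)
          fix i assume "i \<in> S" "i < p"
          then show "\<chi> ! i = Lft" using p(2)[of i] Rgt by (cases "\<chi> ! i") (auto simp: lt_iff)
        qed simp
        then show "G (time_prod S (Z(p := ract p (Z p) b))) = G (time_prod S Z) * j b"
          using Rgt by (simp add: time_prod_ract[OF S p(1)] time_prod_ins_start GR flip: GR)
      next
        case Lft
        have R: "i \<le> p \<and> \<chi> ! i = Lft" if "i \<in> S" for i using p(2)[OF that] Lft by (auto simp: lt_iff split: if_splits)
        have "time_prod_ins S 0 (rop b) Z = time_prod_ins S (Suc p) (rop b) Z"
          by (rule Rm) (use R in auto)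
        moreover have "time_prod_ins S (Suc p) c Z = time_prod S Z * c" for c by (rule time_prod_ins_end) (use R in \<open>auto simp: less_Suc_eq_le\<close>)
        moreover have "time_prod_ins S 0 (rop b) Z = rop b * time_prod S Z" by (rule time_prod_ins_start) simp
        ultimately show "G (time_prod S (Z(p := ract p (Z p) b))) = G (time_prod S Z) * j b"
          using Lft right by (simp add: time_prod_ract[OF S p(1)] flip: GR)
      qed
    next
      fix p q assume p: "p \<in> S" and q: "q \<in> S" and pq: "p \<prec> q \<and> (\<forall>i\<in>S. \<not> (p \<prec> i \<and> i \<prec> q))"
      have lt: "p \<prec> q" and adj: "\<And>i. i \<in> S \<Longrightarrow> p \<prec> i \<Longrightarrow> i \<prec> q \<Longrightarrow> False" using pq by auto
      consider "\<chi> ! p = Lft" "\<chi> ! q = Lft" "p < q" | "\<chi> ! p = Rgt" "\<chi> ! q = Rgt" "q < p"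
        | "\<chi> ! p = Lft" "\<chi> ! q = Rgt"
        using lt by (cases "\<chi> ! p"; cases "\<chi> ! q") (auto simp: lt_iff)
      then show "G (time_prod S (Z(p := ract p (Z p) b))) = G (time_prod S (Z(q := lact q b (Z q))))"
      proof cases
        case 1
        have "time_prod_ins S (Suc p) (lop b) Z = time_prod_ins S q (lop b) Z"
        proof (rule Lm)
          fix i assume "i \<in> S" "Suc p \<le> i" "i < q"
          then show "\<chi> ! i = Rgt" using adj[of i] 1 by (cases "\<chi> ! i") (auto simp: lt_iff)
        qed (use 1 in simp)
        then show ?thesis using 1 by (simp add: time_prod_ract[OF S p] time_prod_lact[OF S q])
      next
        case 2
        have "time_prod_ins S (Suc q) (rop b) Z = time_prod_ins S p (rop b) Z"
        proof (rule Rm)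
          fix i assume "i \<in> S" "Suc q \<le> i" "i < p"
          then show "\<chi> ! i = Lft" using adj[of i] 2 by (cases "\<chi> ! i") (auto simp: lt_iff)
        qed (use 2 in simp)
        then show ?thesis using 2 by (simp add: time_prod_ract[OF S p] time_prod_lact[OF S q])
      next
        case 3
        \<comment> \<open>\<open>p\<close> is the latest left index and \<open>q\<close> the latest
          right one. Both operators move to a position \<open>t\<close> beyond \<open>S\<close>,
          where they may be exchanged.\<close>
        obtain t where t: "\<And>i. i \<in> S \<Longrightarrow> i < t" using S by (metis finite_nat_set_iff_bounded)
        have 0: "time_prod_ins S t c Z = time_prod S Z * c" for c by (rule time_prod_ins_end[OF t])
        have "time_prod_ins S (Suc p) (lop b) Z = time_prod_ins S t (lop b) Z"
        proof (rule Lm)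
          show "Suc p \<le> t" using t[OF p] by simp
          fix i assume "i \<in> S" "Suc p \<le> i"
          then show "\<chi> ! i = Rgt" using adj[of i] 3 by (cases "\<chi> ! i") (auto simp: lt_iff)
        qed
        moreover have "time_prod_ins S (Suc q) (rop b) Z = time_prod_ins S t (rop b) Z"
        proof (rule Rm)
          show "Suc q \<le> t" using t[OF q] by simp
          fix i assume "i \<in> S" "Suc q \<le> i"
          then show "\<chi> ! i = Lft" using adj[of i] 3 by (cases "\<chi> ! i") (auto simp: lt_iff)
        qed
        ultimately show ?thesis using 3 right by (simp add: time_prod_ract[OF S p] time_prod_lact[OF S q] 0)
      qed
    }
  qed
qed

lemma time_prod_linear:
  fixes G :: "'a \<Rightarrow> 'c::complex_unital_algebra"
  assumes "complex_linear G" "finite S"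
  shows "linear_on S (\<lambda>Z. G (time_prod S Z))"
  using assms(1) unfolding linear_on_def
  by (auto simp: time_prod_upd[OF assms(2)] Vector_Spaces.linear_iff distrib_left distrib_right
    mult_scaleC_left mult_scaleC_right)

abbreviation moment_E :: "nat set \<Rightarrow> (nat \<Rightarrow> 'a) \<Rightarrow> 'b" where "moment_E S Z \<equiv> E (time_prod S Z)"
abbreviation moment_F :: "nat set \<Rightarrow> (nat \<Rightarrow> 'a) \<Rightarrow> 'd" where "moment_F S Z \<equiv> F (time_prod S Z)"

lemma moment_E_balanced: "finite S \<Longrightarrow> balanced id S (moment_E S)"
  by (rule time_prod_balanced) (auto simp: E_bimodule E_right)

lemma incl_one: "\<iota> 1 = 1" using incl_hom by (simp add: unital_algebra_hom_def)

lemma moment_F_balanced: "finite S \<Longrightarrow> balanced \<iota> S (moment_F S)"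
  by (rule time_prod_balanced) (auto simp: F_bimodule F_right incl_one)

lemma moment_E_local: "local_on S (moment_E S)" and moment_F_local: "local_on S (moment_F S)"
  unfolding local_on_def by (intro allI impI arg_cong[of _ _ E] arg_cong[of _ _ F] local_onD[OF time_prod_local]; simp)+

lemma moment_E_linear: "finite S \<Longrightarrow> linear_on S (moment_E S)" and moment_F_linear: "finite S \<Longrightarrow> linear_on S (moment_F S)"
  using time_prod_linear E_linear F_linear by auto

section \<open>Subsets of the index set and the relabelled lists of the definitions\<close>

abbreviation sides :: "nat set \<Rightarrow> side list" where "sides S \<equiv> nths \<chi> S"
abbreviation tuple :: "(nat \<Rightarrow> 'a) \<Rightarrow> nat set \<Rightarrow> 'a list" where "tuple Z S \<equiv> nths (map Z [0..<length \<chi>]) S"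

text \<open>\<open>nc_on\<close> does not exclude the empty set from \<pi>, whereas
  \<open>restrict_part\<close> drops it; hence the nonemptiness.\<close>

definition blocks :: "nat set set \<Rightarrow> nat set \<Rightarrow> nat set set" where
  "blocks \<pi> S = {U \<in> \<pi>. U \<subseteq> S \<and> U \<noteq> {}}"

context
  fixes S assumes S: "S \<subseteq> {..<length \<chi>}"
begin

lemma finite_dom: "finite S" using S finite_subset by blast

lemma tuple_eq: "tuple Z S = map Z (sorted_list_of_set S)"
proof -
  have "nths [0..<length \<chi>] S = sorted_list_of_set S"
  proof (rule sorted_distinct_set_unique)
    show "sorted (nths [0..<length \<chi>] S)" by (rule sorted_nths) simp
    show "set (nths [0..<length \<chi>] S) = set (sorted_list_of_set S)"
    proof (intro set_eqI iffI)
      fix x assume "x \<in> set (sorted_list_of_set S)"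
      then have "x \<in> S" "x < length \<chi>" using S finite_dom by auto
      then show "x \<in> set (nths [0..<length \<chi>] S)" by (auto simp: set_nths intro!: exI[of _ x])
    qed (use finite_dom in \<open>auto simp: set_nths\<close>)
  qed auto
  then show ?thesis by (simp add: nths_map)
qed

lemma prod_tuple: "prod_list (tuple Z S) = time_prod S Z"
  by (simp add: tuple_eq time_prod_def)

lemma length_sides: "length (sides S) = card S" and length_tuple: "length (tuple Z S) = card S"
  using S by (simp_all add: length_nths_card)

lemma relabel_img: "relabel S ` S = {..<card S}"
  using relabel_image[OF S] length_sides by simp

lemma tuple_upd: "k \<in> S \<Longrightarrow> (tuple Z S)[relabel S k := v] = tuple (Z(k := v)) S"
proof -
  assume k: "k \<in> S"
  have "(map Z [0..<length \<chi>])[k := v] = map (Z(k := v)) [0..<length \<chi>]"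
    by (rule nth_equalityI) (auto simp: nth_list_update)
  then show ?thesis using nths_update[of S "map Z [0..<length \<chi>]" k v] S k by simp
qed

lemma tuple_nth: "k \<in> S \<Longrightarrow> tuple Z S ! relabel S k = Z k" and sides_nth: "k \<in> S \<Longrightarrow> sides S ! relabel S k = \<chi> ! k"
proof -
  assume k: "k \<in> S"
  then have "k < length \<chi>" using S by auto
  then show "tuple Z S ! relabel S k = Z k" "sides S ! relabel S k = \<chi> ! k" using k by (simp_all add: nth_nths)
qed

lemma diff_relabel: "T \<subseteq> S \<Longrightarrow> {..<length (sides S)} - relabel S ` T = relabel S ` (S - T)"
  using inj_on_image_set_diff[OF relabel_inj_on[of S], of S T] by (simp add: relabel_img length_sides)

lemma chi_less_relabel: "i \<in> S \<Longrightarrow> j \<in> S \<Longrightarrow> chi_less (sides S) (relabel S i) (relabel S j) \<longleftrightarrow> i \<prec> j"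
  using chi_less_nths[OF S] by simp

lemma chi_min_relabel: "T \<subseteq> S \<Longrightarrow> T \<noteq> {} \<Longrightarrow> chi_min (sides S) (relabel S ` T) = relabel S (cmin T)"
proof -
  assume T: "T \<subseteq> S" "T \<noteq> {}"
  have fin: "finite T" using T finite_dom finite_subset by blast
  have m: "cmin T \<in> T" using cmin(1)[OF fin T(2)] .
  show ?thesis
  proof (rule chi_min_unique)
    show "relabel S (cmin T) \<in> relabel S ` T" using m by simp
    show "\<forall>j\<in>relabel S ` T. j = relabel S (cmin T) \<or> chi_less (sides S) (relabel S (cmin T)) j"
    proof
      fix j assume "j \<in> relabel S ` T"
      then obtain i where i: "i \<in> T" "j = relabel S i" by auto
      then show "j = relabel S (cmin T) \<or> chi_less (sides S) (relabel S (cmin T)) j"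
        using cmin(2)[OF fin i(1)] chi_less_relabel[of "cmin T" i] m T(1) by auto
    qed
  qed
qed

lemma chi_max_relabel: "T \<subseteq> S \<Longrightarrow> T \<noteq> {} \<Longrightarrow> chi_max (sides S) (relabel S ` T) = relabel S (cmax T)"
proof -
  assume T: "T \<subseteq> S" "T \<noteq> {}"
  have fin: "finite T" using T finite_dom finite_subset by blast
  have m: "cmax T \<in> T" using cmax(1)[OF fin T(2)] .
  show ?thesis
  proof (rule chi_max_unique)
    show "relabel S (cmax T) \<in> relabel S ` T" using m by simp
    show "\<forall>j\<in>relabel S ` T. j = relabel S (cmax T) \<or> chi_less (sides S) j (relabel S (cmax T))"
    proof
      fix j assume "j \<in> relabel S ` T"
      then obtain i where i: "i \<in> T" "j = relabel S i" by auto
      then show "j = relabel S (cmax T) \<or> chi_less (sides S) j (relabel S (cmax T))"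
        using cmax(2)[OF fin i(1)] chi_less_relabel[of i "cmax T"] m T(1) by auto
    qed
  qed
qed

lemma relabel_img_eq_iff: "T \<subseteq> S \<Longrightarrow> T' \<subseteq> S \<Longrightarrow> relabel S ` T = relabel S ` T' \<longleftrightarrow> T = T'"
  by (rule inj_on_image_eq_iff[OF relabel_inj_on])

lemma relabel_mem_iff: "T \<subseteq> S \<Longrightarrow> i \<in> S \<Longrightarrow> relabel S i \<in> relabel S ` T \<longleftrightarrow> i \<in> T"
  using inj_on_image_mem_iff[OF relabel_inj_on[of S]] by blast

end

lemma restrict_part_blocks: "nc_on \<pi> S \<Longrightarrow> restrict_part S \<pi> = (\<lambda>U. relabel S ` U) ` blocks \<pi> S"
proof (intro set_eqI iffI)
  fix X assume S: "nc_on \<pi> S" and "X \<in> restrict_part S \<pi>"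
  then obtain U where U: "U \<in> \<pi>" "X = relabel S ` (U \<inter> S)" "U \<inter> S \<noteq> {}" by (auto simp: restrict_part_def)
  then obtain i where "i \<in> U" "i \<in> S" by auto
  then have "U \<subseteq> S" using nc_block_sub[OF S U(1)] by blast
  then show "X \<in> (\<lambda>U. relabel S ` U) ` blocks \<pi> S" using U by (auto simp: blocks_def Int_absorb2)
next
  fix X assume "X \<in> (\<lambda>U. relabel S ` U) ` blocks \<pi> S"
  then obtain U where U: "U \<in> \<pi>" "U \<subseteq> S" "U \<noteq> {}" "X = relabel S ` U" by (auto simp: blocks_def)
  then have "X = relabel S ` (U \<inter> S)" by (simp add: Int_absorb2)
  then show "X \<in> restrict_part S \<pi>" using U by (auto simp: restrict_part_def)
qed

lemma restrict_part_nc_BNC: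
  assumes S: "nc_on \<pi> S"
  shows "restrict_part S \<pi> \<in> BNC (sides S)"
proof -
  note d = nc_dom[OF S]
  have "\<Union>(restrict_part S \<pi>) = relabel S ` S"
  proof -
    have "\<Union>(blocks \<pi> S) = S" using nc_ex[OF S] unfolding blocks_def by fastforce
    then show ?thesis unfolding restrict_part_blocks[OF S] by (metis image_Union)
  qed
  then have 1: "\<Union>(restrict_part S \<pi>) = {..<length (sides S)}" by (simp add: relabel_img[OF d] length_sides[OF d])
  have 2: "X = Y" if XY: "X \<in> restrict_part S \<pi>" "Y \<in> restrict_part S \<pi>" "i \<in> X" "i \<in> Y" for X Y i
  proof -
    obtain U where U: "U \<in> \<pi>" "U \<subseteq> S" "X = relabel S ` U" using XY(1) unfolding restrict_part_blocks[OF S] blocks_def by auto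
    obtain W where W: "W \<in> \<pi>" "W \<subseteq> S" "Y = relabel S ` W" using XY(2) unfolding restrict_part_blocks[OF S] blocks_def by auto
    obtain k where k: "k \<in> U" "i = relabel S k" using XY U by auto
    then have "k \<in> W" using XY(4) W U relabel_mem_iff[OF d W(2), of k] by auto
    then show ?thesis using nc_disj[OF S U(1) W(1) k(1)] U W by simp
  qed
  have 3: "X = Y" if XY: "X \<in> restrict_part S \<pi>" "Y \<in> restrict_part S \<pi>" "a \<in> X" "b \<in> Y" "c \<in> X" "e \<in> Y"
    "chi_less (sides S) a b" "chi_less (sides S) b c" "chi_less (sides S) c e" for X Y a b c e
  proof -
    obtain U where U: "U \<in> \<pi>" "U \<subseteq> S" "X = relabel S ` U" using XY(1) unfolding restrict_part_blocks[OF S] blocks_def by auto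
    obtain W where W: "W \<in> \<pi>" "W \<subseteq> S" "Y = relabel S ` W" using XY(2) unfolding restrict_part_blocks[OF S] blocks_def by auto
    obtain a' c' where ac: "a' \<in> U" "a = relabel S a'" "c' \<in> U" "c = relabel S c'" using XY U by auto
    obtain b' e' where be: "b' \<in> W" "b = relabel S b'" "e' \<in> W" "e = relabel S e'" using XY W by auto
    have "a' \<prec> b'" "b' \<prec> c'" "c' \<prec> e'"
      using XY(7-9) ac be U(2) W(2) by (auto simp: chi_less_relabel[OF d] subset_iff)
    then show ?thesis using nc_cross[OF S U(1) W(1) ac(1) be(1) ac(3) be(3)] U W by simp
  qed
  have "disjoint (restrict_part S \<pi>)" unfolding disjoint_def using 2 by blast
  moreover have "{} \<notin> restrict_part S \<pi>" by (auto simp: restrict_part_def)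
  ultimately show ?thesis
    unfolding BNC_def partition_on_def using 1 3 by (intro CollectI conjI ballI impI) auto
qed


section \<open>The recursion for the moments without relabelling\<close>

lemma nc_fin_ne: "nc_on \<pi> S \<Longrightarrow> U \<in> blocks \<pi> S \<Longrightarrow> finite U \<and> U \<noteq> {} \<and> U \<subseteq> S \<and> U \<in> \<pi>"
  using nc_finite finite_subset unfolding blocks_def by blast

lemma nc_block: "nc_on \<pi> S \<Longrightarrow> U \<in> \<pi> \<Longrightarrow> U \<subseteq> S \<Longrightarrow> nc_on \<pi> U"
  by (rule nc_sub) auto

definition is_last :: "nat set set \<Rightarrow> nat set \<Rightarrow> nat set \<Rightarrow> bool" where
  "is_last \<pi> S V \<longleftrightarrow> V \<in> blocks \<pi> S \<and> (\<forall>U\<in>blocks \<pi> S. Min U \<le> Min V)"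

lemma ex_is_last:
  assumes "nc_on \<pi> S" "S \<noteq> {}"
  obtains V where "is_last \<pi> S V"
proof -
  have "blocks \<pi> S \<subseteq> Pow S" by (auto simp: blocks_def)
  then have fin: "finite (blocks \<pi> S)" using nc_finite[OF assms(1)] finite_subset by blast
  obtain i where "i \<in> S" using assms(2) by auto
  then have ne: "blocks \<pi> S \<noteq> {}" using nc_ex[OF assms(1), of i] by (auto simp: blocks_def)
  define M where "M = Max (Min ` blocks \<pi> S)"
  have "M \<in> Min ` blocks \<pi> S" unfolding M_def by (rule Max_in) (use fin ne in auto)
  then obtain V where V: "V \<in> blocks \<pi> S" "M = Min V" by auto
  have "Min U \<le> Min V" if "U \<in> blocks \<pi> S" for U
    unfolding V(2)[symmetric] M_def by (rule Max_ge) (use fin that in auto)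
  then show ?thesis using V(1) by (intro that) (auto simp: is_last_def)
qed

text \<open>Computes both \<^const>\<open>last_block\<close> and \<^const>\<open>last_inner_block\<close>.\<close>

lemma arg_max_Min_restrict_part:
  assumes S: "nc_on \<pi> S" and V: "V \<in> blocks \<pi> S" "P (relabel S ` V)"
    and max: "\<And>U. U \<in> blocks \<pi> S \<Longrightarrow> P (relabel S ` U) \<Longrightarrow> Min U \<le> Min V"
  shows "(ARG_MAX Min X. X \<in> restrict_part S \<pi> \<and> P X) = relabel S ` V"
proof -
  let ?A = "ARG_MAX Min X. X \<in> restrict_part S \<pi> \<and> P X"
  note d = nc_dom[OF S]
  have V': "relabel S ` V \<in> restrict_part S \<pi>" using V(1) by (simp add: restrict_part_blocks[OF S])
  have A: "?A \<in> restrict_part S \<pi>" "P ?A" using BNC_arg_max_Min[OF restrict_part_nc_BNC[OF S] V', of P] V(2) by auto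
  then obtain U where U: "U \<in> blocks \<pi> S" "?A = relabel S ` U" unfolding restrict_part_blocks[OF S] by auto
  note fU = nc_fin_ne[OF S U(1)] and fV = nc_fin_ne[OF S V(1)]
  have bound: "\<forall>X. X \<in> restrict_part S \<pi> \<and> P X \<longrightarrow> Min X < card S"
  proof (intro allI impI)
    fix X assume "X \<in> restrict_part S \<pi> \<and> P X"
    then obtain W where W: "W \<in> blocks \<pi> S" "X = relabel S ` W" unfolding restrict_part_blocks[OF S] by auto
    note f = nc_fin_ne[OF S W(1)]
    have "Min W \<in> S" using f Min_in[of W] by blast
    then have "relabel S (Min W) < card S" using relabel_img[OF d] by auto
    then show "Min X < card S" using f W Min_relabel[of W S] by auto
  qed
  have "Min (relabel S ` V) \<le> Min ?A"
    by (rule arg_max_nat_le[OF _ bound]) (use V' V(2) in simp)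
  then have "relabel S (Min V) \<le> relabel S (Min U)" using U fU fV Min_relabel by metis
  moreover have mUV: "Min U \<in> U" "Min V \<in> V" using fU fV by auto
  moreover have "Min U \<in> S" using mUV fU by blast
  ultimately have "\<not> Min U < Min V" using relabel_less[of "Min U" S "Min V"] by linarith
  then have "Min U = Min V" using max[OF U(1)] A(2) U(2) by auto
  then have "U = V" using nc_disj[OF S, of U V "Min U"] fU fV mUV by auto
  then show ?thesis using U by simp
qed

definition moment :: "nat set set \<Rightarrow> nat set \<Rightarrow> (nat \<Rightarrow> 'a) \<Rightarrow> 'b" where
  "moment \<pi> S Z = bi_moment \<epsilon> E (sides S) (restrict_part S \<pi>) (tuple Z S)"

lemma restrict_part_one_iff:
  assumes S: "nc_on \<pi> S" "S \<noteq> {}"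
  shows "restrict_part S \<pi> = one_chi (sides S) \<longleftrightarrow> S \<in> \<pi>"
proof -
  note d = nc_dom[OF S(1)]
  have one: "one_chi (sides S) = {relabel S ` S}" using d by (simp add: length_sides relabel_img)
  show ?thesis
  proof
    assume "S \<in> \<pi>"
    then have "U = S" if "U \<in> blocks \<pi> S" for U
      using nc_disj[OF S(1), of U S] nc_fin_ne[OF S(1) that] by auto
    moreover have "S \<in> blocks \<pi> S" using \<open>S \<in> \<pi>\<close> S(2) by (simp add: blocks_def)
    ultimately have "blocks \<pi> S = {S}" by auto
    then show "restrict_part S \<pi> = one_chi (sides S)" unfolding one restrict_part_blocks[OF S(1)] by simp
  next
    assume "restrict_part S \<pi> = one_chi (sides S)"
    then have "relabel S ` S \<in> restrict_part S \<pi>" using one by simp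
    then obtain U where "U \<in> blocks \<pi> S" "relabel S ` S = relabel S ` U" unfolding restrict_part_blocks[OF S(1)] by auto
    then show "S \<in> \<pi>" using relabel_img_eq_iff[OF d, of S U] nc_fin_ne[OF S(1), of U] by auto
  qed
qed

lemma restrict_sub:
  assumes "S \<subseteq> {..<length \<chi>}" "T \<subseteq> S"
  shows "nths (sides S) (relabel S ` T) = sides T" "nths (tuple Z S) (relabel S ` T) = tuple Z T" "restrict_part (relabel S ` T) (restrict_part S \<pi>) = restrict_part T \<pi>"
  using assms(2) by (simp_all add: nths_nths_relabel restrict_part_relabel)

lemma moment_one:
  assumes "nc_on \<pi> S" "S \<noteq> {}" "S \<in> \<pi>"
  shows "moment \<pi> S Z = E (time_prod S Z)"
proof -
  note d = nc_dom[OF assms(1)]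
  have ne: "sides S \<noteq> []" using length_sides[OF d] assms(2) nc_finite[OF assms(1)] by (metis card_eq_0_iff list.size(3))
  show ?thesis unfolding moment_def
    by (subst bi_moment.simps)
      (use restrict_part_nc_BNC[OF assms(1)] ne assms(3) restrict_part_one_iff[OF assms(1,2)] in \<open>simp add: length_sides[OF d] length_tuple[OF d] prod_tuple[OF d]\<close>)
qed

lemma last_block_restrict_part:
  assumes "nc_on \<pi> S" "is_last \<pi> S V"
  shows "last_block (restrict_part S \<pi>) = relabel S ` V"
  using arg_max_Min_restrict_part[OF assms(1), of V "\<lambda>_. True"] assms(2)
  unfolding is_last_def last_block_def by simp

text \<open>Ranks are monotone, so the minima, late intervals and \<prec>-extrema that the
  definition computes in the list correspond to those of subsets of \<open>S\<close>. The two
  conclusions keep the definition's choice of the absorbing entry \<open>k\<close>.\<close>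

lemma moment_rec:
  fixes Z :: "nat \<Rightarrow> 'a"
  assumes S: "nc_on \<pi> S" "S \<notin> \<pi>" and V: "is_last \<pi> S V"
  defines "m \<equiv> Min V"
  defines "T \<equiv> (case \<chi> ! m of Lft \<Rightarrow> lop (E (time_prod V Z)) | Rgt \<Rightarrow> rop (E (time_prod V Z)))"
    and "D \<equiv> {i\<in>S. m < i} - V"
  defines "w \<equiv> (case \<chi> ! m of Lft \<Rightarrow> cmin D | Rgt \<Rightarrow> cmax D)"
  shows "V = {i\<in>S. m \<le> i} \<Longrightarrow> k = Max {i\<in>S. i < m} \<Longrightarrow> moment \<pi> S Z = moment \<pi> (S - V) (Z(k := Z k * T))"
    "V \<noteq> {i\<in>S. m \<le> i} \<Longrightarrow> k = Min {j \<in> block_of \<pi> w. m < j} \<Longrightarrow> moment \<pi> S Z = moment \<pi> (S - V) (Z(k := T * Z k))"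
proof -
  note d = nc_dom[OF S(1)] and fin = nc_finite[OF S(1)]
  have Vb: "V \<in> blocks \<pi> S" using V by (simp add: is_last_def)
  then have V': "finite V" "V \<noteq> {}" "V \<subseteq> S" "V \<in> \<pi>" using nc_fin_ne[OF S(1)] by auto
  have m: "m \<in> V" "\<And>i. i \<in> V \<Longrightarrow> m \<le> i" using V' by (auto simp: m_def)
  then have mS: "m \<in> S" using V' by auto
  have neS: "S \<noteq> {}" using V' by auto
  have ne: "sides S \<noteq> []" using length_sides[OF d] neS fin by (metis card_eq_0_iff list.size(3))
  let ?r = "relabel S"
  note lb = last_block_restrict_part[OF S(1) V]
  have Mr: "Min (?r ` V) = ?r m" using Min_relabel[OF V'(3,1,2)] by (simp add: m_def)
  have tpV: "prod_list (nths (tuple Z S) (?r ` V)) = time_prod V Z"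
    using restrict_sub(2)[OF d V'(3)] prod_tuple[of V Z] V'(3) d by auto
  have T: "(case sides S ! ?r m of Lft \<Rightarrow> lop (E (time_prod V Z)) | Rgt \<Rightarrow> rop (E (time_prod V Z))) = T"
    using sides_nth[OF d mS] by (simp add: T_def)
  have step: "moment \<pi> S Z = bi_moment \<epsilon> E (nths (sides S) (?r ` (S - V))) (restrict_part (?r ` (S - V)) (restrict_part S \<pi>))
      (nths (absorb_last_block \<epsilon> E (sides S) (restrict_part S \<pi>) (tuple Z S)) (?r ` (S - V)))"
    unfolding moment_def
    by (subst bi_moment.simps)
      (use restrict_part_nc_BNC[OF S(1)] ne S(2) restrict_part_one_iff[OF S(1) neS] in
        \<open>simp add: length_sides[OF d] length_tuple[OF d] lb diff_relabel[OF d V'(3), unfolded length_sides[OF d]]\<close>)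
  have fin_step: "moment \<pi> S Z = moment \<pi> (S - V) (Z(k := v))"
    if "absorb_last_block \<epsilon> E (sides S) (restrict_part S \<pi>) (tuple Z S) = (tuple Z S)[?r k := v]" "k \<in> S" for k v
    unfolding step unfolding that(1) tuple_upd[OF d that(2)] unfolding moment_def using restrict_sub[OF d, of "S - V"] by simp
  have ge: "?r i \<ge> ?r m \<longleftrightarrow> i \<ge> m" if "i \<in> S" for i
    using relabel_less_iff[OF that mS] by (simp add: linorder_not_less[symmetric])
  have gt: "?r i > ?r m \<longleftrightarrow> i > m" if "i \<in> S" for i
    using relabel_less_iff[OF mS that] .
  have set1: "{?r m..<length (sides S)} = ?r ` {i\<in>S. m \<le> i}"
  proof -
    have "{?r m..<length (sides S)} = {j\<in>?r ` S. ?r m \<le> j}" unfolding relabel_img[OF d] length_sides[OF d] by auto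
    then show ?thesis using ge by auto
  qed
  have set2: "{?r m<..<length (sides S)} - ?r ` V = ?r ` D"
  proof -
    have "{?r m<..<length (sides S)} = {j\<in>?r ` S. ?r m < j}" unfolding relabel_img[OF d] length_sides[OF d] by auto
    also have "\<dots> = ?r ` {i\<in>S. m < i}" using gt by auto
    finally show ?thesis unfolding D_def
      using inj_on_image_set_diff[OF relabel_inj_on[of S], of "{i\<in>S. m < i}" V] V'(3) by auto
  qed
  have cond: "?r ` V = {?r m..<length (sides S)} \<longleftrightarrow> V = {i\<in>S. m \<le> i}"
    unfolding set1 by (rule relabel_img_eq_iff[OF d]) (use V' in auto)
  {
    assume A: "V = {i\<in>S. m \<le> i}" and k: "k = Max {i\<in>S. i < m}"
    have "{i\<in>S. i < m} \<noteq> {}"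
    proof
      assume "{i\<in>S. i < m} = {}"
      then have "S \<subseteq> V" unfolding A by (metis (mono_tags, lifting) empty_Collect_eq mem_Collect_eq not_less subsetI)
      then show False using V' S(2) by auto
    qed
    then have kS: "k \<in> {i\<in>S. i < m}" unfolding k using fin by (intro Max_in) auto
    have kge: "i \<le> k" if "i \<in> S" "i < m" for i unfolding k by (rule Max_ge) (use that fin in auto)
    \<comment> \<open>\<open>k\<close> is the last index of \<open>S\<close> before
      \<open>m\<close>, so their ranks differ by exactly one. This is the \<open>m - 1\<close> of
      the definition, which refers to positions in the list.\<close>
    have "{i\<in>S. i < m} = insert k {i\<in>S. i < k}"
      using kS kge by (auto simp: le_less)
    then have "?r m = Suc (?r k)" using fin by (simp add: relabel_def)
    then have rk: "?r m - 1 = ?r k" by simp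
    show "moment \<pi> S Z = moment \<pi> (S - V) (Z(k := Z k * T))"
    proof (rule fin_step)
      show "absorb_last_block \<epsilon> E (sides S) (restrict_part S \<pi>) (tuple Z S) = (tuple Z S)[?r k := Z k * T]"
        unfolding absorb_last_block_def Let_def lb Mr tpV T cond
        using A tuple_nth[OF d, of k Z] kS unfolding rk by simp
    qed (use kS in auto)
  next
    assume A: "V \<noteq> {i\<in>S. m \<le> i}" and k: "k = Min {j \<in> block_of \<pi> w. m < j}"
    have Dne: "D \<noteq> {}"
    proof
      assume "D = {}"
      then have "{i\<in>S. m \<le> i} \<subseteq> V" using m(1) unfolding D_def by (auto simp: le_less)
      then show False using A m V'(3) by auto
    qed
    have DS: "D \<subseteq> S" "finite D" using fin by (auto simp: D_def)
    have wD: "w \<in> D" unfolding w_def using cmin(1)[OF DS(2) Dne] cmax(1)[OF DS(2) Dne] by (auto split: side.split)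
    have w': "(case sides S ! ?r m of Lft \<Rightarrow> chi_min (sides S) (?r ` D) | Rgt \<Rightarrow> chi_max (sides S) (?r ` D)) = ?r w"
      using sides_nth[OF d mS] chi_min_relabel[OF d DS(1) Dne] chi_max_relabel[OF d DS(1) Dne] by (simp add: w_def split: side.split)
    have wS: "w \<in> S" "m < w" using wD by (auto simp: D_def)
    note W = block_of[OF S(1) wS(1)]
    have Wb: "block_of \<pi> w \<in> blocks \<pi> S" using W by (auto simp: blocks_def)
    have W': "(THE U. U \<in> restrict_part S \<pi> \<and> ?r w \<in> U) = ?r ` block_of \<pi> w"
    proof (rule the_equality)
      show "?r ` block_of \<pi> w \<in> restrict_part S \<pi> \<and> ?r w \<in> ?r ` block_of \<pi> w" using W Wb by (auto simp: restrict_part_blocks[OF S(1)])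
      fix U assume U: "U \<in> restrict_part S \<pi> \<and> ?r w \<in> U"
      show "U = ?r ` block_of \<pi> w"
        by (rule BNC_disjoint[OF restrict_part_nc_BNC[OF S(1)], of _ _ "?r w"]) (use U W Wb in \<open>auto simp: restrict_part_blocks[OF S(1)]\<close>)
    qed
    have K: "{j \<in> ?r ` block_of \<pi> w. ?r m < j} = ?r ` {j \<in> block_of \<pi> w. m < j}" using gt W(3) by auto
    have Kne: "{j \<in> block_of \<pi> w. m < j} \<noteq> {}" "finite {j \<in> block_of \<pi> w. m < j}" "{j \<in> block_of \<pi> w. m < j} \<subseteq> S"
      using W wS finite_subset[OF W(3) fin] by auto
    have k': "Min {j \<in> ?r ` block_of \<pi> w. ?r m < j} = ?r k" unfolding K k by (rule Min_relabel[OF Kne(3,2,1)])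
    have kS: "k \<in> S" using Min_in[OF Kne(2,1)] Kne(3) k by auto
    show "moment \<pi> S Z = moment \<pi> (S - V) (Z(k := T * Z k))"
    proof (rule fin_step)
      show "absorb_last_block \<epsilon> E (sides S) (restrict_part S \<pi>) (tuple Z S) = (tuple Z S)[?r k := T * Z k]"
        unfolding absorb_last_block_def Let_def lb Mr tpV T cond set2 w' W' k'
        using A tuple_nth[OF d kS, of Z] by simp
    qed (rule kS)
  }
qed

section \<open>Position of the block with the largest minimum\<close>

lemma lt_L: "\<chi> ! i = Lft \<Longrightarrow> i < j \<Longrightarrow> i \<prec> j" and lt_R: "\<chi> ! j = Rgt \<Longrightarrow> j < i \<Longrightarrow> i \<prec> j"
  by (auto simp: lt_iff side_neq)

lemma is_lastD:
  assumes S: "nc_on \<pi> S" and V: "is_last \<pi> S V"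
  shows "V \<in> \<pi>" "V \<subseteq> S" "V \<noteq> {}" "finite V" "nc_on \<pi> V" "Min V \<in> V" "\<And>v. v \<in> V \<Longrightarrow> Min V \<le> v" "Min V \<in> S"
proof -
  have "V \<in> blocks \<pi> S" using V by (simp add: is_last_def)
  then show 1: "V \<in> \<pi>" "V \<subseteq> S" "V \<noteq> {}" "finite V" using nc_fin_ne[OF S] by auto
  then show "nc_on \<pi> V" "Min V \<in> V" "\<And>v. v \<in> V \<Longrightarrow> Min V \<le> v" using nc_block[OF S] by auto
  then show "Min V \<in> S" using 1 by blast
qed

lemma is_last_other:
  assumes S: "nc_on \<pi> S" and V: "is_last \<pi> S V" and j: "j \<in> S - V"
  obtains a where "a \<in> block_of \<pi> j" "a < Min V" "a \<in> S - V" "a = Min (block_of \<pi> j)"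
proof -
  note Vd = is_lastD[OF S V]
  have jS: "j \<in> S" using j by simp
  note W = block_of[OF S jS]
  have Wb: "block_of \<pi> j \<in> blocks \<pi> S" using W by (auto simp: blocks_def)
  note f = nc_fin_ne[OF S Wb]
  have a: "Min (block_of \<pi> j) \<in> block_of \<pi> j" using f by auto
  have WV: "block_of \<pi> j \<inter> V = {}" using nc_disj[OF S W(1) Vd(1)] W(2) j by auto
  have "Min (block_of \<pi> j) \<le> Min V" using V Wb by (simp add: is_last_def)
  moreover have "Min (block_of \<pi> j) \<noteq> Min V" using a Vd(6) WV by auto
  ultimately show ?thesis using that[OF a] a W(3) WV by auto
qed

text \<open>The block of \<open>j\<close> begins at some \<open>a\<close> earlier than
  \<open>Min V\<close>. Depending on its side, \<open>a\<close> lies \<prec>-before or \<prec>-after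
  all of \<open>Min V\<close>, \<open>j\<close> and \<open>v\<close>, so with \<open>j\<close> on
  the wrong side of \<open>v\<close> these four points would alternate between two different
  blocks.\<close>

lemma last_after:
  assumes S: "nc_on \<pi> S" and V: "is_last \<pi> S V" and j: "j \<in> S - V" "Min V < j" and v: "v \<in> V"
  shows "\<chi> ! Min V = Lft \<Longrightarrow> v \<prec> j" "\<chi> ! Min V = Rgt \<Longrightarrow> j \<prec> v"
proof -
  let ?m = "Min V"
  note Vd = is_lastD[OF S V]
  obtain a where a: "a \<in> block_of \<pi> j" "a < ?m" "a \<in> S - V" and "a = Min (block_of \<pi> j)" by (rule is_last_other[OF S V j(1)])
  have jS: "j \<in> S" using j by simp
  note W = block_of[OF S jS]
  have WV: "block_of \<pi> j \<noteq> V" using W(2) j(1) by auto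
  have ne: "v \<noteq> j" using j(1) v by auto
  {
    assume m: "\<chi> ! ?m = Lft"
    have mj: "?m \<prec> j" by (rule lt_L[OF m j(2)])
    show "v \<prec> j"
    proof (rule ccontr)
      assume "\<not> v \<prec> j"
      then have jv: "j \<prec> v" using chi_less_total[of v j \<chi>] ne by auto
      then have "v \<noteq> ?m" using mj chi_less_asym[of \<chi> j v] by auto
      then have mv: "?m < v" using Vd(7)[OF v] by auto
      show False
      proof (cases "\<chi> ! a")
        case Lft
        show False using nc_cross[OF S W(1) Vd(1) a(1) Vd(6) W(2) v lt_L[OF Lft a(2)] mj jv] WV by simp
      next
        case Rgt
        show False using nc_cross[OF S Vd(1) W(1) Vd(6) W(2) v a(1) mj jv lt_R[OF Rgt]] mv a(2) WV by simp
      qed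
    qed
  next
    assume m: "\<chi> ! ?m = Rgt"
    have mj: "j \<prec> ?m" by (rule lt_R[OF m j(2)])
    show "j \<prec> v"
    proof (rule ccontr)
      assume "\<not> j \<prec> v"
      then have jv: "v \<prec> j" using chi_less_total[of v j \<chi>] ne by auto
      then have "v \<noteq> ?m" using mj chi_less_asym[of \<chi> j v] by auto
      then have mv: "?m < v" using Vd(7)[OF v] by auto
      show False
      proof (cases "\<chi> ! a")
        case Lft
        have "a \<prec> v" using lt_L[OF Lft] a(2) mv by simp
        then show False using nc_cross[OF S W(1) Vd(1) a(1) v W(2) Vd(6)] jv mj WV by simp
      next
        case Rgt
        show False using nc_cross[OF S Vd(1) W(1) v W(2) Vd(6) a(1) jv mj lt_R[OF Rgt a(2)]] WV by simp
      qed
    qed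
  }
qed

text \<open>Later indices outside \<open>V\<close> lie behind \<open>V\<close> by
  \<open>last_after\<close>. Earlier left indices precede everything later and earlier right indices
  follow everything later, so neither comes between \<open>V\<close> and the \<prec>-first element
  of \<open>D\<close>.\<close>

lemma last_succ:
  assumes S: "nc_on \<pi> S" and V: "is_last \<pi> S V" and m: "\<chi> ! Min V = Lft"
    and D: "D = {i\<in>S. Min V < i} - V" "D \<noteq> {}"
  shows "succ_of S V (cmin D)"
proof -
  note Vd = is_lastD[OF S V]
  have fin: "finite D" using nc_finite[OF S] by (simp add: D)
  have w: "cmin D \<in> D" using cmin(1)[OF fin D(2)] .
  show ?thesis
    unfolding succ_of_def
  proof (intro conjI ballI)
    show "cmin D \<in> S - V" using w D by auto
    show "v \<prec> cmin D" if "v \<in> V" for v using last_after(1)[OF S V _ _ that m] w D by auto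
    fix j assume j: "j \<in> S - V"
    then have "j \<noteq> Min V" using Vd(6) by auto
    then have "j \<in> D \<or> j < Min V" using j D(1) by (simp add: not_less_iff_gr_or_eq) linarith
    then consider "j \<in> D" | "j < Min V" "\<chi> ! j = Lft" | "j < Min V" "\<chi> ! j = Rgt"
      by (cases "\<chi> ! j") blast+
    then show "j = cmin D \<or> cmin D \<prec> j \<or> (\<forall>v\<in>V. j \<prec> v)"
    proof cases
      case 1
      then show ?thesis using cmin(2)[OF fin, of j] by auto
    next
      case 2
      then show ?thesis using Vd(7) lt_L[OF 2(2)] by fastforce
    next
      case 3
      then show ?thesis using lt_R[OF 3(2), of "cmin D"] w D by auto
    qed
  qed
qed

lemma last_pred:
  assumes S: "nc_on \<pi> S" and V: "is_last \<pi> S V" and m: "\<chi> ! Min V = Rgt"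
    and D: "D = {i\<in>S. Min V < i} - V" "D \<noteq> {}"
  shows "pred_of S V (cmax D)"
proof -
  note Vd = is_lastD[OF S V]
  have fin: "finite D" using nc_finite[OF S] by (simp add: D)
  have w: "cmax D \<in> D" using cmax(1)[OF fin D(2)] .
  show ?thesis
    unfolding pred_of_def
  proof (intro conjI ballI)
    show "cmax D \<in> S - V" using w D by auto
    show "cmax D \<prec> v" if "v \<in> V" for v using last_after(2)[OF S V _ _ that m] w D by auto
    fix j assume j: "j \<in> S - V"
    then have "j \<noteq> Min V" using Vd(6) by auto
    then have "j \<in> D \<or> j < Min V" using j D(1) by (simp add: not_less_iff_gr_or_eq) linarith
    then consider "j \<in> D" | "j < Min V" "\<chi> ! j = Lft" | "j < Min V" "\<chi> ! j = Rgt"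
      by (cases "\<chi> ! j") blast+
    then show "j = cmax D \<or> j \<prec> cmax D \<or> (\<forall>v\<in>V. v \<prec> j)"
    proof cases
      case 1
      then show ?thesis using cmax(2)[OF fin, of j] by auto
    next
      case 3
      then show ?thesis using Vd(7) lt_R[OF 3(2)] by fastforce
    next
      case 2
      then show ?thesis using lt_L[OF 2(2), of "cmax D"] w D by auto
    qed
  qed
qed

text \<open>Every remaining index is earlier than all of \<open>V\<close>, so its side alone decides
  whether it lies before or behind \<open>V\<close>; the latest one, \<open>k\<close>, is the
  closest on its side.\<close>

lemma last_final:
  assumes S: "nc_on \<pi> S" and V: "is_last \<pi> S V" and eq: "V = {i\<in>S. Min V \<le> i}"
    and k: "k \<in> S - V" "\<And>j. j \<in> S - V \<Longrightarrow> j \<le> k"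
  shows "\<chi> ! k = Lft \<Longrightarrow> pred_of S V k" "\<chi> ! k = Rgt \<Longrightarrow> succ_of S V k"
proof -
  have lt: "j < v" if "j \<in> S - V" "v \<in> V" for j v
  proof -
    have "j \<in> S" "j \<notin> V" using that(1) by auto
    then have "\<not> Min V \<le> j" using eq by blast
    then show ?thesis using is_lastD(7)[OF S V that(2)] by linarith
  qed
  have side: "(\<chi> ! j = Lft \<longrightarrow> (\<forall>v\<in>V. j \<prec> v)) \<and> (\<chi> ! j = Rgt \<longrightarrow> (\<forall>v\<in>V. v \<prec> j))" if "j \<in> S - V" for j
    using lt[OF that] lt_L lt_R by auto
  have "\<chi> ! j = Lft \<Longrightarrow> \<chi> ! k = Lft \<Longrightarrow> j = k \<or> j \<prec> k" "\<chi> ! j = Rgt \<Longrightarrow> \<chi> ! k = Rgt \<Longrightarrow> j = k \<or> k \<prec> j"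
    if "j \<in> S - V" for j
    using k(2)[OF that] by (auto simp: lt_iff le_less)
  note cmp = this
  show "pred_of S V k" if "\<chi> ! k = Lft"
    unfolding pred_of_def
  proof (intro conjI ballI)
    show "j = k \<or> j \<prec> k \<or> (\<forall>v\<in>V. v \<prec> j)" if j: "j \<in> S - V" for j
      using cmp(1)[OF j _ \<open>\<chi> ! k = Lft\<close>] side[OF j] by (cases "\<chi> ! j") auto
  qed (use side[OF k(1)] k(1) that in auto)
  show "succ_of S V k" if "\<chi> ! k = Rgt"
    unfolding succ_of_def
  proof (intro conjI ballI)
    show "j = k \<or> k \<prec> j \<or> (\<forall>v\<in>V. j \<prec> v)" if j: "j \<in> S - V" for j
      using cmp(2)[OF j _ \<open>\<chi> ! k = Rgt\<close>] side[OF j] by (cases "\<chi> ! j") auto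
  qed (use side[OF k(1)] k(1) that in auto)
qed

text \<open>After the blocks with large minimum have been absorbed, the recursion for the moments sees the
  entries at late times only through their product in each block. This permits moving an absorbed
  operator out of the entry chosen by the definition, which need not lie in a face, to the
  \<open>\<prec>\<close>-neighbour of the absorbed block.\<close>

definition late_equiv :: "nat \<Rightarrow> nat set set \<Rightarrow> nat set \<Rightarrow> (nat \<Rightarrow> 'a) \<Rightarrow> (nat \<Rightarrow> 'a) \<Rightarrow> bool" where
  "late_equiv t \<pi> S Z Z' \<longleftrightarrow> (\<forall>i\<in>S. i < t \<longrightarrow> Z i = Z' i) \<and>
     (\<forall>U\<in>blocks \<pi> S. \<forall>X. E (X * time_prod {u\<in>U. t \<le> u} Z) = E (X * time_prod {u\<in>U. t \<le> u} Z'))"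

section \<open>Moving the absorbed operator to a neighbour of the last block\<close>

lemma time_prod_from_split:
  assumes "finite U" "t \<le> m"
  shows "time_prod {u\<in>U. t \<le> u} Z = time_prod {u\<in>U. t \<le> u \<and> u < m} Z * time_prod {u\<in>U. m \<le> u} Z"
proof -
  have "time_prod ({u\<in>U. t \<le> u \<and> u < m} \<union> {u\<in>U. m \<le> u}) Z = time_prod {u\<in>U. t \<le> u \<and> u < m} Z * time_prod {u\<in>U. m \<le> u} Z"
    by (rule time_prod_Un) (use assms in auto)
  moreover have "{u\<in>U. t \<le> u \<and> u < m} \<union> {u\<in>U. m \<le> u} = {u\<in>U. t \<le> u}" using assms(2) by auto
  ultimately show ?thesis by simp
qed

lemma blocks_Diff: "U \<in> blocks \<pi> (S - V) \<Longrightarrow> U \<in> blocks \<pi> S \<and> U \<inter> V = {}"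
  unfolding blocks_def by blast

lemma last_Diff:
  assumes S: "nc_on \<pi> S" and V: "is_last \<pi> S V" and V': "is_last \<pi> (S - V) V'"
  shows "Min V' < Min V" "Min V' \<in> S - V"
proof -
  have W: "nc_on \<pi> (S - V)" using nc_Diff[OF S is_lastD(5)[OF S V]] .
  note d = is_lastD[OF W V']
  show m: "Min V' \<in> S - V" using d(8) .
  obtain a where "a \<in> block_of \<pi> (Min V')" and a: "a < Min V" and "a \<in> S - V" and a': "a = Min (block_of \<pi> (Min V'))"
    by (rule is_last_other[OF S V m])
  have "block_of \<pi> (Min V') = V'" by (rule block_of_eq[OF W d(1,6)])
  then show "Min V' < Min V" using a a' by simp
qed

text \<open>An absorbed operator goes either into an early entry, where the two tuples agree, or in
  front of the first late entry of its block. In the latter case it stands at the left of the late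
  product and is taken into the arbitrary factor \<open>X\<close> of \<open>late_equiv\<close>. Each
  removal of a block lowers the bound from \<open>Min V\<close> to \<open>Min V'\<close>.\<close>

lemma moment_cong:
  assumes "nc_on \<pi> S" "is_last \<pi> S V" "late_equiv (Min V) \<pi> S Z Z'"
  shows "moment \<pi> S Z = moment \<pi> S Z'"
  using assms
proof (induction "card S" arbitrary: S V Z Z' rule: less_induct)
  case less
  note S = less.prems(1) and V = less.prems(2)
  note Vd = is_lastD[OF S V]
  let ?m = "Min V"
  have early: "Z i = Z' i" if "i \<in> S" "i < ?m" for i
    using less.prems(3) that by (simp add: late_equiv_def)
  have late: "E (X * time_prod {u\<in>U. ?m \<le> u} Z) = E (X * time_prod {u\<in>U. ?m \<le> u} Z')" if "U \<in> blocks \<pi> S" for U X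
    using less.prems(3) that by (simp add: late_equiv_def)
  have neS: "S \<noteq> {}" using Vd by auto
  have "{u\<in>V. ?m \<le> u} = V" using Vd(7) by auto
  \<comment> \<open>\<open>V\<close> is entirely late, so the hypothesis with \<open>X = 1\<close>
    gives equal moments on \<open>V\<close>.\<close>
  then have b: "E (time_prod V Z) = E (time_prod V Z')"
    using late[of V 1] Vd by (auto simp: blocks_def)
  show ?case
  proof (cases "S \<in> \<pi>")
    case True
    obtain i where "i \<in> V" using Vd(3) by auto
    then have "V = S" using nc_disj[OF S Vd(1) True, of i] Vd(2) by auto
    then show ?thesis using b moment_one[OF S neS True] by simp
  next
    case False
    let ?C = "S - V"
    have C: "nc_on \<pi> ?C" using nc_Diff[OF S Vd(5)] .
    have cC: "card ?C < card S"
      by (rule psubset_card_mono[OF nc_finite[OF S]]) (use Vd(2,3) in blast)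
    have neC: "?C \<noteq> {}" using Vd False by auto
    obtain V' where V': "is_last \<pi> ?C V'" using ex_is_last[OF C neC] .
    note m' = last_Diff[OF S V V']
    note rec = moment_rec[OF S False V]
    define T where "T = (case \<chi> ! ?m of Lft \<Rightarrow> lop (E (time_prod V Z)) | Rgt \<Rightarrow> rop (E (time_prod V Z)))"
    show ?thesis
    proof (cases "V = {i\<in>S. ?m \<le> i}")
      case A: True
      define k where "k = Max {i\<in>S. i < ?m}"
      have small: "i < ?m" if "i \<in> ?C" for i
      proof -
        have "i \<in> S" "i \<notin> V" using that by auto
        then have "\<not> ?m \<le> i" using A by blast
        then show ?thesis by linarith
      qed
      have kS: "k \<in> S" "k < ?m"
      proof -
        have "Min V' \<in> {i\<in>S. i < ?m}" using m' by auto
        then have "k \<in> {i\<in>S. i < ?m}" unfolding k_def using nc_finite[OF S] by (intro Max_in) auto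
        then show "k \<in> S" "k < ?m" by auto
      qed
      have "moment \<pi> ?C (Z(k := Z k * T)) = moment \<pi> ?C (Z'(k := Z' k * T))"
      proof (rule less.hyps[OF cC C V'])
        have eq: "(Z(k := Z k * T)) i = (Z'(k := Z' k * T)) i" if "i \<in> ?C" for i
          using early[OF _ small[OF that]] early[OF kS] that by simp
        show "late_equiv (Min V') \<pi> ?C (Z(k := Z k * T)) (Z'(k := Z' k * T))"
          unfolding late_equiv_def
        proof (intro conjI ballI allI impI)
          fix U X assume "U \<in> blocks \<pi> ?C"
          then have U: "U \<subseteq> ?C" "finite U" using nc_fin_ne[OF C] by auto
          have "time_prod {u\<in>U. Min V' \<le> u} (Z(k := Z k * T)) = time_prod {u\<in>U. Min V' \<le> u} (Z'(k := Z' k * T))"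
            by (rule time_prod_cong, use U in simp, rule eq, use U in auto)
          then show "E (X * time_prod {u\<in>U. Min V' \<le> u} (Z(k := Z k * T))) = E (X * time_prod {u\<in>U. Min V' \<le> u} (Z'(k := Z' k * T)))"
            by simp
        qed (rule eq)
      qed
      then show ?thesis
        using rec(1)[OF A k_def, of Z] rec(1)[OF A k_def, of Z'] unfolding T_def b by simp
    next
      case B: False
      define w where "w = (case \<chi> ! ?m of Lft \<Rightarrow> cmin ({i\<in>S. ?m < i} - V) | Rgt \<Rightarrow> cmax ({i\<in>S. ?m < i} - V))"
      define k where "k = Min {j \<in> block_of \<pi> w. ?m < j}"
      let ?D = "{i\<in>S. ?m < i} - V"
      have Dne: "?D \<noteq> {}"
      proof
        assume "?D = {}"
        then have "{i\<in>S. ?m \<le> i} \<subseteq> V" using Vd(6) by (auto simp: le_less)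
        then show False using B Vd(2,7) by auto
      qed
      have finD: "finite ?D" using nc_finite[OF S] by simp
      have wD: "w \<in> ?D" unfolding w_def using cmin(1)[OF finD Dne] cmax(1)[OF finD Dne] by (auto split: side.split)
      then have wS: "w \<in> S" "w \<notin> V" "?m < w" by auto
      note W = block_of[OF S wS(1)]
      have finK: "finite {j \<in> block_of \<pi> w. ?m < j}" using finite_subset[OF W(3) nc_finite[OF S]] by simp
      have kk: "k \<in> block_of \<pi> w" "?m < k"
        using Min_in[OF finK] W(2) wS(3) by (auto simp: k_def)
      have kle: "k \<le> j" if "j \<in> block_of \<pi> w" "?m < j" for j unfolding k_def using that finK by (intro Min_le) auto
      have Wm: "?m \<notin> block_of \<pi> w" using nc_disj[OF S W(1) Vd(1) _ Vd(6)] W(2) wS(2) by auto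
      \<comment> \<open>The product that counts as late after the removal splits at
        \<open>?m\<close>, and the operator stands exactly at the split because \<open>k\<close> is
        the first entry of its block behind \<open>?m\<close>.\<close>
      have key: "E (X * time_prod {u\<in>U. Min V' \<le> u} (Y(k := T * Y k))) =
          E (X * time_prod {u\<in>U. Min V' \<le> u \<and> u < ?m} Y * (if k \<in> U then T else 1) * time_prod {u\<in>U. ?m \<le> u} Y)"
        if U: "U \<in> blocks \<pi> ?C" for U X and Y :: "nat \<Rightarrow> 'a"
      proof -
        have f: "finite U" "U \<in> \<pi>" using nc_fin_ne[OF C U] by auto
        have 1: "time_prod {u\<in>U. Min V' \<le> u \<and> u < ?m} (Y(k := T * Y k)) = time_prod {u\<in>U. Min V' \<le> u \<and> u < ?m} Y"
          by (rule time_prod_cong) (use f kk(2) in auto)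
        have 2: "time_prod {u\<in>U. ?m \<le> u} (Y(k := T * Y k)) = (if k \<in> U then T else 1) * time_prod {u\<in>U. ?m \<le> u} Y"
        proof (cases "k \<in> U")
          case True
          then have UW: "U = block_of \<pi> w" using nc_disj[OF S f(2) W(1) _ kk(1)] by simp
          have "k \<le> u" if "u \<in> {u\<in>U. ?m \<le> u}" for u
            using that kle[of u] Wm UW by (auto simp: le_less)
          then have "time_prod_ins {u\<in>U. ?m \<le> u} k T Y = T * time_prod {u\<in>U. ?m \<le> u} Y" by (rule time_prod_ins_start)
          then show ?thesis using time_prod_upd_left[of "{u\<in>U. ?m \<le> u}" k Y T] f True kk(2) by simp
        next
          case False
          then have "time_prod {u\<in>U. ?m \<le> u} (Y(k := T * Y k)) = time_prod {u\<in>U. ?m \<le> u} Y"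
            by (intro time_prod_cong) (use f in auto)
          then show ?thesis using False by simp
        qed
        show ?thesis
          unfolding time_prod_from_split[OF f(1) less_imp_le[OF m'(1)]] 1 2 by (simp only: mult.assoc)
      qed
      have "moment \<pi> ?C (Z(k := T * Z k)) = moment \<pi> ?C (Z'(k := T * Z' k))"
      proof (rule less.hyps[OF cC C V'])
        show "late_equiv (Min V') \<pi> ?C (Z(k := T * Z k)) (Z'(k := T * Z' k))"
          unfolding late_equiv_def
        proof (intro conjI ballI allI impI)
          fix i assume "i \<in> ?C" "i < Min V'"
          then show "(Z(k := T * Z k)) i = (Z'(k := T * Z' k)) i"
            using m'(1) kk(2) early[of i] by auto
        next
          fix U X assume U: "U \<in> blocks \<pi> ?C"
          then have f: "U \<subseteq> ?C" "finite U" using nc_fin_ne[OF C] by auto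
          have "time_prod {u\<in>U. Min V' \<le> u \<and> u < ?m} Z = time_prod {u\<in>U. Min V' \<le> u \<and> u < ?m} Z'"
            by (rule time_prod_cong) (use f early in auto)
          then show "E (X * time_prod {u\<in>U. Min V' \<le> u} (Z(k := T * Z k))) = E (X * time_prod {u\<in>U. Min V' \<le> u} (Z'(k := T * Z' k)))"
            unfolding key[OF U] using late blocks_Diff[OF U] by simp
        qed
      qed
      then show ?thesis
        using rec(2)[OF B k_def[unfolded w_def], of Z] rec(2)[OF B k_def[unfolded w_def], of Z']
        unfolding T_def b by simp
    qed
  qed
qed


text \<open>The entry \<open>k\<close> of the definition is a \<prec>-neighbour of \<open>V\<close>
  or shares its block with one, but its side may not fit. By \<open>moment_cong\<close> the operator
  may travel within the late product of this block: it passes entries of the other side, and at the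
  end of the product \<open>E_right\<close> changes its own side.\<close>

lemma moment_shift:
  assumes S: "nc_on \<pi> S" "S \<notin> \<pi>" and V: "is_last \<pi> S V" and Z: "faces S Z"
  obtains p where "p \<in> S - V"
    "pred_of S V p \<and> moment \<pi> S Z = moment \<pi> (S - V) (Z(p := ract p (Z p) (E (time_prod V Z)))) \<or>
     succ_of S V p \<and> moment \<pi> S Z = moment \<pi> (S - V) (Z(p := lact p (E (time_prod V Z)) (Z p)))"
proof -
  note Vd = is_lastD[OF S(1) V]
  let ?m = "Min V" and ?C = "S - V" and ?c = "E (time_prod V Z)"
  have C: "nc_on \<pi> ?C" using nc_Diff[OF S(1) Vd(5)] .
  have neC: "?C \<noteq> {}" using Vd S(2) by auto
  obtain V' where V': "is_last \<pi> ?C V'" using ex_is_last[OF C neC] .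
  note m' = last_Diff[OF S(1) V V']
  note rec = moment_rec[OF S V]
  define T where "T = (case \<chi> ! ?m of Lft \<Rightarrow> lop ?c | Rgt \<Rightarrow> rop ?c)"
  have cong: "moment \<pi> ?C (Z(k := x)) = moment \<pi> ?C (Z(q := y))"
    if k: "Min V' \<le> k" "Min V' \<le> q"
      and eq: "\<And>U X. U \<in> blocks \<pi> ?C \<Longrightarrow> k \<in> U \<or> q \<in> U \<Longrightarrow>
        E (X * time_prod {u\<in>U. Min V' \<le> u} (Z(k := x))) = E (X * time_prod {u\<in>U. Min V' \<le> u} (Z(q := y)))" for k q x y
  proof (rule moment_cong[OF C V'])
    show "late_equiv (Min V') \<pi> ?C (Z(k := x)) (Z(q := y))"
      unfolding late_equiv_def
    proof (intro conjI ballI allI impI)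
      fix U X assume U: "U \<in> blocks \<pi> ?C"
      show "E (X * time_prod {u\<in>U. Min V' \<le> u} (Z(k := x))) = E (X * time_prod {u\<in>U. Min V' \<le> u} (Z(q := y)))"
      proof (cases "k \<in> U \<or> q \<in> U")
        case False
        then have "time_prod {u\<in>U. Min V' \<le> u} (Z(k := x)) = time_prod {u\<in>U. Min V' \<le> u} (Z(q := y))"
          by (intro time_prod_cong) (use nc_fin_ne[OF C U] in auto)
        then show ?thesis by simp
      qed (rule eq[OF U])
    qed (use k in auto)
  qed
  have E_end: "E (X * (Y * lop b)) = E (X * (Y * rop b))" for X Y b
    using E_right[of "X * Y" b] by (simp add: mult.assoc)
  show ?thesis
  proof (cases "V = {i\<in>S. ?m \<le> i}")
    case A: True
    define k where "k = Max {i\<in>S. i < ?m}"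
    have small: "i < ?m" if "i \<in> ?C" for i
    proof -
      have "i \<in> S" "i \<notin> V" using that by auto
      then have "\<not> ?m \<le> i" using A by blast
      then show ?thesis by linarith
    qed
    have "Min V' \<in> {i\<in>S. i < ?m}" using m' by auto
    then have "k \<in> {i\<in>S. i < ?m}" unfolding k_def using nc_finite[OF S(1)] by (intro Max_in) auto
    then have k: "k \<in> ?C" using Vd(7)[of k] by auto
    have kge: "j \<le> k" if "j \<in> ?C" for j
      unfolding k_def using that small[OF that] nc_finite[OF S(1)] by (intro Max_ge) auto
    note pr = last_final[OF S(1) V A k kge]
    \<comment> \<open>\<open>k\<close> is the latest remaining index, so the operator is the last
      factor in its block and may be taken on whichever side \<open>k\<close> has.\<close>
    have swap: "moment \<pi> ?C (Z(k := Z k * lop ?c)) = moment \<pi> ?C (Z(k := Z k * rop ?c))"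
    proof (rule cong)
      fix U X assume U: "U \<in> blocks \<pi> ?C" "k \<in> U \<or> k \<in> U"
      have f: "finite U" "U \<subseteq> ?C" using nc_fin_ne[OF C U(1)] by auto
      let ?A = "{u\<in>U. Min V' \<le> u}"
      have "k \<in> ?A" using U(2) kge[OF m'(2)] by auto
      moreover have "time_prod_ins ?A (Suc k) c Z = time_prod ?A Z * c" for c
        by (rule time_prod_ins_end) (use f kge in \<open>auto simp: less_Suc_eq_le\<close>)
      ultimately have "time_prod ?A (Z(k := Z k * c)) = time_prod ?A Z * c" for c using time_prod_upd_right[of ?A k Z c] f by simp
      then show "E (X * time_prod ?A (Z(k := Z k * lop ?c))) = E (X * time_prod ?A (Z(k := Z k * rop ?c)))"
        by (simp add: E_end)
    qed (use kge[OF m'(2)] in auto)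
    have "moment \<pi> S Z = moment \<pi> ?C (Z(k := Z k * T))" using rec(1)[OF A k_def, of Z] by (simp add: T_def)
    then have bL: "moment \<pi> S Z = moment \<pi> ?C (Z(k := Z k * lop ?c))" and bR: "moment \<pi> S Z = moment \<pi> ?C (Z(k := Z k * rop ?c))"
      using swap by (auto simp: T_def split: side.splits)
    show ?thesis
    proof (cases "\<chi> ! k")
      case Lft
      then show ?thesis using that[OF k] pr(1) bL by (simp add: ract_def)
    next
      case Rgt
      then show ?thesis using that[OF k] pr(2) bR by (simp add: lact_def)
    qed
  next
    case B: False
    define D where "D = {i\<in>S. ?m < i} - V"
    define w where "w = (case \<chi> ! ?m of Lft \<Rightarrow> cmin D | Rgt \<Rightarrow> cmax D)"
    define k where "k = Min {j \<in> block_of \<pi> w. ?m < j}"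
    have Dne: "D \<noteq> {}"
    proof
      assume "D = {}"
      then have "{i\<in>S. ?m \<le> i} \<subseteq> V" using Vd(6) by (auto simp: le_less D_def)
      then show False using B Vd(2,7) by auto
    qed
    have finD: "finite D" using nc_finite[OF S(1)] by (simp add: D_def)
    have wD: "w \<in> D" unfolding w_def using cmin(1)[OF finD Dne] cmax(1)[OF finD Dne] by (auto split: side.split)
    then have wS: "w \<in> S" "w \<notin> V" "?m < w" by (auto simp: D_def)
    note W = block_of[OF S(1) wS(1)]
    have finK: "finite {j \<in> block_of \<pi> w. ?m < j}" using finite_subset[OF W(3) nc_finite[OF S(1)]] by simp
    have kk: "k \<in> block_of \<pi> w" "?m < k"
      using Min_in[OF finK] W(2) wS(3) by (auto simp: k_def)
    have kle: "k \<le> j" if "j \<in> block_of \<pi> w" "?m < j" for j unfolding k_def using that finK by (intro Min_le) auto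
    have WV: "block_of \<pi> w \<inter> V = {}" using nc_disj[OF S(1) W(1) Vd(1)] W(2) wS(2) by auto
    have inD: "j \<in> D" if "j \<in> block_of \<pi> w" "?m < j" for j using that W(3) WV by (auto simp: D_def)
    let ?A = "{u\<in>block_of \<pi> w. Min V' \<le> u}"
    have A: "finite ?A" "faces ?A Z" "k \<in> ?A" "w \<in> ?A"
      using finite_subset[OF W(3) nc_finite[OF S(1)]] faces_mono[OF Z, of ?A] W kk wS m'(1) by (auto simp: subset_iff)
    have base: "moment \<pi> S Z = moment \<pi> ?C (Z(k := T * Z k))"
      using rec(2)[OF B k_def[unfolded w_def D_def], of Z] by (simp add: T_def)
    have UW: "U = block_of \<pi> w" if "U \<in> blocks \<pi> ?C" "k \<in> U \<or> w \<in> U" for U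
    proof -
      have "U \<in> \<pi>" using that(1) by (simp add: blocks_def)
      then show ?thesis using nc_disj[OF S(1) _ W(1)] that(2) kk(1) W(2) by blast
    qed
    have up: "time_prod ?A (Z(k := T * Z k)) = time_prod_ins ?A k T Z" by (rule time_prod_upd_left[OF A(1,3)])
    show ?thesis
    proof (cases "\<chi> ! ?m")
      case Lft
      have w: "w = cmin D" and T: "T = lop ?c" using Lft by (simp_all add: w_def T_def)
      have "moment \<pi> ?C (Z(k := T * Z k)) = moment \<pi> ?C (Z(w := lact w ?c (Z w)))"
      proof (rule cong)
        fix U X assume "U \<in> blocks \<pi> ?C" "k \<in> U \<or> w \<in> U"
        then have U: "U = block_of \<pi> w" by (rule UW)
        show "E (X * time_prod {u\<in>U. Min V' \<le> u} (Z(k := T * Z k))) = E (X * time_prod {u\<in>U. Min V' \<le> u} (Z(w := lact w ?c (Z w))))"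
          unfolding U up time_prod_lact[OF A(1,4)]
        proof (cases "\<chi> ! w")
          case wL: Lft
          \<comment> \<open>\<open>w\<close> is \<prec>-least among the later indices outside
            \<open>V\<close>, so from \<open>k\<close> up to \<open>w\<close> in time the block has
            only right entries, and these commute with left operators.\<close>
          have "time_prod_ins ?A k (lop ?c) Z = time_prod_ins ?A w (lop ?c) Z"
          proof (rule time_prod_ins_lop_move[OF A(1,2) kle[OF W(2) wS(3)]])
            fix i assume i: "i \<in> ?A" "k \<le> i" "i < w"
            then have "i \<in> D" using inD kk(2) by auto
            then show "\<chi> ! i = Rgt" using cmin(2)[OF finD, of i] w wL i(3) by (cases "\<chi> ! i") (auto simp: lt_iff)
          qed
          then show "E (X * time_prod_ins ?A k T Z) = E (X * (if \<chi> ! w = Lft then time_prod_ins ?A w (lop ?c) Z else time_prod_ins ?A (Suc w) (rop ?c) Z))"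
            using wL T by simp
        next
          case wR: Rgt
          \<comment> \<open>With \<open>w\<close> on the right, all later indices outside
            \<open>V\<close> are on the right and \<open>w\<close> is the latest of them. The
            operator therefore reaches the end of the product and changes side there.\<close>
          have R: "\<chi> ! i = Rgt \<and> i \<le> w" if "i \<in> D" for i
            using cmin(2)[OF finD that] w wR by (cases "\<chi> ! i") (auto simp: lt_iff)
          have le: "i < Suc w" if "i \<in> ?A" for i
            using R[OF inD, of i] that wS(3) by (cases "?m < i") auto
          have "time_prod_ins ?A k (lop ?c) Z = time_prod_ins ?A (Suc w) (lop ?c) Z"
            by (rule time_prod_ins_lop_move[OF A(1,2)]) (use kle[OF W(2) wS(3)] R inD kk(2) in auto)
          then show "E (X * time_prod_ins ?A k T Z) = E (X * (if \<chi> ! w = Lft then time_prod_ins ?A w (lop ?c) Z else time_prod_ins ?A (Suc w) (rop ?c) Z))"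
            using wR T time_prod_ins_end[of ?A "Suc w", OF le] E_end by simp
        qed
      qed (use m'(1) kk(2) wS(3) in auto)
      then show ?thesis using that[of w] last_succ[OF S(1) V Lft D_def Dne] wS base w by auto
    next
      case Rgt
      have w: "w = cmax D" and T: "T = rop ?c" using Rgt by (simp_all add: w_def T_def)
      have "moment \<pi> ?C (Z(k := T * Z k)) = moment \<pi> ?C (Z(w := ract w (Z w) ?c))"
      proof (rule cong)
        fix U X assume "U \<in> blocks \<pi> ?C" "k \<in> U \<or> w \<in> U"
        then have U: "U = block_of \<pi> w" by (rule UW)
        show "E (X * time_prod {u\<in>U. Min V' \<le> u} (Z(k := T * Z k))) = E (X * time_prod {u\<in>U. Min V' \<le> u} (Z(w := ract w (Z w) ?c)))"
          unfolding U up time_prod_ract[OF A(1,4)]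
        proof (cases "\<chi> ! w")
          case wR: Rgt
          have "time_prod_ins ?A k (rop ?c) Z = time_prod_ins ?A w (rop ?c) Z"
          proof (rule time_prod_ins_rop_move[OF A(1,2) kle[OF W(2) wS(3)]])
            fix i assume i: "i \<in> ?A" "k \<le> i" "i < w"
            then have "i \<in> D" using inD kk(2) by auto
            then show "\<chi> ! i = Lft" using cmax(2)[OF finD, of i] w wR i(3) by (cases "\<chi> ! i") (auto simp: lt_iff)
          qed
          then show "E (X * time_prod_ins ?A k T Z) = E (X * (if \<chi> ! w = Lft then time_prod_ins ?A (Suc w) (lop ?c) Z else time_prod_ins ?A w (rop ?c) Z))"
            using wR T by simp
        next
          case wL: Lft
          have R: "\<chi> ! i = Lft \<and> i \<le> w" if "i \<in> D" for i
            using cmax(2)[OF finD that] w wL by (cases "\<chi> ! i") (auto simp: lt_iff)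
          have le: "i < Suc w" if "i \<in> ?A" for i
            using R[OF inD, of i] that wS(3) by (cases "?m < i") auto
          have "time_prod_ins ?A k (rop ?c) Z = time_prod_ins ?A (Suc w) (rop ?c) Z"
            by (rule time_prod_ins_rop_move[OF A(1,2)]) (use kle[OF W(2) wS(3)] R inD kk(2) in auto)
          then show "E (X * time_prod_ins ?A k T Z) = E (X * (if \<chi> ! w = Lft then time_prod_ins ?A (Suc w) (lop ?c) Z else time_prod_ins ?A w (rop ?c) Z))"
            using wL T time_prod_ins_end[of ?A "Suc w", OF le] E_end by simp
        qed
      qed (use m'(1) kk(2) wS(3) in auto)
      then show ?thesis using that[of w] last_pred[OF S(1) V Rgt D_def Dne] wS base w by auto
    qed
  qed
qed

lemma moment_E_bal: "nc_on \<pi> S \<Longrightarrow> U \<subseteq> S \<Longrightarrow> balanced id U (moment_E U)"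
  by (rule moment_E_balanced) (use nc_finite finite_subset in blast)

text \<open>\<open>moment_shift\<close> puts the operator at a \<prec>-neighbour of the last block,
  where the insertion lemmas apply to the extension. Both sides thus lose the same block with the
  same value, and the new entry is again in its face.\<close>

lemma moment_inner_ext:
  assumes "nc_on \<pi> S" "S \<noteq> {}" "faces S Z"
  shows "moment \<pi> S Z = inner_ext moment_E \<pi> S Z"
  using assms
proof (induction "card S" arbitrary: S Z rule: less_induct)
  case less
  note S = less.prems(1) and ne = less.prems(2) and Z = less.prems(3)
  show ?case
  proof (cases "S \<in> \<pi>")
    case True
    then show ?thesis using moment_one[OF S ne] inner_ext_one[where g = moment_E, OF S True ne moment_E_local] by simp
  next
    case False
    obtain V where V: "is_last \<pi> S V" using ex_is_last[OF S ne] .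
    note Vd = is_lastD[OF S V]
    have c: "inner_ext moment_E \<pi> V Z = E (time_prod V Z)" by (rule inner_ext_one[where g = moment_E, OF Vd(5,1,3) moment_E_local])
    have C: "nc_on \<pi> (S - V)" using nc_Diff[OF S Vd(5)] .
    have cC: "card (S - V) < card S"
      by (rule psubset_card_mono[OF nc_finite[OF S]]) (use Vd(2,3) in blast)
    have neC: "S - V \<noteq> {}" using Vd False by auto
    have ZC: "faces (S - V) Z" using faces_mono[OF Z] by auto
    obtain p where p: "p \<in> S - V" "pred_of S V p \<and> moment \<pi> S Z = moment \<pi> (S - V) (Z(p := ract p (Z p) (E (time_prod V Z)))) \<or>
       succ_of S V p \<and> moment \<pi> S Z = moment \<pi> (S - V) (Z(p := lact p (E (time_prod V Z)) (Z p)))"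
      using moment_shift[OF S False V Z] .
    from p(2) show ?thesis
    proof (elim disjE conjE)
      assume a: "pred_of S V p" "moment \<pi> S Z = moment \<pi> (S - V) (Z(p := ract p (Z p) (E (time_prod V Z))))"
      have "inner_ext moment_E \<pi> S Z = inner_ext moment_E \<pi> (S - V) (Z(p := ract p (Z p) (inner_ext moment_E \<pi> V Z)))"
        by (rule inner_ext_insert_pred[OF moment_E_local moment_E_bal[OF S] S Vd(5,2,3) a(1) Z])
      then show ?thesis using less.hyps[OF cC C neC faces_ract[OF ZC p(1)]] a(2) by (simp add: c)
    next
      assume a: "succ_of S V p" "moment \<pi> S Z = moment \<pi> (S - V) (Z(p := lact p (E (time_prod V Z)) (Z p)))"
      have "inner_ext moment_E \<pi> S Z = inner_ext moment_E \<pi> (S - V) (Z(p := lact p (inner_ext moment_E \<pi> V Z) (Z p)))"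
        by (rule inner_ext_insert_succ[OF moment_E_local moment_E_bal[OF S] S Vd(5,2,3) a(1) Z])
      then show ?thesis using less.hyps[OF cC C neC faces_lact[OF ZC p(1)]] a(2) by (simp add: c)
    qed
  qed
qed

section \<open>Cumulants\<close>

text \<open>Unlike \<open>nc_on\<close>, membership determines all blocks, so that these families
  can be summed over and correspond to \<open>BNC (sides S)\<close>.\<close>

definition NC :: "nat set \<Rightarrow> nat set set set" where
  "NC S = {\<pi>. partition_on S \<pi> \<and> nc_on \<pi> S}"

lemma NC_D: "\<pi> \<in> NC S \<Longrightarrow> partition_on S \<pi>" "\<pi> \<in> NC S \<Longrightarrow> nc_on \<pi> S"
  by (simp_all add: NC_def)

lemma NC_blocks: "\<pi> \<in> NC S \<Longrightarrow> blocks \<pi> S = \<pi>"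
  by (auto simp: NC_def blocks_def partition_on_def)

lemma blocks_NC:
  assumes "nc_on \<pi> S"
  shows "blocks \<pi> S \<in> NC S"
proof -
  have sub: "blocks \<pi> S \<subseteq> \<pi>" by (auto simp: blocks_def)
  have "nc_fam (blocks \<pi> S)" using nc_fam[OF assms] sub unfolding nc_fam_def by (meson subsetD)
  moreover have ex: "\<exists>U\<in>blocks \<pi> S. i \<in> U \<and> U \<subseteq> S" if "i \<in> S" for i
    using nc_ex[OF assms that] by (auto simp: blocks_def)
  ultimately have "nc_on (blocks \<pi> S) S" using nc_dom[OF assms] by (simp add: nc_on_def)
  moreover have "\<Union>(blocks \<pi> S) = S" using ex by (auto simp: blocks_def)
  moreover have "disjoint (blocks \<pi> S)"
  proof (rule disjointI)
    fix X Y assume "X \<in> blocks \<pi> S" "Y \<in> blocks \<pi> S" "X \<noteq> Y"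
    then show "X \<inter> Y = {}" using nc_disj[OF assms, of X Y] sub by auto
  qed
  moreover have "{} \<notin> blocks \<pi> S" by (simp add: blocks_def)
  ultimately show ?thesis by (simp add: NC_def partition_on_def)
qed

lemma blocks_idem: "blocks (blocks \<pi> S) S = blocks \<pi> S"
  by (auto simp: blocks_def)

lemma restrict_part_blocks_eq: "nc_on \<pi> S \<Longrightarrow> restrict_part S (blocks \<pi> S) = restrict_part S \<pi>"
  using restrict_part_blocks[OF NC_D(2)[OF blocks_NC]] restrict_part_blocks blocks_idem by simp

lemma finite_NC: "S \<subseteq> {..<length \<chi>} \<Longrightarrow> finite (NC S)"
  by (rule finite_subset[of _ "Pow (Pow S)"]) (auto simp: NC_def partition_on_def intro: finite_subset)

lemma restrict_part_bij:
  assumes S: "S \<subseteq> {..<length \<chi>}"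
  shows "bij_betw (restrict_part S) (NC S) (BNC (sides S))"
proof (rule bij_betwI')
  fix \<pi> \<sigma> assume ps: "\<pi> \<in> NC S" "\<sigma> \<in> NC S"
  have inj: "inj_on (\<lambda>U. relabel S ` U) (Pow S)" by (rule inj_on_image_Pow[OF relabel_inj_on])
  have "\<pi> \<subseteq> Pow S" "\<sigma> \<subseteq> Pow S" using ps by (auto simp: NC_def partition_on_def)
  then show "(restrict_part S \<pi> = restrict_part S \<sigma>) = (\<pi> = \<sigma>)"
    using inj_on_image_eq_iff[OF inj] by (simp add: restrict_part_blocks[OF NC_D(2)] ps NC_blocks)
next
  show "\<pi> \<in> NC S \<Longrightarrow> restrict_part S \<pi> \<in> BNC (sides S)" for \<pi> using restrict_part_nc_BNC NC_D(2) by blast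
next
  fix \<sigma> assume \<sigma>: "\<sigma> \<in> BNC (sides S)"
  define pb where "pb U = {i\<in>S. relabel S i \<in> U}" for U
  have img: "relabel S ` pb U = U" if "U \<in> \<sigma>" for U
    using BNC_D(7)[OF \<sigma> that] relabel_img[OF S] length_sides[OF S] by (auto simp: pb_def)
  let ?\<pi> = "pb ` \<sigma>"
  have nc: "nc_on ?\<pi> S"
    unfolding nc_on_def nc_fam_def
  proof (intro conjI ballI allI impI)
    fix i assume i: "i \<in> S"
    then have "relabel S i \<in> {..<length (sides S)}" using relabel_img[OF S] length_sides[OF S] by auto
    then obtain U where "U \<in> \<sigma>" "relabel S i \<in> U" using BNC_D(2)[OF \<sigma>] by auto
    then show "\<exists>U\<in>?\<pi>. i \<in> U \<and> U \<subseteq> S" using i by (auto simp: pb_def)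
  next
    fix U W i assume "U \<in> ?\<pi>" "W \<in> ?\<pi>" "i \<in> U" "i \<in> W"
    then obtain U' W' where "U' \<in> \<sigma>" "W' \<in> \<sigma>" "U = pb U'" "W = pb W'" "relabel S i \<in> U'" "relabel S i \<in> W'"
      by (auto simp: pb_def)
    then show "U = W" using BNC_disjoint[OF \<sigma>] by metis
  next
    fix U W a b c d assume "U \<in> ?\<pi>" "W \<in> ?\<pi>" and m: "a \<in> U" "b \<in> W" "c \<in> U" "d \<in> W" "a \<prec> b" "b \<prec> c" "c \<prec> d"
    then obtain U' W' where UW: "U' \<in> \<sigma>" "W' \<in> \<sigma>" "U = pb U'" "W = pb W'" by auto
    then have "a \<in> S" "b \<in> S" "c \<in> S" "d \<in> S" "relabel S a \<in> U'" "relabel S b \<in> W'" "relabel S c \<in> U'" "relabel S d \<in> W'"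
      using m by (auto simp: pb_def)
    then show "U = W"
      using BNC_noncrossing[OF \<sigma> UW(1,2), of "relabel S a" "relabel S b" "relabel S c" "relabel S d"] m UW chi_less_relabel[OF S] by auto
  qed (use S in auto)
  have sub: "pb U \<subseteq> S \<and> pb U \<noteq> {}" if "U \<in> \<sigma>" for U
  proof
    show "pb U \<subseteq> S" by (auto simp: pb_def)
    have "U \<noteq> {}" using BNC_D(4)[OF \<sigma>] that by auto
    then show "pb U \<noteq> {}" using img[OF that] by (metis image_is_empty)
  qed
  then have bl: "blocks ?\<pi> S = ?\<pi>" by (auto simp: blocks_def)
  then have "?\<pi> \<in> NC S" using blocks_NC[OF nc] by simp
  moreover have "restrict_part S ?\<pi> = \<sigma>" unfolding restrict_part_blocks[OF nc] bl image_image using img by simp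
  ultimately show "\<exists>\<pi>\<in>NC S. \<sigma> = restrict_part S \<pi>" by blast
qed

lemma refines_restrict_part:
  assumes S: "S \<subseteq> {..<length \<chi>}" and "\<sigma> \<in> NC S" "\<pi> \<in> NC S"
  shows "refinement (sides S) (restrict_part S \<sigma>) (restrict_part S \<pi>) \<longleftrightarrow> refines S \<sigma> \<pi>"
proof -
  have p: "partition_on {..<length (sides S)} (restrict_part S \<sigma>)" "partition_on {..<length (sides S)} (restrict_part S \<pi>)"
    using restrict_part_nc_BNC[OF NC_D(2)[OF assms(2)]] restrict_part_nc_BNC[OF NC_D(2)[OF assms(3)]] by (simp_all add: BNC_def)
  have sub: "U \<in> \<sigma> \<Longrightarrow> U \<subseteq> S" "U \<in> \<pi> \<Longrightarrow> U \<subseteq> S" for U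
    using assms(2,3) by (auto simp: NC_def partition_on_def)
  have iff: "relabel S ` U \<subseteq> relabel S ` W \<longleftrightarrow> U \<subseteq> W" if "U \<subseteq> S" "W \<subseteq> S" for U W
    unfolding image_subset_iff using that relabel_mem_iff[OF S that(2)] by blast
  have "(\<forall>X\<in>restrict_part S \<sigma>. \<exists>Y\<in>restrict_part S \<pi>. X \<subseteq> Y) \<longleftrightarrow> (\<forall>X\<in>\<sigma>. \<exists>Y\<in>\<pi>. X \<subseteq> Y)"
    using sub iff by (simp add: restrict_part_blocks[OF NC_D(2)] assms NC_blocks)
  then show ?thesis using p NC_D(1)[OF assms(2)] NC_D(1)[OF assms(3)] by (simp add: refines_def)
qed

definition below :: "nat set \<Rightarrow> nat set set \<Rightarrow> nat set set set" where
  "below S \<pi> = {\<sigma> \<in> NC S. refines S \<sigma> \<pi>}"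

lemma sum_below:
  assumes S: "S \<subseteq> {..<length \<chi>}" and \<pi>: "\<pi> \<in> NC S"
  shows "(\<Sum>\<sigma> \<in> {\<sigma> \<in> BNC (sides S). refinement (sides S) \<sigma> (restrict_part S \<pi>)}. f \<sigma>) = (\<Sum>\<sigma>\<in>below S \<pi>. f (restrict_part S \<sigma>))"
proof (rule sum.reindex_bij_betw[symmetric])
  have "bij_betw (restrict_part S) (below S \<pi>) (restrict_part S ` below S \<pi>)"
    by (rule bij_betw_subset[OF restrict_part_bij[OF S]]) (auto simp: below_def)
  moreover have "restrict_part S ` below S \<pi> = {\<sigma> \<in> BNC (sides S). refinement (sides S) \<sigma> (restrict_part S \<pi>)}"
  proof (intro set_eqI iffI)
    fix \<tau> assume "\<tau> \<in> restrict_part S ` below S \<pi>"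
    then obtain \<sigma> where s: "\<sigma> \<in> NC S" "refines S \<sigma> \<pi>" "\<tau> = restrict_part S \<sigma>" by (auto simp: below_def)
    then show "\<tau> \<in> {\<sigma> \<in> BNC (sides S). refinement (sides S) \<sigma> (restrict_part S \<pi>)}"
      using refines_restrict_part[OF S s(1) \<pi>] restrict_part_nc_BNC[OF NC_D(2)[OF s(1)]] by simp
  next
    fix \<tau> assume t: "\<tau> \<in> {\<sigma> \<in> BNC (sides S). refinement (sides S) \<sigma> (restrict_part S \<pi>)}"
    then have "\<tau> \<in> restrict_part S ` NC S" using bij_betw_imp_surj_on[OF restrict_part_bij[OF S]] by simp
    then obtain \<sigma> where s: "\<sigma> \<in> NC S" "\<tau> = restrict_part S \<sigma>" by auto
    then show "\<tau> \<in> restrict_part S ` below S \<pi>" using refines_restrict_part[OF S s(1) \<pi>] t by (auto simp: below_def)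
  qed
  ultimately show "bij_betw (restrict_part S) (below S \<pi>) {\<sigma> \<in> BNC (sides S). refinement (sides S) \<sigma> (restrict_part S \<pi>)}" by simp
qed

definition cumulant :: "nat set set \<Rightarrow> nat set \<Rightarrow> (nat \<Rightarrow> 'a) \<Rightarrow> 'b" where
  "cumulant \<pi> S Z = bi_cumulant \<epsilon> E (sides S) (restrict_part S \<pi>) (tuple Z S)"

abbreviation block_cumulant :: "nat set \<Rightarrow> (nat \<Rightarrow> 'a) \<Rightarrow> 'b" where "block_cumulant S Z \<equiv> cumulant {S} S Z"

lemma tuple_local: "(\<And>i. i \<in> S \<Longrightarrow> Z i = Z' i) \<Longrightarrow> tuple Z S = tuple Z' S"
  by (auto simp: nths_map set_nths)

lemma block_cumulant_local: "local_on S (block_cumulant S)"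
  unfolding local_on_def cumulant_def by (intro allI impI arg_cong[of _ _ "bi_cumulant _ _ _ _"] tuple_local) simp

lemma cumulant_blocks: "nc_on \<pi> S \<Longrightarrow> cumulant \<pi> S Z = cumulant (blocks \<pi> S) S Z"
  by (simp add: cumulant_def restrict_part_blocks_eq)

lemma sum_cumulant:
  assumes "\<pi> \<in> NC S" "S \<noteq> {}" "faces S Z"
  shows "(\<Sum>\<sigma>\<in>below S \<pi>. cumulant \<sigma> S Z) = inner_ext moment_E \<pi> S Z"
proof -
  note d = nc_dom[OF NC_D(2)[OF assms(1)]]
  have "(\<Sum>\<sigma>\<in>below S \<pi>. cumulant \<sigma> S Z) =
      (\<Sum>\<sigma> \<in> {\<sigma> \<in> BNC (sides S). refinement (sides S) \<sigma> (restrict_part S \<pi>)}. bi_cumulant \<epsilon> E (sides S) \<sigma> (tuple Z S))"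
    unfolding cumulant_def by (rule sum_below[OF d assms(1), symmetric])
  also have "\<dots> = moment \<pi> S Z"
    unfolding moment_def by (rule sum_bi_cumulant[OF restrict_part_nc_BNC[OF NC_D(2)[OF assms(1)]]])
  finally show ?thesis using moment_inner_ext[OF NC_D(2)[OF assms(1)] assms(2,3)] by simp
qed

lemma cumulant_eq:
  assumes "\<pi> \<in> NC S" "S \<noteq> {}" "faces S Z"
  shows "cumulant \<pi> S Z = (\<Sum>\<sigma>\<in>below S \<pi>. of_int (mu_BNC (sides S) (restrict_part S \<sigma>) (restrict_part S \<pi>)) *\<^sub>C inner_ext moment_E \<sigma> S Z)"
proof -
  note d = nc_dom[OF NC_D(2)[OF assms(1)]]
  show ?thesis
    unfolding cumulant_def bi_cumulant_def sum_below[OF d assms(1)]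
    by (rule sum.cong[OF refl]) (use moment_inner_ext[OF NC_D(2) assms(2,3)] in \<open>auto simp: below_def moment_def\<close>)
qed

lemma balanced_empty: "balanced j {} f" and linear_empty: "linear_on {} f"
  by (auto simp: balanced_def linear_on_def)

text \<open>Equality with the combination is asked on faces only. This suffices because the actions
  keep entries in their faces, and it matches \<open>moment_inner_ext\<close>, which compares the
  moments with the extension on faces.\<close>

lemma balanced_sum:
  assumes "\<And>\<sigma>. \<sigma> \<in> A \<Longrightarrow> balanced j S (f \<sigma>)" "S \<noteq> {}" "finite S"
    and eq: "\<And>Z. faces S Z \<Longrightarrow> g Z = (\<Sum>\<sigma>\<in>A. c \<sigma> *\<^sub>C f \<sigma> Z)"
  shows "balanced j S g"
  unfolding balanced_def
proof (intro allI impI conjI ballI)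
  fix Z b assume Z: "faces S Z"
  have m: "cmin S \<in> S" "cmax S \<in> S" using cmin cmax assms(2,3) by auto
  have "(\<Sum>\<sigma>\<in>A. c \<sigma> *\<^sub>C f \<sigma> (Z(cmin S := lact (cmin S) b (Z (cmin S))))) = j b * (\<Sum>\<sigma>\<in>A. c \<sigma> *\<^sub>C f \<sigma> Z)"
    unfolding sum_distrib_left by (rule sum.cong[OF refl]) (simp add: balancedD(1)[OF assms(1) Z assms(2) refl] mult_scaleC_right)
  then show "g (Z(cmin S := lact (cmin S) b (Z (cmin S)))) = j b * g Z"
    using eq[OF Z] eq[OF faces_lact[OF Z m(1)]] by simp
  have "(\<Sum>\<sigma>\<in>A. c \<sigma> *\<^sub>C f \<sigma> (Z(cmax S := ract (cmax S) (Z (cmax S)) b))) = (\<Sum>\<sigma>\<in>A. c \<sigma> *\<^sub>C f \<sigma> Z) * j b"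
    unfolding sum_distrib_right by (rule sum.cong[OF refl]) (simp add: balancedD(2)[OF assms(1) Z assms(2) refl] mult_scaleC_left)
  then show "g (Z(cmax S := ract (cmax S) (Z (cmax S)) b)) = g Z * j b"
    using eq[OF Z] eq[OF faces_ract[OF Z m(2)]] by simp
  fix p q assume pq: "p \<in> S" "q \<in> S" "p \<prec> q \<and> (\<forall>i\<in>S. \<not> (p \<prec> i \<and> i \<prec> q))"
  have "(\<Sum>\<sigma>\<in>A. c \<sigma> *\<^sub>C f \<sigma> (Z(p := ract p (Z p) b))) = (\<Sum>\<sigma>\<in>A. c \<sigma> *\<^sub>C f \<sigma> (Z(q := lact q b (Z q))))"
  proof (rule sum.cong[OF refl])
    fix \<sigma> assume "\<sigma> \<in> A"
    then show "c \<sigma> *\<^sub>C f \<sigma> (Z(p := ract p (Z p) b)) = c \<sigma> *\<^sub>C f \<sigma> (Z(q := lact q b (Z q)))"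
      using balancedD(3)[OF assms(1) Z pq(1,2)] pq(3) by metis
  qed
  then show "g (Z(p := ract p (Z p) b)) = g (Z(q := lact q b (Z q)))"
    using eq[OF faces_ract[OF Z pq(1)]] eq[OF faces_lact[OF Z pq(2)]] by simp
qed

lemma linear_sum:
  assumes f: "\<And>\<sigma>. \<sigma> \<in> A \<Longrightarrow> linear_on S (f \<sigma>)"
    and eq: "\<And>Z. faces S Z \<Longrightarrow> g Z = (\<Sum>\<sigma>\<in>A. c \<sigma> *\<^sub>C f \<sigma> Z)"
  shows "linear_on S g"
  unfolding linear_on_def
proof (intro allI impI ballI)
  fix Z i X Y a assume Z: "faces S Z" and i: "i \<in> S" and XY: "X \<in> face_at i" "Y \<in> face_at i"
  have e: "g (Z(i := v)) = (\<Sum>\<sigma>\<in>A. c \<sigma> *\<^sub>C f \<sigma> (Z(i := v)))" if "v \<in> face_at i" for v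
    by (rule eq[OF faces_upd[OF Z that]])
  have "(\<Sum>\<sigma>\<in>A. c \<sigma> *\<^sub>C f \<sigma> (Z(i := X + Y))) = (\<Sum>\<sigma>\<in>A. c \<sigma> *\<^sub>C f \<sigma> (Z(i := X)) + c \<sigma> *\<^sub>C f \<sigma> (Z(i := Y)))"
    by (rule sum.cong[OF refl]) (simp add: linear_onD(1)[OF f Z i XY] scaleC_add_right)
  moreover have "(\<Sum>\<sigma>\<in>A. c \<sigma> *\<^sub>C f \<sigma> (Z(i := a *\<^sub>C X))) = (\<Sum>\<sigma>\<in>A. a *\<^sub>C (c \<sigma> *\<^sub>C f \<sigma> (Z(i := X))))"
    by (rule sum.cong[OF refl]) (simp add: linear_onD(2)[OF f Z i XY(1)] scaleC_scaleC mult.commute)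
  ultimately show "g (Z(i := X + Y)) = g (Z(i := X)) + g (Z(i := Y)) \<and> g (Z(i := a *\<^sub>C X)) = a *\<^sub>C g (Z(i := X))"
    using XY face_add face_scale by (simp add: e sum.distrib complex_alg.scale_sum_right)
qed

text \<open>A cumulant is a combination of extended moments with coefficients independent of the
  entries. This makes one-block cumulants admissible data for the insertion lemmas before any
  multiplicativity of cumulants is known.\<close>

lemma cumulant_balanced:
  assumes "\<pi> \<in> NC S"
  shows "balanced id S (cumulant \<pi> S)"
proof (cases "S = {}")
  case False
  note nc = NC_D(2)[OF assms]
  show ?thesis
  proof (rule balanced_sum[OF _ False nc_finite[OF nc] cumulant_eq[OF assms False]])
    fix \<sigma> assume "\<sigma> \<in> below S \<pi>"
    then have s: "nc_on \<sigma> S" using NC_D(2) by (simp add: below_def)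
    show "balanced id S (inner_ext moment_E \<sigma> S)" by (rule inner_ext_balanced[OF moment_E_local s moment_E_bal[OF s]])
  qed
qed (simp add: balanced_empty)

lemma cumulant_linear:
  assumes "\<pi> \<in> NC S"
  shows "linear_on S (cumulant \<pi> S)"
proof (cases "S = {}")
  case False
  show ?thesis
  proof (rule linear_sum[OF _ cumulant_eq[OF assms False]])
    fix \<sigma> assume "\<sigma> \<in> below S \<pi>"
    then have s: "nc_on \<sigma> S" using NC_D(2) by (simp add: below_def)
    show "linear_on S (inner_ext moment_E \<sigma> S)"
      by (rule inner_ext_linear[OF moment_E_local s moment_E_linear]) (rule finite_subset[OF _ nc_finite[OF s]])
  qed
qed (simp add: linear_empty)

lemma one_NC: "S \<subseteq> {..<length \<chi>} \<Longrightarrow> S \<noteq> {} \<Longrightarrow> {S} \<in> NC S"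
  using nc_on_single by (simp add: NC_def partition_on_def)

lemma block_cumulant_balanced: "S \<subseteq> {..<length \<chi>} \<Longrightarrow> balanced id S (block_cumulant S)"
  using cumulant_balanced[OF one_NC] balanced_empty by (cases "S = {}") auto

lemma block_cumulant_linear: "S \<subseteq> {..<length \<chi>} \<Longrightarrow> linear_on S (block_cumulant S)"
  using cumulant_linear[OF one_NC] linear_empty by (cases "S = {}") auto

section \<open>Refinements and removal of a gap\<close>

lemma ex_gap:
  assumes S: "nc_on \<pi> S" "S \<noteq> {}" "S \<notin> \<pi>"
  obtains i V where "nc_on \<pi> V" "V \<subseteq> S" "V \<noteq> {}" "pred_of S V i"
proof -
  let ?U = "first_block \<pi> S"
  note U = first_block[OF S(1,2)]
  have "?U \<noteq> S" using U(1) S(3) by auto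
  then obtain j where "j \<in> S" "j \<notin> ?U" using U(3) by auto
  then obtain i where i: "i \<in> ?U" "j \<in> gap S ?U i" using gap_cover[OF S(1)] by blast
  let ?V = "gap S ?U i"
  \<comment> \<open>What lies behind \<open>i\<close> outside the gap is at or behind an element of
    the block that follows the whole gap. If \<open>i\<close> is the last element of the block, the
    gap is the tail.\<close>
  have "pred_of S ?V i"
    unfolding pred_of_def
  proof (intro conjI ballI)
    show "i \<in> S - ?V" using i(1) U(3) gap_disj by blast
    show "i \<prec> v" if "v \<in> ?V" for v using that by (simp add: gap_def)
    fix j assume j: "j \<in> S - ?V"
    show "j = i \<or> j \<prec> i \<or> (\<forall>v\<in>?V. v \<prec> j)"
    proof (cases "i \<prec> j")
      case True
      then obtain u where u: "u \<in> ?U" "i \<prec> u" "\<not> j \<prec> u" using j by (auto simp: gap_def)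
      have "v \<prec> j" if "v \<in> ?V" for v
      proof -
        have "v \<prec> u" using that u by (simp add: gap_def)
        then show ?thesis using u(3) chi_less_total[of j u \<chi>] chi_less_trans[of \<chi> v u j] by auto
      qed
      then show ?thesis by simp
    next
      case False
      then show ?thesis using chi_less_total[of i j \<chi>] by auto
    qed
  qed
  then show ?thesis using that[OF nc_gap[OF S(1,2) i(1)] gap_sub] i(2) by blast
qed

text \<open>The action is linear in the absorbed scalar, so linearity of \<open>f\<close> in one
  entry passes to sums of scalars; the empty sum is homogeneity with the factor 0.\<close>

lemma linear_on_sum:
  assumes f: "linear_on S f" and Z: "faces S Z" and i: "i \<in> S" and A: "finite A"
  shows "f (Z(i := ract i (Z i) (\<Sum>a\<in>A. c a))) = (\<Sum>a\<in>A. f (Z(i := ract i (Z i) (c a))))"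
  using A
proof (induction A rule: finite_induct)
  case empty
  have face_at: "ract i (Z i) x \<in> face_at i" for x by (rule face_closed(1)[OF facesD[OF Z i]])
  have "ract i (Z i) 0 = 0 *\<^sub>C ract i (Z i) 0" by (simp flip: action_simps(9))
  then have "f (Z(i := ract i (Z i) 0)) = 0 *\<^sub>C f (Z(i := ract i (Z i) 0))"
    using linear_onD(2)[OF f Z i face_at, of 0 0] by simp
  then show ?case by (simp only: sum.empty complex_alg.scale_zero_left)
next
  case (insert a A)
  have face_at: "ract i (Z i) x \<in> face_at i" for x by (rule face_closed(1)[OF facesD[OF Z i]])
  show ?case
    by (simp only: sum.insert[OF insert.hyps] action_simps(7) linear_onD(1)[OF f Z i face_at face_at] insert.IH)
qed

context
  fixes \<pi> S V W
  assumes \<pi>: "\<pi> \<in> NC S" and V: "nc_on \<pi> V" "V \<subseteq> S" and W: "W = S - V"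
begin

text \<open>Blocks of \<tau> and \<rho> cannot cross, as they lie in different blocks of \<pi>, one
  inside \<open>V\<close> and the other inside \<open>W\<close>.\<close>

lemma below_union:
  assumes "\<tau> \<in> below V (blocks \<pi> V)" "\<rho> \<in> below W (blocks \<pi> W)"
  shows "\<tau> \<union> \<rho> \<in> below S \<pi>" "blocks (\<tau> \<union> \<rho>) V = \<tau>" "blocks (\<tau> \<union> \<rho>) W = \<rho>"
    "nc_on (\<tau> \<union> \<rho>) V" "nc_on (\<tau> \<union> \<rho>) W"
proof -
  note nc = NC_D(2)[OF \<pi>]
  have \<tau>: "\<tau> \<in> NC V" "refines V \<tau> (blocks \<pi> V)" and \<rho>: "\<rho> \<in> NC W" "refines W \<rho> (blocks \<pi> W)"
    using assms by (auto simp: below_def)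
  have pt: "\<Union>\<tau> = V" "{} \<notin> \<tau>" "disjoint \<tau>" "\<Union>\<rho> = W" "{} \<notin> \<rho>" "disjoint \<rho>"
    using \<tau>(1) \<rho>(1) by (auto simp: NC_def partition_on_def)
  have VW: "V \<inter> W = {}" "V \<union> W = S" using V W by auto
  have part: "partition_on S (\<tau> \<union> \<rho>)"
    unfolding partition_on_def
  proof (intro conjI)
    show "disjoint (\<tau> \<union> \<rho>)"
      by (rule disjoint_union[OF pt(3,6)]) (simp add: pt VW)
  qed (use pt VW in auto)
  have up\<tau>: "\<exists>P\<in>\<pi>. X \<subseteq> P \<and> P \<subseteq> V" if "X \<in> \<tau>" for X
    using \<tau>(2) that by (auto simp: refines_def blocks_def)
  have up\<rho>: "\<exists>P\<in>\<pi>. X \<subseteq> P \<and> P \<subseteq> W" if "X \<in> \<rho>" for X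
    using \<rho>(2) that by (auto simp: refines_def blocks_def)
  have sub\<tau>: "X \<subseteq> V" "X \<noteq> {}" if "X \<in> \<tau>" for X using that pt by auto
  have sub\<rho>: "X \<subseteq> W" "X \<noteq> {}" if "X \<in> \<rho>" for X using that pt by auto
  have mixed: False
    if X: "X \<in> \<tau>" "Y \<in> \<rho>" and m: "a \<in> X" "b \<in> Y" "c \<in> X" "d \<in> Y" and
      c: "(a \<prec> b \<and> b \<prec> c \<and> c \<prec> d) \<or> (b \<prec> a \<and> a \<prec> d \<and> d \<prec> c)" for X Y a b c d
  proof -
    obtain P where P: "P \<in> \<pi>" "X \<subseteq> P" "P \<subseteq> V" using up\<tau>[OF X(1)] by auto
    obtain Q where Q: "Q \<in> \<pi>" "Y \<subseteq> Q" "Q \<subseteq> W" using up\<rho>[OF X(2)] by auto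
    have mP: "a \<in> P" "c \<in> P" "b \<in> Q" "d \<in> Q" using m P Q by auto
    have "P = Q"
      using c nc_cross[OF nc P(1) Q(1) mP(1,3,2,4)] nc_cross[OF nc Q(1) P(1) mP(3,1,4,2)] by auto
    then show False using mP P Q VW by auto
  qed
  have fam: "nc_fam (\<tau> \<union> \<rho>)"
    unfolding nc_fam_def
  proof (intro conjI ballI allI impI)
    fix X Y i assume "X \<in> \<tau> \<union> \<rho>" "Y \<in> \<tau> \<union> \<rho>" "i \<in> X" "i \<in> Y"
    then show "X = Y" using disjointD[of "\<tau> \<union> \<rho>" X Y] part unfolding partition_on_def by auto
  next
    fix X Y a b c d
    assume XY: "X \<in> \<tau> \<union> \<rho>" "Y \<in> \<tau> \<union> \<rho>" and m: "a \<in> X" "b \<in> Y" "c \<in> X" "d \<in> Y"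
      and l: "a \<prec> b" "b \<prec> c" "c \<prec> d"
    consider "X \<in> \<tau>" "Y \<in> \<tau>" | "X \<in> \<rho>" "Y \<in> \<rho>" | "X \<in> \<tau>" "Y \<in> \<rho>" | "X \<in> \<rho>" "Y \<in> \<tau>" using XY by auto
    then show "X = Y"
    proof cases
      case 1
      then show ?thesis using nc_cross[OF NC_D(2)[OF \<tau>(1)] _ _ m l] by simp
    next
      case 2
      then show ?thesis using nc_cross[OF NC_D(2)[OF \<rho>(1)] _ _ m l] by simp
    next
      case 3
      then show ?thesis using mixed[OF 3 m] l by simp
    next
      case 4
      then show ?thesis using mixed[OF 4(2,1) m(2,1,4,3)] l by simp
    qed
  qed
  have bl\<tau>: "\<exists>U\<in>\<tau> \<union> \<rho>. i \<in> U \<and> U \<subseteq> V" if "i \<in> V" for i using that pt by blast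
  have bl\<rho>: "\<exists>U\<in>\<tau> \<union> \<rho>. i \<in> U \<and> U \<subseteq> W" if "i \<in> W" for i using that pt by blast
  show nV: "nc_on (\<tau> \<union> \<rho>) V" and nW: "nc_on (\<tau> \<union> \<rho>) W"
    using bl\<tau> bl\<rho> fam nc_dom[OF NC_D(2)[OF \<tau>(1)]] nc_dom[OF NC_D(2)[OF \<rho>(1)]] by (simp_all add: nc_on_def)
  have "nc_on (\<tau> \<union> \<rho>) S" using nc_Un[OF nV nW] VW(2) by simp
  moreover have "refines S (\<tau> \<union> \<rho>) \<pi>"
    unfolding refines_def
  proof (intro conjI ballI part NC_D(1)[OF \<pi>])
    fix X assume "X \<in> \<tau> \<union> \<rho>"
    then obtain P where "P \<in> \<pi>" "X \<subseteq> P" by (elim UnE) ((drule up\<tau> | drule up\<rho>), elim bexE conjE, rule that, assumption+)+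
    then show "\<exists>Y\<in>\<pi>. X \<subseteq> Y" by (rule bexI[rotated])
  qed
  ultimately show "\<tau> \<union> \<rho> \<in> below S \<pi>" using part by (simp add: below_def NC_def)
  show "blocks (\<tau> \<union> \<rho>) V = \<tau>" "blocks (\<tau> \<union> \<rho>) W = \<rho>"
  proof -
    have "\<not> X \<subseteq> W" if "X \<in> \<tau>" for X using sub\<tau>[OF that] VW(1) by auto
    then show "blocks (\<tau> \<union> \<rho>) W = \<rho>" using sub\<rho> by (auto simp: blocks_def)
    have "\<not> X \<subseteq> V" if "X \<in> \<rho>" for X using sub\<rho>[OF that] VW(1) by auto
    then show "blocks (\<tau> \<union> \<rho>) V = \<tau>" using sub\<tau> by (auto simp: blocks_def)
  qed
qed

lemma below_split:
  assumes "\<sigma> \<in> below S \<pi>"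
  shows "blocks \<sigma> V \<in> below V (blocks \<pi> V)" "blocks \<sigma> W \<in> below W (blocks \<pi> W)"
    "blocks \<sigma> V \<union> blocks \<sigma> W = \<sigma>"
proof -
  have \<sigma>: "\<sigma> \<in> NC S" "refines S \<sigma> \<pi>" using assms by (auto simp: below_def)
  note nc = NC_D(2)[OF \<pi>]
  have pt: "\<Union>\<sigma> = S" "{} \<notin> \<sigma>" using \<sigma>(1) by (auto simp: NC_def partition_on_def)
  have nW: "nc_on \<pi> W" using nc_Diff[OF nc V(1)] W by simp
  have up: "\<exists>P\<in>\<pi>. X \<subseteq> P" if "X \<in> \<sigma>" for X using \<sigma>(2) that by (simp add: refines_def)
  have dich: "X \<subseteq> V \<or> X \<subseteq> W" if X: "X \<in> \<sigma>" for X
  proof -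
    obtain P where P: "P \<in> \<pi>" "X \<subseteq> P" using up[OF X] by auto
    show ?thesis
    proof (cases "P \<inter> V = {}")
      case True
      then show ?thesis using P pt X W by auto
    next
      case False
      then obtain i where "i \<in> P" "i \<in> V" by auto
      then have "P \<subseteq> V" using nc_block_sub[OF V(1) P(1)] by blast
      then show ?thesis using P by auto
    qed
  qed
  show "blocks \<sigma> V \<union> blocks \<sigma> W = \<sigma>" using dich pt(2) by (auto simp: blocks_def)
  have sub: "nc_on \<sigma> T" if "T = V \<or> T = W" for T
  proof (rule nc_sub[OF NC_D(2)[OF \<sigma>(1)]])
    show "T \<subseteq> S" using that V W by auto
    fix i assume i: "i \<in> T"
    then have "i \<in> \<Union>\<sigma>" using pt(1) that V(2) W by auto
    then obtain X where X: "X \<in> \<sigma>" "i \<in> X" by auto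
    then show "\<exists>U\<in>\<sigma>. i \<in> U \<and> U \<subseteq> T" using dich[OF X(1)] i that W by blast
  qed
  have ref: "refines T (blocks \<sigma> T) (blocks \<pi> T)" if T: "nc_on \<pi> T" "nc_on \<sigma> T" for T
    unfolding refines_def
  proof (intro conjI ballI)
    show "partition_on T (blocks \<sigma> T)" "partition_on T (blocks \<pi> T)"
      using NC_D(1) blocks_NC T by auto
    fix X assume "X \<in> blocks \<sigma> T"
    then have X: "X \<in> \<sigma>" "X \<subseteq> T" "X \<noteq> {}" by (auto simp: blocks_def)
    obtain P where P: "P \<in> \<pi>" "X \<subseteq> P" using up[OF X(1)] by auto
    obtain i where i: "i \<in> X" using X by auto
    then have "P \<subseteq> T" using nc_block_sub[OF T(1) P(1)] P(2) X(2) by blast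
    then show "\<exists>Y\<in>blocks \<pi> T. X \<subseteq> Y" using P i by (auto simp: blocks_def)
  qed
  show "blocks \<sigma> V \<in> below V (blocks \<pi> V)" "blocks \<sigma> W \<in> below W (blocks \<pi> W)"
    using blocks_NC[OF sub] ref[OF V(1) sub] ref[OF nW sub] by (auto simp: below_def)
qed

text \<open>\<open>V\<close> and \<open>W\<close> are unions of blocks of \<pi>, so each block of a
  refinement lies in one of them: refinements of \<pi> are exactly the unions of refinements of the
  two parts.\<close>

lemma sum_below_split:
  "(\<Sum>\<sigma>\<in>below S \<pi>. f \<sigma>) = (\<Sum>\<tau>\<in>below V (blocks \<pi> V). \<Sum>\<rho>\<in>below W (blocks \<pi> W). f (\<tau> \<union> \<rho>))"
proof -
  have "(\<Sum>\<sigma>\<in>below S \<pi>. f \<sigma>) = (\<Sum>(\<tau>, \<rho>)\<in>below V (blocks \<pi> V) \<times> below W (blocks \<pi> W). f (\<tau> \<union> \<rho>))"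
  proof (rule sum.reindex_bij_witness[of _ "\<lambda>(\<tau>, \<rho>). \<tau> \<union> \<rho>" "\<lambda>\<sigma>. (blocks \<sigma> V, blocks \<sigma> W)"])
    fix \<sigma> assume s: "\<sigma> \<in> below S \<pi>"
    note b = below_split[OF s]
    show "(case (blocks \<sigma> V, blocks \<sigma> W) of (\<tau>, \<rho>) \<Rightarrow> \<tau> \<union> \<rho>) = \<sigma>"
      "(blocks \<sigma> V, blocks \<sigma> W) \<in> below V (blocks \<pi> V) \<times> below W (blocks \<pi> W)"
      "(case (blocks \<sigma> V, blocks \<sigma> W) of (\<tau>, \<rho>) \<Rightarrow> f (\<tau> \<union> \<rho>)) = f \<sigma>"
      using b by (simp_all only: prod.case mem_Times_iff fst_conv snd_conv)
  next
    fix p assume "p \<in> below V (blocks \<pi> V) \<times> below W (blocks \<pi> W)"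
    then obtain \<tau> \<rho> where p: "p = (\<tau>, \<rho>)" "\<tau> \<in> below V (blocks \<pi> V)" "\<rho> \<in> below W (blocks \<pi> W)" by auto
    note u = below_union[OF p(2,3)]
    show "(blocks (case p of (\<tau>, \<rho>) \<Rightarrow> \<tau> \<union> \<rho>) V, blocks (case p of (\<tau>, \<rho>) \<Rightarrow> \<tau> \<union> \<rho>) W) = p"
      "(case p of (\<tau>, \<rho>) \<Rightarrow> \<tau> \<union> \<rho>) \<in> below S \<pi>"
      unfolding p(1) prod.case using u(1) by (simp_all only: u(2,3))
  qed
  then show ?thesis unfolding sum.cartesian_product .
qed

end

lemma inner_ext_blocks: "nc_on \<pi> S \<Longrightarrow> inner_ext g (blocks \<pi> S) S Z = inner_ext g \<pi> S Z"
  by (rule inner_ext_part_cong[OF NC_D(2)[OF blocks_NC]]; simp add: blocks_def)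

lemma block_cumulant_bal: "nc_on \<pi> S \<Longrightarrow> U \<subseteq> S \<Longrightarrow> balanced id U (block_cumulant U)"
  by (rule block_cumulant_balanced) (drule nc_dom, erule (1) order_trans)

lemma finite_below:
  assumes "\<pi> \<in> NC S"
  shows "finite (below S \<pi>)"
  using finite_NC[OF nc_dom[OF NC_D(2)[OF assms]]] by (simp add: below_def)

lemma below_self:
  assumes "\<pi> \<in> NC S"
  shows "\<pi> \<in> below S \<pi>"
  using refines_refl[OF NC_D(1)[OF assms]] assms by (simp add: below_def)

text \<open>Induction on \<open>card S\<close> supplies the claim on the two parts of a split
  partition. On the one-block partition it holds by construction. For the others the total over all
  refinements is known on both sides, and a second induction, on the number of refinements, isolates
  the top term.\<close>

lemma cumulant_inner_ext:
  assumes "nc_on \<pi> S" "S \<noteq> {}" "faces S Z"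
  shows "cumulant \<pi> S Z = inner_ext block_cumulant \<pi> S Z"
  using assms
proof (induction "card S" arbitrary: \<pi> S Z rule: less_induct)
  case less
  note ne = less.prems(2) and Z = less.prems(3)
  note d = nc_dom[OF less.prems(1)]
  have IH: "cumulant \<sigma> T Y = inner_ext block_cumulant \<sigma> T Y" if "T \<subset> S" "nc_on \<sigma> T" "T \<noteq> {}" "faces T Y" for \<sigma> T Y
    by (rule less.hyps[OF psubset_card_mono[OF nc_finite[OF less.prems(1)] that(1)] that(2-4)])
  \<comment> \<open>Remove a gap \<open>V\<close>, expand the moments of both parts over their
    refinements, pull the inner sum out of the absorbed scalar by linearity, and reassemble each
    pair of refinements by insertion.\<close>
  have sum_ival: "(\<Sum>\<sigma>\<in>below S \<pi>. inner_ext block_cumulant \<sigma> S Z) = inner_ext moment_E \<pi> S Z" if \<pi>: "\<pi> \<in> NC S" "S \<notin> \<pi>" for \<pi>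
  proof -
    note nc = NC_D(2)[OF \<pi>(1)]
    obtain i V where V: "nc_on \<pi> V" "V \<subseteq> S" "V \<noteq> {}" and i: "pred_of S V i" using ex_gap[OF nc ne \<pi>(2)] .
    define W where "W = S - V"
    have nW: "nc_on \<pi> W" using nc_Diff[OF nc V(1)] by (simp add: W_def)
    have iW: "i \<in> W" using i by (simp add: pred_of_def W_def)
    have subs: "V \<subset> S" "W \<subset> S" "W \<noteq> {}" using V(2,3) iW unfolding W_def by blast+
    have ZV: "faces V Z" and ZW: "faces W Z" using faces_mono[OF Z] subs by auto
    let ?A = "below V (blocks \<pi> V)" and ?B = "below W (blocks \<pi> W)"
    let ?Z = "\<lambda>c. Z(i := ract i (Z i) c)"
    have inner: "inner_ext moment_E \<pi> V Z = (\<Sum>\<tau>\<in>?A. inner_ext block_cumulant \<tau> V Z)"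
    proof -
      have "inner_ext moment_E \<pi> V Z = (\<Sum>\<tau>\<in>?A. cumulant \<tau> V Z)"
        using sum_cumulant[OF blocks_NC[OF V(1)] V(3) ZV] inner_ext_blocks[OF V(1), of moment_E Z] by simp
      also have "\<dots> = (\<Sum>\<tau>\<in>?A. inner_ext block_cumulant \<tau> V Z)"
      proof (rule sum.cong[OF refl])
        fix \<tau> assume "\<tau> \<in> ?A"
        then have "nc_on \<tau> V" using NC_D(2)[of \<tau> V] by (simp add: below_def)
        then show "cumulant \<tau> V Z = inner_ext block_cumulant \<tau> V Z" by (rule IH[OF subs(1) _ V(3) ZV])
      qed
      finally show ?thesis .
    qed
    have outer: "inner_ext moment_E \<pi> W (?Z c) = (\<Sum>\<rho>\<in>?B. inner_ext block_cumulant \<rho> W (?Z c))" for c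
    proof -
      have ZW': "faces W (?Z c)" by (rule faces_ract[OF ZW iW])
      have "inner_ext moment_E \<pi> W (?Z c) = (\<Sum>\<rho>\<in>?B. cumulant \<rho> W (?Z c))"
        using sum_cumulant[OF blocks_NC[OF nW] subs(3) ZW'] inner_ext_blocks[OF nW, of moment_E "?Z c"] by simp
      also have "\<dots> = (\<Sum>\<rho>\<in>?B. inner_ext block_cumulant \<rho> W (?Z c))"
      proof (rule sum.cong[OF refl])
        fix \<rho> assume "\<rho> \<in> ?B"
        then have "nc_on \<rho> W" using NC_D(2)[of \<rho> W] by (simp add: below_def)
        then show "cumulant \<rho> W (?Z c) = inner_ext block_cumulant \<rho> W (?Z c)" by (rule IH[OF subs(2) _ subs(3) ZW'])
      qed
      finally show ?thesis .
    qed
    have lin: "linear_on W (inner_ext moment_E \<pi> W)"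
      by (rule inner_ext_linear[OF moment_E_local nW moment_E_linear]) (rule finite_subset[OF _ nc_finite[OF nW]])
    have fin: "finite ?A" by (rule finite_below[OF blocks_NC[OF V(1)]])
    have step: "inner_ext block_cumulant \<rho> W (?Z (inner_ext block_cumulant \<tau> V Z)) = inner_ext block_cumulant (\<tau> \<union> \<rho>) S Z" if tr: "\<tau> \<in> ?A" "\<rho> \<in> ?B" for \<tau> \<rho>
    proof -
      note u = below_union[OF \<pi>(1) V(1,2) W_def tr]
      have nS: "nc_on (\<tau> \<union> \<rho>) S" using u(1) NC_D(2)[of "\<tau> \<union> \<rho>" S] by (simp add: below_def)
      have "inner_ext block_cumulant (\<tau> \<union> \<rho>) S Z = inner_ext block_cumulant (\<tau> \<union> \<rho>) W (?Z (inner_ext block_cumulant (\<tau> \<union> \<rho>) V Z))"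
        unfolding W_def by (rule inner_ext_insert_pred[OF block_cumulant_local block_cumulant_bal[OF nS] nS u(4) V(2,3) i Z])
      then show ?thesis
        using inner_ext_blocks[OF u(4), of block_cumulant Z] inner_ext_blocks[OF u(5), of block_cumulant] u(2,3) by simp
    qed
    have "inner_ext moment_E \<pi> S Z = inner_ext moment_E \<pi> W (?Z (inner_ext moment_E \<pi> V Z))"
      unfolding W_def by (rule inner_ext_insert_pred[OF moment_E_local moment_E_bal[OF nc] nc V i Z])
    also have "\<dots> = (\<Sum>\<tau>\<in>?A. inner_ext moment_E \<pi> W (?Z (inner_ext block_cumulant \<tau> V Z)))"
      unfolding inner by (rule linear_on_sum[OF lin ZW iW fin])
    also have "\<dots> = (\<Sum>\<tau>\<in>?A. \<Sum>\<rho>\<in>?B. inner_ext block_cumulant (\<tau> \<union> \<rho>) S Z)"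
      unfolding outer by (intro sum.cong refl step)
    also have "\<dots> = (\<Sum>\<sigma>\<in>below S \<pi>. inner_ext block_cumulant \<sigma> S Z)"
      by (rule sum_below_split[OF \<pi>(1) V(1,2) W_def, symmetric])
    finally show ?thesis by simp
  qed
  have one: "cumulant \<pi> S Z = inner_ext block_cumulant \<pi> S Z" if \<pi>: "\<pi> \<in> NC S" "S \<in> \<pi>" for \<pi>
  proof -
    have all: "U = S" if U: "U \<in> \<pi>" for U
    proof -
      have "U \<noteq> {}" "U \<subseteq> S" using NC_D(1)[OF \<pi>(1)] U by (auto simp: partition_on_def)
      then obtain i where "i \<in> U" "i \<in> S" by auto
      then show ?thesis by (rule nc_disj[OF NC_D(2)[OF \<pi>(1)] U \<pi>(2)])
    qed
    have eq: "\<pi> = {S}"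
    proof (intro equalityI subsetI)
      fix U assume "U \<in> \<pi>"
      from all[OF this] show "U \<in> {S}" by simp
    qed (use \<pi>(2) in simp)
    show ?thesis using inner_ext_one[where g = block_cumulant, OF NC_D(2)[OF \<pi>(1)] \<pi>(2) ne block_cumulant_local] unfolding eq by simp
  qed
  \<comment> \<open>A proper refinement of \<pi> again lacks the block \<open>S\<close>, which would
    otherwise have to fit into a block of \<pi>. So all terms but the top one agree, and equal
    totals give the claim.\<close>
  have many: "cumulant \<pi> S Z = inner_ext block_cumulant \<pi> S Z" if "\<pi> \<in> NC S" "S \<notin> \<pi>" for \<pi>
    using that
  proof (induction "card (below S \<pi>)" arbitrary: \<pi> rule: less_induct)
    case (less \<pi>)
    note \<pi> = less.prems
    have strict: "cumulant \<sigma> S Z = inner_ext block_cumulant \<sigma> S Z" if s: "\<sigma> \<in> below S \<pi> - {\<pi>}" for \<sigma>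
    proof (rule less.hyps)
      have \<sigma>: "\<sigma> \<in> NC S" "refines S \<sigma> \<pi>" "\<sigma> \<noteq> \<pi>" using s by (auto simp: below_def)
      show "\<sigma> \<in> NC S" by (rule \<sigma>(1))
      have "below S \<sigma> \<subseteq> below S \<pi>"
        unfolding below_def by (intro subsetI CollectI conjI; elim CollectE conjE) (assumption | erule refines_trans[OF _ \<sigma>(2)])+
      moreover have "\<pi> \<notin> below S \<sigma>"
      proof
        assume "\<pi> \<in> below S \<sigma>"
        then have "refines S \<pi> \<sigma>" by (simp add: below_def)
        then show False using refines_asym[OF \<sigma>(2)] \<sigma>(3) by simp
      qed
      ultimately have "below S \<sigma> \<subset> below S \<pi>" using below_self[OF \<pi>(1)] by (metis psubsetI)
      then show "card (below S \<sigma>) < card (below S \<pi>)" by (rule psubset_card_mono[OF finite_below[OF \<pi>(1)]])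
      show "S \<notin> \<sigma>"
      proof
        assume "S \<in> \<sigma>"
        then obtain P where P: "P \<in> \<pi>" "S \<subseteq> P" using \<sigma>(2) by (auto simp: refines_def)
        then have "P = S" using NC_D(1)[OF \<pi>(1)] by (auto simp: partition_on_def)
        then show False using P \<pi>(2) by simp
      qed
    qed
    have fin: "finite (below S \<pi>)" by (rule finite_below[OF \<pi>(1)])
    have "cumulant \<pi> S Z + (\<Sum>\<sigma>\<in>below S \<pi> - {\<pi>}. cumulant \<sigma> S Z) = inner_ext block_cumulant \<pi> S Z + (\<Sum>\<sigma>\<in>below S \<pi> - {\<pi>}. inner_ext block_cumulant \<sigma> S Z)"
      using sum.remove[OF fin below_self[OF \<pi>(1)], of "\<lambda>\<sigma>. cumulant \<sigma> S Z"]
        sum.remove[OF fin below_self[OF \<pi>(1)], of "\<lambda>\<sigma>. inner_ext block_cumulant \<sigma> S Z"]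
        sum_cumulant[OF \<pi>(1) ne Z] sum_ival[OF \<pi>] by simp
    moreover have "(\<Sum>\<sigma>\<in>below S \<pi> - {\<pi>}. cumulant \<sigma> S Z) = (\<Sum>\<sigma>\<in>below S \<pi> - {\<pi>}. inner_ext block_cumulant \<sigma> S Z)"
      by (rule sum.cong[OF refl strict])
    ultimately show ?case by simp
  qed
  have "cumulant (blocks \<pi> S) S Z = inner_ext block_cumulant (blocks \<pi> S) S Z"
    by (cases "S \<in> blocks \<pi> S") (rule one many, rule blocks_NC[OF less.prems(1)], assumption)+
  then show ?case using cumulant_blocks[OF less.prems(1)] inner_ext_blocks[OF less.prems(1)] by simp
qed

section \<open>Conditional cumulants\<close>

lemma tree_ext_decomp:
  assumes T: "tree_ext g h \<Theta>"
    and "sorted_wrt (\<lambda>V W. \<forall>i\<in>V. \<forall>j\<in>W. i \<prec> j) Vs" "\<And>V. V \<in> set Vs \<Longrightarrow> nc_on \<pi> V"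
    and "nc_on \<pi> {}"
  shows "\<Theta> \<pi> (\<Union>(set Vs)) Z = prod_list (map (\<lambda>V. \<Theta> \<pi> V Z) Vs) \<and> nc_on \<pi> (\<Union>(set Vs))"
  using assms(2,3)
proof (induction Vs)
  case Nil
  then show ?case using tree_ext_empty[OF T assms(4)] assms(4) by simp
next
  case (Cons V Vs)
  have IH: "\<Theta> \<pi> (\<Union>(set Vs)) Z = prod_list (map (\<lambda>V. \<Theta> \<pi> V Z) Vs)" "nc_on \<pi> (\<Union>(set Vs))"
    using Cons by auto
  have V: "nc_on \<pi> V" using Cons.prems(2) by simp
  have lt: "i \<prec> j" if "i \<in> V" "j \<in> \<Union>(set Vs)" for i j using Cons.prems(1) that by auto
  show ?case using tree_ext_Un[OF T V IH(2) lt, of Z] nc_Un[OF V IH(2)] IH(1) by simp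
qed

lemma nc_empty: "nc_on \<pi> S \<Longrightarrow> nc_on \<pi> {}"
  by (rule nc_sub) auto

definition cond_cumulant :: "nat set set \<Rightarrow> nat set \<Rightarrow> (nat \<Rightarrow> 'a) \<Rightarrow> 'd" where
  "cond_cumulant \<pi> S Z = cond_bi_cumulant \<epsilon> E F (sides S) (restrict_part S \<pi>) (tuple Z S)"

abbreviation cond_block_cumulant :: "nat set \<Rightarrow> (nat \<Rightarrow> 'a) \<Rightarrow> 'd" where "cond_block_cumulant S Z \<equiv> cond_cumulant {S} S Z"

lemma cond_block_cumulant_local: "local_on S (cond_block_cumulant S)"
  unfolding local_on_def cond_cumulant_def by (intro allI impI arg_cong[of _ _ "cond_bi_cumulant _ _ _ _ _"] tuple_local) simp

lemma cond_cumulant_blocks: "nc_on \<pi> S \<Longrightarrow> cond_cumulant \<pi> S Z = cond_cumulant (blocks \<pi> S) S Z"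
  by (simp add: cond_cumulant_def restrict_part_blocks_eq)

lemma blocks_one:
  assumes "nc_on \<pi> S" "S \<in> \<pi>" "S \<noteq> {}"
  shows "blocks \<pi> S = {S}"
proof (intro equalityI subsetI)
  fix U assume "U \<in> blocks \<pi> S"
  then have U: "U \<in> \<pi>" "U \<subseteq> S" "U \<noteq> {}" by (auto simp: blocks_def)
  then obtain i where "i \<in> U" "i \<in> S" by auto
  then have "U = S" by (rule nc_disj[OF assms(1) U(1) assms(2)])
  then show "U \<in> {S}" by simp
qed (use assms in \<open>simp add: blocks_def\<close>)

lemma sides_nonempty: "S \<subseteq> {..<length \<chi>} \<Longrightarrow> S \<noteq> {} \<Longrightarrow> sides S \<noteq> []"
  using length_sides[of S] card_0_eq[OF finite_dom[of S]] by (metis list.size(3))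

text \<open>For a single index the definition returns \<open>F\<close> directly. There
  \<open>NC S\<close> contains only the one-block partition, so the sum is empty and the formula for
  longer tuples covers this case as well.\<close>

lemma cond_block_cumulant_eq:
  assumes S: "S \<subseteq> {..<length \<chi>}" "S \<noteq> {}"
  shows "cond_block_cumulant S Z = F (time_prod S Z) - (\<Sum>\<sigma>\<in>NC S - {{S}}. cond_cumulant \<sigma> S Z)"
proof -
  note nc = NC_D(2)[OF one_NC[OF S]]
  note bij = restrict_part_bij[OF S(1)]
  have one: "restrict_part S {S} = one_chi (sides S)" using restrict_part_one_iff[OF nc S(2)] by simp
  have ex: "{S} \<in> NC S" by (rule one_NC[OF S])
  have base0: "restrict_part S {S} \<in> BNC (sides S)" by (rule restrict_part_nc_BNC[OF nc])
  have sum: "(\<Sum>\<sigma>\<in>BNC (sides S) - {one_chi (sides S)}. f \<sigma>) = (\<Sum>\<sigma>\<in>NC S - {{S}}. f (restrict_part S \<sigma>))" for f :: "_ \<Rightarrow> 'd"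
  proof (rule sum.reindex_bij_betw[symmetric])
    show "bij_betw (restrict_part S) (NC S - {{S}}) (BNC (sides S) - {one_chi (sides S)})"
      unfolding one[symmetric]
      by (rule bij_betw_DiffI[OF bij]) (use ex base0 in \<open>auto simp: bij_betw_def\<close>)
  qed
  have base: "restrict_part S {S} \<in> BNC (sides S)" "length (tuple Z S) = length (sides S)" "sides S \<noteq> []"
    using restrict_part_nc_BNC[OF nc] length_sides[OF S(1)] length_tuple[OF S(1)] sides_nonempty[OF S] by auto
  show ?thesis
  proof (cases "card S = 1")
    case True
    then obtain i where i: "S = {i}" by (auto simp: card_1_singleton_iff)
    have "NC S - {{S}} = {}"
    proof -
      have "\<sigma> = {S}" if "\<sigma> \<in> NC S" for \<sigma>
      proof -
        have p: "\<Union>\<sigma> = {i}" "{} \<notin> \<sigma>" using NC_D(1)[OF that] i by (auto simp: partition_on_def)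
        have "X = {i}" if "X \<in> \<sigma>" for X
        proof -
          have "X \<subseteq> {i}" "X \<noteq> {}" using p that by auto
          then show ?thesis by (simp add: subset_singleton_iff)
        qed
        moreover have "\<sigma> \<noteq> {}" using p by auto
        ultimately show ?thesis using i by blast
      qed
      then show ?thesis by auto
    qed
    moreover have "tuple Z S ! 0 = Z i" using tuple_eq[OF S(1), of Z] i by simp
    moreover have "time_prod S Z = Z i" using i by simp
    moreover have "length (sides S) = 1" using True length_sides[OF S(1)] by simp
    moreover have "cond_block_cumulant S Z = F (tuple Z S ! 0)"
      unfolding cond_cumulant_def by (subst cond_bi_cumulant.simps) (use base \<open>length (sides S) = 1\<close> in simp)
    ultimately show ?thesis by (simp only: sum.empty diff_zero)
  next
    case False
    have "cond_block_cumulant S Z = F (prod_list (tuple Z S)) - (\<Sum>\<sigma>\<in>BNC (sides S) - {one_chi (sides S)}. cond_bi_cumulant \<epsilon> E F (sides S) \<sigma> (tuple Z S))"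
      unfolding cond_cumulant_def by (subst cond_bi_cumulant.simps) (use base False length_sides[OF S(1)] one in simp)
    then show ?thesis unfolding sum prod_tuple[OF S(1)] cond_cumulant_def .
  qed
qed

section \<open>The recursion for conditional cumulants without relabelling\<close>

lemma union_of_blocks_nc:
  assumes S: "nc_on \<pi> S" and V: "V \<subseteq> S" and u: "union_of_blocks (restrict_part S \<pi>) (relabel S ` V)"
  shows "nc_on \<pi> V"
proof (rule nc_sub[OF S V])
  note d = nc_dom[OF S]
  fix i assume i: "i \<in> V"
  obtain A where A: "A \<subseteq> restrict_part S \<pi>" "relabel S ` V = \<Union>A" using u by (auto simp: union_of_blocks_def)
  then have "relabel S i \<in> \<Union>A" using i by blast
  then obtain X where X: "X \<in> A" "relabel S i \<in> X" by auto
  then obtain U where U: "U \<in> blocks \<pi> S" "X = relabel S ` U" using A(1) restrict_part_blocks[OF S] by auto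
  note f = nc_fin_ne[OF S U(1)]
  have "i \<in> S" using i V by auto
  then have "i \<in> U" using X(2) U(2) relabel_mem_iff[OF d, of U i] f by auto
  moreover have "U \<subseteq> V"
  proof
    fix u assume u: "u \<in> U"
    then have "u \<in> S" using f by auto
    moreover have "relabel S u \<in> relabel S ` V" using A(2) X(1) U(2) u by auto
    ultimately show "u \<in> V" using relabel_mem_iff[OF d V] by simp
  qed
  ultimately show "\<exists>U\<in>\<pi>. i \<in> U \<and> U \<subseteq> V" using f by auto
qed

text \<open>The outer decomposition is pulled back along \<open>relabel S\<close>. That its members
  are proper subsets of \<open>S\<close> serves the later induction on \<open>card S\<close>, and it
  rests on the decomposition being nontrivial.\<close>

lemma cond_cumulant_decomp:
  assumes S: "nc_on \<pi> S" "S \<noteq> {}" "S \<notin> \<pi>" and nt: "outer_decomp (sides S) (restrict_part S \<pi>) \<noteq> [{..<length (sides S)}]"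
  obtains Vs where "sorted_wrt (\<lambda>V W. \<forall>i\<in>V. \<forall>j\<in>W. i \<prec> j) Vs" "\<forall>V\<in>set Vs. nc_on \<pi> V \<and> V \<subset> S \<and> V \<noteq> {}"
    "\<Union>(set Vs) = S" "\<forall>Z. cond_cumulant \<pi> S Z = prod_list (map (\<lambda>V. cond_cumulant \<pi> V Z) Vs)"
proof -
  note d = nc_dom[OF S(1)]
  define Ws where "Ws = outer_decomp (sides S) (restrict_part S \<pi>)"
  have dec: "\<Union>(set Ws) = {..<length (sides S)}" "{} \<notin> set Ws"
    "sorted_wrt (\<lambda>V W. \<forall>i\<in>V. \<forall>j\<in>W. chi_less (sides S) i j) Ws"
    "\<And>W. W \<in> set Ws \<Longrightarrow> union_of_blocks (restrict_part S \<pi>) W"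
    using outer_decomp[OF restrict_part_nc_BNC[OF S(1)]] unfolding Ws_def[symmetric] is_outer_decomp_iff by auto
  define pb where "pb W = {i\<in>S. relabel S i \<in> W}" for W
  define Vs where "Vs = map pb Ws"
  have Wsub: "W \<subseteq> relabel S ` S" if "W \<in> set Ws" for W
    using dec(1) that relabel_img[OF d] length_sides[OF d] by auto
  have img: "relabel S ` pb W = W" if "W \<in> set Ws" for W
    using Wsub[OF that] by (auto simp: pb_def)
  have pbS: "pb W \<subseteq> S" for W by (auto simp: pb_def)
  have pb_ne: "pb W \<noteq> {}" if "W \<in> set Ws" for W
  proof -
    have "W \<noteq> {}" using dec(2) that by auto
    then show ?thesis using img[OF that] by (metis image_is_empty)
  qed
  have sorted: "sorted_wrt (\<lambda>V W. \<forall>i\<in>V. \<forall>j\<in>W. i \<prec> j) Vs"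
    unfolding Vs_def sorted_wrt_map
  proof (rule sorted_wrt_mono_rel[OF _ dec(3)], intro ballI)
    fix x y i j assume "\<forall>i\<in>x. \<forall>j\<in>y. chi_less (sides S) i j" and ij: "i \<in> pb x" "j \<in> pb y"
    then have "chi_less (sides S) (relabel S i) (relabel S j)" "i \<in> S" "j \<in> S" by (auto simp: pb_def)
    then show "i \<prec> j" using chi_less_relabel[OF d] by simp
  qed
  have un: "\<Union>(set Vs) = S"
  proof (intro equalityI subsetI)
    fix i assume i: "i \<in> S"
    then have "relabel S i \<in> \<Union>(set Ws)" using dec(1) relabel_img[OF d] length_sides[OF d] by auto
    then show "i \<in> \<Union>(set Vs)" using i by (auto simp: Vs_def pb_def)
  qed (use pbS in \<open>auto simp: Vs_def\<close>)
  have VsD: "nc_on \<pi> V" "V \<subseteq> S" "V \<noteq> {}" if "V \<in> set Vs" for V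
  proof -
    obtain W where W: "W \<in> set Ws" "V = pb W" using \<open>V \<in> set Vs\<close> by (auto simp: Vs_def)
    show "V \<subseteq> S" "V \<noteq> {}" using W pbS pb_ne by auto
    show "nc_on \<pi> V"
      using union_of_blocks_nc[OF S(1) pbS[of W]] dec(4)[OF W(1)] img[OF W(1)] W(2) by simp
  qed
  \<comment> \<open>Members are nonempty and strictly ordered, so a member equal to \<open>S\<close>
    would leave room for no other, and the decomposition would be trivial.\<close>
  have proper: "V \<noteq> S" if V: "V \<in> set Vs" for V
  proof
    assume eq: "V = S"
    obtain xs ys where split: "Vs = xs @ V # ys" using split_list[OF V] by auto
    have False if W: "W \<in> set xs \<union> set ys" for W
    proof -
      have "W \<in> set Vs" using W split by auto
      then obtain x where x: "x \<in> W" "x \<in> V" using VsD(2,3) eq by blast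
      have "(\<forall>W\<in>set xs. \<forall>i\<in>W. \<forall>j\<in>V. i \<prec> j) \<and> (\<forall>W\<in>set ys. \<forall>i\<in>V. \<forall>j\<in>W. i \<prec> j)"
        using sorted unfolding split sorted_wrt_append by simp
      then have "x \<prec> x" using W x by (metis Un_iff)
      then show False by simp
    qed
    then have "xs = []" "ys = []" by (cases xs; cases ys; auto)+
    then have "map pb Ws = [S]" using split eq by (simp add: Vs_def)
    then obtain W where W: "Ws = [W]" "pb W = S" by auto
    then have "W = relabel S ` S" using img[of W] by simp
    then show False using nt W(1) relabel_img[OF d] length_sides[OF d] by (simp add: Ws_def)
  qed
  have card1: "card S \<noteq> 1"
  proof
    assume "card S = 1"
    then obtain i where i: "S = {i}" by (auto simp: card_1_singleton_iff)
    then obtain U where U: "U \<in> \<pi>" "i \<in> U" "U \<subseteq> S" using nc_ex[OF S(1), of i] by auto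
    then have "U = S" using i by auto
    then show False using U S(3) by simp
  qed
  have "cond_cumulant \<pi> S Z = prod_list (map (\<lambda>V. cond_cumulant \<pi> V Z) Vs)" for Z
  proof -
    have "cond_cumulant \<pi> S Z = prod_list (map (\<lambda>W. cond_bi_cumulant \<epsilon> E F (nths (sides S) W) (restrict_part W (restrict_part S \<pi>)) (nths (tuple Z S) W)) Ws)"
      unfolding cond_cumulant_def by (subst cond_bi_cumulant.simps)
        (use restrict_part_nc_BNC[OF S(1)] length_sides[OF d] length_tuple[OF d] sides_nonempty[OF d S(2)] card1 restrict_part_one_iff[OF S(1,2)] S(3) nt in \<open>simp add: Ws_def\<close>)
    also have "map (\<lambda>W. cond_bi_cumulant \<epsilon> E F (nths (sides S) W) (restrict_part W (restrict_part S \<pi>)) (nths (tuple Z S) W)) Ws = map (\<lambda>V. cond_cumulant \<pi> V Z) Vs"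
      unfolding Vs_def map_map
    proof (rule map_cong[OF refl])
      fix W assume W: "W \<in> set Ws"
      show "cond_bi_cumulant \<epsilon> E F (nths (sides S) W) (restrict_part W (restrict_part S \<pi>)) (nths (tuple Z S) W) = ((\<lambda>V. cond_cumulant \<pi> V Z) \<circ> pb) W"
        using restrict_sub[OF d pbS[of W], unfolded img[OF W]] by (simp add: cond_cumulant_def)
    qed
    finally show ?thesis .
  qed
  moreover have "\<forall>V\<in>set Vs. nc_on \<pi> V \<and> V \<subset> S \<and> V \<noteq> {}" using VsD proper by (simp add: psubset_eq)
  ultimately show ?thesis using that[OF sorted _ un] by simp
qed

text \<open>A trivial outer decomposition puts the \<prec>-last index into the first block, so the
  tail is empty. The block \<open>V\<close> chosen by the definition is an interval of
  \<open>S\<close>, since a block nested in it would start later than \<open>Min V\<close>, against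
  the choice of \<open>V\<close>.\<close>

lemma cond_cumulant_absorb:
  assumes S: "nc_on \<pi> S" "S \<noteq> {}" "S \<notin> \<pi>" and nt: "outer_decomp (sides S) (restrict_part S \<pi>) = [{..<length (sides S)}]"
  obtains V p where "V \<in> \<pi>" "V \<subseteq> S" "V \<noteq> {}" "pred_of S V p" "tail \<pi> S = {}"
    "\<forall>Z. cond_cumulant \<pi> S Z = cond_cumulant \<pi> (S - V) (Z(p := ract p (Z p) (cumulant \<pi> V Z)))"
proof -
  note d = nc_dom[OF S(1)] and fin = nc_finite[OF S(1)]
  let ?U = "first_block \<pi> S"
  note U = first_block[OF S(1,2)]
  have ends: "{..<length (sides S)} = relabel S ` S" using relabel_img[OF d] length_sides[OF d] by simp
  have mnS: "chi_min (sides S) {..<length (sides S)} = relabel S (cmin S)" and mxS: "chi_max (sides S) {..<length (sides S)} = relabel S (cmax S)"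
    unfolding ends using chi_min_relabel[OF d order_refl S(2)] chi_max_relabel[OF d order_refl S(2)] by auto
  have Ub: "?U \<in> blocks \<pi> S" using U by (simp add: blocks_def)
  have m: "cmin S \<in> S" "cmax S \<in> S" using cmin(1)[OF fin S(2)] cmax(1)[OF fin S(2)] by auto
  have bl_eq: "X = ?U" if X: "X \<in> blocks \<pi> S" "cmin S \<in> X" for X
  proof -
    have "X \<in> \<pi>" using X(1) by (simp add: blocks_def)
    then show ?thesis by (rule nc_disj[OF S(1) _ U(1) X(2) U(2)])
  qed
  have "is_outer_decomp (sides S) (restrict_part S \<pi>) [{..<length (sides S)}]"
    using outer_decomp[OF restrict_part_nc_BNC[OF S(1)]] nt by simp
  then obtain X' where X': "X' \<in> restrict_part S \<pi>" "relabel S (cmin S) \<in> X'" "relabel S (cmax S) \<in> X'"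
    unfolding is_outer_decomp_def by (auto simp: mnS mxS)
  then obtain X where X: "X \<in> blocks \<pi> S" "X' = relabel S ` X" using restrict_part_blocks[OF S(1)] by auto
  have "X \<subseteq> S" using X(1) by (simp add: blocks_def)
  then have "cmin S \<in> X" "cmax S \<in> X" using X' X m relabel_mem_iff[OF d] by auto
  then have mxU: "cmax S \<in> ?U" using bl_eq[OF X(1)] by simp
  have fxS: "first_end \<pi> S = cmax S"
    unfolding first_end_def by (rule cmaxI[OF mxU]) (use cmax(2)[OF fin] U(3) in auto)
  have tl0: "tail \<pi> S = {}"
    unfolding tail_eq[OF S(1,2)] fxS using cmax(2)[OF fin] chi_less_asym chi_less_irrefl by (metis (mono_tags, lifting) Collect_empty_eq)
  have out: "outer_block (sides S) (restrict_part S \<pi>) = relabel S ` ?U"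
    unfolding outer_block_def mnS mxS
  proof (rule the_equality)
    show "relabel S ` ?U \<in> restrict_part S \<pi> \<and> relabel S (cmin S) \<in> relabel S ` ?U \<and> relabel S (cmax S) \<in> relabel S ` ?U"
      using Ub U(2) mxU by (simp add: restrict_part_blocks[OF S(1)])
    fix Y assume Y: "Y \<in> restrict_part S \<pi> \<and> relabel S (cmin S) \<in> Y \<and> relabel S (cmax S) \<in> Y"
    show "Y = relabel S ` ?U"
      by (rule BNC_disjoint[OF restrict_part_nc_BNC[OF S(1)], of _ _ "relabel S (cmin S)"]) (use Y Ub U(2) in \<open>simp_all add: restrict_part_blocks[OF S(1)]\<close>)
  qed
  define B where "B = blocks \<pi> S - {?U}"
  have finB: "finite B" unfolding B_def blocks_def
    by (rule finite_subset[of _ "Pow S"]) (use fin in auto)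
  have neB: "B \<noteq> {}"
  proof
    assume "B = {}"
    then have "blocks \<pi> S = {?U}" using Ub by (auto simp: B_def)
    then have "S = ?U" using NC_D(1)[OF blocks_NC[OF S(1)]] by (simp add: partition_on_def)
    then show False using U(1) S(3) by simp
  qed
  define M where "M = Max (Min ` B)"
  have "M \<in> Min ` B" unfolding M_def by (rule Max_in) (use finB neB in auto)
  then obtain V where V: "V \<in> B" "M = Min V" by auto
  have Vmax: "Min Y \<le> Min V" if "Y \<in> B" for Y
    unfolding V(2)[symmetric] M_def by (rule Max_ge) (use finB that in auto)
  have Vb: "V \<in> blocks \<pi> S" "V \<noteq> ?U" using V by (auto simp: B_def)
  note f = nc_fin_ne[OF S(1) Vb(1)]
  have VS: "V \<subseteq> S" "V \<in> \<pi>" "V \<noteq> {}" "finite V" using f by auto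
  have lib: "last_inner_block (sides S) (restrict_part S \<pi>) = relabel S ` V"
    unfolding last_inner_block_def out
  proof (rule arg_max_Min_restrict_part[OF S(1) Vb(1)])
    show "relabel S ` V \<noteq> relabel S ` ?U" using relabel_img_eq_iff[OF d VS(1) U(3)] Vb(2) by simp
    fix Y assume Y: "Y \<in> blocks \<pi> S" "relabel S ` Y \<noteq> relabel S ` ?U"
    then show "Min Y \<le> Min V" by (intro Vmax) (auto simp: B_def)
  qed
  have mV: "cmin V \<in> V" "cmax V \<in> V" "cmin V \<in> S" using cmin(1)[OF VS(4,3)] cmax(1)[OF VS(4,3)] VS(1) by auto
  have UV: "i \<notin> V" if "i \<in> ?U" for i using nc_disj[OF S(1) U(1) VS(2) that] Vb(2) by auto
  have eV: "cmin S \<prec> cmin V" using cmin(2)[OF fin mV(3)] UV[OF U(2)] mV(1) by auto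
  define A where "A = {j\<in>S. j \<prec> cmin V}"
  have A: "A \<subseteq> S" "finite A" "A \<noteq> {}" using fin m(1) eV by (auto simp: A_def)
  define p where "p = cmax A"
  have p: "p \<in> A" "\<And>j. j \<in> A \<Longrightarrow> j = p \<or> j \<prec> p" unfolding p_def using cmax[OF A(2)] A(3) by auto
  then have pS: "p \<in> S" "p \<prec> cmin V" by (auto simp: A_def)
  have mnV: "cmin V = v \<or> cmin V \<prec> v" if "v \<in> V" for v using cmin(2)[OF VS(4) that] by auto
  have interval: "v \<prec> j" if j: "j \<in> S - V" "cmin V \<prec> j" and v: "v \<in> V" for j v
  proof (rule ccontr)
    assume "\<not> v \<prec> j"
    moreover have "v \<noteq> j" using v j(1) by auto
    ultimately have jv: "j \<prec> v" using chi_less_total[of v j \<chi>] by auto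
    have jS: "j \<in> S" using j by simp
    define W where "W = block_of \<pi> j"
    note W = block_of[OF S(1) jS, folded W_def]
    have WV: "W \<noteq> V" using W(2) j(1) by auto
    have Wb: "W \<in> blocks \<pi> S" using W by (auto simp: blocks_def)
    show False
    proof (cases "W = ?U")
      case True
      then show False using nc_cross[OF S(1) U(1) VS(2) U(2) mV(1) _ v eV j(2) jv] W(2) Vb(2) by simp
    next
      case False
      then have "W \<in> B" using Wb by (simp add: B_def)
      then have le: "Min W \<le> Min V" by (rule Vmax)
      note fW = nc_fin_ne[OF S(1) Wb]
      define a where "a = Min W"
      have a: "a \<in> W" using fW by (simp add: a_def)
      have aV: "a \<notin> V" using nc_disj[OF S(1) W(1) VS(2) a] WV by auto
      have "Min V \<in> V" using VS by simp
      then have lt: "a < Min V" using le aV by (auto simp: a_def le_less)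
      have Vge: "Min V \<le> u" if "u \<in> V" for u using VS(4) that by simp
      have a1: "cmin V \<prec> a"
      proof (rule ccontr)
        assume "\<not> cmin V \<prec> a"
        moreover have "a \<noteq> cmin V" using aV mV(1) by auto
        ultimately have "a \<prec> cmin V" using chi_less_total[of a "cmin V" \<chi>] by auto
        then show False using nc_cross[OF S(1) W(1) VS(2) a mV(1) W(2) v _ j(2) jv] WV by simp
      qed
      have a2: "a \<prec> cmax V"
      proof (rule ccontr)
        assume "\<not> a \<prec> cmax V"
        moreover have "a \<noteq> cmax V" using aV mV(2) by auto
        ultimately have x: "cmax V \<prec> a" using chi_less_total[of a "cmax V" \<chi>] by auto
        have "j \<prec> cmax V" using cmax(2)[OF VS(4) v] jv chi_less_trans[OF jv] by auto
        then show False using nc_cross[OF S(1) VS(2) W(1) mV(1) W(2) mV(2) a j(2) _ x] WV by simp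
      qed
      \<comment> \<open>Strictly between the ends of \<open>V\<close>, every left index is later
        than \<open>cmin V\<close> and every right index later than \<open>cmax V\<close>; so
        \<open>a\<close> cannot be earlier than \<open>Min V\<close>.\<close>
      show False
      proof (cases "\<chi> ! a")
        case Lft
        then have "cmin V < a" using a1 by (cases "\<chi> ! cmin V") (auto simp: lt_iff)
        then show False using lt Vge[OF mV(1)] by simp
      next
        case Rgt
        then have "cmax V < a" using a2 by (cases "\<chi> ! cmax V") (auto simp: lt_iff)
        then show False using lt Vge[OF mV(2)] by simp
      qed
    qed
  qed
  have pred: "pred_of S V p"
    unfolding pred_of_def
  proof (intro conjI ballI)
    have "p \<notin> V" using mnV[of p] pS(2) chi_less_asym[OF pS(2)] by auto
    then show "p \<in> S - V" using pS by simp
    show "p \<prec> v" if "v \<in> V" for v using mnV[OF that] chi_less_trans[OF pS(2)] pS(2) by auto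
    fix j assume j: "j \<in> S - V"
    then have "j \<noteq> cmin V" using mV(1) by auto
    then consider "j \<prec> cmin V" | "cmin V \<prec> j" using chi_less_total[of j "cmin V" \<chi>] by auto
    then show "j = p \<or> j \<prec> p \<or> (\<forall>v\<in>V. v \<prec> j)"
    proof cases
      case 1
      then show ?thesis using p(2)[of j] j by (auto simp: A_def)
    next
      case 2
      then show ?thesis using interval[OF j 2] by simp
    qed
  qed
  have A': "{j \<in> {..<length (sides S)}. chi_less (sides S) j (chi_min (sides S) (relabel S ` V))} = relabel S ` A"
    unfolding chi_min_relabel[OF d VS(1,3)] ends A_def using chi_less_relabel[OF d _ mV(3)] by auto
  have p': "chi_max (sides S) (relabel S ` A) = relabel S p" unfolding p_def by (rule chi_max_relabel[OF d A(1,3)])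
  have card1: "card S \<noteq> 1"
  proof
    assume "card S = 1"
    then obtain i where i: "S = {i}" by (auto simp: card_1_singleton_iff)
    then have "V = S" using VS by auto
    then show False using VS(2) S(3) by simp
  qed
  have "cond_cumulant \<pi> S Z = cond_cumulant \<pi> (S - V) (Z(p := ract p (Z p) (cumulant \<pi> V Z)))" for Z
  proof -
    let ?c = "cumulant \<pi> V Z"
    have c: "bi_cumulant \<epsilon> E (nths (sides S) (relabel S ` V)) (restrict_part (relabel S ` V) (restrict_part S \<pi>)) (nths (tuple Z S) (relabel S ` V)) = ?c"
      using restrict_sub[OF d VS(1)] by (simp add: cumulant_def)
    have abs: "absorb_last_inner_block \<epsilon> E (sides S) (restrict_part S \<pi>) (tuple Z S) = tuple (Z(p := ract p (Z p) ?c)) S"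
      unfolding absorb_last_inner_block_def Let_def lib A' p' c insert_after_def
      using tuple_upd[OF d pS(1), of Z "ract p (Z p) ?c"] tuple_nth[OF d pS(1), of Z] sides_nth[OF d pS(1)]
      by (simp add: ract_def cong: side.case_cong)
    have "cond_cumulant \<pi> S Z = cond_bi_cumulant \<epsilon> E F (nths (sides S) (relabel S ` (S - V))) (restrict_part (relabel S ` (S - V)) (restrict_part S \<pi>))
        (nths (tuple (Z(p := ract p (Z p) ?c)) S) (relabel S ` (S - V)))"
      unfolding cond_cumulant_def by (subst cond_bi_cumulant.simps)
        (use restrict_part_nc_BNC[OF S(1)] length_sides[OF d] length_tuple[OF d] sides_nonempty[OF d S(2)] card1 restrict_part_one_iff[OF S(1,2)] S(3) nt
          in \<open>simp add: lib abs diff_relabel[OF d VS(1), unfolded length_sides[OF d]]\<close>)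
    then show ?thesis using restrict_sub[OF d, of "S - V"] by (simp add: cond_cumulant_def)
  qed
  then show ?thesis using that[OF VS(2,1,3) pred tl0] by simp
qed

text \<open>Both cases of the recursion are known for the extension: splitting is
  \<open>tree_ext_decomp\<close>, and absorption is \<open>outer_ext_insert_pred\<close>, whose
  condition on the tail holds because the tail is empty there.\<close>

lemma cond_cumulant_outer_ext:
  assumes "nc_on \<pi> S" "S \<noteq> {}" "faces S Z"
  shows "cond_cumulant \<pi> S Z = outer_ext cond_block_cumulant (inner_ext block_cumulant) \<pi> S Z"
  using assms
proof (induction "card S" arbitrary: S Z rule: less_induct)
  case less
  note S = less.prems(1,2) and Z = less.prems(3)
  note d = nc_dom[OF S(1)]
  have IH: "cond_cumulant \<pi> T Y = outer_ext cond_block_cumulant (inner_ext block_cumulant) \<pi> T Y" if "T \<subset> S" "nc_on \<pi> T" "T \<noteq> {}" "faces T Y" for T Y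
    by (rule less.hyps[OF psubset_card_mono[OF nc_finite[OF S(1)] that(1)] that(2-4)])
  show ?case
  proof (cases "S \<in> \<pi>")
    case True
    then show ?thesis
      using outer_ext_one[where g = cond_block_cumulant, OF S(1) True S(2) cond_block_cumulant_local] cond_cumulant_blocks[OF S(1)] blocks_one[OF S(1) True S(2)] by simp
  next
    case False
    show ?thesis
    proof (cases "outer_decomp (sides S) (restrict_part S \<pi>) = [{..<length (sides S)}]")
      case True
      obtain V p where V: "V \<in> \<pi>" "V \<subseteq> S" "V \<noteq> {}" and p: "pred_of S V p" and tail0: "tail \<pi> S = {}"
        and K: "\<forall>Z. cond_cumulant \<pi> S Z = cond_cumulant \<pi> (S - V) (Z(p := ract p (Z p) (cumulant \<pi> V Z)))"
        using cond_cumulant_absorb[OF S False True] .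
      have nV: "nc_on \<pi> V" by (rule nc_block[OF S(1) V(1,2)])
      have c: "cumulant \<pi> V Z = inner_ext block_cumulant \<pi> V Z" by (rule cumulant_inner_ext[OF nV V(3) faces_mono[OF Z V(2)]])
      have pW: "p \<in> S - V" using p by (simp add: pred_of_def)
      have tail1: "tail \<pi> S \<inter> V = {}" unfolding tail0 by simp
      have "outer_ext cond_block_cumulant (inner_ext block_cumulant) \<pi> S Z = outer_ext cond_block_cumulant (inner_ext block_cumulant) \<pi> (S - V) (Z(p := ract p (Z p) (inner_ext block_cumulant \<pi> V Z)))"
        by (rule outer_ext_insert_pred[OF cond_block_cumulant_local block_cumulant_local block_cumulant_bal[OF S(1)] S(1) nV V(2,3) p Z tail1])
      also have "\<dots> = cond_cumulant \<pi> (S - V) (Z(p := ract p (Z p) (inner_ext block_cumulant \<pi> V Z)))"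
      proof (rule IH[symmetric])
        show "S - V \<subset> S" "S - V \<noteq> {}" using V pW by auto
        show "nc_on \<pi> (S - V)" by (rule nc_Diff[OF S(1) nV])
        show "faces (S - V) (Z(p := ract p (Z p) (inner_ext block_cumulant \<pi> V Z)))"
          by (rule faces_ract[OF _ pW]) (rule faces_mono[OF Z], simp)
      qed
      finally show ?thesis using K c by simp
    next
      case nt: False
      obtain Vs where Vs: "sorted_wrt (\<lambda>V W. \<forall>i\<in>V. \<forall>j\<in>W. i \<prec> j) Vs" "\<forall>V\<in>set Vs. nc_on \<pi> V \<and> V \<subset> S \<and> V \<noteq> {}"
        "\<Union>(set Vs) = S" "\<forall>Z. cond_cumulant \<pi> S Z = prod_list (map (\<lambda>V. cond_cumulant \<pi> V Z) Vs)"
        using cond_cumulant_decomp[OF S False nt] .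
      have "nc_on \<pi> V" if "V \<in> set Vs" for V using Vs(2) that by simp
      then have "outer_ext cond_block_cumulant (inner_ext block_cumulant) \<pi> S Z = prod_list (map (\<lambda>V. outer_ext cond_block_cumulant (inner_ext block_cumulant) \<pi> V Z) Vs)"
        using tree_ext_decomp[OF tree_ext_outer_ext[of cond_block_cumulant "inner_ext block_cumulant"] Vs(1) _ nc_empty[OF S(1)], of Z] Vs(3) by simp
      also have "map (\<lambda>V. outer_ext cond_block_cumulant (inner_ext block_cumulant) \<pi> V Z) Vs = map (\<lambda>V. cond_cumulant \<pi> V Z) Vs"
      proof (rule map_cong[OF refl])
        fix V assume "V \<in> set Vs"
        then have V: "nc_on \<pi> V" "V \<subset> S" "V \<noteq> {}" using Vs(2) by simp_all
        show "outer_ext cond_block_cumulant (inner_ext block_cumulant) \<pi> V Z = cond_cumulant \<pi> V Z"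
          by (rule IH[symmetric]) (use V faces_mono[OF Z, of V] in auto)
      qed
      finally show ?thesis using Vs(4) by simp
    qed
  qed
qed

section \<open>Balance and linearity of the one-block conditional cumulants\<close>

lemma outer_ext_balanced_linear:
  assumes S: "nc_on \<sigma> S" "S \<noteq> {}" and K: "\<And>U. U \<in> \<sigma> \<Longrightarrow> U \<subseteq> S \<Longrightarrow> balanced \<iota> U (cond_block_cumulant U) \<and> linear_on U (cond_block_cumulant U)"
  shows "balanced \<iota> S (outer_ext cond_block_cumulant (inner_ext block_cumulant) \<sigma> S)" "linear_on S (outer_ext cond_block_cumulant (inner_ext block_cumulant) \<sigma> S)"
proof -
  have k: "linear_on U (block_cumulant U)" if "U \<in> \<sigma>" "U \<subseteq> S" for U
    by (rule block_cumulant_linear) (use nc_dom[OF S(1)] that in auto)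
  show "balanced \<iota> S (outer_ext cond_block_cumulant (inner_ext block_cumulant) \<sigma> S)"
    by (rule outer_ext_balanced[OF cond_block_cumulant_local block_cumulant_local S(1) _ block_cumulant_bal[OF S(1)]]) (use K in auto)
  show "linear_on S (outer_ext cond_block_cumulant (inner_ext block_cumulant) \<sigma> S)"
    by (rule outer_ext_linear[OF cond_block_cumulant_local block_cumulant_local S(1) _ k]) (use K in auto)
qed

text \<open>A one-block value is \<open>F\<close> of the product minus extended values over
  partitions with strictly smaller blocks. The latter are balanced and linear by induction on the
  block size, as the cumulants filling the gaps already have these properties.\<close>

lemma cond_block_cumulant_balanced_linear:
  assumes "S \<subseteq> {..<length \<chi>}"
  shows "balanced \<iota> S (cond_block_cumulant S) \<and> linear_on S (cond_block_cumulant S)"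
  using assms
proof (induction "card S" arbitrary: S rule: less_induct)
  case less
  show ?case
  proof (cases "S = {}")
    case True
    then show ?thesis by (simp add: balanced_empty linear_empty)
  next
    case False
    have fin: "finite S" using less.prems finite_subset by blast
    \<comment> \<open>\<open>None\<close> stands for the moment under \<open>F\<close> with
      coefficient 1 and \<open>Some \<sigma>\<close> for a subtracted term, so that the difference
      is a single combination as required by \<open>balanced_sum\<close> and
      \<open>linear_sum\<close>.\<close>
    let ?A = "insert None (Some ` (NC S - {{S}}))"
    define c :: "nat set set option \<Rightarrow> complex" where "c a = (if a = None then 1 else - 1)" for a
    define f where "f a Z = (case a of None \<Rightarrow> moment_F S Z | Some \<sigma> \<Rightarrow> outer_ext cond_block_cumulant (inner_ext block_cumulant) \<sigma> S Z)" for a Z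
    have f_good: "balanced \<iota> S (f a) \<and> linear_on S (f a)" if a: "a \<in> ?A" for a
    proof (cases a)
      case None
      then have "f a = moment_F S" by (intro ext) (simp add: f_def)
      then show ?thesis using moment_F_balanced[OF fin] moment_F_linear[OF fin] by simp
    next
      case (Some \<sigma>)
      then have \<sigma>: "\<sigma> \<in> NC S" "\<sigma> \<noteq> {S}" using a by auto
      note nc = NC_D(2)[OF \<sigma>(1)]
      have fa: "f a = outer_ext cond_block_cumulant (inner_ext block_cumulant) \<sigma> S" by (rule ext) (simp add: f_def Some)
      have "balanced \<iota> U (cond_block_cumulant U) \<and> linear_on U (cond_block_cumulant U)" if U: "U \<in> \<sigma>" "U \<subseteq> S" for U
      proof (rule less.hyps)
        have "S \<notin> \<sigma>" using blocks_one[OF nc _ False] NC_blocks[OF \<sigma>(1)] \<sigma>(2) by auto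
        then have "U \<subset> S" using U by auto
        then show "card U < card S" by (rule psubset_card_mono[OF fin])
        show "U \<subseteq> {..<length \<chi>}" using U(2) less.prems by auto
      qed
      then show ?thesis unfolding fa using outer_ext_balanced_linear[OF nc False] by simp
    qed
    have eq: "cond_block_cumulant S Z = (\<Sum>a\<in>?A. c a *\<^sub>C f a Z)" if Z: "faces S Z" for Z
    proof -
      have fN: "finite (NC S - {{S}})" using finite_NC[OF less.prems] by simp
      have "(\<Sum>a\<in>?A. c a *\<^sub>C f a Z) = moment_F S Z + (\<Sum>\<sigma>\<in>NC S - {{S}}. (- 1) *\<^sub>C outer_ext cond_block_cumulant (inner_ext block_cumulant) \<sigma> S Z)"
        using fN by (simp add: c_def f_def sum.reindex)
      also have "(\<Sum>\<sigma>\<in>NC S - {{S}}. (- 1) *\<^sub>C outer_ext cond_block_cumulant (inner_ext block_cumulant) \<sigma> S Z) = - (\<Sum>\<sigma>\<in>NC S - {{S}}. cond_cumulant \<sigma> S Z)"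
        unfolding sum_negf[symmetric]
      proof (rule sum.cong[OF refl])
        fix \<sigma> assume "\<sigma> \<in> NC S - {{S}}"
        then have "nc_on \<sigma> S" using NC_D(2) by auto
        then show "(- 1) *\<^sub>C outer_ext cond_block_cumulant (inner_ext block_cumulant) \<sigma> S Z = - cond_cumulant \<sigma> S Z"
          using cond_cumulant_outer_ext[OF _ False Z, of \<sigma>] by simp
      qed
      finally show ?thesis using cond_block_cumulant_eq[OF less.prems False, of Z] by simp
    qed
    show ?thesis
    proof
      show "balanced \<iota> S (cond_block_cumulant S)"
        by (rule balanced_sum[OF _ False fin eq]) (use f_good in simp_all)
      show "linear_on S (cond_block_cumulant S)"
        by (rule linear_sum[OF _ eq]) (use f_good in simp_all)
    qed
  qed
qed

lemma linear_cong: "linear_on S f \<Longrightarrow> (\<And>Z. faces S Z \<Longrightarrow> g Z = f Z) \<Longrightarrow> linear_on S g"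
  by (rule linear_sum[of "{()}" _ "\<lambda>_. f" _ "\<lambda>_. 1"]) (simp_all)

lemma cond_cumulant_linear:
  assumes "nc_on \<pi> S" "S \<noteq> {}"
  shows "linear_on S (cond_cumulant \<pi> S)"
proof (rule linear_cong)
  show "linear_on S (outer_ext cond_block_cumulant (inner_ext block_cumulant) \<pi> S)"
    by (rule outer_ext_balanced_linear(2)[OF assms]) (use cond_block_cumulant_balanced_linear nc_dom[OF assms(1)] in auto)
qed (rule cond_cumulant_outer_ext[OF assms])

section \<open>Conditional bi-multiplicativity\<close>

abbreviation all where "all \<equiv> {..<length \<chi>}"

lemma sides_all: "sides all = \<chi>" and tuple_all: "tuple Z all = map Z [0..<length \<chi>]"
  by simp_all

lemma BNC_NC: "\<pi> \<in> BNC \<chi> \<Longrightarrow> nc_on \<pi> all"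
proof -
  assume \<pi>: "\<pi> \<in> BNC \<chi>"
  have "\<exists>U\<in>\<pi>. i \<in> U \<and> U \<subseteq> all" if "i \<in> all" for i
  proof -
    have "i \<in> \<Union>\<pi>" using BNC_D(2)[OF \<pi>] that by simp
    then obtain U where "U \<in> \<pi>" "i \<in> U" by auto
    then show ?thesis using BNC_D(7)[OF \<pi>, of U] by auto
  qed
  moreover have "nc_fam \<pi>"
    unfolding nc_fam_def
  proof (intro conjI ballI allI impI)
    show "U = W" if "U \<in> \<pi>" "W \<in> \<pi>" "i \<in> U" "i \<in> W" for U W i
      using BNC_disjoint[OF \<pi> that] .
    show "U = W" if "U \<in> \<pi>" "W \<in> \<pi>" "a \<in> U" "b \<in> W" "c \<in> U" "d \<in> W" "a \<prec> b" "b \<prec> c" "c \<prec> d" for U W a b c d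
      using BNC_noncrossing[OF \<pi> that] .
  qed
  ultimately show ?thesis by (simp add: nc_on_def)
qed

lemma restrict_part_all: "\<pi> \<in> BNC \<chi> \<Longrightarrow> restrict_part all \<pi> = \<pi>"
proof -
  assume \<pi>: "\<pi> \<in> BNC \<chi>"
  have r: "relabel all i = i" if "i < length \<chi>" for i
  proof -
    have "{j \<in> all. j < i} = {..<i}" using that by auto
    then show ?thesis by (simp add: relabel_def)
  qed
  have img: "relabel all ` U = U" if "U \<in> \<pi>" for U
  proof -
    have "relabel all ` U = id ` U" by (rule image_cong[OF refl]) (use BNC_D(7)[OF \<pi> that] r in auto)
    then show ?thesis by simp
  qed
  have "blocks \<pi> all = \<pi>" using BNC_D(4,7)[OF \<pi>] by (auto simp: blocks_def)
  then show ?thesis using restrict_part_blocks[OF BNC_NC[OF \<pi>]] img by simp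
qed

section \<open>One-block conditions as moves between neighbours\<close>

lemma face_tuplesD:
  assumes "Z \<in> face_tuples \<epsilon> \<chi>"
  shows "faces all ((!) Z)" "map ((!) Z) [0..<length \<chi>] = Z" "k < length \<chi> \<Longrightarrow> Z[k := v] = map (((!) Z)(k := v)) [0..<length \<chi>]"
proof -
  have len: "length Z = length \<chi>" using assms by (simp add: face_tuples_def)
  show "faces all ((!) Z)" using assms by (auto simp: faces_def face_tuples_def)
  show "map ((!) Z) [0..<length \<chi>] = Z" unfolding len[symmetric] by (rule map_nth)
  show "k < length \<chi> \<Longrightarrow> Z[k := v] = map (((!) Z)(k := v)) [0..<length \<chi>]"
    by (rule nth_equalityI) (auto simp: len nth_list_update)
qed

text \<open>The latest index \<open>p\<close> is the \<prec>-last left or the \<prec>-first right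
  index. The latest index \<open>q\<close> of the other side is then its \<prec>-neighbour across
  the two sides, and a right factor at \<open>q\<close> is the action that faces \<open>p\<close>.
  Without such a \<open>q\<close>, the index \<open>p\<close> is an end of the order.\<close>

lemma balanced_mult_1:
  assumes ne: "\<chi> \<noteq> []" and Zf: "Z \<in> face_tuples \<epsilon> \<chi>"
    and bal: "balanced j all (\<lambda>Z. \<Theta> \<chi> (one_chi \<chi>) (map Z [0..<length \<chi>]))"
  shows "let n = length \<chi>; Q = {k. k < n \<and> \<chi> ! k \<noteq> \<chi> ! (n - 1)}; q = Max Q
         in case \<chi> ! (n - 1) of
              Lft \<Rightarrow> \<Theta> \<chi> (one_chi \<chi>) (Z[n - 1 := Z ! (n - 1) * left_op \<epsilon> b]) =
                (if Q \<noteq> {} then \<Theta> \<chi> (one_chi \<chi>) (Z[q := Z ! q * right_op \<epsilon> b])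
                 else \<Theta> \<chi> (one_chi \<chi>) Z * j b)
            | Rgt \<Rightarrow> \<Theta> \<chi> (one_chi \<chi>) (Z[n - 1 := Z ! (n - 1) * right_op \<epsilon> b]) =
                (if Q \<noteq> {} then \<Theta> \<chi> (one_chi \<chi>) (Z[q := Z ! q * left_op \<epsilon> b])
                 else j b * \<Theta> \<chi> (one_chi \<chi>) Z)"
proof -
  define n where "n = length \<chi>"
  define Q where "Q = {k. k < n \<and> \<chi> ! k \<noteq> \<chi> ! (n - 1)}"
  define p q where "p = n - 1" and "q = Max Q"
  let ?g = "\<lambda>Z. \<Theta> \<chi> (one_chi \<chi>) (map Z [0..<length \<chi>])" and ?Z = "(!) Z"
  note Zd = face_tuplesD[OF Zf]
  note B = balancedD[OF bal Zd(1)]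
  have n: "n > 0" using ne by (simp add: n_def)
  have ple: "i \<le> p" if "i \<in> all" for i using that by (auto simp: p_def n_def)
  have pS: "p \<in> all" "p < length \<chi>" using n by (auto simp: p_def n_def)
  have neS: "all \<noteq> {}" using pS by auto
  have finQ: "finite Q" by (simp add: Q_def)
  have q: "q \<in> all" "q < length \<chi>" "\<chi> ! q \<noteq> \<chi> ! p" if "Q \<noteq> {}"
    using Max_in[OF finQ that] by (auto simp: q_def Q_def p_def n_def)
  have qmax: "i \<le> q" if "i \<in> all" "\<chi> ! i \<noteq> \<chi> ! p" for i
    unfolding q_def by (rule Max_ge[OF finQ]) (use that in \<open>auto simp: Q_def p_def n_def\<close>)
  have same: "\<chi> ! i = \<chi> ! p" if "Q = {}" "i \<in> all" for i
  proof (rule ccontr)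
    assume "\<chi> ! i \<noteq> \<chi> ! p"
    then have "i \<in> Q" using that(2) by (simp add: Q_def p_def n_def)
    then show False using that(1) by simp
  qed
  have g0: "\<Theta> \<chi> (one_chi \<chi>) Z = ?g ?Z" using Zd(2) by simp
  have gu: "\<Theta> \<chi> (one_chi \<chi>) (Z[k := v]) = ?g (?Z(k := v))" if "k < length \<chi>" for k v
    using Zd(3)[OF that] by simp
  have "case \<chi> ! p of
      Lft \<Rightarrow> \<Theta> \<chi> (one_chi \<chi>) (Z[p := Z ! p * lop b]) =
        (if Q \<noteq> {} then \<Theta> \<chi> (one_chi \<chi>) (Z[q := Z ! q * rop b]) else \<Theta> \<chi> (one_chi \<chi>) Z * j b)
    | Rgt \<Rightarrow> \<Theta> \<chi> (one_chi \<chi>) (Z[p := Z ! p * rop b]) =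
        (if Q \<noteq> {} then \<Theta> \<chi> (one_chi \<chi>) (Z[q := Z ! q * lop b]) else j b * \<Theta> \<chi> (one_chi \<chi>) Z)"
  proof (cases "\<chi> ! p")
    case Lft
    have p': "Z ! p * lop b = ract p (?Z p) b" using Lft by (simp add: ract_def)
    show ?thesis
    proof (cases "Q = {}")
      case True
      have "cmax all = p"
      proof (rule cmaxI[OF pS(1)])
        fix i assume "i \<in> all"
        from same[OF True this] ple[OF this] show "i = p \<or> i \<prec> p" using Lft by (simp add: lt_iff le_less) auto
      qed
      then show ?thesis using B(2)[OF neS, of p b] True Lft by (simp add: gu[OF pS(2)] p' g0)
    next
      case False
      note q = q[OF False]
      have qR: "\<chi> ! q = Rgt" using q(3) Lft by (cases "\<chi> ! q") auto
      have q': "Z ! q * rop b = lact q b (?Z q)" using qR by (simp add: lact_def)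
      have "?g (?Z(p := ract p (?Z p) b)) = ?g (?Z(q := lact q b (?Z q)))"
      proof (rule B(3)[OF pS(1) q(1)])
        show "p \<prec> q" using Lft qR by (simp add: lt_iff)
        fix i assume i: "i \<in> all" "p \<prec> i" "i \<prec> q"
        show False
        proof (cases "\<chi> ! i")
          case L: Lft
          then show False using i(2) ple[OF i(1)] Lft by (simp add: lt_iff)
        next
          case Rgt
          then show False using i(3) qmax[OF i(1)] Lft qR by (simp add: lt_iff)
        qed
      qed
      then show ?thesis using False Lft by (simp add: gu[OF pS(2)] gu[OF q(2)] p' q')
    qed
  next
    case Rgt
    have p': "Z ! p * rop b = lact p b (?Z p)" using Rgt by (simp add: lact_def)
    show ?thesis
    proof (cases "Q = {}")
      case True
      have "cmin all = p"
      proof (rule cminI[OF pS(1)])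
        fix i assume "i \<in> all"
        from same[OF True this] ple[OF this] show "i = p \<or> p \<prec> i" using Rgt by (simp add: lt_iff le_less) auto
      qed
      then show ?thesis using B(1)[OF neS, of p b] True Rgt by (simp add: gu[OF pS(2)] p' g0)
    next
      case False
      note q = q[OF False]
      have qL: "\<chi> ! q = Lft" using q(3) Rgt by (cases "\<chi> ! q") auto
      have q': "Z ! q * lop b = ract q (?Z q) b" using qL by (simp add: ract_def)
      have "?g (?Z(q := ract q (?Z q) b)) = ?g (?Z(p := lact p b (?Z p)))"
      proof (rule B(3)[OF q(1) pS(1)])
        show "q \<prec> p" using Rgt qL by (simp add: lt_iff)
        fix i assume i: "i \<in> all" "q \<prec> i" "i \<prec> p"
        show False
        proof (cases "\<chi> ! i")
          case R: Rgt
          then show False using i(3) ple[OF i(1)] Rgt by (simp add: lt_iff)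
        next
          case Lft
          then show False using i(2) qmax[OF i(1)] Rgt qL by (simp add: lt_iff)
        qed
      qed
      then show ?thesis using False Rgt by (simp add: gu[OF pS(2)] gu[OF q(2)] p' q')
    qed
  qed
  then show ?thesis unfolding Let_def p_def q_def Q_def n_def .
qed

text \<open>The previous index on the same side is a \<prec>-neighbour: in front of \<open>p\<close>
  on the left, behind it on the right, where the order is reversed. If there is none,
  \<open>p\<close> is the \<prec>-first left index, hence first of all, or the \<prec>-last right
  index, hence last of all.\<close>

lemma balanced_mult_2:
  assumes p: "p < length \<chi>" and Zf: "Z \<in> face_tuples \<epsilon> \<chi>"
    and bal: "balanced j all (\<lambda>Z. \<Theta> \<chi> (one_chi \<chi>) (map Z [0..<length \<chi>]))"
  shows "let Q = {k. k < p \<and> \<chi> ! k = \<chi> ! p}; q = Max Q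
         in case \<chi> ! p of
              Lft \<Rightarrow> \<Theta> \<chi> (one_chi \<chi>) (Z[p := left_op \<epsilon> b * Z ! p]) =
                (if Q \<noteq> {} then \<Theta> \<chi> (one_chi \<chi>) (Z[q := Z ! q * left_op \<epsilon> b])
                 else j b * \<Theta> \<chi> (one_chi \<chi>) Z)
            | Rgt \<Rightarrow> \<Theta> \<chi> (one_chi \<chi>) (Z[p := right_op \<epsilon> b * Z ! p]) =
                (if Q \<noteq> {} then \<Theta> \<chi> (one_chi \<chi>) (Z[q := Z ! q * right_op \<epsilon> b])
                 else \<Theta> \<chi> (one_chi \<chi>) Z * j b)"
proof -
  define Q where "Q = {k. k < p \<and> \<chi> ! k = \<chi> ! p}"
  define q where "q = Max Q"
  let ?g = "\<lambda>Z. \<Theta> \<chi> (one_chi \<chi>) (map Z [0..<length \<chi>])" and ?Z = "(!) Z"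
  note Zd = face_tuplesD[OF Zf]
  note B = balancedD[OF bal Zd(1)]
  have pS: "p \<in> all" using p by simp
  then have neS: "all \<noteq> {}" by auto
  have finQ: "finite Q" by (simp add: Q_def)
  have q: "q < p" "q \<in> all" "q < length \<chi>" "\<chi> ! q = \<chi> ! p" if "Q \<noteq> {}"
    using Max_in[OF finQ that] p by (auto simp: q_def Q_def)
  have qmax: "i \<le> q" if "i < p" "\<chi> ! i = \<chi> ! p" for i
    unfolding q_def by (rule Max_ge[OF finQ]) (use that in \<open>auto simp: Q_def\<close>)
  have first: "\<chi> ! i = \<chi> ! p \<Longrightarrow> i = p \<or> p < i" if "Q = {}" for i
    using that by (auto simp: Q_def not_less le_less)
  have g0: "\<Theta> \<chi> (one_chi \<chi>) Z = ?g ?Z" using Zd(2) by simp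
  have gu: "\<Theta> \<chi> (one_chi \<chi>) (Z[k := v]) = ?g (?Z(k := v))" if "k < length \<chi>" for k v
    using Zd(3)[OF that] by simp
  have "case \<chi> ! p of
      Lft \<Rightarrow> \<Theta> \<chi> (one_chi \<chi>) (Z[p := lop b * Z ! p]) =
        (if Q \<noteq> {} then \<Theta> \<chi> (one_chi \<chi>) (Z[q := Z ! q * lop b]) else j b * \<Theta> \<chi> (one_chi \<chi>) Z)
    | Rgt \<Rightarrow> \<Theta> \<chi> (one_chi \<chi>) (Z[p := rop b * Z ! p]) =
        (if Q \<noteq> {} then \<Theta> \<chi> (one_chi \<chi>) (Z[q := Z ! q * rop b]) else \<Theta> \<chi> (one_chi \<chi>) Z * j b)"
  proof (cases "\<chi> ! p")
    case Lft
    have p': "lop b * Z ! p = lact p b (?Z p)" using Lft by (simp add: lact_def)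
    show ?thesis
    proof (cases "Q = {}")
      case True
      have "cmin all = p"
        by (rule cminI[OF pS]) (use first[OF True] Lft in \<open>auto simp: lt_iff\<close>)
      then show ?thesis using B(1)[OF neS, of p b] True Lft by (simp add: gu[OF p] p' g0)
    next
      case False
      note q = q[OF False]
      have q': "Z ! q * lop b = ract q (?Z q) b" using q(4) Lft by (simp add: ract_def)
      have "?g (?Z(q := ract q (?Z q) b)) = ?g (?Z(p := lact p b (?Z p)))"
      proof (rule B(3)[OF q(2) pS])
        show "q \<prec> p" using Lft q by (simp add: lt_iff)
        fix i assume i: "i \<in> all" "q \<prec> i" "i \<prec> p"
        then have "\<chi> ! i = Lft" using Lft by (auto simp: lt_iff split: if_splits)
        then show False using i(2,3) qmax[of i] Lft q(4) by (simp add: lt_iff)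
      qed
      then show ?thesis using False Lft by (simp add: gu[OF p] gu[OF q(3)] p' q')
    qed
  next
    case Rgt
    have p': "rop b * Z ! p = ract p (?Z p) b" using Rgt by (simp add: ract_def)
    show ?thesis
    proof (cases "Q = {}")
      case True
      have "i = p \<or> i \<prec> p" for i
        using first[OF True, of i] Rgt by (cases "\<chi> ! i") (auto simp: lt_iff)
      then have "cmax all = p" by (rule cmaxI[OF pS])
      then show ?thesis using B(2)[OF neS, of p b] True Rgt by (simp add: gu[OF p] p' g0)
    next
      case False
      note q = q[OF False]
      have q': "Z ! q * rop b = lact q b (?Z q)" using q(4) Rgt by (simp add: lact_def)
      have "?g (?Z(p := ract p (?Z p) b)) = ?g (?Z(q := lact q b (?Z q)))"
      proof (rule B(3)[OF pS q(2)])
        show "p \<prec> q" using Rgt q by (simp add: lt_iff)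
        fix i assume i: "i \<in> all" "p \<prec> i" "i \<prec> q"
        then have "\<chi> ! i = Rgt" using Rgt by (auto simp: lt_iff split: if_splits)
        then show False using i(2,3) qmax[of i] Rgt q(4) by (simp add: lt_iff)
      qed
      then show ?thesis using False Rgt by (simp add: gu[OF p] gu[OF q(3)] p' q')
    qed
  qed
  then show ?thesis unfolding Let_def q_def Q_def .
qed

section \<open>Products over intervals and insertion, on subsets of the index set\<close>

lemma union_of_blocks_all:
  assumes "\<pi> \<in> BNC \<chi>" "union_of_blocks \<pi> V"
  shows "nc_on \<pi> V"
proof (rule nc_sub[OF BNC_NC[OF assms(1)]])
  obtain A where A: "A \<subseteq> \<pi>" "V = \<Union>A" using assms(2) by (auto simp: union_of_blocks_def)
  then show "V \<subseteq> all" using BNC_D(2)[OF assms(1)] by blast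
  fix i assume "i \<in> V"
  then obtain U where "U \<in> A" "i \<in> U" using A by auto
  then show "\<exists>U\<in>\<pi>. i \<in> U \<and> U \<subseteq> V" using A by auto
qed

lemma full_eq:
  assumes "\<pi> \<in> BNC \<chi>" "Z \<in> face_tuples \<epsilon> \<chi>"
  shows "bi_cumulant \<epsilon> E \<chi> \<pi> Z = cumulant \<pi> all ((!) Z)" "cond_bi_cumulant \<epsilon> E F \<chi> \<pi> Z = cond_cumulant \<pi> all ((!) Z)"
  unfolding cumulant_def cond_cumulant_def restrict_part_all[OF assms(1)] sides_all tuple_all
  unfolding face_tuplesD(2)[OF assms(2)] by (rule refl)+

lemma sub_eq:
  assumes "Z \<in> face_tuples \<epsilon> \<chi>"
  shows "bi_cumulant \<epsilon> E (nths \<chi> V) (restrict_part V \<pi>) (nths Z V) = cumulant \<pi> V ((!) Z)"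
    "cond_bi_cumulant \<epsilon> E F (nths \<chi> V) (restrict_part V \<pi>) (nths Z V) = cond_cumulant \<pi> V ((!) Z)"
  unfolding cumulant_def cond_cumulant_def face_tuplesD(2)[OF assms] by (rule refl)+

lemma tree_ext_mult_3:
  assumes \<pi>: "\<pi> \<in> BNC \<chi>" and Z: "Z \<in> face_tuples \<epsilon> \<chi>" and dec: "interval_decomp \<chi> \<pi> Vs"
    and T: "tree_ext g h \<Theta>" and eq: "\<And>V. nc_on \<pi> V \<Longrightarrow> V \<noteq> {} \<Longrightarrow> faces V ((!) Z) \<Longrightarrow> \<Phi> \<pi> V ((!) Z) = \<Theta> \<pi> V ((!) Z)"
    and ne: "\<chi> \<noteq> []"
  shows "\<Phi> \<pi> all ((!) Z) = prod_list (map (\<lambda>V. \<Phi> \<pi> V ((!) Z)) Vs)"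
proof -
  have p: "\<Union>(set Vs) = all" "{} \<notin> set Vs" "sorted_wrt (\<lambda>V W. \<forall>i\<in>V. \<forall>j\<in>W. i \<prec> j) Vs"
    "\<And>V. V \<in> set Vs \<Longrightarrow> union_of_blocks \<pi> V"
    using dec by (auto simp: interval_decomp_def partition_on_def)
  note nc = union_of_blocks_all[OF \<pi> p(4)]
  note Zf = face_tuplesD(1)[OF Z]
  have "all \<noteq> {}" using ne by auto
  then have "\<Phi> \<pi> all ((!) Z) = \<Theta> \<pi> all ((!) Z)" by (rule eq[OF BNC_NC[OF \<pi>] _ Zf])
  also have "\<dots> = prod_list (map (\<lambda>V. \<Theta> \<pi> V ((!) Z)) Vs)"
    using tree_ext_decomp[OF T p(3) nc nc_empty[OF BNC_NC[OF \<pi>]]] p(1) by simp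
  also have "map (\<lambda>V. \<Theta> \<pi> V ((!) Z)) Vs = map (\<lambda>V. \<Phi> \<pi> V ((!) Z)) Vs"
  proof (rule map_cong[OF refl])
    fix V assume V: "V \<in> set Vs"
    then have "V \<noteq> {}" "V \<subseteq> all" using p(1,2) by auto
    then show "\<Theta> \<pi> V ((!) Z) = \<Phi> \<pi> V ((!) Z)" using eq[OF nc[OF V]] faces_mono[OF Zf] by simp
  qed
  finally show ?thesis .
qed

text \<open>\<open>W\<close> contains both ends of the order, so it has elements before and behind
  \<open>V\<close>; and since \<open>V\<close> is a \<chi>-interval, each element of
  \<open>W\<close> is of one of these two kinds. The neighbours are the closest of each
  kind.\<close>

lemma mult_4_setting:
  assumes VW: "V \<union> W = all" "V \<inter> W = {}" and V: "chi_interval \<chi> V" and e: "cmin all \<in> W" "cmax all \<in> W"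
  shows "pred_of all V (cmax {k \<in> W. k \<prec> cmin V})" "succ_of all V (cmin {k \<in> W. cmax V \<prec> k})" "W = all - V" "V \<noteq> {}" "V \<subseteq> all"
proof -
  show W: "W = all - V" and V': "V \<noteq> {}" "V \<subseteq> all" using VW V by (auto simp: chi_interval_def)
  have fin: "finite all" "finite V" using V'(2) finite_subset by auto
  have int: "j \<in> V" if "i \<in> V" "k \<in> V" "j \<in> all" "i \<prec> j" "j \<prec> k" for i j k
    using V that unfolding chi_interval_def by (metis lessThan_iff)
  have mV: "cmin V \<in> V" "cmax V \<in> V" using cmin(1)[OF fin(2) V'(1)] cmax(1)[OF fin(2) V'(1)] by auto
  have bd: "cmin V = v \<or> cmin V \<prec> v" "v = cmax V \<or> v \<prec> cmax V" if "v \<in> V" for v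
    using cmin(2)[OF fin(2) that] cmax(2)[OF fin(2) that] by auto
  have WV: "i \<notin> V" if "i \<in> W" for i using that W by auto
  have dich: "j \<prec> cmin V \<or> cmax V \<prec> j" if j: "j \<in> W" for j
  proof (rule ccontr)
    assume "\<not> ?thesis"
    moreover have "j \<noteq> cmin V" "j \<noteq> cmax V" using WV[OF j] mV by auto
    ultimately have "cmin V \<prec> j" "j \<prec> cmax V" using chi_less_total[of j "cmin V" \<chi>] chi_less_total[of j "cmax V" \<chi>] by auto
    then show False using int[OF mV, of j] j W by auto
  qed
  have low: "j \<prec> v" if "j \<prec> cmin V" "v \<in> V" for j v using bd(1)[OF that(2)] chi_less_trans[OF that(1)] that(1) by auto
  have high: "v \<prec> j" if "cmax V \<prec> j" "v \<in> V" for j v using bd(2)[OF that(2)] chi_less_trans[OF _ that(1)] that(1) by auto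
  let ?A = "{k \<in> W. k \<prec> cmin V}" and ?B = "{k \<in> W. cmax V \<prec> k}"
  have finAB: "finite ?A" "finite ?B" using fin(1) W by auto
  have inall: "cmin V \<in> all" "cmax V \<in> all" using V'(2) mV by blast+
  have neq: "cmin V \<noteq> cmin all" "cmax V \<noteq> cmax all" using WV e mV by metis+
  have "cmin all \<prec> cmin V" using cmin(2)[OF fin(1) inall(1)] neq(1) by simp
  then have neA: "?A \<noteq> {}" using e by auto
  have "cmax V \<prec> cmax all" using cmax(2)[OF fin(1) inall(2)] neq(2) by simp
  then have neB: "?B \<noteq> {}" using e by auto
  note A = cmax(1)[OF finAB(1) neA] cmax(2)[OF finAB(1)]
  note B = cmin(1)[OF finAB(2) neB] cmin(2)[OF finAB(2)]
  show "pred_of all V (cmax ?A)"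
    unfolding pred_of_def W[symmetric]
  proof (intro conjI ballI)
    show "cmax ?A \<in> W" using A(1) by simp
    show "cmax ?A \<prec> v" if "v \<in> V" for v using A(1) low[OF _ that] by simp
    show "j = cmax ?A \<or> j \<prec> cmax ?A \<or> (\<forall>v\<in>V. v \<prec> j)" if "j \<in> W" for j
      using dich[OF that] A(2)[of j] high[of j] that by auto
  qed
  show "succ_of all V (cmin ?B)"
    unfolding succ_of_def W[symmetric]
  proof (intro conjI ballI)
    show "cmin ?B \<in> W" using B(1) by simp
    show "v \<prec> cmin ?B" if "v \<in> V" for v using B(1) high[OF _ that] by simp
    show "j = cmin ?B \<or> cmin ?B \<prec> j \<or> (\<forall>v\<in>V. j \<prec> v)" if "j \<in> W" for j
      using dich[OF that] B(2)[of j] low[of j] that by auto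
  qed
qed

lemma insert_eq:
  assumes "Z \<in> face_tuples \<epsilon> \<chi>" "p < length \<chi>"
  shows "insert_after \<epsilon> \<chi> p c Z = map (((!) Z)(p := ract p (Z ! p) c)) [0..<length \<chi>]"
    "insert_before \<epsilon> \<chi> p c Z = map (((!) Z)(p := lact p c (Z ! p))) [0..<length \<chi>]"
  unfolding insert_after_def insert_before_def face_tuplesD(3)[OF assms] ract_def lact_def by (rule refl)+

end

section \<open>Conclusions for arbitrary \<chi>\<close>

context bb_nc_prob_space_pair
begin

text \<open>No assumption of the locale mentions \<chi>, so its predicate does not take \<chi>, and
  one fact serves all interpretations.\<close>

lemma index: "bi_index \<iota> \<epsilon> E F"
  using bb_nc_prob_space_pair_axioms by (simp add: bi_index_def)

lemma multilinear:
  "face_multilinear \<epsilon> (bi_cumulant \<epsilon> E)" "face_multilinear \<epsilon> (cond_bi_cumulant \<epsilon> E F)"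
proof -
  have *: "bi_cumulant \<epsilon> E \<chi> \<pi> (Z[k := X + Y]) = bi_cumulant \<epsilon> E \<chi> \<pi> (Z[k := X]) + bi_cumulant \<epsilon> E \<chi> \<pi> (Z[k := Y]) \<and>
      bi_cumulant \<epsilon> E \<chi> \<pi> (Z[k := a *\<^sub>C X]) = a *\<^sub>C bi_cumulant \<epsilon> E \<chi> \<pi> (Z[k := X]) \<and>
      cond_bi_cumulant \<epsilon> E F \<chi> \<pi> (Z[k := X + Y]) = cond_bi_cumulant \<epsilon> E F \<chi> \<pi> (Z[k := X]) + cond_bi_cumulant \<epsilon> E F \<chi> \<pi> (Z[k := Y]) \<and>
      cond_bi_cumulant \<epsilon> E F \<chi> \<pi> (Z[k := a *\<^sub>C X]) = a *\<^sub>C cond_bi_cumulant \<epsilon> E F \<chi> \<pi> (Z[k := X])"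
    if Z: "Z \<in> face_tuples \<epsilon> \<chi>" and k: "k < length \<chi>" and X: "X \<in> face \<epsilon> (\<chi> ! k)" and Y: "Y \<in> face \<epsilon> (\<chi> ! k)"
      and \<pi>: "\<pi> \<in> BNC \<chi>" for \<chi> \<pi> Z k X Y a
  proof -
    interpret b: bi_index \<iota> \<epsilon> E F \<chi> by (rule index)
    note nc = b.BNC_NC[OF \<pi>]
    have ne: "b.all \<noteq> {}" and kA: "k \<in> b.all" using k by auto
    have bl: "b.blocks \<pi> b.all = \<pi>" using BNC_D(4,7)[OF \<pi>] by (auto simp: b.blocks_def)
    have lc: "b.linear_on b.all (b.cumulant \<pi> b.all)" using b.cumulant_linear[OF b.blocks_NC[OF nc]] bl by simp
    note lK = b.cond_cumulant_linear[OF nc ne]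
    note Zd = b.face_tuplesD[OF Z]
    have c: "bi_cumulant \<epsilon> E \<chi> \<pi> (Z[k := v]) = b.cumulant \<pi> b.all (((!) Z)(k := v))"
      and K: "cond_bi_cumulant \<epsilon> E F \<chi> \<pi> (Z[k := v]) = b.cond_cumulant \<pi> b.all (((!) Z)(k := v))" for v
      unfolding Zd(3)[OF k] b.cumulant_def b.cond_cumulant_def b.restrict_part_all[OF \<pi>] b.sides_all b.tuple_all by (rule refl)+
    show ?thesis
      unfolding c K
      using b.linear_onD(1)[OF lc Zd(1) kA X Y] b.linear_onD(2)[OF lc Zd(1) kA X]
        b.linear_onD(1)[OF lK Zd(1) kA X Y] b.linear_onD(2)[OF lK Zd(1) kA X] by simp
  qed
  show "face_multilinear \<epsilon> (bi_cumulant \<epsilon> E)" "face_multilinear \<epsilon> (cond_bi_cumulant \<epsilon> E F)"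
    unfolding face_multilinear_def using * by simp_all
qed

lemma one_BNC: "\<chi> \<noteq> [] \<Longrightarrow> one_chi \<chi> \<in> BNC \<chi>"
  by (auto simp: BNC_def partition_on_def)

lemma one_balanced:
  assumes "\<chi> \<noteq> []"
  shows "bi_index.balanced \<epsilon> \<chi> (\<lambda>b. b) {..<length \<chi>} (\<lambda>Z. bi_cumulant \<epsilon> E \<chi> (one_chi \<chi>) (map Z [0..<length \<chi>]))"
    "bi_index.balanced \<epsilon> \<chi> \<iota> {..<length \<chi>} (\<lambda>Z. cond_bi_cumulant \<epsilon> E F \<chi> (one_chi \<chi>) (map Z [0..<length \<chi>]))"
proof -
  interpret b: bi_index \<iota> \<epsilon> E F \<chi> by (rule index)
  have "b.block_cumulant b.all = (\<lambda>Z. bi_cumulant \<epsilon> E \<chi> (one_chi \<chi>) (map Z [0..<length \<chi>]))"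
    "b.cond_block_cumulant b.all = (\<lambda>Z. cond_bi_cumulant \<epsilon> E F \<chi> (one_chi \<chi>) (map Z [0..<length \<chi>]))"
    unfolding b.cumulant_def b.cond_cumulant_def b.restrict_part_all[OF one_BNC[OF assms]] b.sides_all b.tuple_all by (rule refl)+
  then show "b.balanced (\<lambda>b. b) b.all (\<lambda>Z. bi_cumulant \<epsilon> E \<chi> (one_chi \<chi>) (map Z [0..<length \<chi>]))"
    "b.balanced \<iota> b.all (\<lambda>Z. cond_bi_cumulant \<epsilon> E F \<chi> (one_chi \<chi>) (map Z [0..<length \<chi>]))"
    using b.block_cumulant_balanced[OF order_refl] b.cond_block_cumulant_balanced_linear[OF order_refl] unfolding id_def by simp_all
qed

lemma mult_1: "bi_mult_1 \<epsilon> (\<lambda>b. b) (bi_cumulant \<epsilon> E)" "bi_mult_1 \<epsilon> \<iota> (cond_bi_cumulant \<epsilon> E F)"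
proof -
  show "bi_mult_1 \<epsilon> (\<lambda>b. b) (bi_cumulant \<epsilon> E)"
    unfolding bi_mult_1_def
  proof (intro allI ballI impI, goal_cases)
    case (1 \<chi> Z b)
    note x = bi_index.balanced_mult_1[where \<Theta> = "bi_cumulant \<epsilon> E" and j = "\<lambda>b. b" and Z = Z and \<chi> = \<chi> and b = b,
        OF index 1(2,1)]
    note y = x[OF one_balanced(1)[OF 1(2)]]
    show ?case by (fact y)
  qed
  show "bi_mult_1 \<epsilon> \<iota> (cond_bi_cumulant \<epsilon> E F)"
    unfolding bi_mult_1_def
  proof (intro allI ballI impI, goal_cases)
    case (1 \<chi> Z b)
    note x = bi_index.balanced_mult_1[where \<Theta> = "cond_bi_cumulant \<epsilon> E F" and j = \<iota> and Z = Z and \<chi> = \<chi> and b = b,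
        OF index 1(2,1)]
    note y = x[OF one_balanced(2)[OF 1(2)]]
    show ?case by (fact y)
  qed
qed

lemma mult_2: "bi_mult_2 \<epsilon> (\<lambda>b. b) (bi_cumulant \<epsilon> E)" "bi_mult_2 \<epsilon> \<iota> (cond_bi_cumulant \<epsilon> E F)"
proof -
  have ne: "\<chi> \<noteq> []" if "p < length \<chi>" for p and \<chi> :: "side list" using that by auto
  show "bi_mult_2 \<epsilon> (\<lambda>b. b) (bi_cumulant \<epsilon> E)"
    unfolding bi_mult_2_def
  proof (intro allI ballI impI, goal_cases)
    case (1 \<chi> Z b p)
    note x = bi_index.balanced_mult_2[where \<Theta> = "bi_cumulant \<epsilon> E" and j = "\<lambda>b. b" and Z = Z and \<chi> = \<chi> and b = b and p = p,
        OF index 1(2,1)]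
    note y = x[OF one_balanced(1)[OF ne[OF 1(2)]]]
    show ?case by (fact y)
  qed
  show "bi_mult_2 \<epsilon> \<iota> (cond_bi_cumulant \<epsilon> E F)"
    unfolding bi_mult_2_def
  proof (intro allI ballI impI, goal_cases)
    case (1 \<chi> Z b p)
    note x = bi_index.balanced_mult_2[where \<Theta> = "cond_bi_cumulant \<epsilon> E F" and j = \<iota> and Z = Z and \<chi> = \<chi> and b = b and p = p,
        OF index 1(2,1)]
    note y = x[OF one_balanced(2)[OF ne[OF 1(2)]]]
    show ?case by (fact y)
  qed
qed

lemma mult_3: "bi_mult_3 \<epsilon> (bi_cumulant \<epsilon> E)" "bi_mult_3 \<epsilon> (cond_bi_cumulant \<epsilon> E F)"
proof -
  have *: "bi_cumulant \<epsilon> E \<chi> \<pi> Z = prod_list (map (\<lambda>V. bi_cumulant \<epsilon> E (nths \<chi> V) (restrict_part V \<pi>) (nths Z V)) Vs) \<and>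
     cond_bi_cumulant \<epsilon> E F \<chi> \<pi> Z = prod_list (map (\<lambda>V. cond_bi_cumulant \<epsilon> E F (nths \<chi> V) (restrict_part V \<pi>) (nths Z V)) Vs)"
    if \<pi>: "\<pi> \<in> BNC \<chi>" and Z: "Z \<in> face_tuples \<epsilon> \<chi>" and "\<chi> \<noteq> []" "interval_decomp \<chi> \<pi> Vs" for \<chi> \<pi> Z Vs
  proof -
    interpret b: bi_index \<iota> \<epsilon> E F \<chi> by (rule index)
    have c: "b.cumulant \<pi> b.all ((!) Z) = prod_list (map (\<lambda>V. b.cumulant \<pi> V ((!) Z)) Vs)"
    proof (rule b.tree_ext_mult_3[where \<Phi> = b.cumulant and \<Theta> = "b.inner_ext b.block_cumulant", OF \<pi> Z that(4) b.tree_ext_inner_ext])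
      show "b.cumulant \<pi> V ((!) Z) = b.inner_ext b.block_cumulant \<pi> V ((!) Z)"
        if "b.nc_on \<pi> V" "V \<noteq> {}" "b.faces V ((!) Z)" for V
        by (rule b.cumulant_inner_ext[OF that])
    qed (rule that(3))
    have K: "b.cond_cumulant \<pi> b.all ((!) Z) = prod_list (map (\<lambda>V. b.cond_cumulant \<pi> V ((!) Z)) Vs)"
    proof (rule b.tree_ext_mult_3[where \<Phi> = b.cond_cumulant and \<Theta> = "b.outer_ext b.cond_block_cumulant (b.inner_ext b.block_cumulant)", OF \<pi> Z that(4) b.tree_ext_outer_ext])
      show "b.cond_cumulant \<pi> V ((!) Z) = b.outer_ext b.cond_block_cumulant (b.inner_ext b.block_cumulant) \<pi> V ((!) Z)"
        if "b.nc_on \<pi> V" "V \<noteq> {}" "b.faces V ((!) Z)" for V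
        by (rule b.cond_cumulant_outer_ext[OF that])
    qed (rule that(3))
    show ?thesis
      unfolding b.full_eq[OF \<pi> Z] b.sub_eq[OF Z] by (intro conjI c K)
  qed
  then show "bi_mult_3 \<epsilon> (bi_cumulant \<epsilon> E)" "bi_mult_3 \<epsilon> (cond_bi_cumulant \<epsilon> E F)"
    unfolding bi_mult_3_def by simp_all
qed

lemma mult_4:
  fixes \<chi> V W \<pi> Z
  assumes \<pi>: "\<pi> \<in> BNC \<chi>" and Z: "Z \<in> face_tuples \<epsilon> \<chi>" and ne: "\<chi> \<noteq> []" and VW: "V \<union> W = {..<length \<chi>}" "V \<inter> W = {}"
    and u: "union_of_blocks \<pi> V" "union_of_blocks \<pi> W" and V: "chi_interval \<chi> V"
    and e: "chi_min \<chi> {..<length \<chi>} \<in> W" "chi_max \<chi> {..<length \<chi>} \<in> W"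
  defines "p \<equiv> chi_max \<chi> {k \<in> W. chi_less \<chi> k (chi_min \<chi> V)}"
    and "q \<equiv> chi_min \<chi> {k \<in> W. chi_less \<chi> (chi_max \<chi> V) k}"
    and "c \<equiv> bi_cumulant \<epsilon> E (nths \<chi> V) (restrict_part V \<pi>) (nths Z V)"
  shows "bi_cumulant \<epsilon> E \<chi> \<pi> Z = bi_cumulant \<epsilon> E (nths \<chi> W) (restrict_part W \<pi>) (nths (insert_after \<epsilon> \<chi> p c Z) W) \<and>
     bi_cumulant \<epsilon> E \<chi> \<pi> Z = bi_cumulant \<epsilon> E (nths \<chi> W) (restrict_part W \<pi>) (nths (insert_before \<epsilon> \<chi> q c Z) W)"
    "\<exists>U\<in>\<pi>. chi_min \<chi> {..<length \<chi>} \<in> U \<and> chi_max \<chi> {..<length \<chi>} \<in> U \<Longrightarrow>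
     cond_bi_cumulant \<epsilon> E F \<chi> \<pi> Z = cond_bi_cumulant \<epsilon> E F (nths \<chi> W) (restrict_part W \<pi>) (nths (insert_after \<epsilon> \<chi> p c Z) W) \<and>
     cond_bi_cumulant \<epsilon> E F \<chi> \<pi> Z = cond_bi_cumulant \<epsilon> E F (nths \<chi> W) (restrict_part W \<pi>) (nths (insert_before \<epsilon> \<chi> q c Z) W)"
proof -
  interpret b: bi_index \<iota> \<epsilon> E F \<chi> by (rule index)
  note st = b.mult_4_setting[OF VW V e]
  note pr = st(1)[folded p_def] and su = st(2)[folded q_def] and W = st(3) and Vs = st(5,4)
  note nc = b.BNC_NC[OF \<pi>] and nV = b.union_of_blocks_all[OF \<pi> u(1)] and nW = b.union_of_blocks_all[OF \<pi> u(2)]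
  note Zf = b.face_tuplesD(1)[OF Z]
  have ne': "b.all \<noteq> {}" using ne by auto
  have pq: "p \<in> W" "q \<in> W" using pr su W by (auto simp: b.pred_of_def b.succ_of_def)
  then have pq': "p < length \<chi>" "q < length \<chi>" "W \<noteq> {}" using W by auto
  have ZV: "b.faces V ((!) Z)" and ZW: "b.faces W ((!) Z)" using b.faces_mono[OF Zf] Vs W by auto
  have c: "c = b.inner_ext b.block_cumulant \<pi> V ((!) Z)"
    unfolding c_def b.sub_eq[OF Z] by (rule b.cumulant_inner_ext[OF nV Vs(2) ZV])
  have ins: "bi_cumulant \<epsilon> E (nths \<chi> W) (restrict_part W \<pi>) (nths (insert_after \<epsilon> \<chi> p c Z) W)
      = b.cumulant \<pi> W (((!) Z)(p := b.ract p (Z ! p) c))"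
    "bi_cumulant \<epsilon> E (nths \<chi> W) (restrict_part W \<pi>) (nths (insert_before \<epsilon> \<chi> q c Z) W)
      = b.cumulant \<pi> W (((!) Z)(q := b.lact q c (Z ! q)))"
    "cond_bi_cumulant \<epsilon> E F (nths \<chi> W) (restrict_part W \<pi>) (nths (insert_after \<epsilon> \<chi> p c Z) W)
      = b.cond_cumulant \<pi> W (((!) Z)(p := b.ract p (Z ! p) c))"
    "cond_bi_cumulant \<epsilon> E F (nths \<chi> W) (restrict_part W \<pi>) (nths (insert_before \<epsilon> \<chi> q c Z) W)
      = b.cond_cumulant \<pi> W (((!) Z)(q := b.lact q c (Z ! q)))"
    unfolding b.insert_eq[OF Z pq'(1)] b.insert_eq[OF Z pq'(2)] b.cumulant_def b.cond_cumulant_def by (rule refl)+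
  note fp = b.faces_ract[OF ZW pq(1), of c] and fq = b.faces_lact[OF ZW pq(2), of c]
  note kb = b.block_cumulant_bal[OF nc]
  have Kb: "b.balanced \<iota> U (b.cond_block_cumulant U)" if "U \<in> \<pi>" "U \<subseteq> b.all" for U
    using b.cond_block_cumulant_balanced_linear[OF that(2)] by simp
  show "bi_cumulant \<epsilon> E \<chi> \<pi> Z = bi_cumulant \<epsilon> E (nths \<chi> W) (restrict_part W \<pi>) (nths (insert_after \<epsilon> \<chi> p c Z) W) \<and>
     bi_cumulant \<epsilon> E \<chi> \<pi> Z = bi_cumulant \<epsilon> E (nths \<chi> W) (restrict_part W \<pi>) (nths (insert_before \<epsilon> \<chi> q c Z) W)"
    unfolding ins b.full_eq[OF \<pi> Z] b.cumulant_inner_ext[OF nc ne' Zf] b.cumulant_inner_ext[OF nW pq'(3) fp] b.cumulant_inner_ext[OF nW pq'(3) fq]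
    using b.inner_ext_insert_pred[OF b.block_cumulant_local kb nc nV Vs pr Zf] b.inner_ext_insert_succ[OF b.block_cumulant_local kb nc nV Vs su Zf]
    unfolding c W by simp
  assume adm: "\<exists>U\<in>\<pi>. chi_min \<chi> {..<length \<chi>} \<in> U \<and> chi_max \<chi> {..<length \<chi>} \<in> U"
  \<comment> \<open>The first block contains the \<prec>-last index, so nothing is left for the
    tail. This is where the additional assumption on the ends enters.\<close>
  have tl0: "b.tail \<pi> b.all \<inter> V = {}"
  proof -
    have fin: "finite b.all" by simp
    obtain U where U: "U \<in> \<pi>" "chi_min \<chi> b.all \<in> U" "chi_max \<chi> b.all \<in> U" using adm by auto
    have fbU: "b.first_block \<pi> b.all = U" unfolding b.first_block_def by (rule b.block_of_eq[OF nc U(1,2)])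
    have "chi_max \<chi> b.all = b.first_end \<pi> b.all \<or> chi_less \<chi> (chi_max \<chi> b.all) (b.first_end \<pi> b.all)"
      using b.first_block(6)[OF nc ne'] U(3) unfolding fbU by simp
    moreover have "b.first_end \<pi> b.all = chi_max \<chi> b.all \<or> chi_less \<chi> (b.first_end \<pi> b.all) (chi_max \<chi> b.all)"
      by (rule b.cmax(2)[OF fin b.first_block(8)[OF nc ne']])
    ultimately have first_end: "b.first_end \<pi> b.all = chi_max \<chi> b.all" using chi_less_asym by metis
    have "\<not> chi_less \<chi> (chi_max \<chi> b.all) j" if "j \<in> b.all" for j
      using b.cmax(2)[OF fin that] chi_less_asym[of \<chi> j "chi_max \<chi> b.all"] by auto
    then show ?thesis unfolding b.tail_eq[OF nc ne'] first_end by auto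
  qed
  show "cond_bi_cumulant \<epsilon> E F \<chi> \<pi> Z = cond_bi_cumulant \<epsilon> E F (nths \<chi> W) (restrict_part W \<pi>) (nths (insert_after \<epsilon> \<chi> p c Z) W) \<and>
     cond_bi_cumulant \<epsilon> E F \<chi> \<pi> Z = cond_bi_cumulant \<epsilon> E F (nths \<chi> W) (restrict_part W \<pi>) (nths (insert_before \<epsilon> \<chi> q c Z) W)"
    unfolding ins b.full_eq[OF \<pi> Z] b.cond_cumulant_outer_ext[OF nc ne' Zf] b.cond_cumulant_outer_ext[OF nW pq'(3) fp] b.cond_cumulant_outer_ext[OF nW pq'(3) fq]
    using b.outer_ext_insert_pred[OF b.cond_block_cumulant_local b.block_cumulant_local kb nc nV Vs pr Zf tl0]
      b.outer_ext_insert_succ[OF b.cond_block_cumulant_local b.block_cumulant_local Kb kb nc nV Vs pr su Zf tl0]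
    unfolding c W by simp
qed

end

theorem theorem4p8:
  fixes \<iota> :: "'b::complex_unital_algebra \<Rightarrow> 'd::complex_unital_algebra"
    and \<epsilon> :: "('b, 'b opp) tensor \<Rightarrow> 'a::complex_unital_algebra"
    and E :: "'a \<Rightarrow> 'b"
    and F :: "'a \<Rightarrow> 'd"
  assumes "bb_nc_prob_space_pair \<iota> \<epsilon> E F"
  shows "cond_bi_multiplicative \<iota> \<epsilon> (bi_cumulant \<epsilon> E) (cond_bi_cumulant \<epsilon> E F)"
proof -
  interpret bb_nc_prob_space_pair \<iota> \<epsilon> E F by (rule assms)
  show ?thesis
    unfolding cond_bi_multiplicative_def
  proof (intro conjI multilinear mult_1 mult_2 mult_3)
    show "bi_mult_4 \<epsilon> (\<lambda>_ _. True) (bi_cumulant \<epsilon> E) (bi_cumulant \<epsilon> E)"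
      unfolding bi_mult_4_def Let_def by (intro allI ballI impI, elim conjE) (rule mult_4(1); assumption)
    show "bi_mult_4 \<epsilon> (\<lambda>\<chi> \<pi>. \<exists>U\<in>\<pi>. chi_min \<chi> {..<length \<chi>} \<in> U \<and> chi_max \<chi> {..<length \<chi>} \<in> U)
        (bi_cumulant \<epsilon> E) (cond_bi_cumulant \<epsilon> E F)"
      unfolding bi_mult_4_def Let_def by (intro allI ballI impI, elim conjE) (rule mult_4(2); assumption)
  qed
qed

end
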